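(* Let $(Y(t))_{t\in\mathbb{R}^d}$ be a causal CARMA$(p,q)$ random field with companion matrices $A_1,\dots,A_d$, each having distinct eigenvalues, driven by a homogeneous Lévy basis $\Lambda$ with mean zero, finite second moment (variance $\kappa_2$) and finite fourth moment $\kappa_4$. Suppose observations of $Y$ are given on the lattice $\{\Delta,\dots,N\Delta\}^d$ with $\Delta>0$, and let $\psi_N^*$ be the empirical variogram and $\psi$ the variogram of $Y$. Then for all $t\in\Delta\mathbb{Z}^d$, $$\lim_{N\to\infty}\psi_N^*(t)=\psi(t)\quad\text{a.s.}$$ Further, let $t^{(1)},\dots,t^{(K)}\in\Delta\mathbb{Z}^d$ be $K$ distinct lags and $t^{(0)}=(0,\dots,0)^\top$. Then, as $N\to\infty$, $$N^{d/2}\big(\psi_N^*(t^{(1)})-\psi(t^{(1)}),\dots,\psi_N^*(t^{(K)})-\psi(t^{(K)})\big)\stackrel{d}{\rightarrow}\mathcal N(0,FVF^\top),$$ where $$F=2\begin{pmatrix}1&-1&0&\cdots&0\\1&0&-1&\cdots&0\\\vdots&\vdots&\vdots&\ddots&\vdots\\1&0&0&\cdots&-1\end{pmatrix}\in\mathbb{R}^{K\times(K+1)}$$ and $V=(v_{i,j})_{i,j=0,\dots,K}$ is given by $$v_{i,j}=\sum_{l\in\Delta\mathbb{Z}^d}\Big[(\kappa_4-3\kappa_2^2)\int_{\mathbb{R}^d}g(s)g(s+t^{(i)})g(s+l)g(s+l+t^{(j)})\,ds+\gamma(l)\gamma(l+t^{(i)}-t^{(j)})+\gamma(l+t^{(i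)})\gamma(l-t^{(j)})\Big].$$
   Context: Homogeneous Lévy basis: an infinitely divisible, independently scattered random measure $\Lambda$ on $\mathbb{R}^d$ with $\mathbb{E}[e^{\mathrm{i}u\Lambda(B)}]=\exp\{\mathrm{Leb}(B)(\mathrm{i}\beta u-\tfrac12\sigma^2u^2+\int_{\mathbb{R}}(e^{\mathrm{i}uz}-1-\mathrm{i}uz\mathbf 1_{\{|z|<1\}})\,\nu(dz))\}$ for bounded Borel sets $B$; its characteristic triplet is $(\beta,\sigma^2,\nu)$. It has finite second moment iff $\int z^2\nu(dz)<\infty$, and then its variance is $\kappa_2=\sigma^2+\int z^2\nu(dz)$. The fourth moment is $\kappa_4=\mathbb{E}[\Lambda([0,1]^d)^4]$. Stochastic integrals are in the sense of Rajput and Rosinski. Causal CARMA$(p,q)$ random field: let $0\le q<p$ be integers, $b=(b_0,\dots,b_{p-1})^\top\in\mathbb{R}^p$ with $b_q\ne0$ and $b_i=0$ for $i>q$, $\mathbf e_p=(0,\dots,0,1)^\top\in\mathbb{R}^p$, and for $i=1,\dots,d$ let $A_i\in\mathbb{R}^{p\times p}$ be the companion matrix (ones on the superdiagonal, last row $(-a_{i,p},\dots,-a_{i,1})$, other entries $0$) of a monic real polynomial $a_i(z)=z^p+a_{i,1}z^{p-1}+\dots+a_{i,p}$ all of whose roots have strictly negative real parts. With $\Lambda$ a homogeneous Lévy basis with $\int\log(|z|)^d\mathbf 1_{\{|z|>1\}}\nu(dz)<\infty$, set $Y(t)=\int_{\mathbb{R}^d}g(t-s)\,\Lambda(ds)$,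 $t\in\mathbb{R}^d$, with kernel $$g(s)=b^\top e^{A_1s_1}\cdots e^{A_ds_d}\mathbf e_p\,\mathbf 1_{\{s\ge0\}}$$ ($s\ge 0$ componentwise). Autocovariance and variogram: $\gamma(t)=\mathrm{Cov}[Y(t),Y(0)]$, $\psi(t)=\mathrm{Var}[Y(t)-Y(0)]$. Empirical variogram: $\psi_N^*(t)=\frac1{|B_{N,t}|}\sum_{s\in B_{N,t}}(Y(t+s)-Y(s))^2$ for $t\in\{(1-N)\Delta,\dots,(N-1)\Delta\}^d$, where $B_{N,t}=\{s\in\Delta\mathbb{Z}^d\colon s,\,s+t\in\{\Delta,\dots,N\Delta\}^d\}$ and $|B_{N,t}|$ is its cardinality. *)

theory Defs
  imports "HOL-Probability.Probability" "Jordan_Normal_Form.Spectral_Radius"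
begin

(* "$" and "\<bullet>" are reserved for the vectors of type real^'n; the p x p matrices of
   the CARMA model are those of Jordan_Normal_Form. *)
no_notation Matrix.vec_index (infixl "$" 100)
no_notation Matrix.scalar_prod (infix "\<bullet>" 70)

section \<open>Probabilistic notions\<close>

context prob_space
begin

definition covariance :: "('a \<Rightarrow> real) \<Rightarrow> ('a \<Rightarrow> real) \<Rightarrow> real" where
  "covariance X Z = expectation (\<lambda>\<omega>. (X \<omega> - expectation X) * (Z \<omega> - expectation Z))"

definition conv_in_prob :: "(nat \<Rightarrow> 'a \<Rightarrow> real) \<Rightarrow> ('a \<Rightarrow> real) \<Rightarrow> bool" where
  "conv_in_prob X Z \<longleftrightarrow> (\<forall>n. random_variable borel (X n)) \<and> random_variable borel Z \<and>
     (\<forall>\<epsilon>>0. (\<lambda>n. prob {\<omega> \<in> space M. \<bar>X n \<omega> - Z \<omega>\<bar> > \<epsilon>}) \<longlonglongrightarrow> 0)"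

definition conv_in_distribution ::
    "(nat \<Rightarrow> 'a \<Rightarrow> 'b::euclidean_space) \<Rightarrow> 'b measure \<Rightarrow> bool" where
  "conv_in_distribution X \<mu> \<longleftrightarrow> (\<forall>n. random_variable borel (X n)) \<and>
     (\<forall>f::'b \<Rightarrow> real. continuous_on UNIV f \<and> bounded (range f) \<longrightarrow>
        (\<lambda>n. expectation (\<lambda>\<omega>. f (X n \<omega>))) \<longlonglongrightarrow> (\<integral>x. f x \<partial>\<mu>))"

end

text \<open>The normal law with mean \<open>m\<close> and covariance matrix \<open>S\<close>, characterised by its
  characteristic function so that singular \<open>S\<close> are allowed.\<close>

definition is_multivariate_normal ::
    "real^'k \<Rightarrow> real^'k^'k \<Rightarrow> (real^'k) measure \<Rightarrow> bool" where
  "is_multivariate_normal m S \<mu> \<longleftrightarrow> prob_space \<mu> \<and> sets \<mu> = sets borel \<and>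
     (\<forall>u. (CLINT x|\<mu>. iexp (u \<bullet> x)) =
        exp (\<i> * of_real (u \<bullet> m) - of_real (u \<bullet> (S *v u)) / 2))"

definition infinitely_divisible :: "real measure \<Rightarrow> bool" where
  "infinitely_divisible \<mu> \<longleftrightarrow> (\<forall>n>0. \<exists>\<rho>. real_distribution \<rho> \<and> (\<forall>u. char \<mu> u = char \<rho> u ^ n))"

section \<open>Homogeneous Levy bases and stochastic integrals\<close>

definition levy_measure :: "real measure \<Rightarrow> bool" where
  "levy_measure \<nu> \<longleftrightarrow> sets \<nu> = sets borel \<and> emeasure \<nu> {0} = 0 \<and>
     (\<integral>\<^sup>+z. ennreal (min 1 (z\<^sup>2)) \<partial>\<nu>) < \<infinity>"

definition levy_exponent :: "real \<Rightarrow> real \<Rightarrow> real measure \<Rightarrow> real \<Rightarrow> complex" where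
  "levy_exponent \<beta> \<sigma> \<nu> u = \<i> * of_real (\<beta> * u) - of_real (\<sigma>\<^sup>2 * u\<^sup>2) / 2 +
     (CLINT z|\<nu>. iexp (u * z) - 1 - \<i> * of_real (u * z * indicator {z. \<bar>z\<bar> < 1} z))"

definition bounded_borel :: "('b::euclidean_space) set set" where
  "bounded_borel = {B. B \<in> sets borel \<and> bounded B}"

text \<open>The characteristic triplet is \<open>(\<beta>, \<sigma>\<^sup>2, \<nu>)\<close>; the basis is a family of real random
  variables indexed by the bounded Borel sets (its values on other sets are irrelevant).\<close>

locale homogeneous_levy_basis = prob_space M
  for M :: "'w measure"
    and \<Lambda> :: "(real^'d) set \<Rightarrow> 'w \<Rightarrow> real"
    and \<beta> \<sigma> :: real and \<nu> :: "real measure" +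
  assumes levy_measure: "levy_measure \<nu>"
    and basis_rv: "B \<in> bounded_borel \<Longrightarrow> random_variable borel (\<Lambda> B)"
    and basis_indep: "range Bs \<subseteq> bounded_borel \<Longrightarrow> disjoint_family Bs \<Longrightarrow>
          indep_vars (\<lambda>_. borel) (\<lambda>n. \<Lambda> (Bs n)) (UNIV :: nat set)"
    and basis_countably_additive:
          "range Bs \<subseteq> bounded_borel \<Longrightarrow> disjoint_family Bs \<Longrightarrow> (\<Union>n::nat. Bs n) \<in> bounded_borel \<Longrightarrow>
           AE \<omega> in M. (\<lambda>n. \<Lambda> (Bs n) \<omega>) sums \<Lambda> (\<Union>n. Bs n) \<omega>"
    and basis_infinitely_divisible:
          "B \<in> bounded_borel \<Longrightarrow> infinitely_divisible (distr M borel (\<Lambda> B))"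
    and basis_char: "B \<in> bounded_borel \<Longrightarrow>
          char (distr M borel (\<Lambda> B)) u =
            exp (of_real (measure lborel B) * levy_exponent \<beta> \<sigma> \<nu> u)"

definition kappa2 :: "real \<Rightarrow> real measure \<Rightarrow> real" where
  "kappa2 \<sigma> \<nu> = \<sigma>\<^sup>2 + (\<integral>z. z\<^sup>2 \<partial>\<nu>)"

definition (in prob_space) kappa4 :: "((real^'d) set \<Rightarrow> 'a \<Rightarrow> real) \<Rightarrow> real" where
  "kappa4 \<Lambda> = expectation (\<lambda>\<omega>. (\<Lambda> (cbox 0 1) \<omega>) ^ 4)"

definition bounded_simple :: "(real^'d \<Rightarrow> real) \<Rightarrow> bool" where
  "bounded_simple f \<longleftrightarrow> simple_function borel f \<and> bounded {s. f s \<noteq> 0}"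

text \<open>The integral over \<open>A\<close> of a simple function, written in its canonical form
  \<open>\<Sum>x. x * indicator {s. f s = x}\<close> over its nonzero values.\<close>

definition simple_stoch_integral ::
    "((real^'d) set \<Rightarrow> 'w \<Rightarrow> real) \<Rightarrow> (real^'d) set \<Rightarrow> (real^'d \<Rightarrow> real) \<Rightarrow> 'w \<Rightarrow> real" where
  "simple_stoch_integral \<Lambda> A f \<omega> = (\<Sum>x \<in> range f - {0}. x * \<Lambda> (A \<inter> {s. f s = x}) \<omega>)"

text \<open>Rajput and Rosinski: \<open>f\<close> is integrable with integral (a version of) \<open>X\<close> if there are simple
  functions converging to \<open>f\<close> almost everywhere whose integrals over every Borel set converge
  in probability; \<open>X\<close> is the limit over the whole space.  "Almost everywhere" refers to the
  control measure, which for a nonzero homogeneous basis is a positive multiple of Lebesgue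
  measure.\<close>

definition (in prob_space) has_stoch_integral ::
    "((real^'d) set \<Rightarrow> 'a \<Rightarrow> real) \<Rightarrow> (real^'d \<Rightarrow> real) \<Rightarrow> ('a \<Rightarrow> real) \<Rightarrow> bool" where
  "has_stoch_integral \<Lambda> f X \<longleftrightarrow> f \<in> borel_measurable borel \<and>
     (\<exists>fs. (\<forall>n. bounded_simple (fs n)) \<and>
        (AE s in lborel. (\<lambda>n. fs n s) \<longlonglongrightarrow> f s) \<and>
        (\<forall>A \<in> sets borel. \<exists>Z. conv_in_prob (\<lambda>n. simple_stoch_integral \<Lambda> A (fs n)) Z) \<and>
        conv_in_prob (\<lambda>n. simple_stoch_integral \<Lambda> UNIV (fs n)) X)"

section \<open>Causal CARMA random fields\<close>

text \<open>For \<open>a(z) = z^p + a\<^sub>1 z^(p-1) + \<dots> + a\<^sub>p\<close> rows and columns are counted from \<open>0\<close>, so the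
  entry in column \<open>j\<close> of the last row is minus the coefficient of \<open>z^j\<close>.\<close>

definition companion_matrix :: "nat \<Rightarrow> real poly \<Rightarrow> real mat" where
  "companion_matrix p a = Matrix.mat p p (\<lambda>(i, j).
     if i = p - 1 then - coeff a j else if j = i + 1 then 1 else 0)"

definition distinct_eigenvalues :: "real mat \<Rightarrow> bool" where
  "distinct_eigenvalues A \<longleftrightarrow> card (spectrum (map_mat complex_of_real A)) = dim_row A"

definition mat_exp :: "real mat \<Rightarrow> real mat" where
  "mat_exp A = Matrix.mat (dim_row A) (dim_row A) (\<lambda>ij. \<Sum>n. ((A ^\<^sub>m n) $$ ij) / fact n)"

text \<open>The matrix factors do not commute in general; they are multiplied in the order of the
  coordinates, i.e. of the linearly ordered index type \<open>'d\<close>.\<close>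

definition carma_kernel ::
    "nat \<Rightarrow> (nat \<Rightarrow> real) \<Rightarrow> ('d::{finite,linorder} \<Rightarrow> real poly)
     \<Rightarrow> real^('d::{finite,linorder}) \<Rightarrow> real" where
  "carma_kernel p b a s =
     (if \<forall>i. 0 \<le> s $ i then
        Matrix.scalar_prod (Matrix.vec p b)
          (foldr (\<lambda>i P. mat_exp (s $ i \<cdot>\<^sub>m companion_matrix p (a i)) * P)
             (sorted_list_of_set UNIV) (1\<^sub>m p) *\<^sub>v unit_vec p (p - 1))
      else 0)"

locale causal_carma_field = homogeneous_levy_basis M \<Lambda> \<beta> \<sigma> \<nu>
  for M :: "'w measure"
    and \<Lambda> :: "(real^('d::{finite,linorder})) set \<Rightarrow> 'w \<Rightarrow> real"
    and \<beta> \<sigma> :: real and \<nu> :: "real measure" +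
  fixes p q :: nat
    and b :: "nat \<Rightarrow> real"
    and a :: "'d::{finite,linorder} \<Rightarrow> real poly"
    and Y :: "real^('d::{finite,linorder}) \<Rightarrow> 'w \<Rightarrow> real"
  assumes q_less_p: "q < p"
    and b_q: "b q \<noteq> 0"
    and b_beyond_q: "q < i \<Longrightarrow> i < p \<Longrightarrow> b i = 0"
    and a_monic: "lead_coeff (a k) = 1"
    and a_degree: "degree (a k) = p"
    and a_stable: "poly (map_poly complex_of_real (a k)) z = 0 \<Longrightarrow> Re z < 0"
    and log_moment: "(\<integral>\<^sup>+z. ennreal (ln \<bar>z\<bar> ^ CARD('d) * indicator {z. \<bar>z\<bar> > 1} z) \<partial>\<nu>) < \<infinity>"
    and Y_integral: "has_stoch_integral \<Lambda> (\<lambda>s. carma_kernel p b a (t - s)) (Y t)"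

section \<open>Autocovariance and variogram\<close>

definition (in prob_space) autocov :: "(real^'d \<Rightarrow> 'a \<Rightarrow> real) \<Rightarrow> real^'d \<Rightarrow> real" where
  "autocov Y t = covariance (Y t) (Y 0)"

definition (in prob_space) variogram :: "(real^'d \<Rightarrow> 'a \<Rightarrow> real) \<Rightarrow> real^'d \<Rightarrow> real" where
  "variogram Y t = variance (\<lambda>\<omega>. Y t \<omega> - Y 0 \<omega>)"

definition lattice_pts :: "real \<Rightarrow> (real^'d) set" where
  "lattice_pts \<Delta> = {s. \<forall>i. \<exists>k::int. s $ i = \<Delta> * of_int k}"

definition obs_pts :: "real \<Rightarrow> nat \<Rightarrow> (real^'d) set" where
  "obs_pts \<Delta> N = {s. \<forall>i. \<exists>k\<in>{1..N}. s $ i = \<Delta> * of_nat k}"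

definition lag_pts :: "real \<Rightarrow> nat \<Rightarrow> real^'d \<Rightarrow> (real^'d) set" where
  "lag_pts \<Delta> N t = {s \<in> lattice_pts \<Delta>. s \<in> obs_pts \<Delta> N \<and> s + t \<in> obs_pts \<Delta> N}"

definition empirical_variogram ::
    "(real^'d \<Rightarrow> 'w \<Rightarrow> real) \<Rightarrow> real \<Rightarrow> nat \<Rightarrow> real^'d \<Rightarrow> 'w \<Rightarrow> real" where
  "empirical_variogram Y \<Delta> N t \<omega> =
     (\<Sum>s \<in> lag_pts \<Delta> N t. (Y (t + s) \<omega> - Y s \<omega>)\<^sup>2) / of_nat (card (lag_pts \<Delta> N t))"

section \<open>The asymptotic covariance matrix\<close>

text \<open>The lags are indexed by \<open>'k\<close> (so \<open>K = CARD('k)\<close>); the index set \<open>{0, \<dots>, K}\<close> is \<open>'k option\<close>,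
  where \<open>None\<close> plays the role of \<open>0\<close>.\<close>

definition lag0 :: "('k \<Rightarrow> real^'d) \<Rightarrow> 'k option \<Rightarrow> real^'d" where
  "lag0 lag i = (case i of None \<Rightarrow> 0 | Some k \<Rightarrow> lag k)"

definition F_matrix :: "real^('k::finite option)^'k" where
  "F_matrix = (\<chi> k j. 2 * (case j of None \<Rightarrow> 1 | Some j' \<Rightarrow> if j' = k then - 1 else 0))"

definition V_matrix ::
    "real \<Rightarrow> real \<Rightarrow> (real^'d \<Rightarrow> real) \<Rightarrow> (real^'d \<Rightarrow> real) \<Rightarrow> real \<Rightarrow> ('k::finite \<Rightarrow> real^'d)
     \<Rightarrow> real^('k option)^('k option)" where
  "V_matrix \<kappa>2 \<kappa>4 g \<gamma> \<Delta> lag = (\<chi> i j. \<Sum>\<^sub>\<infinity>l\<in>lattice_pts \<Delta>.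
     (\<kappa>4 - 3 * \<kappa>2\<^sup>2) *
       (\<integral>s. g s * g (s + lag0 lag i) * g (s + l) * g (s + l + lag0 lag j) \<partial>lborel)
     + \<gamma> l * \<gamma> (l + lag0 lag i - lag0 lag j)
     + \<gamma> (l + lag0 lag i) * \<gamma> (l - lag0 lag j))"

end

(* The stochastic integral against the basis is continued from bounded simple functions to kernels in
L2 and L4, where its moments up to order four are explicit: the covariance of two products of
integrals is (kappa4 - 3 kappa2^2) times an integral of four kernels plus kappa2^2 times the two
cross pairings. Distinct stable eigenvalues make the CARMA kernel decay exponentially, so the
covariances of the lagged products Y(s) Y(s + t) are summable over the lattice. Hence sums over a
window have variance of the order of its size; along the windows of side n^2 the normalized variances
are summable, which gives the strong law, and monotonicity of the sums of squares fills the gaps.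
For the central limit theorem the kernels are truncated to large cubic cells and made simple, which
turns block sums into iid variables at a cost that is small in L2 uniformly in the window, and the
limits are identified through characteristic functions. *)

theory Submission
 imports Defs
begin

section \<open>Square and fourth power integrable functions\<close>

text \<open>The hypothesis on \<open>Y t\<close> gives only some simple functions whose integrals
  converge in probability on every Borel set, with no control of moments. The moment calculus
  therefore hinges on showing that such a limit agrees with the L4 limit along better chosen
  approximations; this is the purpose of the gliding hump. Likewise a finite second moment of the
  basis is given, whereas \<integral>z^2 d\<nu> < \<infinity> has to be recovered from the
  characteristic exponent by Fatou's lemma. The limit theorem is proved for products of two moving
  averages with different kernels. This generality reduces the vector statement to a scalar one: a
  linear combination over the lags of the products Y(x) Y(x + t_i) is again Y(x) times a single
  moving average. The covariances of these products differ from the summands of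
  \<open>V_matrix\<close> by an exchange of the two lags; only quadratic forms occur, in which the
  difference cancels. The normal limit may be degenerate, so it is built from a sum of squares and
  not from a density.\<close>

lemma sq_integrable_mult:
 fixes f g :: "'a \<Rightarrow> real"
 assumes [measurable]: "f \<in> borel_measurable N" "g \<in> borel_measurable N"
  and "integrable N (\<lambda>x. (f x)^2)" "integrable N (\<lambda>x. (g x)^2)"
 shows "integrable N (\<lambda>x. f x * g x)"
proof (rule Bochner_Integration.integrable_bound[where f="\<lambda>x. (f x)^2 + (g x)^2"])
 show "integrable N (\<lambda>x. (f x)^2 + (g x)^2)" using assms by simp
 have "\<bar>u * v\<bar> \<le> u^2 + v^2" for u v :: real
  using sum_squares_bound[of "\<bar>u\<bar>" "\<bar>v\<bar>"] mult_nonneg_nonneg[OF abs_ge_zero[of u] abs_ge_zero[of v]]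
  unfolding abs_mult power2_abs by linarith
 then show "AE x in N. norm (f x * g x) \<le> norm ((f x)^2 + (g x)^2)" by auto
qed simp

lemma integral_Cauchy_Schwarz:
 fixes f g :: "'a \<Rightarrow> real"
 assumes [measurable]: "f \<in> borel_measurable N" "g \<in> borel_measurable N"
  and f: "integrable N (\<lambda>x. (f x)^2)" and g: "integrable N (\<lambda>x. (g x)^2)"
 shows "(\<integral>x. f x * g x \<partial>N)^2 \<le> (\<integral>x. (f x)^2 \<partial>N) * (\<integral>x. (g x)^2 \<partial>N)"
proof -
 define A B C where "A = (\<integral>x. (f x)^2 \<partial>N)" and "B = (\<integral>x. (g x)^2 \<partial>N)" and "C = (\<integral>x. f x * g x \<partial>N)"
 have fg: "integrable N (\<lambda>x. f x * g x)" by (rule sq_integrable_mult) (use f g in auto)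
 have *: "0 \<le> A - 2 * t * C + t^2 * B" for t
 proof -
  have "0 \<le> (\<integral>x. (f x - t * g x)^2 \<partial>N)" by simp
  also have "(\<lambda>x. (f x - t * g x)^2) = (\<lambda>x. (f x)^2 - 2 * t * (f x * g x) + t^2 * (g x)^2)"
   by (auto simp: power2_eq_square algebra_simps)
  also have "(\<integral>x. \<dots> x \<partial>N) = A - 2 * t * C + t^2 * B"
   using f g fg unfolding A_def B_def C_def by simp
  finally show ?thesis .
 qed
 have "B \<ge> 0" unfolding B_def by simp
 show ?thesis
 proof (cases "B = 0")
  case True
  have "C = 0"
  proof (rule ccontr)
   assume "C \<noteq> 0"
   \<comment> \<open>With B = 0 the nonnegative expression is affine in t, and this value of t makes
     it equal to -1.\<close>
   then show False using *[of "(A+1)/(2*C)"] True by simp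
  qed
  then show ?thesis using True A_def B_def C_def by simp
 next
  case False
  have "0 \<le> A - 2 * (C/B) * C + (C/B)^2 * B" by (rule *)
  also have "\<dots> = A - C^2/B" using False by (simp add: field_simps power2_eq_square)
  finally have "C^2 \<le> A * B" using False \<open>B \<ge> 0\<close> by (simp add: field_simps)
  then show ?thesis unfolding A_def B_def C_def .
 qed
qed

lemma integral_abs_Cauchy_Schwarz:
 fixes f g :: "'a \<Rightarrow> real"
 assumes "f \<in> borel_measurable N" "g \<in> borel_measurable N"
  and "integrable N (\<lambda>x. (f x)^2)" "integrable N (\<lambda>x. (g x)^2)"
 shows "\<bar>\<integral>x. f x * g x \<partial>N\<bar> \<le> sqrt (\<integral>x. (f x)^2 \<partial>N) * sqrt (\<integral>x. (g x)^2 \<partial>N)"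
 using real_sqrt_le_mono[OF integral_Cauchy_Schwarz[OF assms]]
 by (simp add: real_sqrt_mult)

text \<open>Lebesgue measure is infinite, so the fourth power alone does not control the square;
  both are carried along. Over a probability space the fourth power suffices, see
  \<open>integrable_power4_imp_L24\<close>.\<close>

definition L24 :: "'a measure \<Rightarrow> ('a \<Rightarrow> real) \<Rightarrow> bool" where
 "L24 N f \<longleftrightarrow> f \<in> borel_measurable N \<and> integrable N (\<lambda>x. (f x)^2) \<and> integrable N (\<lambda>x. (f x)^4)"

lemma L24D:
 assumes "L24 N f"
 shows "f \<in> borel_measurable N" "integrable N (\<lambda>x. (f x)^2)" "integrable N (\<lambda>x. (f x)^4)"
 using assms unfolding L24_def by auto

lemma power2_sum_le: "((u::real) + v)^2 \<le> 2 * u^2 + 2 * v^2"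
 using sum_squares_bound[of u v] unfolding power2_sum by linarith

lemma power4_sum_le: "((u::real) + v)^4 \<le> 8 * u^4 + 8 * v^4"
proof -
 have "(u + v)^4 = ((u+v)^2)^2" by simp
 also have "\<dots> \<le> (2 * u^2 + 2 * v^2)^2" by (intro power_mono power2_sum_le) simp
 also have "\<dots> \<le> 2 * (2 * u^2)^2 + 2 * (2 * v^2)^2" by (rule power2_sum_le)
 also have "\<dots> = 8 * u^4 + 8 * v^4" by (simp add: power_mult_distrib)
 finally show ?thesis .
qed

lemma L24_add:
 assumes "L24 N f" "L24 N g"
 shows "L24 N (\<lambda>x. f x + g x)"
proof -
 note [measurable] = L24D(1)[OF assms(1)] L24D(1)[OF assms(2)]
 have "integrable N (\<lambda>x. (f x + g x)^2)"
  by (rule Bochner_Integration.integrable_bound[where f="\<lambda>x. 2 * (f x)^2 + 2 * (g x)^2"])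
   (use L24D[OF assms(1)] L24D[OF assms(2)] power2_sum_le in auto)
 moreover have "integrable N (\<lambda>x. (f x + g x)^4)"
  by (rule Bochner_Integration.integrable_bound[where f="\<lambda>x. 8 * (f x)^4 + 8 * (g x)^4"])
   (use L24D[OF assms(1)] L24D[OF assms(2)] power4_sum_le in auto)
 ultimately show ?thesis unfolding L24_def by simp
qed

lemma L24_cmult:
 assumes "L24 N f"
 shows "L24 N (\<lambda>x. c * f x)"
 using assms unfolding L24_def by (auto simp: power_mult_distrib)

lemma L24_diff:
 assumes "L24 N f" "L24 N g"
 shows "L24 N (\<lambda>x. f x - g x)"
 using L24_add[OF assms(1) L24_cmult[OF assms(2), of "-1"]] by simp

lemma L24_zero: "L24 N (\<lambda>x. 0)"
 unfolding L24_def by simp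

lemma L24_sum:
 assumes "\<And>i. i \<in> I \<Longrightarrow> L24 N (f i)"
 shows "L24 N (\<lambda>x. \<Sum>i\<in>I. f i x)"
 using assms by (induction I rule: infinite_finite_induct) (auto intro: L24_add L24_zero)

lemma L24_mult2:
 assumes "L24 N f" "L24 N g"
 shows "integrable N (\<lambda>x. f x * g x)"
 using assms sq_integrable_mult L24_def by blast

lemma L24_mult_sq:
 assumes "L24 N f" "L24 N g"
 shows "integrable N (\<lambda>x. (f x * g x)^2)"
proof -
 have "integrable N (\<lambda>x. (f x)^2 * (g x)^2)"
  by (rule sq_integrable_mult) (use assms in \<open>auto simp: L24_def\<close>)
 then show ?thesis by (simp add: power_mult_distrib)
qed

lemma L24_mult4:
 assumes "L24 N f" "L24 N g" "L24 N h" "L24 N k"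
 shows "integrable N (\<lambda>x. f x * g x * h x * k x)"
proof -
 note [measurable] = assms[THEN L24D(1)]
 have "integrable N (\<lambda>x. (f x * g x) * (h x * k x))"
  by (rule sq_integrable_mult) (use assms L24_mult_sq in auto)
 then show ?thesis by (simp add: mult.assoc)
qed

lemma L2_conv_integral_sq:
 fixes f :: "nat \<Rightarrow> 'a \<Rightarrow> real"
 assumes [measurable]: "\<And>n. f n \<in> borel_measurable N" "g \<in> borel_measurable N"
  and f: "\<And>n. integrable N (\<lambda>x. (f n x)^2)" and g: "integrable N (\<lambda>x. (g x)^2)"
  and lim: "(\<lambda>n. \<integral>x. (f n x - g x)^2 \<partial>N) \<longlonglongrightarrow> 0"
 shows "(\<lambda>n. \<integral>x. (f n x)^2 \<partial>N) \<longlonglongrightarrow> (\<integral>x. (g x)^2 \<partial>N)"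
proof -
 have d: "integrable N (\<lambda>x. (f n x - g x)^2)" for n
 proof (rule Bochner_Integration.integrable_bound[where f="\<lambda>x. 2 * (f n x)^2 + 2 * (g x)^2"])
  show "AE x in N. norm ((f n x - g x)^2) \<le> norm (2 * (f n x)^2 + 2 * (g x)^2)"
   using power2_sum_le[of "f n x" "- g x" for x] by auto
 qed (use f g in auto)
 have dg: "integrable N (\<lambda>x. (f n x - g x) * g x)" for n
  by (rule sq_integrable_mult) (use d g in auto)
 have eq: "(\<integral>x. (f n x)^2 \<partial>N) = (\<integral>x. (f n x - g x)^2 \<partial>N) + 2 * (\<integral>x. (f n x - g x) * g x \<partial>N) + (\<integral>x. (g x)^2 \<partial>N)" for n
 proof -
  have "(\<lambda>x. (f n x)^2) = (\<lambda>x. (f n x - g x)^2 + 2 * ((f n x - g x) * g x) + (g x)^2)"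
   by (auto simp: power2_eq_square algebra_simps)
  then show ?thesis using d dg g by simp
 qed
 have "(\<lambda>n. \<integral>x. (f n x - g x) * g x \<partial>N) \<longlonglongrightarrow> 0"
 proof (rule Lim_null_comparison)
  show "\<forall>\<^sub>F n in sequentially. norm (\<integral>x. (f n x - g x) * g x \<partial>N) \<le> sqrt (\<integral>x. (f n x - g x)^2 \<partial>N) * sqrt (\<integral>x. (g x)^2 \<partial>N)"
   using integral_abs_Cauchy_Schwarz[of "\<lambda>x. f n x - g x" N g for n] d g by auto
  show "(\<lambda>n. sqrt (\<integral>x. (f n x - g x)^2 \<partial>N) * sqrt (\<integral>x. (g x)^2 \<partial>N)) \<longlonglongrightarrow> 0"
   using tendsto_mult[OF tendsto_real_sqrt[OF lim] tendsto_const] by simp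
 qed
 from tendsto_add[OF tendsto_add[OF lim tendsto_mult[OF tendsto_const this]] tendsto_const]
 show ?thesis unfolding eq by simp
qed

text \<open>\<open>L2_conv_integral_sq\<close> is applied to the squares: f^2 - g^2 = (f - g)^2 + 2
  (f - g) g, and Cauchy-Schwarz bounds the L2 norm of the last product by fourth powers.\<close>

lemma L4_conv_integral:
 fixes f :: "nat \<Rightarrow> 'a \<Rightarrow> real"
 assumes f: "\<And>n. L24 N (f n)" and g: "L24 N g"
  and lim: "(\<lambda>n. \<integral>x. (f n x - g x)^4 \<partial>N) \<longlonglongrightarrow> 0"
 shows "(\<lambda>n. \<integral>x. (f n x)^4 \<partial>N) \<longlonglongrightarrow> (\<integral>x. (g x)^4 \<partial>N)"
proof -
 note [measurable] = L24D(1)[OF f] L24D(1)[OF g]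
 have d: "L24 N (\<lambda>x. f n x - g x)" for n using L24_diff f g by blast
 have sq4: "(u^2)^2 = u^4" for u :: real by simp
 have "(\<lambda>n. \<integral>x. ((f n x)^2 - (g x)^2)^2 \<partial>N) \<longlonglongrightarrow> 0"
 proof (rule Lim_null_comparison)
  have "(\<integral>x. ((f n x)^2 - (g x)^2)^2 \<partial>N) \<le> 2 * (\<integral>x. (f n x - g x)^4 \<partial>N) + 8 * (sqrt (\<integral>x. (f n x - g x)^4 \<partial>N) * sqrt (\<integral>x. (g x)^4 \<partial>N))" for n
  proof -
   have i2: "integrable N (\<lambda>x. (f n x - g x)^2 * (g x)^2)"
    using L24_mult_sq[OF d g] by (simp add: power_mult_distrib)
   have pt: "((f n x)^2 - (g x)^2)^2 \<le> 2 * (f n x - g x)^4 + 8 * ((f n x - g x)^2 * (g x)^2)" for x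
   proof -
    have "(f n x)^2 - (g x)^2 = (f n x - g x)^2 + 2 * ((f n x - g x) * g x)"
     by (simp add: power2_eq_square algebra_simps)
    then have "((f n x)^2 - (g x)^2)^2 \<le> 2 * ((f n x - g x)^2)^2 + 2 * (2 * ((f n x - g x) * g x))^2"
     by (metis power2_sum_le)
    then show ?thesis by (simp add: power_mult_distrib)
   qed
   have "(\<integral>x. ((f n x)^2 - (g x)^2)^2 \<partial>N) \<le> (\<integral>x. 2 * (f n x - g x)^4 + 8 * ((f n x - g x)^2 * (g x)^2) \<partial>N)"
   proof (rule integral_mono)
    show "integrable N (\<lambda>x. ((f n x)^2 - (g x)^2)^2)"
     by (rule Bochner_Integration.integrable_bound[where f="\<lambda>x. 2 * (f n x - g x)^4 + 8 * ((f n x - g x)^2 * (g x)^2)"])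
      (use pt i2 L24D(3)[OF d] in auto)
   qed (use pt i2 L24D(3)[OF d] in auto)
   also have "\<dots> = 2 * (\<integral>x. (f n x - g x)^4 \<partial>N) + 8 * (\<integral>x. (f n x - g x)^2 * (g x)^2 \<partial>N)"
    using i2 L24D(3)[OF d] by simp
   also have "(\<integral>x. (f n x - g x)^2 * (g x)^2 \<partial>N) \<le> sqrt (\<integral>x. (f n x - g x)^4 \<partial>N) * sqrt (\<integral>x. (g x)^4 \<partial>N)"
    using integral_abs_Cauchy_Schwarz[of "\<lambda>x. (f n x - g x)^2" N "\<lambda>x. (g x)^2"] L24D(3)[OF d] L24D(3)[OF g]
    unfolding sq4 by (simp add: sq4)
   finally show ?thesis by simp
  qed
  then show "\<forall>\<^sub>F n in sequentially. norm (\<integral>x. ((f n x)^2 - (g x)^2)^2 \<partial>N) \<le> 2 * (\<integral>x. (f n x - g x)^4 \<partial>N) + 8 * (sqrt (\<integral>x. (f n x - g x)^4 \<partial>N) * sqrt (\<integral>x. (g x)^4 \<partial>N))"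
   by simp
  show "(\<lambda>n. 2 * (\<integral>x. (f n x - g x)^4 \<partial>N) + 8 * (sqrt (\<integral>x. (f n x - g x)^4 \<partial>N) * sqrt (\<integral>x. (g x)^4 \<partial>N))) \<longlonglongrightarrow> 0"
   using tendsto_add[OF tendsto_mult[OF tendsto_const lim] tendsto_mult[OF tendsto_const tendsto_mult[OF tendsto_real_sqrt[OF lim] tendsto_const]]]
   by (simp only: real_sqrt_zero mult_zero_left mult_zero_right add_0_left)
 qed
 from L2_conv_integral_sq[OF _ _ _ _ this] show ?thesis
  using L24D[OF f] L24D[OF g] by (simp add: sq4)
qed

lemma (in prob_space) integrable_power4_imp_L24:
 fixes X :: "'a \<Rightarrow> real"
 assumes [measurable]: "random_variable borel X" and "integrable M (\<lambda>x. (X x)^4)"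
 shows "L24 M X"
proof -
 have "integrable M (\<lambda>x. ((X x)^2)^2)" using assms(2) by simp
 then have "integrable M (\<lambda>x. (X x)^2)"
  by (rule square_integrable_imp_integrable[rotated]) simp
 then show ?thesis using assms unfolding L24_def by simp
qed

lemma (in prob_space) expectation_le_sqrt:
 fixes X :: "'a \<Rightarrow> real"
 assumes [measurable]: "random_variable borel X" and "integrable M (\<lambda>x. (X x)^2)"
 shows "expectation (\<lambda>x. \<bar>X x\<bar>) \<le> sqrt (expectation (\<lambda>x. (X x)^2))"
 using integral_abs_Cauchy_Schwarz[of "\<lambda>x. \<bar>X x\<bar>" M "\<lambda>x. 1"] assms by (simp add: prob_space)

lemma (in prob_space) L24_integrable: "L24 M X \<Longrightarrow> integrable M X"
 using L24_def square_integrable_imp_integrable by blast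

lemma (in prob_space) expectation_sq_le_power4:
 assumes "L24 M X"
 shows "expectation (\<lambda>x. (X x)^2) \<le> sqrt (expectation (\<lambda>x. (X x)^4))"
proof -
 note [measurable] = L24D(1)[OF assms]
 have "integrable M (\<lambda>x. ((X x)^2)^2)" using L24D(3)[OF assms] by simp
 then show ?thesis using expectation_le_sqrt[of "\<lambda>x. (X x)^2"] L24D[OF assms] by simp
qed

text \<open>The fourth powers run over all signs of x2, x3, x4, weighted by the product of the
  signs. Only a monomial odd in each of these three variables survives, hence only x1 x2 x3 x4, with
  multinomial coefficient 24 in each of the eight terms.\<close>

lemma polarization4:
 fixes x1 x2 x3 x4 :: real
 shows "192 * (x1 * x2 * x3 * x4) =
  (x1+x2+x3+x4)^4 - (x1+x2+x3-x4)^4 - (x1+x2-x3+x4)^4 + (x1+x2-x3-x4)^4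
  - (x1-x2+x3+x4)^4 + (x1-x2+x3-x4)^4 + (x1-x2-x3+x4)^4 - (x1-x2-x3-x4)^4"
proof -
 have 4: "(s + t)^4 - (s - t)^4 = 8 * t * s^3 + 8 * t^3 * s" for s t :: real
  by (simp add: power4_eq_xxxx power3_eq_cube algebra_simps)
 have 3: "(x1+x2+x3)^3 - (x1+x2-x3)^3 - (x1-x2+x3)^3 + (x1-x2-x3)^3 = 24 * (x1 * x2 * x3)"
  by (simp add: power3_eq_cube algebra_simps)
 have "192 * (x1 * x2 * x3 * x4) = 8 * x4 * (24 * (x1 * x2 * x3))" by simp
 also have "\<dots> = (8 * x4 * (x1+x2+x3)^3 + 8 * x4^3 * (x1+x2+x3)) - (8 * x4 * (x1+x2-x3)^3 + 8 * x4^3 * (x1+x2-x3))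
   - (8 * x4 * (x1-x2+x3)^3 + 8 * x4^3 * (x1-x2+x3)) + (8 * x4 * (x1-x2-x3)^3 + 8 * x4^3 * (x1-x2-x3))"
  unfolding 3[symmetric] by (simp only: ring_distribs)
 finally show ?thesis unfolding 4[symmetric] by linarith
qed

section \<open>Moments of the basis\<close>

lemma exp_neg_bounds:
 fixes y :: real
 assumes "0 \<le> y"
 shows "1 - exp (- y) \<le> y" "exp (-y) * y \<le> 1 - exp (- y)"
proof -
 show "1 - exp (- y) \<le> y" using exp_ge_add_one_self[of "-y"] by simp
 have "exp (-y) * (1 + y) \<le> exp (-y) * exp y" by (intro mult_left_mono exp_ge_add_one_self) auto
 then show "exp (-y) * y \<le> 1 - exp (- y)" by (simp add: exp_minus_inverse algebra_simps flip: exp_add)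
qed

text \<open>The Taylor remainder is the expectation of the minimum of a quadratic and a cubic term
  in X. The quadratic one dominates and the cubic one tends to 0, so a second moment yields an error
  of order o(u^2).\<close>

lemma (in prob_space) char_quadratic_approx:
 fixes X :: "'a \<Rightarrow> real" and u :: "nat \<Rightarrow> real"
 assumes X[measurable]: "random_variable borel X" and X2: "integrable M (\<lambda>x. (X x)^2)"
  and mean: "expectation X = 0" and u: "u \<longlonglongrightarrow> 0"
 obtains e where "e \<longlonglongrightarrow> 0"
  "\<And>n. cmod (char (distr M borel X) (u n) - of_real (1 - (u n)^2 * expectation (\<lambda>x. (X x)^2) / 2)) \<le> (u n)^2 * e n"
proof
 define e where "e n = expectation (\<lambda>x. min (6 * (X x)^2) (\<bar>u n\<bar> * \<bar>X x\<bar>^3)) / 6" for n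
 have Xi: "integrable M X" using X2 square_integrable_imp_integrable[of X] by simp
 have "(\<lambda>n. expectation (\<lambda>x. min (6 * (X x)^2) (\<bar>u n\<bar> * \<bar>X x\<bar>^3))) \<longlonglongrightarrow> expectation (\<lambda>x. 0)"
 proof (rule integral_dominated_convergence[where w="\<lambda>x. 6 * (X x)^2"])
  show "AE x in M. (\<lambda>n. min (6 * (X x)^2) (\<bar>u n\<bar> * \<bar>X x\<bar> ^ 3)) \<longlonglongrightarrow> 0"
  proof (rule AE_I2)
   fix x
   have "(\<lambda>n. min (6 * (X x)^2) (\<bar>u n\<bar> * \<bar>X x\<bar> ^ 3)) \<longlonglongrightarrow> min (6 * (X x)^2) (\<bar>0\<bar> * \<bar>X x\<bar> ^ 3)"
    by (intro tendsto_intros u)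
   then show "(\<lambda>n. min (6 * (X x)^2) (\<bar>u n\<bar> * \<bar>X x\<bar> ^ 3)) \<longlonglongrightarrow> 0" by simp
  qed
 qed (use X2 in auto)
 then show "e \<longlonglongrightarrow> 0" unfolding e_def by (auto intro: tendsto_eq_intros)
 show "cmod (char (distr M borel X) (u n) - of_real (1 - (u n)^2 * expectation (\<lambda>x. (X x)^2) / 2)) \<le> (u n)^2 * e n" for n
  using char_approx3'[OF X Xi X2 mean, of "expectation (\<lambda>x. (X x)^2)" "distr M borel X" "u n"] mean unfolding e_def by simp
qed

text \<open>Working with the modulus removes the drift and the compensator of a Levy exponent and
  leaves exp (- y). The second moment is read off from 1 - exp (- y), which
  \<open>exp_neg_bounds\<close> compares with y from both sides.\<close>

lemma (in prob_space) char_second_order: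
 fixes X :: "'a \<Rightarrow> real" and u :: "nat \<Rightarrow> real"
 assumes X[measurable]: "random_variable borel X" and X2: "integrable M (\<lambda>x. (X x)^2)"
  and mean: "expectation X = 0"
  and y: "\<And>n. cmod (char (distr M borel X) (u n)) = exp (- y n)" "\<And>n. 0 \<le> y n"
  and u: "u \<longlonglongrightarrow> 0" "\<And>n. u n \<noteq> 0"
 shows "(\<lambda>n. 2 * y n / (u n)^2) \<longlonglongrightarrow> expectation (\<lambda>x. (X x)^2)"
proof -
 define v where "v = expectation (\<lambda>x. (X x)^2)"
 have v0: "v \<ge> 0" unfolding v_def by simp
 obtain e where e0: "e \<longlonglongrightarrow> 0"
  and b: "\<And>n. cmod (char (distr M borel X) (u n) - of_real (1 - (u n)^2 * v / 2)) \<le> (u n)^2 * e n"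
  using char_quadratic_approx[OF X X2 mean u(1)] unfolding v_def by blast
 have u2: "(\<lambda>n. (u n)^2) \<longlonglongrightarrow> 0" using tendsto_power[OF u(1), of 2] by simp
 have small: "\<forall>\<^sub>F n in sequentially. (u n)^2 * v / 2 < 1"
 proof (rule order_tendstoD(2)[of _ 0])
  show "(\<lambda>n. (u n)^2 * v / 2) \<longlonglongrightarrow> 0"
   using tendsto_mult[OF u2 tendsto_const[of "v/2"]] by simp
 qed simp
 define w where "w n = (1 - exp (- y n)) / (u n)^2" for n
 have w: "w \<longlonglongrightarrow> v / 2"
 proof (rule LIM_zero_cancel, rule Lim_null_comparison[OF _ e0])
  show "\<forall>\<^sub>F n in sequentially. norm (w n - v / 2) \<le> e n"
   using small
  proof eventually_elim
   case (elim n)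
   have "\<bar>cmod (char (distr M borel X) (u n)) - cmod (of_real (1 - (u n)^2 * v / 2))\<bar> \<le> (u n)^2 * e n"
    using b[of n] norm_triangle_ineq3 order_trans by blast
   moreover have "cmod (of_real (1 - (u n)^2 * v / 2)) = 1 - (u n)^2 * v / 2"
    unfolding norm_of_real using elim by simp
   ultimately have "\<bar>exp (- y n) - (1 - (u n)^2 * v / 2)\<bar> \<le> (u n)^2 * e n" using y by simp
   moreover have "(w n - v/2) = - (exp (- y n) - (1 - (u n)^2 * v / 2)) / (u n)^2"
    unfolding w_def using u(2)[of n] by (simp add: field_simps)
   ultimately show ?case using u(2)[of n] by (simp add: abs_divide pos_divide_le_eq mult.commute)
  qed
 qed
 have "(\<lambda>n. w n * (u n)^2) \<longlonglongrightarrow> 0" using tendsto_mult[OF w u2] by simp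
 then have "(\<lambda>n. 1 - w n * (u n)^2) \<longlonglongrightarrow> 1" by (auto intro: tendsto_eq_intros)
 moreover have "1 - w n * (u n)^2 = exp (- y n)" for n unfolding w_def using u(2) by simp
 ultimately have ey: "(\<lambda>n. exp (- y n)) \<longlonglongrightarrow> 1" by simp
 have "(\<lambda>n. y n / (u n)^2) \<longlonglongrightarrow> v / 2"
 proof (rule tendsto_sandwich[of w _ _ "\<lambda>n. w n / exp (- y n)"])
  show "\<forall>\<^sub>F n in sequentially. w n \<le> y n / (u n)^2"
   unfolding w_def using exp_neg_bounds(1)[OF y(2)] by (auto intro!: divide_right_mono always_eventually)
  show "\<forall>\<^sub>F n in sequentially. y n / (u n)^2 \<le> w n / exp (- y n)"
  proof (rule always_eventually, rule allI)
   fix n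
   have "y n \<le> (1 - exp (- y n)) / exp (- y n)"
    using exp_neg_bounds(2)[OF y(2)[of n]] by (simp add: pos_le_divide_eq mult.commute)
   then have "y n / (u n)^2 \<le> ((1 - exp (- y n)) / exp (- y n)) / (u n)^2" by (rule divide_right_mono) simp
   then show "y n / (u n)^2 \<le> w n / exp (- y n)" unfolding w_def by (simp only: divide_divide_eq_left mult.commute)
  qed
  show "(\<lambda>n. w n / exp (- y n)) \<longlonglongrightarrow> v / 2" using tendsto_divide[OF w ey] by simp
 qed (rule w)
 from tendsto_mult[OF tendsto_const[of 2] this] show ?thesis unfolding v_def by simp
qed

lemma min_1_power2_bound:
 fixes u z :: real
 shows "cmod (iexp (u * z) - 1 - \<i> * of_real (u * z * indicator {z. \<bar>z\<bar> < 1} z)) \<le> (u^2 + 2) * min 1 (z^2)"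
proof (cases "\<bar>z\<bar> < 1")
 case True
 have "cmod (iexp (u*z) - (1 + \<i> * of_real (u * z))) \<le> (u*z)^2 / 2"
  using iexp_approx1[of "u*z" 1] by (simp add: power2_eq_square)
 moreover have "z^2 \<le> 1" using True by (simp add: abs_square_le_1)
 moreover have "(u*z)^2 / 2 \<le> (u^2 + 2) * z^2" by (simp add: power_mult_distrib algebra_simps)
 ultimately show ?thesis using True by (simp add: diff_diff_eq)
next
 case False
 have "z^2 \<ge> 1" using False by (metis abs_le_square_iff abs_one linorder_not_less one_power2)
 moreover have "cmod (iexp (u*z) - 1) \<le> 2"
  using norm_triangle_ineq4[of "iexp (u*z)" 1] norm_exp_i_times[of "u*z"] by simp
 moreover have "2 \<le> u^2 + 2" by simp
 ultimately have "cmod (iexp (u*z) - 1) \<le> u^2 + 2" by linarith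
 then show ?thesis using False \<open>z^2 \<ge> 1\<close> by (simp add: min_absorb1)
qed

lemma bounded_borelD:
 assumes "B \<in> bounded_borel"
 shows "B \<in> sets borel" "B \<in> sets lborel" "bounded B" "emeasure lborel B < \<infinity>"
 using assms emeasure_bounded_finite unfolding bounded_borel_def by auto

lemma bounded_borel_Int: "A \<in> sets borel \<Longrightarrow> B \<in> bounded_borel \<Longrightarrow> A \<inter> B \<in> bounded_borel"
 unfolding bounded_borel_def by (auto intro: bounded_subset)

lemma bounded_borel_Un: "A \<in> bounded_borel \<Longrightarrow> B \<in> bounded_borel \<Longrightarrow> A \<union> B \<in> bounded_borel"
 unfolding bounded_borel_def by auto

lemma bounded_borel_empty: "{} \<in> bounded_borel"
 unfolding bounded_borel_def by auto

lemma bounded_borel_UN: "finite I \<Longrightarrow> (\<And>i. i \<in> I \<Longrightarrow> B i \<in> bounded_borel) \<Longrightarrow> (\<Union>i\<in>I. B i) \<in> bounded_borel"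
 unfolding bounded_borel_def by auto

lemma unit_cube_bounded_borel: "cbox 0 (1::real^'d) \<in> bounded_borel"
 unfolding bounded_borel_def by auto

lemma measure_unit_cube: "measure lborel (cbox 0 (1::real^'d)) = 1"
proof -
 have "cbox 0 (1::real^'d) \<noteq> {}" by (simp add: interval_ne_empty_cart)
 then show ?thesis using content_cbox_cart[of "0::real^'d" 1] by simp
qed

locale centered_levy_basis = homogeneous_levy_basis M \<Lambda> \<beta> \<sigma> \<nu>
 for M :: "'w measure" and \<Lambda> :: "(real^'d) set \<Rightarrow> 'w \<Rightarrow> real" and \<beta> \<sigma> \<nu> +
 assumes mean_zero: "\<And>B. B \<in> bounded_borel \<Longrightarrow> expectation (\<Lambda> B) = 0"
  and second_moment: "\<And>B. B \<in> bounded_borel \<Longrightarrow> integrable M (\<lambda>w. (\<Lambda> B w)^2)"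
  and fourth_moment: "integrable M (\<lambda>w. (\<Lambda> (cbox 0 1) w) ^ 4)"
begin

abbreviation "k2 \<equiv> kappa2 \<sigma> \<nu>"
text \<open>The fourth cumulant of the basis per unit volume: the mean is zero, and
  \<open>k2\<close> is the variance per unit volume by \<open>basis_variance\<close>.\<close>

abbreviation "c4 \<equiv> kappa4 \<Lambda> - 3 * k2^2"

lemma levy_integrable:
 "integrable \<nu> (\<lambda>z. iexp (u * z) - 1 - \<i> * of_real (u * z * indicator {z. \<bar>z\<bar> < 1} z))"
proof (rule Bochner_Integration.integrable_bound[where f="\<lambda>z. (u^2 + 2) * min 1 (z^2)"])
 have [measurable_cong]: "sets \<nu> = sets borel" using levy_measure levy_measure_def by blast
 have "integrable \<nu> (\<lambda>z. min 1 (z^2))"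
  using levy_measure unfolding levy_measure_def by (intro integrableI_nonneg) auto
 then show "integrable \<nu> (\<lambda>z. (u^2 + 2) * min 1 (z^2))" by simp
 have "{z::real. \<bar>z\<bar> < 1} \<in> sets borel" by measurable
 then show "(\<lambda>z. iexp (u * z) - 1 - \<i> * of_real (u * z * indicator {z. \<bar>z\<bar> < 1} z)) \<in> borel_measurable \<nu>"
  by measurable
 have "0 \<le> (u^2 + 2) * min 1 (z^2)" for z by simp
 then show "AE z in \<nu>. norm (iexp (u * z) - 1 - \<i> * of_real (u * z * indicator {z. \<bar>z\<bar> < 1} z))
   \<le> norm ((u^2 + 2) * min 1 (z^2))"
  using min_1_power2_bound[of u] by (intro AE_I2) (metis abs_of_nonneg real_norm_def)
qed

text \<open>The real part is governed by the nonnegative integrand 2 (1 - cos (u z)), to which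
  Fatou's lemma will be applicable; drift and compensator are purely imaginary.\<close>

lemma Re_levy_exponent:
 "Re (levy_exponent \<beta> \<sigma> \<nu> u) = - (\<sigma>^2 * u^2 + (\<integral>z. 2 * (1 - cos (u * z)) \<partial>\<nu>)) / 2"
 "integrable \<nu> (\<lambda>z. 2 * (1 - cos (u * z)))"
proof -
 have re: "Re (iexp (u * z) - 1 - \<i> * of_real (u * z * indicator {z. \<bar>z\<bar> < 1} z)) = (- 1/2) * (2 * (1 - cos (u * z)))" for z
  by (simp add: Re_exp field_simps)
 have "(\<lambda>z. 2 * (1 - cos (u * z))) = (\<lambda>z. - 2 * Re (iexp (u * z) - 1 - \<i> * of_real (u * z * indicator {z. \<bar>z\<bar> < 1} z)))"
  unfolding re by (auto simp: field_simps)
 moreover have "integrable \<nu> (\<lambda>z. - 2 * Re (iexp (u * z) - 1 - \<i> * of_real (u * z * indicator {z. \<bar>z\<bar> < 1} z)))"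
  using integrable_Re[OF levy_integrable[of u]] by (intro integrable_mult_right)
 ultimately show "integrable \<nu> (\<lambda>z. 2 * (1 - cos (u * z)))" by simp
 have "Re (CLINT z|\<nu>. iexp (u * z) - 1 - \<i> * of_real (u * z * indicator {z. \<bar>z\<bar> < 1} z)) = (\<integral>z. (- 1/2) * (2 * (1 - cos (u * z))) \<partial>\<nu>)"
  unfolding re[symmetric] by (rule integral_Re[OF levy_integrable, symmetric])
 also have "\<dots> = (-1/2) * (\<integral>z. (2 * (1 - cos (u * z))) \<partial>\<nu>)"
  by (rule integral_mult_right_zero)
 finally have 1: "Re (CLINT z|\<nu>. iexp (u * z) - 1 - \<i> * of_real (u * z * indicator {z. \<bar>z\<bar> < 1} z)) = (-1/2) * (\<integral>z. (2 * (1 - cos (u * z))) \<partial>\<nu>)" .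
 show "Re (levy_exponent \<beta> \<sigma> \<nu> u) = - (\<sigma>^2 * u^2 + (\<integral>z. 2 * (1 - cos (u * z)) \<partial>\<nu>)) / 2"
  unfolding levy_exponent_def plus_complex.simps 1 by (simp add: field_simps)
qed

lemma basis_variance_limit:
 assumes B: "B \<in> bounded_borel"
 shows "(\<lambda>n. measure lborel B * (\<sigma>^2 + (\<integral>z. 2 * (1 - cos (1 / real (Suc n) * z)) \<partial>\<nu>) / (1 / real (Suc n))^2))
   \<longlonglongrightarrow> expectation (\<lambda>w. (\<Lambda> B w)^2)"
proof -
 define u where "u n = 1 / real (Suc n)" for n
 define y where "y n = measure lborel B * ((\<sigma>^2 * (u n)^2 + (\<integral>z. 2 * (1 - cos (u n * z)) \<partial>\<nu>)) / 2)" for n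
 have "(\<lambda>n. 2 * y n / (u n)^2) \<longlonglongrightarrow> expectation (\<lambda>w. (\<Lambda> B w)^2)"
 proof (rule char_second_order)
  show "u \<longlonglongrightarrow> 0" unfolding u_def using LIMSEQ_inverse_real_of_nat by (simp add: inverse_eq_divide)
  show "cmod (char (distr M borel (\<Lambda> B)) (u n)) = exp (- y n)" for n
   unfolding basis_char[OF B] norm_exp_eq_Re y_def by (simp add: Re_levy_exponent field_simps)
  show "0 \<le> y n" for n unfolding y_def by (intro mult_nonneg_nonneg divide_nonneg_nonneg add_nonneg_nonneg integral_nonneg_AE) auto
 qed (use B basis_rv second_moment mean_zero in \<open>auto simp: u_def\<close>)
 moreover have "2 * y n / (u n)^2 = measure lborel B * (\<sigma>^2 + (\<integral>z. 2 * (1 - cos (u n * z)) \<partial>\<nu>) / (u n)^2)" for n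
  unfolding y_def u_def by (simp add: field_simps)
 ultimately show ?thesis unfolding u_def by simp
qed

text \<open>Integrability of z^2 under \<open>\<nu>\<close> is extracted from the finite second
  moment on the unit cube. The functions 2 (1 - cos (u z)) / u^2 are nonnegative, bounded by z^2 and
  converge to z^2 as u tends to 0: Fatou's lemma gives integrability of the limit, which then serves
  as the dominating function.\<close>

lemma basis_variance_limit_kappa2:
 "(\<lambda>n. \<sigma>^2 + (\<integral>z. 2 * (1 - cos (1 / real (Suc n) * z)) \<partial>\<nu>) / (1 / real (Suc n))^2) \<longlonglongrightarrow> k2"
proof -
 have sets[measurable_cong]: "sets \<nu> = sets borel" using levy_measure levy_measure_def by blast
 define u where "u n = 1 / real (Suc n)" for n
 have u: "u \<longlonglongrightarrow> 0" "\<And>n. u n \<noteq> 0"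
  unfolding u_def using LIMSEQ_inverse_real_of_nat by (simp_all add: inverse_eq_divide)
 define h where "h n z = 2 * (1 - cos (u n * z)) / (u n)^2" for n z
 have hi: "integrable \<nu> (h n)" for n unfolding h_def using Re_levy_exponent(2) by (rule integrable_divide_zero)
 have h0: "0 \<le> h n z" for n z unfolding h_def by (intro divide_nonneg_nonneg) auto
 have hb: "h n z \<le> z^2" for n z
 proof -
  have "1 - cos (u n * z) = 2 * (sin (u n * z / 2))^2"
   using cos_double_sin[of "u n * z / 2"] by simp
  moreover have "(sin (u n * z / 2))^2 \<le> (u n * z / 2)^2"
   using abs_sin_le_one abs_sin_x_le_abs_x[of "u n * z/2"] abs_le_square_iff by blast
  ultimately have "2 * (1 - cos (u n * z)) \<le> (u n)^2 * z^2" by (simp add: power_divide power_mult_distrib)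
  then show ?thesis unfolding h_def using u(2)[of n] by (simp add: pos_divide_le_eq mult.commute)
 qed
 have hlim: "(\<lambda>n. h n z) \<longlonglongrightarrow> z^2" for z
 proof (cases "z = 0")
  case False
  have f: "filterlim (\<lambda>n. u n * z / 2) (at 0) sequentially"
  proof (rule filterlim_atI)
   show "(\<lambda>n. u n * z / 2) \<longlonglongrightarrow> 0" using tendsto_mult[OF u(1) tendsto_const[of "z/2"]] by simp
  qed (use u(2) False in auto)
  have "((\<lambda>x. sin x / x) \<longlongrightarrow> 1) (at (0::real))"
   using DERIV_sin[of "0::real"] by (simp add: has_field_derivative_iff)
  from tendsto_power[OF filterlim_compose[OF this f], of 2]
  have "(\<lambda>n. z^2 * (sin (u n * z / 2) / (u n * z / 2))^2) \<longlonglongrightarrow> z^2"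
   using tendsto_mult[OF tendsto_const[of "z^2"]] by fastforce
  moreover have "z^2 * (sin (u n * z / 2) / (u n * z / 2))^2 = h n z" for n
  proof -
   have "1 - cos (u n * z) = 2 * (sin (u n * z / 2))^2"
    using cos_double_sin[of "u n * z / 2"] by simp
   then show ?thesis unfolding h_def using False u(2)[of n] by (simp add: power_divide power_mult_distrib)
  qed
  ultimately show ?thesis by simp
 qed (simp add: h_def)
 have lim1: "(\<lambda>n. \<sigma>^2 + (\<integral>z. h n z \<partial>\<nu>)) \<longlonglongrightarrow> expectation (\<lambda>v. (\<Lambda> (cbox 0 1) v)^2)"
  using basis_variance_limit[OF unit_cube_bounded_borel] unfolding h_def u_def measure_unit_cube by simp
 have lim2: "(\<lambda>n. (\<integral>z. h n z \<partial>\<nu>)) \<longlonglongrightarrow> expectation (\<lambda>v. (\<Lambda> (cbox 0 1) v)^2) - \<sigma>^2"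
  using tendsto_diff[OF lim1 tendsto_const[of "\<sigma>^2"]] by simp
 have "integrable \<nu> (\<lambda>z. z^2)"
 proof (rule integrableI_nonneg)
  have "(\<integral>\<^sup>+ z. ennreal (z^2) \<partial>\<nu>) = (\<integral>\<^sup>+ z. liminf (\<lambda>n. ennreal (h n z)) \<partial>\<nu>)"
  proof (rule nn_integral_cong)
   fix z show "ennreal (z^2) = liminf (\<lambda>n. ennreal (h n z))"
    using lim_imp_Liminf[OF _ tendsto_ennrealI[OF hlim[of z]]] by simp
  qed
  also have "\<dots> \<le> liminf (\<lambda>n. \<integral>\<^sup>+ z. ennreal (h n z) \<partial>\<nu>)"
   by (rule nn_integral_liminf) (use hi in auto)
  also have "\<dots> = liminf (\<lambda>n. ennreal (\<integral>z. h n z \<partial>\<nu>))"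
   using nn_integral_eq_integral[OF hi] h0 by simp
  also have "\<dots> = ennreal (expectation (\<lambda>v. (\<Lambda> (cbox 0 1) v)^2) - \<sigma>^2)"
   by (rule lim_imp_Liminf[OF _ tendsto_ennrealI[OF lim2]]) simp
  finally show "(\<integral>\<^sup>+ z. ennreal (z^2) \<partial>\<nu>) < \<infinity>" using le_less_trans by fastforce
 qed auto
 then have "(\<lambda>n. (\<integral>z. h n z \<partial>\<nu>)) \<longlonglongrightarrow> (\<integral>z. z^2 \<partial>\<nu>)"
  by (intro integral_dominated_convergence[where w="\<lambda>z. z^2"]) (use hlim hb h0 hi in auto)
 from tendsto_add[OF tendsto_const[of "\<sigma>^2"] this] show ?thesis
  unfolding kappa2_def h_def u_def by simp
qed

lemma basis_variance:
 assumes "B \<in> bounded_borel"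
 shows "expectation (\<lambda>w. (\<Lambda> B w)^2) = k2 * measure lborel B"
 using LIMSEQ_unique[OF basis_variance_limit[OF assms] tendsto_mult[OF tendsto_const basis_variance_limit_kappa2]]
 by simp

lemma k2_nonneg: "0 \<le> k2"
proof -
 have "0 \<le> expectation (\<lambda>w. (\<Lambda> (cbox 0 1) w)^2)" by simp
 then show ?thesis unfolding basis_variance[OF unit_cube_bounded_borel] measure_unit_cube by simp
qed

lemma basis_law:
 assumes "B \<in> bounded_borel" "B' \<in> bounded_borel" "measure lborel B = measure lborel B'"
 shows "distr M borel (\<Lambda> B) = distr M borel (\<Lambda> B')"
proof (rule Levy_uniqueness)
 show "char (distr M borel (\<Lambda> B)) = char (distr M borel (\<Lambda> B'))"
  using basis_char assms by auto
qed (use assms basis_rv in auto)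

lemma basis_empty: "AE w in M. \<Lambda> {} w = 0"
proof -
 have "expectation (\<lambda>w. (\<Lambda> {} w)^2) = 0" using basis_variance[OF bounded_borel_empty] by simp
 then have "AE w in M. (\<Lambda> {} w)^2 = 0"
  using integral_nonneg_eq_0_iff_AE[OF second_moment[OF bounded_borel_empty]] by simp
 then show ?thesis by simp
qed

lemma basis_Un:
 assumes A: "A \<in> bounded_borel" and B: "B \<in> bounded_borel" and disj: "A \<inter> B = {}"
 shows "AE w in M. \<Lambda> (A \<union> B) w = \<Lambda> A w + \<Lambda> B w"
proof -
 define Bs where "Bs n = (if n = 0 then A else if n = 1 then B else {})" for n :: nat
 have U: "(\<Union>n. Bs n) = A \<union> B" unfolding Bs_def by (auto split: if_splits)
 have "range Bs \<subseteq> bounded_borel" unfolding Bs_def using A B bounded_borel_empty by auto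
 moreover have "disjoint_family Bs" unfolding Bs_def disjoint_family_on_def using disj by auto
 moreover have "(\<Union>n. Bs n) \<in> bounded_borel" unfolding U using A B by (rule bounded_borel_Un)
 ultimately have "AE w in M. (\<lambda>n. \<Lambda> (Bs n) w) sums \<Lambda> (\<Union>n. Bs n) w"
  by (rule basis_countably_additive)
 then show ?thesis using basis_empty
 proof eventually_elim
  case (elim w)
  have "(\<lambda>n. \<Lambda> (Bs n) w) sums (\<Sum>n\<in>{0,1}. \<Lambda> (Bs n) w)"
   by (rule sums_finite) (use elim in \<open>auto simp: Bs_def\<close>)
  moreover have "(\<Sum>n\<in>{0,1}. \<Lambda> (Bs n) w) = \<Lambda> A w + \<Lambda> B w" by (simp add: Bs_def)
  ultimately show ?case using elim sums_unique2 unfolding U by metis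
 qed
qed

lemma basis_UN:
 assumes "finite I" "\<And>i. i \<in> I \<Longrightarrow> B i \<in> bounded_borel" "disjoint_family_on B I"
 shows "AE w in M. \<Lambda> (\<Union>i\<in>I. B i) w = (\<Sum>i\<in>I. \<Lambda> (B i) w)"
 using assms
proof (induction I rule: finite_induct)
 case empty
 then show ?case using basis_empty by simp
next
 case (insert i I)
 have "AE w in M. \<Lambda> (B i \<union> (\<Union>i\<in>I. B i)) w = \<Lambda> (B i) w + \<Lambda> (\<Union>i\<in>I. B i) w"
 proof (rule basis_Un)
  show "(\<Union>i\<in>I. B i) \<in> bounded_borel" using insert by (intro bounded_borel_UN) auto
  show "B i \<inter> (\<Union>i\<in>I. B i) = {}" using insert(2,5) unfolding disjoint_family_on_def by fastforce
 qed (use insert in auto)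
 moreover have "AE w in M. \<Lambda> (\<Union>i\<in>I. B i) w = (\<Sum>i\<in>I. \<Lambda> (B i) w)"
  using insert by (intro insert.IH) (auto simp: disjoint_family_on_def)
 ultimately show ?case
  by eventually_elim (use insert in simp)
qed

text \<open>The locale speaks of sequences of sets, so the finite family is placed into a sequence
  through an injection into the naturals and padded with empty sets; independence is then pulled
  back along the injection.\<close>

lemma basis_indep_finite:
 fixes I :: "'i set"
 assumes I: "finite I" and B: "\<And>i. i \<in> I \<Longrightarrow> B i \<in> bounded_borel" and disj: "disjoint_family_on B I"
 shows "indep_vars (\<lambda>_. borel) (\<lambda>i. \<Lambda> (B i)) I"
proof -
 obtain e :: "'i \<Rightarrow> nat" where e: "inj_on e I" using I finite_imp_inj_to_nat_seg by metis
 define Bs where "Bs n = (if n \<in> e ` I then B (inv_into I e n) else {})" for n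
 have Bs: "Bs (e i) = B i" if "i \<in> I" for i unfolding Bs_def using that e by simp
 have r: "range Bs \<subseteq> bounded_borel" unfolding Bs_def using B bounded_borel_empty by (auto simp: e)
 have d: "disjoint_family Bs" unfolding disjoint_family_on_def
 proof (intro ballI impI)
  fix m n :: nat assume "(m::nat) \<noteq> n"
  show "Bs m \<inter> Bs n = {}"
  proof (cases "m \<in> e ` I \<and> n \<in> e ` I")
   case True
   then obtain i j where "i \<in> I" "j \<in> I" "m = e i" "n = e j" by auto
   moreover from this have "i \<noteq> j" using \<open>m \<noteq> n\<close> by auto
   ultimately show ?thesis using Bs disj unfolding disjoint_family_on_def by auto
  qed (auto simp: Bs_def)
 qed
 have "indep_vars (\<lambda>j. PiM {e j} (\<lambda>_. borel)) (\<lambda>j w. restrict (\<lambda>i. \<Lambda> (Bs i) w) {e j}) I"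
  by (rule indep_vars_restrict[OF basis_indep[OF r d]]) (use e in \<open>auto simp: disjoint_family_on_def inj_on_def\<close>)
 then have "indep_vars (\<lambda>_. borel) (\<lambda>j w. (restrict (\<lambda>i. \<Lambda> (Bs i) w) {e j}) (e j)) I"
  by (rule indep_vars_compose2[where Y="\<lambda>j f. f (e j)"]) measurable
 then show ?thesis
  by (rule indep_vars_cong[THEN iffD1, rotated 3]) (auto simp: Bs)
qed

end

section \<open>Moments of independent sums and the fourth cumulant as a function of volume\<close>

lemma (in prob_space) indep_var_L24_moments:
 fixes X Z :: "'a \<Rightarrow> real"
 assumes indep: "indep_var borel X borel Z" and X: "L24 M X" and Z: "L24 M Z"
  and "expectation X = 0" "expectation Z = 0"
 shows "expectation (\<lambda>z. (X z + Z z)^2) = expectation (\<lambda>z. (X z)^2) + expectation (\<lambda>z. (Z z)^2)"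
  and "expectation (\<lambda>z. (X z + Z z)^4) = expectation (\<lambda>z. (X z)^4)
   + 6 * (expectation (\<lambda>z. (X z)^2) * expectation (\<lambda>z. (Z z)^2)) + expectation (\<lambda>z. (Z z)^4)"
proof -
 note [measurable] = L24D(1)[OF X] L24D(1)[OF Z]
 have cube: "integrable M (\<lambda>z. (W z)^3)" if "L24 M W" for W
 proof (rule Bochner_Integration.integrable_bound[where f="\<lambda>x. (W x)^2 + (W x)^4"])
  have "\<bar>w^3\<bar> \<le> w^2 + w^4" for w :: real
  proof -
   have "2 * \<bar>w\<bar> * w^2 \<le> \<bar>w\<bar>^2 + (w^2)^2" by (rule sum_squares_bound)
   moreover have "\<bar>w^3\<bar> = \<bar>w\<bar> * w^2" by (simp add: power3_eq_cube power2_eq_square abs_mult)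
   moreover have "0 \<le> \<bar>w\<bar> * w^2" by simp
   ultimately show ?thesis unfolding power2_abs power_mult[symmetric] by simp
  qed
  then show "AE x in M. norm ((W x)^3) \<le> norm ((W x)^2 + (W x)^4)" by (intro AE_I2) simp
 qed (use L24D[OF that] in auto)
 have prod: "expectation (\<lambda>z. (X z)^i * (Z z)^j) = expectation (\<lambda>z. (X z)^i) * expectation (\<lambda>z. (Z z)^j)"
   "integrable M (\<lambda>z. (X z)^i * (Z z)^j)"
  if "integrable M (\<lambda>z. (X z)^i)" "integrable M (\<lambda>z. (Z z)^j)" for i j
 proof -
  have "indep_var borel ((\<lambda>x. x^i) \<circ> X) borel ((\<lambda>x. x^j) \<circ> Z)"
   by (rule indep_var_compose[OF indep]) auto
  then have *: "indep_var borel (\<lambda>z. (X z)^i) borel (\<lambda>z. (Z z)^j)" by (simp add: comp_def)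
  show "expectation (\<lambda>z. (X z)^i * (Z z)^j) = expectation (\<lambda>z. (X z)^i) * expectation (\<lambda>z. (Z z)^j)"
   by (rule indep_var_lebesgue_integral[OF * that])
  show "integrable M (\<lambda>z. (X z)^i * (Z z)^j)"
   by (rule indep_var_integrable[OF * that])
 qed
 have i1: "integrable M (\<lambda>z. (X z)^1)" "integrable M (\<lambda>z. (Z z)^1)"
  using L24_integrable[OF X] L24_integrable[OF Z] by simp_all
 note i = i1 L24D[OF X] L24D[OF Z] cube[OF X] cube[OF Z]
 have e1: "expectation (\<lambda>z. (X z)^1) = 0" "expectation (\<lambda>z. (Z z)^1) = 0" using assms by simp_all
 have "(\<lambda>z. (X z + Z z)^2) = (\<lambda>z. (X z)^2 + 2 * ((X z)^1 * (Z z)^1) + (Z z)^2)"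
  by (auto simp: power2_eq_square algebra_simps)
 moreover have "expectation \<dots> = expectation (\<lambda>z. (X z)^2) + 2 * expectation (\<lambda>z. (X z)^1 * (Z z)^1) + expectation (\<lambda>z. (Z z)^2)"
  using i prod(2)[OF i1] by (simp del: power_one_right)
 ultimately show "expectation (\<lambda>z. (X z + Z z)^2) = expectation (\<lambda>z. (X z)^2) + expectation (\<lambda>z. (Z z)^2)"
  unfolding prod(1)[OF i1] e1 by simp
 have "(\<lambda>z. (X z + Z z)^4) = (\<lambda>z. (X z)^4 + 4 * ((X z)^3 * (Z z)^1) + 6 * ((X z)^2 * (Z z)^2) + 4 * ((X z)^1 * (Z z)^3) + (Z z)^4)"
  by (auto simp: power2_eq_square power4_eq_xxxx power3_eq_cube algebra_simps)
 moreover have "expectation \<dots> = expectation (\<lambda>z. (X z)^4) + 4 * expectation (\<lambda>z. (X z)^3 * (Z z)^1)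
   + 6 * expectation (\<lambda>z. (X z)^2 * (Z z)^2) + 4 * expectation (\<lambda>z. (X z)^1 * (Z z)^3) + expectation (\<lambda>z. (Z z)^4)"
  using i prod(2)[OF cube[OF X] i1(2)] prod(2)[OF i1(1) cube[OF Z]] prod(2)[OF L24D(2)[OF X] L24D(2)[OF Z]]
  by (simp del: power_one_right)
 ultimately show "expectation (\<lambda>z. (X z + Z z)^4) = expectation (\<lambda>z. (X z)^4)
   + 6 * (expectation (\<lambda>z. (X z)^2) * expectation (\<lambda>z. (Z z)^2)) + expectation (\<lambda>z. (Z z)^4)"
  unfolding prod(1)[OF cube[OF X] i1(2)] prod(1)[OF i1(1) cube[OF Z]] prod(1)[OF L24D(2)[OF X] L24D(2)[OF Z]] e1 by simp
qed

text \<open>For centred variables E X^4 - 3 (E X^2)^2 is the fourth cumulant. It is additive because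
  the mixed term 6 E X^2 E Z^2 of \<open>indep_var_L24_moments\<close> is exactly the cross term of
  3 (E X^2 + E Z^2)^2.\<close>

lemma (in prob_space) indep_vars_L24_moments:
 fixes X :: "'i \<Rightarrow> 'a \<Rightarrow> real"
 assumes "finite I" "indep_vars (\<lambda>_. borel) X I" "\<And>i. i \<in> I \<Longrightarrow> L24 M (X i)" "\<And>i. i \<in> I \<Longrightarrow> expectation (X i) = 0"
 shows "expectation (\<lambda>w. (\<Sum>i\<in>I. X i w)) = 0"
  and "expectation (\<lambda>w. (\<Sum>i\<in>I. X i w)^2) = (\<Sum>i\<in>I. expectation (\<lambda>w. (X i w)^2))"
  and "expectation (\<lambda>w. (\<Sum>i\<in>I. X i w)^4) - 3 * (expectation (\<lambda>w. (\<Sum>i\<in>I. X i w)^2))^2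
   = (\<Sum>i\<in>I. expectation (\<lambda>w. (X i w)^4) - 3 * (expectation (\<lambda>w. (X i w)^2))^2)"
proof -
 have "expectation (\<lambda>w. (\<Sum>i\<in>I. X i w)) = 0 \<and>
  expectation (\<lambda>w. (\<Sum>i\<in>I. X i w)^2) = (\<Sum>i\<in>I. expectation (\<lambda>w. (X i w)^2)) \<and>
  expectation (\<lambda>w. (\<Sum>i\<in>I. X i w)^4) - 3 * (expectation (\<lambda>w. (\<Sum>i\<in>I. X i w)^2))^2
   = (\<Sum>i\<in>I. expectation (\<lambda>w. (X i w)^4) - 3 * (expectation (\<lambda>w. (X i w)^2))^2)"
  using assms
 proof (induction I rule: finite_induct)
  case (insert i I)
  have ind: "indep_var borel (X i) borel (\<lambda>w. \<Sum>i\<in>I. X i w)"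
   by (rule indep_vars_sum) (use insert in auto)
  have LI: "L24 M (\<lambda>w. \<Sum>i\<in>I. X i w)" using insert by (intro L24_sum) auto
  have Li: "L24 M (X i)" using insert by auto
  have IH: "expectation (\<lambda>w. (\<Sum>i\<in>I. X i w)) = 0"
   "expectation (\<lambda>w. (\<Sum>i\<in>I. X i w)^2) = (\<Sum>i\<in>I. expectation (\<lambda>w. (X i w)^2))"
   "expectation (\<lambda>w. (\<Sum>i\<in>I. X i w)^4) - 3 * (expectation (\<lambda>w. (\<Sum>i\<in>I. X i w)^2))^2
   = (\<Sum>i\<in>I. expectation (\<lambda>w. (X i w)^4) - 3 * (expectation (\<lambda>w. (X i w)^2))^2)"
   using insert indep_vars_subset[OF insert(4)] by auto
  have Ei: "expectation (X i) = 0" using insert by auto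
  note m = indep_var_L24_moments[OF ind Li LI Ei IH(1)]
  show ?case
   unfolding sum.insert[OF insert(1,2)] m IH(3)[symmetric] IH(2)
   using L24_integrable[OF Li] L24_integrable[OF LI] IH(1) Ei
   by (simp add: power2_sum algebra_simps)
 qed (auto simp: prob_space)
 then show "expectation (\<lambda>w. (\<Sum>i\<in>I. X i w)) = 0"
  and "expectation (\<lambda>w. (\<Sum>i\<in>I. X i w)^2) = (\<Sum>i\<in>I. expectation (\<lambda>w. (X i w)^2))"
  and "expectation (\<lambda>w. (\<Sum>i\<in>I. X i w)^4) - 3 * (expectation (\<lambda>w. (\<Sum>i\<in>I. X i w)^2))^2
   = (\<Sum>i\<in>I. expectation (\<lambda>w. (X i w)^4) - 3 * (expectation (\<lambda>w. (X i w)^2))^2)"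
  by blast+
qed

text \<open>By Fubini the fourth power of z + X is integrable for almost every value z of Z. One
  such z suffices, since a constant shift does not affect integrability. This carries the fourth
  moment from a set of the basis to its parts.\<close>

lemma (in prob_space) indep_var_power4_summand:
 fixes X Z :: "'a \<Rightarrow> real"
 assumes indep: "indep_var borel Z borel X" and int: "integrable M (\<lambda>w. (Z w + X w)^4)"
 shows "integrable M (\<lambda>w. (X w)^4)"
proof -
 have [measurable]: "random_variable borel X" "random_variable borel Z"
  using indep indep_var_rv1 indep_var_rv2 by blast+
 interpret PX: prob_space "distr M borel X" by (rule prob_space_distr) simp
 interpret PZ: prob_space "distr M borel Z" by (rule prob_space_distr) simp
 interpret P: pair_sigma_finite "distr M borel Z" "distr M borel X" ..
 have eq: "distr M borel Z \<Otimes>\<^sub>M distr M borel X = distr M (borel \<Otimes>\<^sub>M borel) (\<lambda>x. (Z x, X x))"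
  using indep indep_var_distribution_eq by blast
 have "integrable (distr M borel Z \<Otimes>\<^sub>M distr M borel X) (\<lambda>p. (fst p + snd p)^4)"
  unfolding eq by (subst integrable_distr_eq) (use int in auto)
 then have "AE z in distr M borel Z. integrable (distr M borel X) (\<lambda>x. (fst (z, x) + snd (z, x))^4)"
  by (rule P.AE_integrable_fst')
 moreover have "ae_filter (distr M borel Z) \<noteq> bot"
  by (simp add: ae_filter_eq_bot_iff PZ.emeasure_space_1 del: space_distr)
 ultimately obtain z where z: "integrable (distr M borel X) (\<lambda>x. (z + x)^4)"
  using eventually_happens' by fastforce
 have "integrable M (\<lambda>w. (z + X w)^4)" using z by (simp add: integrable_distr_eq)
 then have i: "integrable M (\<lambda>w. 8 * (z + X w)^4 + 8 * (-z)^4)" by simp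
 show ?thesis
 proof (rule Bochner_Integration.integrable_bound[OF i])
  have "(X w)^4 \<le> 8 * (z + X w)^4 + 8 * (-z)^4" for w using power4_sum_le[of "z + X w" "-z"] by simp
  then show "AE x in M. norm ((X x)^4) \<le> norm (8 * (z + X x)^4 + 8 * (-z)^4)" by auto
 qed simp
qed

text \<open>Cauchy's functional equation on the half line, with boundedness on [0, 1] as the
  regularity condition. It will be applied to the fourth cumulant as a function of volume.\<close>

lemma bounded_additive_imp_linear:
 fixes k :: "real \<Rightarrow> real"
 assumes add: "\<And>x y. 0 \<le> x \<Longrightarrow> 0 \<le> y \<Longrightarrow> k (x + y) = k x + k y"
  and bound: "\<And>x. 0 \<le> x \<Longrightarrow> x \<le> 1 \<Longrightarrow> \<bar>k x\<bar> \<le> C"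
  and x: "0 \<le> x"
 shows "k x = x * k 1"
proof -
 have k0: "k 0 = 0" using add[of 0 0] by simp
 have mult: "k (real n * y) = real n * k y" if "0 \<le> y" for n y
  by (induction n) (use that k0 add in \<open>simp_all add: algebra_simps\<close>)
 have C: "C \<ge> 0" using bound[of 0] by simp
 have "\<bar>k x - x * k 1\<bar> \<le> (C + \<bar>k 1\<bar>) / real (Suc n)" for n
 proof -
  \<comment> \<open>x is split into a multiple m / N of the mesh and a remainder r \<le> 1 / N.
    Additivity gives k (N r) = N k r with N r in [0, 1], so |k r| is at most C / N, and k (1 / N) =
    k 1 / N.\<close>
  define N where "N = real (Suc n)"
  define m where "m = nat \<lfloor>N * x\<rfloor>"
  define r where "r = x - real m / N"
  have N: "N > 0" unfolding N_def by simp
  have m: "real m \<le> N * x" "N * x < real m + 1" unfolding m_def using x N by (simp_all add: of_nat_floor)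
  have Nr: "N * r = N * x - real m" unfolding r_def using N by (simp add: field_simps)
  have r: "0 \<le> r" "r \<le> 1 / N" "N * r \<le> 1"
   using m N Nr zero_le_mult_iff[of N r] by (simp_all add: pos_le_divide_eq mult.commute)
  have "k (N * r) = N * k r" unfolding N_def using mult r by blast
  then have "N * \<bar>k r\<bar> \<le> C" using bound[of "N * r"] r N by (simp add: abs_mult)
  then have kr: "\<bar>k r\<bar> \<le> C / N" using N by (simp add: field_simps)
  have "k (N * (1/N)) = N * k (1/N)" unfolding N_def using mult[of "1 / real (Suc n)" "Suc n"] by simp
  then have k1: "k (1/N) = k 1 / N" using N by (simp add: field_simps)
  have "k x = k (real m * (1/N) + r)" unfolding r_def by simp
  also have "\<dots> = real m * (k 1 / N) + k r" using add[of "real m * (1/N)" r] mult[of "1/N" m] r N k1 by simp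
  finally have "k x - x * k 1 = k r - r * k 1" unfolding r_def by (simp add: algebra_simps)
  also have "\<bar>\<dots>\<bar> \<le> C / N + (1/N) * \<bar>k 1\<bar>"
  proof -
   have "\<bar>r * k 1\<bar> \<le> (1/N) * \<bar>k 1\<bar>" unfolding abs_mult using r by (intro mult_right_mono) auto
   then show ?thesis using kr by linarith
  qed
  finally show ?thesis unfolding N_def add_divide_distrib by simp
 qed
 moreover have "(\<lambda>n. (C + \<bar>k 1\<bar>) / real (Suc n)) \<longlonglongrightarrow> 0"
  using tendsto_mult[OF tendsto_const[of "C + \<bar>k 1\<bar>"] LIMSEQ_inverse_real_of_nat] by (simp add: divide_inverse)
 ultimately have "\<bar>k x - x * k 1\<bar> \<le> 0"
  by (intro tendsto_lowerbound[of _ _ sequentially]) (auto intro: always_eventually)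
 then show ?thesis by simp
qed

text \<open>Representatives of every volume: the law of the basis on a set depends on its volume
  alone, so a one-parameter family is enough. Open boxes make neighbouring slabs disjoint, and the
  missing face is a null set. \<open>undefined\<close> serves as some fixed coordinate.\<close>

definition slab :: "real \<Rightarrow> real \<Rightarrow> (real^'d) set" where
 "slab l u = box (\<chi> i. if i = undefined then l else 0) (\<chi> i. if i = undefined then u else 1)"

lemma slab_bounded_borel: "slab l u \<in> bounded_borel"
 unfolding slab_def bounded_borel_def by auto

lemma measure_slab:
 assumes "l \<le> u" shows "measure lborel (slab l u :: (real^'d) set) = u - l"
proof -
 let ?l = "(\<chi> i. if i = undefined then l else 0) :: real^'d" and ?u = "(\<chi> i. if i = undefined then u else 1) :: real^'d"
 have ne: "cbox ?l ?u \<noteq> {}" using assms by (auto simp: interval_ne_empty_cart)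
 have "measure lborel (slab l u :: (real^'d) set) = measure lborel (cbox ?l ?u)"
  unfolding slab_def measure_def by (simp add: emeasure_lborel_box_eq emeasure_lborel_cbox_eq)
 also have "\<dots> = (\<Prod>i\<in>(UNIV::'d set). ?u $ i - ?l $ i)" using content_cbox_cart[OF ne] .
 also have "\<dots> = (\<Prod>i\<in>(UNIV::'d set). if i = undefined then u - l else 1)" by (intro prod.cong) auto
 also have "\<dots> = u - l" by simp
 finally show ?thesis .
qed

lemma slab_disjoint: "slab l u \<inter> slab u v = {}"
proof -
 have "x $ undefined < u" if "x \<in> slab l u" for x :: "real^'d"
  using that unfolding slab_def by (auto simp: mem_box_cart dest: spec[of _ undefined])
 moreover have "x $ undefined > u" if "x \<in> slab u v" for x :: "real^'d"
  using that unfolding slab_def by (auto simp: mem_box_cart dest: spec[of _ undefined])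
 ultimately show ?thesis by fastforce
qed

context centered_levy_basis
begin

lemma basis_power4_law:
 assumes "B \<in> bounded_borel" "B' \<in> bounded_borel" "measure lborel B = measure lborel B'"
 shows "integrable M (\<lambda>w. (\<Lambda> B w)^4) \<longleftrightarrow> integrable M (\<lambda>w. (\<Lambda> B' w)^4)"
  and "expectation (\<lambda>w. (\<Lambda> B w)^4) = expectation (\<lambda>w. (\<Lambda> B' w)^4)"
proof -
 note [measurable] = basis_rv[OF assms(1)] basis_rv[OF assms(2)]
 show "integrable M (\<lambda>w. (\<Lambda> B w)^4) \<longleftrightarrow> integrable M (\<lambda>w. (\<Lambda> B' w)^4)"
  using integrable_distr_eq[of "\<Lambda> B" M borel "\<lambda>x. x^4"] integrable_distr_eq[of "\<Lambda> B'" M borel "\<lambda>x. x^4"]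
  unfolding basis_law[OF assms] by simp
 show "expectation (\<lambda>w. (\<Lambda> B w)^4) = expectation (\<lambda>w. (\<Lambda> B' w)^4)"
  using integral_distr[of "\<Lambda> B" M borel "\<lambda>x. x^4"] integral_distr[of "\<Lambda> B'" M borel "\<lambda>x. x^4"]
  unfolding basis_law[OF assms] by simp
qed

lemma basis_indep2:
 assumes A: "A \<in> bounded_borel" and B: "B \<in> bounded_borel" and disj: "A \<inter> B = {}"
 shows "indep_var borel (\<Lambda> A) borel (\<Lambda> B)"
proof -
 have "indep_vars (\<lambda>_. borel) (\<lambda>i. \<Lambda> (if i then A else B)) (insert True {False})"
  by (rule basis_indep_finite) (use A B disj in \<open>auto simp: disjoint_family_on_def\<close>)
 from indep_vars_sum[OF _ _ this] show ?thesis by simp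
qed

text \<open>Two neighbouring slabs do not quite fill the slab of length x + y, but their union has
  the same volume and therefore the same law. Independence gives the moment identity, and
  \<open>indep_var_power4_summand\<close> the integrability of the parts.\<close>

lemma basis_power4_slabs:
 assumes x: "0 \<le> x" and y: "0 \<le> y"
 shows "integrable M (\<lambda>w. (\<Lambda> (slab 0 (x+y)) w)^4) \<longleftrightarrow> 
   integrable M (\<lambda>w. (\<Lambda> (slab 0 x) w)^4) \<and> integrable M (\<lambda>w. (\<Lambda> (slab 0 y) w)^4)" (is "?L \<longleftrightarrow> ?R")
  and "integrable M (\<lambda>w. (\<Lambda> (slab 0 (x+y)) w)^4) \<Longrightarrow> expectation (\<lambda>w. (\<Lambda> (slab 0 (x+y)) w)^4) =
   expectation (\<lambda>w. (\<Lambda> (slab 0 x) w)^4) + 6 * (k2 * x * (k2 * y)) + expectation (\<lambda>w. (\<Lambda> (slab 0 y) w)^4)"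
proof -
 define A B :: "(real^'d) set" where "A = slab 0 x" and "B = slab x (x + y)"
 have bb: "A \<in> bounded_borel" "B \<in> bounded_borel" and AB: "A \<inter> B = {}"
  unfolding A_def B_def using slab_bounded_borel slab_disjoint by blast+
 have mA: "measure lborel A = x" and mB: "measure lborel B = y" "measure lborel (slab 0 y :: (real^'d) set) = y"
  unfolding A_def B_def using x y by (simp_all add: measure_slab)
 note [measurable] = basis_rv[OF bb(1)] basis_rv[OF bb(2)]
 have U: "A \<union> B \<in> bounded_borel" using bb by (rule bounded_borel_Un)
 note [measurable] = basis_rv[OF U]
 have mU: "measure lborel (A \<union> B) = measure lborel (slab 0 (x + y) :: (real^'d) set)"
  using measure_Union[of lborel A B] bounded_borelD[OF bb(1)] bounded_borelD[OF bb(2)] AB mA mB x y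
  by (simp add: measure_slab)
 note law = basis_power4_law[OF slab_bounded_borel U mU[symmetric]]
 note lawB = basis_power4_law[OF slab_bounded_borel bb(2), of 0 y, unfolded mB, OF refl]
 have ae: "AE w in M. (\<Lambda> (A \<union> B) w)^4 = (\<Lambda> A w + \<Lambda> B w)^4"
  using basis_Un[OF bb AB] by eventually_elim simp
 have iff: "integrable M (\<lambda>w. (\<Lambda> (A \<union> B) w)^4) \<longleftrightarrow> integrable M (\<lambda>w. (\<Lambda> A w + \<Lambda> B w)^4)"
  by (rule integrable_cong_AE[OF _ _ ae]) auto
 have eq: "expectation (\<lambda>w. (\<Lambda> (A \<union> B) w)^4) = expectation (\<lambda>w. (\<Lambda> A w + \<Lambda> B w)^4)"
  by (rule integral_cong_AE[OF _ _ ae]) auto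
 have BA: "indep_var borel (\<Lambda> B) borel (\<Lambda> A)" by (rule basis_indep2) (use bb AB in auto)
 note AB' = basis_indep2[OF bb AB]
 have imp: "?R" if "integrable M (\<lambda>w. (\<Lambda> A w + \<Lambda> B w)^4)"
  using indep_var_power4_summand[OF AB' that] indep_var_power4_summand[OF BA] that lawB(1)
  unfolding A_def[symmetric] by (simp add: add.commute)
 have L: "L24 M (\<Lambda> A)" "L24 M (\<Lambda> B)" if ?R
  using that lawB(1) unfolding A_def[symmetric] by (auto intro!: integrable_power4_imp_L24)
 show iff2: "?L \<longleftrightarrow> ?R"
  unfolding law(1) iff using imp L24D(3)[OF L24_add[OF L]] by blast
 assume ?L
 then have ?R using iff2 by blast
 from indep_var_L24_moments(2)[OF AB' L[OF this] mean_zero[OF bb(1)] mean_zero[OF bb(2)]]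
 show "expectation (\<lambda>w. (\<Lambda> (slab 0 (x+y)) w)^4) =
   expectation (\<lambda>w. (\<Lambda> (slab 0 x) w)^4) + 6 * (k2 * x * (k2 * y)) + expectation (\<lambda>w. (\<Lambda> (slab 0 y) w)^4)"
  unfolding law(2) eq lawB(2) A_def[symmetric] basis_variance[OF bb(1)] basis_variance[OF bb(2)] mA mB by simp
qed

lemma slab_power4_unit:
 "integrable M (\<lambda>w. (\<Lambda> (slab 0 1) w)^4)" "expectation (\<lambda>w. (\<Lambda> (slab 0 1) w)^4) = kappa4 \<Lambda>"
 using basis_power4_law[OF slab_bounded_borel unit_cube_bounded_borel, of 0 1] fourth_moment
 unfolding kappa4_def by (simp_all add: measure_slab measure_unit_cube)

text \<open>Volumes up to 1 are parts of a unit slab; larger ones are reached by adding unit slabs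
  one at a time.\<close>

lemma slab_power4_integrable:
 assumes "0 \<le> x" shows "integrable M (\<lambda>w. (\<Lambda> (slab 0 x) w)^4)"
proof -
 have le1: "integrable M (\<lambda>w. (\<Lambda> (slab 0 x) w)^4)" if "0 \<le> x" "x \<le> 1" for x
  using basis_power4_slabs(1)[of x "1 - x"] that slab_power4_unit(1) by simp
 have "x \<le> real n \<Longrightarrow> integrable M (\<lambda>w. (\<Lambda> (slab 0 x) w)^4)" for n
  using assms
 proof (induction n arbitrary: x)
  case (Suc n)
  show ?case
  proof (cases "x \<le> 1")
   case False
   then have "integrable M (\<lambda>w. (\<Lambda> (slab 0 (x - 1)) w)^4)" using Suc.prems by (intro Suc.IH) auto
   then show ?thesis using basis_power4_slabs(1)[of "x - 1" 1] False slab_power4_unit(1) by simp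
  qed (use le1 Suc in auto)
 qed (use le1 in auto)
 then show ?thesis using real_arch_simple by blast
qed

text \<open>Subtracting three times the squared variance turns the fourth moment into the fourth
  cumulant, which is additive in the volume. It is bounded on [0, 1], where the fourth moment is at
  most that of the unit slab, and is therefore linear with slope \<open>c4\<close>.\<close>

lemma slab_power4:
 assumes x: "0 \<le> x"
 shows "expectation (\<lambda>w. (\<Lambda> (slab 0 x) w)^4) = c4 * x + 3 * k2^2 * x^2"
proof -
 define k where "k x = expectation (\<lambda>w. (\<Lambda> (slab 0 x) w)^4) - 3 * k2^2 * x^2" for x
 have "k x = x * k 1"
 proof (rule bounded_additive_imp_linear)
  show "k (x + y) = k x + k y" if "0 \<le> x" "0 \<le> y" for x y
   unfolding k_def using basis_power4_slabs(2)[OF that slab_power4_integrable] that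
   by (simp add: algebra_simps power2_eq_square)
  show "\<bar>k x\<bar> \<le> kappa4 \<Lambda> + 3 * k2^2" if x: "0 \<le> x" "x \<le> 1" for x
  proof -
   have "expectation (\<lambda>w. (\<Lambda> (slab 0 (x + (1 - x))) w)^4) =
   expectation (\<lambda>w. (\<Lambda> (slab 0 x) w)^4) + 6 * (k2 * x * (k2 * (1 - x))) + expectation (\<lambda>w. (\<Lambda> (slab 0 (1 - x)) w)^4)"
    by (rule basis_power4_slabs(2)) (use x slab_power4_unit in auto)
   moreover have "0 \<le> k2 * x * (k2 * (1 - x))" using x k2_nonneg by simp
   moreover have "0 \<le> expectation (\<lambda>w. (\<Lambda> (slab 0 (1 - x)) w)^4)" "0 \<le> expectation (\<lambda>w. (\<Lambda> (slab 0 x) w)^4)" by simp_all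
   ultimately have "expectation (\<lambda>w. (\<Lambda> (slab 0 x) w)^4) \<le> kappa4 \<Lambda>" using slab_power4_unit(2) by simp
   moreover have "3 * k2^2 * x^2 \<le> 3 * k2^2 * 1" using x by (intro mult_left_mono) (auto simp: abs_square_le_1)
   moreover have "0 \<le> 3 * k2^2 * x^2" by simp
   ultimately show ?thesis unfolding k_def using \<open>0 \<le> expectation (\<lambda>w. (\<Lambda> (slab 0 x) w)^4)\<close> by linarith
  qed
 qed (rule x)
 then show ?thesis unfolding k_def slab_power4_unit(2) by (simp add: algebra_simps)
qed

lemma basis_L24:
 assumes "B \<in> bounded_borel" shows "L24 M (\<Lambda> B)"
 using basis_power4_law(1)[OF assms slab_bounded_borel, of 0 "measure lborel B"] slab_power4_integrable[of "measure lborel B"]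
  basis_rv[OF assms] by (intro integrable_power4_imp_L24) (auto simp: measure_slab)

lemma basis_power4:
 assumes "B \<in> bounded_borel"
 shows "expectation (\<lambda>w. (\<Lambda> B w)^4) = c4 * measure lborel B + 3 * k2^2 * (measure lborel B)^2"
 using basis_power4_law(2)[OF assms slab_bounded_borel, of 0 "measure lborel B"] slab_power4[of "measure lborel B"]
 by (simp add: measure_slab)

end

section \<open>Integrals of simple functions\<close>

lemma bounded_simpleD:
 assumes "bounded_simple f"
 shows "f \<in> borel_measurable borel" "finite (range f)" "x \<noteq> 0 \<Longrightarrow> {s. f s = x} \<in> bounded_borel" "{s. f s = x} \<in> sets borel"
proof -
 have f: "simple_function borel f" and b: "bounded {s. f s \<noteq> 0}" using assms unfolding bounded_simple_def by auto
 show m: "f \<in> borel_measurable borel" using f by (rule borel_measurable_simple_function)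
 show "finite (range f)" using simple_functionD(1)[OF f] by simp
 have "f -` {x} \<inter> space borel \<in> sets borel" using m by (rule measurable_sets) simp
 moreover have "f -` {x} \<inter> space borel = {s. f s = x}" by auto
 ultimately show s: "{s. f s = x} \<in> sets borel" by simp
 show "{s. f s = x} \<in> bounded_borel" if "x \<noteq> 0"
  unfolding bounded_borel_def using s that by (auto intro: bounded_subset[OF b])
qed

lemma bounded_simple_step:
 assumes I: "finite I" and B: "\<And>i. i \<in> I \<Longrightarrow> B i \<in> bounded_borel"
 shows "bounded_simple (\<lambda>s. \<Sum>i\<in>I. c i * indicator (B i) s)"
 unfolding bounded_simple_def
proof
 have [measurable]: "B i \<in> sets borel" if "i \<in> I" for i using bounded_borelD(1)[OF B[OF that]] .
 show "simple_function borel (\<lambda>s. \<Sum>i\<in>I. c i * indicator (B i) s)"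
  by (intro simple_function_sum simple_function_mult simple_function_const simple_function_indicator) auto
 have "{s. (\<Sum>i\<in>I. c i * indicator (B i) s) \<noteq> 0} \<subseteq> (\<Union>i\<in>I. B i)"
 proof
  fix s assume s: "s \<in> {s. (\<Sum>i\<in>I. c i * indicator (B i) s) \<noteq> 0}"
  show "s \<in> (\<Union>i\<in>I. B i)"
  proof (rule ccontr)
   assume "s \<notin> (\<Union>i\<in>I. B i)"
   then have "(\<Sum>i\<in>I. c i * indicator (B i) s) = 0" by (intro sum.neutral) auto
   then show False using s by simp
  qed
 qed
 moreover have "bounded (\<Union>i\<in>I. B i)" using I B bounded_borelD by (intro bounded_UN) auto
 ultimately show "bounded {s. (\<Sum>i\<in>I. c i * indicator (B i) s) \<noteq> 0}" by (rule bounded_subset[rotated])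
qed

text \<open>A finite family of simple functions is jointly constant on the level sets of the vector function
 they form; the index of each level set is that vector.\<close>

lemma bounded_simple_common_refinement:
 fixes f :: "'j \<Rightarrow> (real^'d) \<Rightarrow> real"
 assumes J: "finite J" and f: "\<And>j. j \<in> J \<Longrightarrow> bounded_simple (f j)"
 obtains I :: "('j \<Rightarrow> real) set" and B where "finite I" "disjoint_family_on B I"
  "\<And>v. v \<in> I \<Longrightarrow> B v \<in> bounded_borel"
  "\<And>j. j \<in> J \<Longrightarrow> f j = (\<lambda>s. \<Sum>v\<in>I. v j * indicator (B v) s)"
  "\<And>v s. v \<in> I \<Longrightarrow> s \<in> B v \<Longrightarrow> \<exists>j\<in>J. f j s \<noteq> 0"
proof
 define \<Phi> where "\<Phi> s = (\<lambda>j\<in>J. f j s)" for s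
 define z where "z = (\<lambda>j\<in>J. 0::real)"
 define I where "I = range \<Phi> - {z}"
 define B where "B v = {s. \<Phi> s = v}" for v
 have "finite (\<Pi>\<^sub>E j\<in>J. range (f j))" using J bounded_simpleD(2)[OF f] by (rule finite_PiE)
 then have "finite (range \<Phi>)" by (rule finite_subset[rotated]) (auto simp: \<Phi>_def)
 then show I: "finite I" unfolding I_def by simp
 show "disjoint_family_on B I" unfolding B_def disjoint_family_on_def by auto
 show nz: "\<exists>j\<in>J. f j s \<noteq> 0" if "v \<in> I" "s \<in> B v" for v s
 proof (rule ccontr)
  assume "\<not> (\<exists>j\<in>J. f j s \<noteq> 0)"
  then have "\<Phi> s = z" unfolding \<Phi>_def z_def by (intro restrict_ext) blast
  then show False using that unfolding I_def B_def by auto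
 qed
 show "B v \<in> bounded_borel" if v: "v \<in> I" for v
 proof -
  have "B v = (if v \<in> extensional J then {s. \<forall>j\<in>J. f j s = v j} else {})"
  proof (cases "v \<in> extensional J")
   case True
   have "(\<lambda>j\<in>J. f j s) = v \<longleftrightarrow> (\<forall>j\<in>J. f j s = v j)" for s
    using True extensionalityI[of "\<lambda>j\<in>J. f j s" J v] by auto
   then show ?thesis using True unfolding B_def \<Phi>_def by simp
  next
   case False
   have "(\<lambda>j\<in>J. f j s) \<noteq> v" for s
    using False restrict_extensional[of "\<lambda>j. f j s" J] by metis
   then show ?thesis using False unfolding B_def \<Phi>_def by simp
  qed
  moreover have "{s. \<forall>j\<in>J. f j s = v j} \<in> sets borel"
  proof -
   have "{s \<in> space borel. \<forall>j\<in>J. f j s = v j} \<in> sets borel"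
    by (rule sets.sets_Collect_finite_All) (use bounded_simpleD(4)[OF f] J in simp_all)
   then show ?thesis by simp
  qed
  ultimately have "B v \<in> sets borel" by auto
  moreover have "bounded (B v)"
  proof (rule bounded_subset)
   show "bounded (\<Union>j\<in>J. {s. f j s \<noteq> 0})" using f J unfolding bounded_simple_def by (intro bounded_UN) auto
   show "B v \<subseteq> (\<Union>j\<in>J. {s. f j s \<noteq> 0})" using nz[OF v] by auto
  qed
  ultimately show ?thesis unfolding bounded_borel_def by simp
 qed
 show "f j = (\<lambda>s. \<Sum>v\<in>I. v j * indicator (B v) s)" if j: "j \<in> J" for j
 proof
  fix s
  have "(\<Sum>v\<in>I. v j * indicator (B v) s) = (\<Sum>v\<in>I. if v = \<Phi> s then v j else 0)"
   by (rule sum.cong) (auto simp: B_def)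
  also have "\<dots> = (if \<Phi> s \<in> I then \<Phi> s j else 0)" using I by (simp add: sum.delta')
  also have "\<dots> = f j s"
  proof (cases "\<Phi> s = z")
   case True
   have "\<Phi> s j = z j" using arg_cong[OF True, of "\<lambda>h. h j"] .
   then have "f j s = 0" using j unfolding \<Phi>_def z_def by simp
   then show ?thesis using True unfolding I_def by simp
  next
   case False
   then have "\<Phi> s \<in> I" unfolding I_def by blast
   moreover have "\<Phi> s j = f j s" using j unfolding \<Phi>_def by simp
   ultimately show ?thesis by simp
  qed
  finally show "f j s = (\<Sum>v\<in>I. v j * indicator (B v) s)" by simp
 qed
qed

lemma bounded_simple_lincomb:
 assumes "bounded_simple f" "bounded_simple g"
 shows "bounded_simple (\<lambda>s. a * f s + b * g s)"
proof -
 define F where "F i = (if i then f else g)" for i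
 have F: "bounded_simple (F i)" for i unfolding F_def using assms by simp
 obtain I B where IB: "finite I" "disjoint_family_on B I" "\<And>v. v \<in> I \<Longrightarrow> B v \<in> bounded_borel"
  "\<And>j. j \<in> UNIV \<Longrightarrow> F j = (\<lambda>s. \<Sum>v\<in>I. v j * indicator (B v) s)"
  by (rule bounded_simple_common_refinement[of UNIV F]) (use F in auto)
 have "(\<lambda>s. a * f s + b * g s) = (\<lambda>s. \<Sum>v\<in>I. (a * v True + b * v False) * indicator (B v) s)"
 proof
  fix s
  have f: "f s = (\<Sum>v\<in>I. v True * indicator (B v) s)" and g: "g s = (\<Sum>v\<in>I. v False * indicator (B v) s)"
   using fun_cong[OF IB(4)[of True], of s] fun_cong[OF IB(4)[of False], of s] unfolding F_def by simp_all
  show "a * f s + b * g s = (\<Sum>v\<in>I. (a * v True + b * v False) * indicator (B v) s)"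
   unfolding f g distrib_right sum.distrib sum_distrib_left by (simp only: mult.assoc)
 qed
 then show ?thesis using bounded_simple_step[OF IB(1,3)] by simp
qed

lemma bounded_simple_mult_indicator:
 assumes "bounded_simple f" and [measurable]: "A \<in> sets borel"
 shows "bounded_simple (\<lambda>s. f s * indicator A s)"
 unfolding bounded_simple_def
proof
 show "simple_function borel (\<lambda>s. f s * indicator A s)"
  using assms unfolding bounded_simple_def by (intro simple_function_mult simple_function_indicator) auto
 show "bounded {s. f s * indicator A s \<noteq> 0}"
  by (rule bounded_subset[of "{s. f s \<noteq> 0}"]) (use assms in \<open>auto simp: bounded_simple_def\<close>)
qed

lemma bounded_simple_canonical:
 assumes f: "bounded_simple f"
 shows "f s = (\<Sum>x\<in>range f - {0}. x * indicator {s. f s = x} s)"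
proof -
 have "(\<Sum>x\<in>range f - {0}. x * indicator {s. f s = x} s) = (\<Sum>x\<in>range f - {0}. if x = f s then x else 0)"
  by (rule sum.cong) auto
 also have "\<dots> = f s" using bounded_simpleD(2)[OF f] by (simp add: sum.delta')
 finally show ?thesis by simp
qed

lemma step_power:
 assumes I: "finite I" and disj: "disjoint_family_on B I" and n: "n > 0"
 shows "(\<Sum>i\<in>I. c i * indicator (B i) s :: real)^n = (\<Sum>i\<in>I. (c i)^n * indicator (B i) s)"
proof (cases "\<exists>i\<in>I. s \<in> B i")
 case True
 then obtain i where i: "i \<in> I" "s \<in> B i" by auto
 have *: "(\<Sum>j\<in>I. d j * indicator (B j) s) = d i" for d :: "_ \<Rightarrow> real"
 proof -
  have "(\<Sum>j\<in>I. d j * indicator (B j) s) = (\<Sum>j\<in>I. if j = i then d j else 0)"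
   by (rule sum.cong) (use i disj in \<open>auto simp: disjoint_family_on_def indicator_def\<close>)
  then show ?thesis using I i by simp
 qed
 show ?thesis unfolding * ..
next
 case False
 then have *: "(\<Sum>j\<in>I. d j * indicator (B j) s) = 0" for d :: "_ \<Rightarrow> real" by (intro sum.neutral) auto
 show ?thesis unfolding * using n by simp
qed

lemma step_integral_power:
 fixes B :: "'i \<Rightarrow> (real^'d) set"
 assumes I: "finite I" and disj: "disjoint_family_on B I" and n: "n > 0"
  and B: "\<And>i. i \<in> I \<Longrightarrow> B i \<in> bounded_borel"
 shows "integrable lborel (\<lambda>s. (\<Sum>i\<in>I. c i * indicator (B i) s)^n)"
  and "(LBINT s. (\<Sum>i\<in>I. c i * indicator (B i) s)^n) = (\<Sum>i\<in>I. (c i)^n * measure lborel (B i))"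
proof -
 have i: "integrable lborel (\<lambda>s. (c i)^n * indicator (B i) s)" if "i \<in> I" for i
  using bounded_borelD[OF B[OF that]] by (intro integrable_mult_right integrable_real_indicator) auto
 show "integrable lborel (\<lambda>s. (\<Sum>i\<in>I. c i * indicator (B i) s)^n)"
  unfolding step_power[OF I disj n] using i by (rule Bochner_Integration.integrable_sum)
 show "(LBINT s. (\<Sum>i\<in>I. c i * indicator (B i) s)^n) = (\<Sum>i\<in>I. (c i)^n * measure lborel (B i))"
  unfolding step_power[OF I disj n] using i by (simp add: Bochner_Integration.integral_sum)
qed

lemma level_sets_disjoint: "disjoint_family_on (\<lambda>x. {s. f s = x}) I"
 unfolding disjoint_family_on_def by auto

lemma bounded_simple_L24:
 assumes f: "bounded_simple (f :: real^'d \<Rightarrow> real)" shows "L24 lborel f"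
proof -
 have "integrable lborel (\<lambda>s. (f s)^n)" if "n > 0" for n
  using step_integral_power(1)[OF _ level_sets_disjoint[of f] that, of "range f - {0}" "\<lambda>x. x"] bounded_simpleD[OF f]
  unfolding bounded_simple_canonical[OF f, symmetric] by simp
 then show ?thesis unfolding L24_def using bounded_simpleD[OF f] by simp
qed

context centered_levy_basis
begin

abbreviation "S \<equiv> simple_stoch_integral \<Lambda> UNIV"

text \<open>The integral is defined through level sets, whereas several pieces of a partition may
  carry the same coefficient. Each nonzero level set is the union of its pieces; additivity of the
  basis holds almost surely, and only finitely many null sets occur.\<close>

lemma simple_integral_partition:
 assumes I: "finite I" and disj: "disjoint_family_on B I" and B: "\<And>i. i \<in> I \<Longrightarrow> B i \<in> bounded_borel"
  and f: "f = (\<lambda>s. \<Sum>i\<in>I. c i * indicator (B i) s)"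
 shows "AE w in M. S f w = (\<Sum>i\<in>I. c i * \<Lambda> (B i) w)"
proof -
 have fs: "bounded_simple f" unfolding f by (rule bounded_simple_step[OF I B])
 have fB: "f s = c i" if "i \<in> I" "s \<in> B i" for i s
 proof -
  have "f s = (\<Sum>j\<in>I. if j = i then c j else 0)"
   unfolding f by (rule sum.cong) (use that disj in \<open>auto simp: disjoint_family_on_def indicator_def\<close>)
  then show ?thesis using I that by simp
 qed
 have f0: "f s = 0" if "\<And>i. i \<in> I \<Longrightarrow> s \<notin> B i" for s
  unfolding f using that by (intro sum.neutral) auto
 have lev: "{s. f s = x} = (\<Union>i\<in>{i\<in>I. c i = x}. B i)" if "x \<noteq> 0" for x
 proof (rule Set.set_eqI)
  fix s
  show "s \<in> {s. f s = x} \<longleftrightarrow> s \<in> (\<Union>i\<in>{i\<in>I. c i = x}. B i)"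
  proof (cases "\<exists>i\<in>I. s \<in> B i")
   case True
   then obtain i where i: "i \<in> I" "s \<in> B i" by auto
   have c: "c j = c i" if "j \<in> I" "s \<in> B j" for j using fB[OF that] fB[OF i] by simp
   have "s \<in> (\<Union>i\<in>{i\<in>I. c i = x}. B i) \<longleftrightarrow> c i = x"
   proof
    assume "s \<in> (\<Union>i\<in>{i\<in>I. c i = x}. B i)"
    then obtain j where "j \<in> I" "c j = x" "s \<in> B j" by auto
    then show "c i = x" using c by simp
   qed (use i in auto)
   then show ?thesis using fB[OF i] by simp
  next
   case False
   then show ?thesis using f0[of s] that by auto
  qed
 qed
 have "AE w in M. \<forall>x\<in>range f - {0}. \<Lambda> {s. f s = x} w = (\<Sum>i\<in>{i\<in>I. c i = x}. \<Lambda> (B i) w)"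
 proof (rule AE_finite_allI)
  show "finite (range f - {0})" using bounded_simpleD(2)[OF fs] by simp
  fix x assume "x \<in> range f - {0}"
  then have x: "x \<noteq> 0" by simp
  show "AE w in M. \<Lambda> {s. f s = x} w = (\<Sum>i\<in>{i\<in>I. c i = x}. \<Lambda> (B i) w)"
   unfolding lev[OF x] by (rule basis_UN) (use I B disj in \<open>auto simp: disjoint_family_on_def\<close>)
 qed
 moreover have "AE w in M. \<Lambda> {} w = 0" by (rule basis_empty)
 ultimately show ?thesis
 proof eventually_elim
  case (elim w)
  have "S f w = (\<Sum>x\<in>range f - {0}. \<Sum>i\<in>{i\<in>I. c i = x}. c i * \<Lambda> (B i) w)"
   unfolding simple_stoch_integral_def using elim(1) by (intro sum.cong) (auto simp: sum_distrib_left)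
  also have "\<dots> = (\<Sum>x\<in>range f - {0}. \<Sum>i\<in>{i\<in>{i\<in>I. c i \<in> range f - {0}}. c i = x}. c i * \<Lambda> (B i) w)"
   by (rule sum.cong, simp, rule sum.cong) auto
  also have "\<dots> = (\<Sum>i\<in>{i\<in>I. c i \<in> range f - {0}}. c i * \<Lambda> (B i) w)"
   by (rule sum.group) (use I bounded_simpleD(2)[OF fs] in auto)
  also have "\<dots> = (\<Sum>i\<in>I. c i * \<Lambda> (B i) w)"
  proof (rule sum.mono_neutral_left)
   show "\<forall>i\<in>I - {i \<in> I. c i \<in> range f - {0}}. c i * \<Lambda> (B i) w = 0"
   proof
    fix i assume i: "i \<in> I - {i \<in> I. c i \<in> range f - {0}}"
    \<comment> \<open>A coefficient that is not a nonzero value of f is either zero or belongs to an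
      empty piece, on which the basis vanishes almost surely.\<close>
    show "c i * \<Lambda> (B i) w = 0"
    proof (cases "B i = {}")
     case False
     then obtain s where "s \<in> B i" by auto
     then have "f s = c i" using fB[of i s] i by blast
     then have "c i \<in> range f" using rangeI[of f s] by simp
     then show ?thesis using i by auto
    next
     case True
     then show ?thesis using elim(2) by simp
    qed
   qed
  qed (use I in auto)
  finally show ?case .
 qed
qed

lemma simple_integral_lincomb:
 assumes "bounded_simple f" "bounded_simple g"
 shows "AE w in M. S (\<lambda>s. a * f s + b * g s) w = a * S f w + b * S g w"
proof -
 define F where "F i = (if i then f else g)" for i
 have F: "bounded_simple (F i)" for i unfolding F_def using assms by simp
 obtain I B where IB: "finite I" "disjoint_family_on B I" "\<And>v. v \<in> I \<Longrightarrow> B v \<in> bounded_borel"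
  "\<And>j. j \<in> UNIV \<Longrightarrow> F j = (\<lambda>s. \<Sum>v\<in>I. v j * indicator (B v) s)"
  by (rule bounded_simple_common_refinement[of UNIV F]) (use F in auto)
 have eq: "(\<lambda>s. a * f s + b * g s) = (\<lambda>s. \<Sum>v\<in>I. (a * v True + b * v False) * indicator (B v) s)"
 proof
  fix s
  have f: "f s = (\<Sum>v\<in>I. v True * indicator (B v) s)" and g: "g s = (\<Sum>v\<in>I. v False * indicator (B v) s)"
   using fun_cong[OF IB(4)[of True], of s] fun_cong[OF IB(4)[of False], of s] unfolding F_def by simp_all
  show "a * f s + b * g s = (\<Sum>v\<in>I. (a * v True + b * v False) * indicator (B v) s)"
   unfolding f g distrib_right sum.distrib sum_distrib_left by (simp only: mult.assoc)
 qed
 have "AE w in M. S f w = (\<Sum>v\<in>I. v True * \<Lambda> (B v) w)"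
  using IB(4)[of True] unfolding F_def by (intro simple_integral_partition[OF IB(1-3)]) auto
 moreover have "AE w in M. S g w = (\<Sum>v\<in>I. v False * \<Lambda> (B v) w)"
  using IB(4)[of False] unfolding F_def by (intro simple_integral_partition[OF IB(1-3)]) auto
 moreover have "AE w in M. S (\<lambda>s. a * f s + b * g s) w = (\<Sum>v\<in>I. (a * v True + b * v False) * \<Lambda> (B v) w)"
  by (rule simple_integral_partition[OF IB(1-3) eq])
 ultimately show ?thesis
 proof eventually_elim
  case (elim w)
  show ?case unfolding elim distrib_right sum.distrib sum_distrib_left by (simp only: mult.assoc)
 qed
qed

lemma simple_integral_restrict:
 assumes f: "bounded_simple f" and A: "A \<in> sets borel"
 shows "AE w in M. simple_stoch_integral \<Lambda> A f w = S (\<lambda>s. f s * indicator A s) w"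
proof -
 have "AE w in M. S (\<lambda>s. f s * indicator A s) w = (\<Sum>x\<in>range f - {0}. x * \<Lambda> (A \<inter> {s. f s = x}) w)"
 proof (rule simple_integral_partition)
  show "(\<lambda>s. f s * indicator A s) = (\<lambda>s. \<Sum>i\<in>range f - {0}. i * indicator (A \<inter> {s. f s = i}) s)"
  proof
   fix s
   have "(\<Sum>i\<in>range f - {0}. i * indicator (A \<inter> {s. f s = i}) s) = (\<Sum>i\<in>range f - {0}. i * indicator {s. f s = i} s) * indicator A s"
    unfolding sum_distrib_right by (rule sum.cong) (auto simp: indicator_def)
   then show "f s * indicator A s = (\<Sum>i\<in>range f - {0}. i * indicator (A \<inter> {s. f s = i}) s)"
    unfolding bounded_simple_canonical[OF f, symmetric] by simp
  qed
 qed (use bounded_simpleD[OF f] A in \<open>auto simp: disjoint_family_on_def intro!: bounded_borel_Int\<close>)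
 then show ?thesis unfolding simple_stoch_integral_def by eventually_elim simp
qed

lemma simple_integral_restrict_measurable:
 assumes f: "bounded_simple f" and A: "A \<in> sets borel"
 shows "random_variable borel (simple_stoch_integral \<Lambda> A f)"
proof -
 have "random_variable borel (\<Lambda> (A \<inter> {s. f s = x}))" if "x \<in> range f - {0}" for x
  using bounded_simpleD(3)[OF f] A that by (intro basis_rv bounded_borel_Int) auto
 then show ?thesis unfolding simple_stoch_integral_def[abs_def] by (intro borel_measurable_sum) auto
qed

lemma simple_integral_L24:
 assumes f: "bounded_simple f" shows "L24 M (S f)"
 unfolding simple_stoch_integral_def[abs_def]
 by (intro L24_sum L24_cmult basis_L24) (use bounded_simpleD(3)[OF f] in auto)

text \<open>The level sets give independent centred summands. Variance and fourth cumulant are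
  additive and linear in the volume, which turns the sums over the levels into the integrals of f^2
  and f^4.\<close>

lemma simple_integral_moments:
 assumes f: "bounded_simple f"
 shows "expectation (S f) = 0"
  and "expectation (\<lambda>w. (S f w)^2) = k2 * (LBINT s. (f s)^2)"
  and "expectation (\<lambda>w. (S f w)^4) = c4 * (LBINT s. (f s)^4) + 3 * k2^2 * (LBINT s. (f s)^2)^2"
proof -
 define I where "I = range f - {0}"
 define B where "B x = {s. f s = x}" for x
 define X where "X x = (\<lambda>w. x * \<Lambda> (B x) w)" for x
 have fin: "finite I" using bounded_simpleD(2)[OF f] unfolding I_def by simp
 have disj: "disjoint_family_on B I" unfolding B_def by (rule level_sets_disjoint)
 have B: "B x \<in> bounded_borel" if "x \<in> I" for x using bounded_simpleD(3)[OF f] that unfolding B_def I_def by auto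
 have Sf: "S f = (\<lambda>w. \<Sum>x\<in>I. X x w)" unfolding simple_stoch_integral_def[abs_def] I_def X_def B_def by simp
 have ind: "indep_vars (\<lambda>_. borel) X I" unfolding X_def
  by (rule indep_vars_compose2[OF basis_indep_finite[OF fin B disj]]) auto
 have L: "L24 M (X x)" if "x \<in> I" for x unfolding X_def using basis_L24[OF B[OF that]] by (rule L24_cmult)
 have mean: "expectation (X x) = 0" if "x \<in> I" for x unfolding X_def using mean_zero[OF B[OF that]] by simp
 have E2: "expectation (\<lambda>w. (X x w)^2) = k2 * (x^2 * measure lborel (B x))" if "x \<in> I" for x
  unfolding X_def power_mult_distrib using basis_variance[OF B[OF that]] by simp
 have E4: "expectation (\<lambda>w. (X x w)^4) = c4 * (x^4 * measure lborel (B x)) + 3 * (k2 * (x^2 * measure lborel (B x)))^2" if "x \<in> I" for x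
 proof -
  have "expectation (\<lambda>w. (X x w)^4) = x^4 * (c4 * measure lborel (B x) + 3 * k2^2 * (measure lborel (B x))^2)"
   unfolding X_def power_mult_distrib basis_power4[OF B[OF that], symmetric] by simp
  also have "\<dots> = c4 * (x^4 * measure lborel (B x)) + 3 * (k2 * (x^2 * measure lborel (B x)))^2"
   unfolding power_mult_distrib by (simp add: distrib_left)
  finally show ?thesis .
 qed
 have fe: "f s = (\<Sum>x\<in>I. x * indicator (B x) s)" for s unfolding I_def B_def by (rule bounded_simple_canonical[OF f])
 have int2: "(LBINT s. (f s)^2) = (\<Sum>x\<in>I. x^2 * measure lborel (B x))"
  using step_integral_power(2)[OF fin disj _ B, of 2 "\<lambda>x. x"] unfolding fe[symmetric] by simp
 have int4: "(LBINT s. (f s)^4) = (\<Sum>x\<in>I. x^4 * measure lborel (B x))"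
  using step_integral_power(2)[OF fin disj _ B, of 4 "\<lambda>x. x"] unfolding fe[symmetric] by simp
 note m = indep_vars_L24_moments[OF fin ind]
 show "expectation (S f) = 0" unfolding Sf by (rule m(1)) (use L mean in auto)
 have "expectation (\<lambda>w. (S f w)^2) = (\<Sum>x\<in>I. expectation (\<lambda>w. (X x w)^2))"
  unfolding Sf by (rule m(2)) (use L mean in auto)
 also have "\<dots> = (\<Sum>x\<in>I. k2 * (x^2 * measure lborel (B x)))" by (rule sum.cong) (auto simp: E2)
 finally show 2: "expectation (\<lambda>w. (S f w)^2) = k2 * (LBINT s. (f s)^2)"
  unfolding int2 sum_distrib_left .
 have "expectation (\<lambda>w. (S f w)^4) - 3 * (expectation (\<lambda>w. (S f w)^2))^2
   = (\<Sum>x\<in>I. expectation (\<lambda>w. (X x w)^4) - 3 * (expectation (\<lambda>w. (X x w)^2))^2)"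
  unfolding Sf by (rule m(3)) (use L mean in auto)
 also have "\<dots> = (\<Sum>x\<in>I. c4 * (x^4 * measure lborel (B x)))" by (rule sum.cong) (auto simp: E2 E4)
 also have "\<dots> = c4 * (LBINT s. (f s)^4)" unfolding int4 sum_distrib_left ..
 finally show "expectation (\<lambda>w. (S f w)^4) = c4 * (LBINT s. (f s)^4) + 3 * k2^2 * (LBINT s. (f s)^2)^2"
  unfolding 2 power_mult_distrib by linarith
qed

end

section \<open>The stochastic integral\<close>

context prob_space
begin

text \<open>One e bounds both the deviation and its probability. Over a general Borel set the
  stochastic integral only comes with the existence of some limit in probability, and the Cauchy
  property is what is extracted from it.\<close>

definition prob_Cauchy :: "(nat \<Rightarrow> 'a \<Rightarrow> real) \<Rightarrow> bool" where
 "prob_Cauchy X \<longleftrightarrow> (\<forall>e>0. \<exists>n0. \<forall>m\<ge>n0. \<forall>n\<ge>n0. prob {w \<in> space M. \<bar>X m w - X n w\<bar> > e} < e)"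

lemma prob_abs_sum_le:
 fixes X Z :: "'a \<Rightarrow> real"
 assumes [measurable]: "random_variable borel X" "random_variable borel Z" "random_variable borel W"
  and ae: "AE w in M. \<bar>W w\<bar> \<le> \<bar>X w\<bar> + \<bar>Z w\<bar>" and "a + b \<le> c"
 shows "prob {w \<in> space M. \<bar>W w\<bar> > c} \<le> prob {w \<in> space M. \<bar>X w\<bar> > a} + prob {w \<in> space M. \<bar>Z w\<bar> > b}"
proof -
 have "prob {w \<in> space M. \<bar>W w\<bar> > c} \<le> prob ({w \<in> space M. \<bar>X w\<bar> > a} \<union> {w \<in> space M. \<bar>Z w\<bar> > b})"
 proof (rule finite_measure_mono_AE)
  show "AE w in M. w \<in> {w \<in> space M. c < \<bar>W w\<bar>} \<longrightarrow> w \<in> {w \<in> space M. a < \<bar>X w\<bar>} \<union> {w \<in> space M. b < \<bar>Z w\<bar>}"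
   using ae by eventually_elim (use assms(5) in auto)
 qed measurable
 also have "\<dots> \<le> prob {w \<in> space M. \<bar>X w\<bar> > a} + prob {w \<in> space M. \<bar>Z w\<bar> > b}"
  by (rule measure_Un_le) measurable
 finally show ?thesis .
qed

lemma prob_abs_le_second_moment:
 fixes X :: "'a \<Rightarrow> real"
 assumes [measurable]: "random_variable borel X" and X: "integrable M (\<lambda>w. (X w)^2)" and a: "a > 0"
 shows "prob {w \<in> space M. \<bar>X w\<bar> > a} \<le> expectation (\<lambda>w. (X w)^2) / a^2"
proof -
 have "prob {w \<in> space M. \<bar>X w\<bar> > a} \<le> prob {w \<in> space M. (X w)^2 \<ge> a^2}"
 proof (rule finite_measure_mono)
  show "{w \<in> space M. \<bar>X w\<bar> > a} \<subseteq> {w \<in> space M. (X w)^2 \<ge> a^2}"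
   using a by (auto simp: abs_le_square_iff[symmetric])
 qed measurable
 also have "\<dots> \<le> expectation (\<lambda>w. (X w)^2) / a^2"
  by (rule integral_Markov_inequality_measure[OF X, of "space M"]) (use a in auto)
 finally show ?thesis .
qed

lemma conv_in_prob_imp_Cauchy:
 assumes "conv_in_prob X Z" shows "prob_Cauchy X"
 unfolding prob_Cauchy_def
proof (intro allI impI)
 fix r :: real assume e: "r > 0"
 have [measurable]: "random_variable borel (X n)" "random_variable borel Z" for n
  using assms unfolding conv_in_prob_def by auto
 have "(\<lambda>n. prob {w \<in> space M. \<bar>X n w - Z w\<bar> > r/2}) \<longlonglongrightarrow> 0"
 proof -
  have "\<forall>r>0. (\<lambda>n. prob {w \<in> space M. \<bar>X n w - Z w\<bar> > r}) \<longlonglongrightarrow> 0"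
   using assms unfolding conv_in_prob_def by blast
  from this[rule_format, of "r/2"] e show ?thesis by linarith
 qed
 then have "\<forall>\<^sub>F n in sequentially. prob {w \<in> space M. \<bar>X n w - Z w\<bar> > r/2} < r/2"
  using e by (intro order_tendstoD(2)[of _ 0]) auto
 then obtain n0 where n0: "\<And>n. n \<ge> n0 \<Longrightarrow> prob {w \<in> space M. \<bar>X n w - Z w\<bar> > r/2} < r/2"
  unfolding eventually_sequentially by auto
 show "\<exists>n0. \<forall>m\<ge>n0. \<forall>n\<ge>n0. prob {w \<in> space M. \<bar>X m w - X n w\<bar> > r} < r"
 proof (intro exI allI impI)
  fix m n assume "m \<ge> n0" "n \<ge> n0"
  have "prob {w \<in> space M. \<bar>X m w - X n w\<bar> > r} \<le> prob {w \<in> space M. \<bar>X m w - Z w\<bar> > r/2} + prob {w \<in> space M. \<bar>X n w - Z w\<bar> > r/2}"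
   by (rule prob_abs_sum_le) (auto intro!: always_eventually AE_I2)
  then show "prob {w \<in> space M. \<bar>X m w - X n w\<bar> > r} < r"
   using n0[OF \<open>m \<ge> n0\<close>] n0[OF \<open>n \<ge> n0\<close>] by linarith
 qed
qed

lemma L2_Cauchy_imp_prob_Cauchy:
 fixes X :: "nat \<Rightarrow> 'a \<Rightarrow> real"
 assumes X: "\<And>n. L24 M (X n)"
  and C: "\<And>r. r > 0 \<Longrightarrow> \<exists>n0. \<forall>m\<ge>n0. \<forall>n\<ge>n0. expectation (\<lambda>w. (X m w - X n w)^2) < r"
 shows "prob_Cauchy X"
 unfolding prob_Cauchy_def
proof (intro allI impI)
 fix r :: real assume e: "r > 0"
 obtain n0 where n0: "\<And>m n. m \<ge> n0 \<Longrightarrow> n \<ge> n0 \<Longrightarrow> expectation (\<lambda>w. (X m w - X n w)^2) < r^3"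
  using C[of "r^3"] e by auto
 show "\<exists>n0. \<forall>m\<ge>n0. \<forall>n\<ge>n0. prob {w \<in> space M. \<bar>X m w - X n w\<bar> > r} < r"
 proof (intro exI allI impI)
  fix m n assume mn: "m \<ge> n0" "n \<ge> n0"
  have "prob {w \<in> space M. \<bar>X m w - X n w\<bar> > r} \<le> expectation (\<lambda>w. (X m w - X n w)^2) / r^2"
   using L24D[OF L24_diff[OF X X]] e by (intro prob_abs_le_second_moment)
  also have "\<dots> < r^3 / r^2" using n0[OF mn] e by (intro divide_strict_right_mono) auto
  also have "\<dots> = r" using e by (simp add: power3_eq_cube power2_eq_square)
  finally show "prob {w \<in> space M. \<bar>X m w - X n w\<bar> > r} < r" .
 qed
qed

lemma prob_Cauchy_diff_AE:
 fixes X :: "nat \<Rightarrow> 'a \<Rightarrow> real"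
 assumes X: "prob_Cauchy X" and Z: "prob_Cauchy Z"
  and [measurable]: "\<And>n. random_variable borel (X n)" "\<And>n. random_variable borel (Z n)" "\<And>n. random_variable borel (W n)"
  and ae: "\<And>n. AE w in M. W n w = X n w - Z n w"
 shows "prob_Cauchy W"
 unfolding prob_Cauchy_def
proof (intro allI impI)
 fix r :: real assume e: "r > 0"
 obtain n0 where n0: "\<And>m n. m \<ge> n0 \<Longrightarrow> n \<ge> n0 \<Longrightarrow> prob {w \<in> space M. \<bar>X m w - X n w\<bar> > r/2} < r/2"
  using X e unfolding prob_Cauchy_def by (meson half_gt_zero)
 obtain n1 where n1: "\<And>m n. m \<ge> n1 \<Longrightarrow> n \<ge> n1 \<Longrightarrow> prob {w \<in> space M. \<bar>Z m w - Z n w\<bar> > r/2} < r/2"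
  using Z e unfolding prob_Cauchy_def by (meson half_gt_zero)
 show "\<exists>n0. \<forall>m\<ge>n0. \<forall>n\<ge>n0. prob {w \<in> space M. \<bar>W m w - W n w\<bar> > r} < r"
 proof (intro exI[of _ "max n0 n1"] allI impI)
  fix m n assume mn: "m \<ge> max n0 n1" "n \<ge> max n0 n1"
  have "prob {w \<in> space M. \<bar>W m w - W n w\<bar> > r} \<le> prob {w \<in> space M. \<bar>X m w - X n w\<bar> > r/2} + prob {w \<in> space M. \<bar>Z m w - Z n w\<bar> > r/2}"
  proof (rule prob_abs_sum_le)
   show "AE w in M. \<bar>W m w - W n w\<bar> \<le> \<bar>X m w - X n w\<bar> + \<bar>Z m w - Z n w\<bar>"
    using ae[of m] ae[of n] by eventually_elim simp
  qed auto
  then show "prob {w \<in> space M. \<bar>W m w - W n w\<bar> > r} < r"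
   using n0[of m n] n1[of m n] mn by linarith
 qed
qed

text \<open>A form of Fatou's lemma for convergence in probability. The fourth power is truncated at
  K, so that an event of small probability costs at most K times that probability; monotone
  convergence removes the truncation. The factor 8 is the one of
  \<open>power4_sum_le\<close>.\<close>

lemma L4_bound_limit_in_prob:
 fixes X :: "nat \<Rightarrow> 'a \<Rightarrow> real"
 assumes X: "\<And>n. L24 M (X n)" and Z[measurable]: "random_variable borel Z"
  and lim: "\<And>r. r > 0 \<Longrightarrow> (\<lambda>n. prob {w \<in> space M. \<bar>X n w - Z w\<bar> > r}) \<longlonglongrightarrow> 0"
  and U: "L24 M U" and bound: "\<And>m. m \<ge> n0 \<Longrightarrow> expectation (\<lambda>w. (X m w - U w)^4) \<le> B"
 shows "integrable M (\<lambda>w. (Z w - U w)^4)" "expectation (\<lambda>w. (Z w - U w)^4) \<le> 8 * B"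
proof -
 note [measurable] = L24D(1)[OF X] L24D(1)[OF U]
 have B0: "0 \<le> B"
 proof -
  have "0 \<le> expectation (\<lambda>w. (X n0 w - U w)^4)" by simp
  also have "\<dots> \<le> B" by (rule bound) simp
  finally show ?thesis .
 qed
 define T where "T K = (\<lambda>w. min ((Z w - U w)^4) (real K))" for K
 have [measurable]: "random_variable borel (T K)" for K unfolding T_def by measurable
 have Ti: "integrable M (T K)" for K
  by (rule integrable_const_bound[where B="real K"]) (auto simp: T_def)
 have T0: "0 \<le> T K w" for K w unfolding T_def by simp
 have ET: "expectation (T K) \<le> 8 * B" for K
 proof (rule field_le_epsilon)
  fix e :: real assume e: "e > 0"
  \<comment> \<open>Chosen so that 8 \<delta>^4 \<le> e / 2; the minimum with 1 allows \<delta>^4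
    \<le> \<delta>.\<close>
  define \<delta> where "\<delta> = min 1 (e / 16)"
  have \<delta>: "\<delta> > 0" "8 * \<delta>^4 \<le> e / 2"
  proof -
   show "\<delta> > 0" unfolding \<delta>_def using e by simp
   have "\<delta>^4 \<le> \<delta>^1" using \<open>\<delta> > 0\<close> by (intro power_decreasing) (auto simp: \<delta>_def)
   then show "8 * \<delta>^4 \<le> e / 2" unfolding \<delta>_def by simp
  qed
  have "(\<lambda>n. 8 * \<delta>^4 + real K * prob {w \<in> space M. \<bar>X n w - Z w\<bar> > \<delta>}) \<longlonglongrightarrow> 8 * \<delta>^4 + real K * 0"
   by (intro tendsto_intros lim \<delta>)
  then have "\<forall>\<^sub>F n in sequentially. 8 * \<delta>^4 + real K * prob {w \<in> space M. \<bar>X n w - Z w\<bar> > \<delta>} < e"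
   by (rule order_tendstoD(2)) (use \<delta> e in simp)
  then have "\<forall>\<^sub>F n in sequentially. 8 * \<delta>^4 + real K * prob {w \<in> space M. \<bar>X n w - Z w\<bar> > \<delta>} < e \<and> n \<ge> n0"
   using eventually_ge_at_top by eventually_elim simp
  then obtain m where m: "8 * \<delta>^4 + real K * prob {w \<in> space M. \<bar>X m w - Z w\<bar> > \<delta>} < e" "m \<ge> n0"
   using eventually_happens'[OF sequentially_bot] by blast
  let ?A = "{w \<in> space M. \<bar>X m w - Z w\<bar> > \<delta>}"
  have pt: "T K w \<le> (8 * \<delta>^4 + 8 * (X m w - U w)^4) + real K * indicator ?A w" if "w \<in> space M" for w
  proof (cases "w \<in> ?A")
   case True
   have "0 \<le> 8 * \<delta>^4 + 8 * (X m w - U w)^4" by simp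
   moreover have "T K w \<le> real K" unfolding T_def by simp
   moreover have "real K * indicator ?A w = real K" using True by simp
   ultimately show ?thesis by linarith
  next
   case False
   have "(Z w - U w)^4 \<le> 8 * (Z w - X m w)^4 + 8 * (X m w - U w)^4"
    using power4_sum_le[of "Z w - X m w" "X m w - U w"] by simp
   moreover have "(Z w - X m w)^4 \<le> \<delta>^4"
   proof -
    have "\<bar>Z w - X m w\<bar>^4 \<le> \<delta>^4" using False that by (intro power_mono) auto
    then show ?thesis by simp
   qed
   ultimately show ?thesis using False unfolding T_def by simp
  qed
  have i: "integrable M (\<lambda>w. (X m w - U w)^4)" by (rule L24D(3)[OF L24_diff[OF X U]])
  have ii: "integrable M (\<lambda>w. real K * indicator ?A w)"
   by (intro integrable_mult_right integrable_real_indicator) (auto simp: less_top[symmetric])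
  have "expectation (T K) \<le> expectation (\<lambda>w. (8 * \<delta>^4 + 8 * (X m w - U w)^4) + real K * indicator ?A w)"
   by (rule integral_mono[OF Ti]) (use i ii pt in simp_all)
  also have "\<dots> = 8 * \<delta>^4 + 8 * expectation (\<lambda>w. (X m w - U w)^4) + real K * prob ?A"
   using i ii by (simp add: prob_space)
  also have "\<dots> \<le> 8 * B + e" using bound[OF m(2)] m(1) by simp
  finally show "expectation (T K) \<le> 8 * B + e" .
 qed
 have nn: "(\<integral>\<^sup>+w. ennreal ((Z w - U w)^4) \<partial>M) \<le> ennreal (8 * B)"
 proof -
  have "(\<integral>\<^sup>+w. ennreal ((Z w - U w)^4) \<partial>M) = (\<integral>\<^sup>+w. (SUP K. ennreal (T K w)) \<partial>M)"
  proof (rule nn_integral_cong)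
   fix w
   obtain K0 :: nat where K0: "(Z w - U w)^4 \<le> real K0" using real_arch_simple by blast
   show "ennreal ((Z w - U w)^4) = (SUP K. ennreal (T K w))"
   proof (rule antisym)
    have "T K0 w = (Z w - U w)^4" unfolding T_def using K0 by simp
    then show "ennreal ((Z w - U w)^4) \<le> (SUP K. ennreal (T K w))"
     using SUP_upper[of K0 UNIV "\<lambda>K. ennreal (T K w)"] by simp
    show "(SUP K. ennreal (T K w)) \<le> ennreal ((Z w - U w)^4)"
     by (rule SUP_least) (auto simp: T_def intro!: ennreal_leI)
   qed
  qed
  also have "\<dots> = (SUP K. \<integral>\<^sup>+w. ennreal (T K w) \<partial>M)"
   by (rule nn_integral_monotone_convergence_SUP) (auto simp: T_def incseq_def le_fun_def intro!: ennreal_leI)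
  also have "\<dots> \<le> ennreal (8 * B)"
  proof (rule SUP_least)
   fix K
   have "(\<integral>\<^sup>+w. ennreal (T K w) \<partial>M) = ennreal (expectation (T K))"
    by (rule nn_integral_eq_integral[OF Ti]) (use T0 in auto)
   then show "(\<integral>\<^sup>+w. ennreal (T K w) \<partial>M) \<le> ennreal (8 * B)" using ET by (simp add: ennreal_leI)
  qed
  finally show ?thesis .
 qed
 show int: "integrable M (\<lambda>w. (Z w - U w)^4)"
  by (rule integrableI_nonneg) (use nn in \<open>auto intro: le_less_trans\<close>)
 show "expectation (\<lambda>w. (Z w - U w)^4) \<le> 8 * B"
  using nn nn_integral_eq_integral[OF int] B0 by simp
qed

end

context centered_levy_basis
begin

lemma simple_integral_tail_bound:
 assumes h: "bounded_simple h" and A: "A \<in> sets borel" and a: "a > 0"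
 shows "prob {w \<in> space M. \<bar>simple_stoch_integral \<Lambda> A h w\<bar> > a} \<le> k2 * (LBINT s. (h s)^2 * indicator A s) / a^2"
proof -
 have hA: "bounded_simple (\<lambda>s. h s * indicator A s)" by (rule bounded_simple_mult_indicator[OF h A])
 note [measurable] = simple_integral_restrict_measurable[OF h A] L24D(1)[OF simple_integral_L24[OF hA]]
 have "prob {w \<in> space M. \<bar>simple_stoch_integral \<Lambda> A h w\<bar> > a} = prob {w \<in> space M. \<bar>S (\<lambda>s. h s * indicator A s) w\<bar> > a}"
 proof (rule finite_measure_eq_AE)
  show "AE w in M. w \<in> {w \<in> space M. \<bar>simple_stoch_integral \<Lambda> A h w\<bar> > a} \<longleftrightarrow> w \<in> {w \<in> space M. \<bar>S (\<lambda>s. h s * indicator A s) w\<bar> > a}"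
   using simple_integral_restrict[OF h A] by eventually_elim simp
 qed measurable
 also have "\<dots> \<le> expectation (\<lambda>w. (S (\<lambda>s. h s * indicator A s) w)^2) / a^2"
  using L24D[OF simple_integral_L24[OF hA]] a by (intro prob_abs_le_second_moment)
 also have "\<dots> = k2 * (LBINT s. (h s * indicator A s)^2) / a^2" unfolding simple_integral_moments[OF hA] ..
 also have "(\<lambda>s. (h s * indicator A s)^2) = (\<lambda>s. (h s)^2 * indicator A s)"
  by (auto simp: indicator_def)
 finally show ?thesis .
qed

text \<open>Gliding hump: the integrand is concentrated on disjoint shells \<open>F (k (Suc j)) - F (k j)\<close> along a
 subsequence; on the union of every other shell the integrals can only converge if they vanish.\<close>

lemma simple_integral_gliding_hump:
 assumes h: "\<And>n. bounded_simple (h n)" and h0: "AE s in lborel. (\<lambda>n. h n s) \<longlonglongrightarrow> 0"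
  and C: "\<And>A. A \<in> sets borel \<Longrightarrow> prob_Cauchy (\<lambda>n. simple_stoch_integral \<Lambda> A (h n))"
  and e: "e > 0"
 shows "(\<lambda>n. prob {z \<in> space M. \<bar>S (h n) z\<bar> > e}) \<longlonglongrightarrow> 0"
proof -
 define X where "X n A = simple_stoch_integral \<Lambda> A (h n)" for n A
 define q where "q n A = (LBINT s. (h n s)^2 * indicator A s)" for n A
 \<comment> \<open>On \<open>F k\<close> the domain is bounded and the whole sequence is bounded by
   k, so dominated convergence applies for fixed k. Almost every point lies in some
   \<open>F k\<close>, because a convergent sequence is bounded.\<close>
 define F where "F k = {s \<in> cball 0 (real k). \<forall>n. \<bar>h n s\<bar> \<le> real k}" for k
 have hm[measurable]: "h n \<in> borel_measurable borel" for n using bounded_simpleD(1)[OF h] .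
 have Fm[measurable]: "F k \<in> sets borel" for k unfolding F_def by measurable
 have Fmono: "F i \<subseteq> F j" if "i \<le> j" for i j
  unfolding F_def using that by (auto intro: order_trans[of _ "real i"])
 have hi: "integrable lborel (\<lambda>s. (h n s)^2)" for n using L24D(2)[OF bounded_simple_L24[OF h]] .
 have hiA: "integrable lborel (\<lambda>s. (h n s)^2 * indicator A s)" if "A \<in> sets borel" for n A
  using integrable_mult_indicator[OF _ hi, of A n] that by (simp add: mult.commute)
 have Xm[measurable]: "random_variable borel (X n A)" if "A \<in> sets borel" for n A
  unfolding X_def using simple_integral_restrict_measurable[OF h that] .
 have XB: "prob {z \<in> space M. \<bar>X n A z\<bar> > a} \<le> k2 * q n A / a^2" if "A \<in> sets borel" "a > 0" for n A a
  unfolding X_def q_def using simple_integral_tail_bound[OF h that] .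
 have q_sub: "q n A \<le> q n B + q n D" if "A \<subseteq> B \<union> D" "A \<in> sets borel" "B \<in> sets borel" "D \<in> sets borel" for n A B D
 proof -
  have "q n A \<le> (LBINT s. (h n s)^2 * indicator B s + (h n s)^2 * indicator D s)"
   unfolding q_def by (rule integral_mono) (use hiA that in \<open>auto simp: indicator_def\<close>)
  also have "\<dots> = q n B + q n D" unfolding q_def using hiA that by simp
  finally show ?thesis .
 qed
 have L: "(\<lambda>n. q n (F k)) \<longlonglongrightarrow> 0" for k
 proof -
  have "(\<lambda>n. q n (F k)) \<longlonglongrightarrow> (integral\<^sup>L lborel (\<lambda>s::real^'d. 0::real))" unfolding q_def
  proof (rule integral_dominated_convergence[where w="\<lambda>s. (real k)^2 * indicator (cball 0 (real k)) s"])
   show "integrable lborel (\<lambda>s::real^'d. (real k)^2 * indicator (cball 0 (real k)) s)"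
    using emeasure_bounded_finite[OF bounded_cball] by (intro integrable_mult_right integrable_real_indicator) auto
   show "AE s in lborel. (\<lambda>n. (h n s)^2 * indicator (F k) s) \<longlonglongrightarrow> 0"
    using h0
   proof eventually_elim
    case (elim s)
    show ?case using tendsto_mult[OF tendsto_power[OF elim, of 2] tendsto_const[of "indicator (F k) s"]] by simp
   qed
   show "AE s in lborel. norm ((h n s)^2 * indicator (F k) s) \<le> (real k)^2 * indicator (cball 0 (real k)) s" for n
   proof (rule AE_I2)
    fix s
    show "norm ((h n s)^2 * indicator (F k) s) \<le> (real k)^2 * indicator (cball 0 (real k)) s"
    proof (cases "s \<in> F k")
     case True
     then have "\<bar>h n s\<bar> \<le> real k" "s \<in> cball 0 (real k)" unfolding F_def by auto
     then show ?thesis using True power_mono[of "\<bar>h n s\<bar>" "real k" 2] by simp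
    qed simp
   qed
  qed auto
  then show ?thesis by simp
 qed
 have R: "(\<lambda>k. q n (- F k)) \<longlonglongrightarrow> 0" for n
 proof -
  have "(\<lambda>k. q n (- F k)) \<longlonglongrightarrow> (integral\<^sup>L lborel (\<lambda>s::real^'d. 0::real))" unfolding q_def
  proof (rule integral_dominated_convergence[where w="\<lambda>s. (h n s)^2"])
   show "AE s in lborel. (\<lambda>k. (h n s)^2 * indicator (- F k) s) \<longlonglongrightarrow> 0"
    using h0
   proof eventually_elim
    case (elim s)
    then obtain K where K: "\<And>n. \<bar>h n s\<bar> \<le> K"
     using convergent_imp_Bseq[OF convergentI[OF elim]] unfolding Bseq_def by auto
    obtain k0 :: nat where k0: "max K (norm s) \<le> real k0" using real_arch_simple by blast
    show ?case
    proof (rule tendsto_eventually, unfold eventually_sequentially, intro exI allI impI)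
     fix k assume "k0 \<le> k"
     then have "real k0 \<le> real k" by simp
     then have "norm s \<le> real k" "\<bar>h m s\<bar> \<le> real k" for m using k0 K[of m] by linarith+
     then have "s \<in> F k" unfolding F_def by simp
     then show "(h n s)^2 * indicator (- F k) s = 0" by simp
    qed
   qed
   show "AE s in lborel. norm ((h n s)^2 * indicator (- F k) s) \<le> (h n s)^2" for k
    by (intro AE_I2) (auto simp: indicator_def)
  qed (use hi in auto)
  then show ?thesis by simp
 qed
 have sparse: "\<exists>n\<ge>n0. prob {z \<in> space M. \<bar>X n UNIV z\<bar> > 3 * \<eta>} < 3 * \<eta>" if \<eta>: "\<eta> > 0" for \<eta> n0
 proof -
  \<comment> \<open>Each stage chooses a pair (k, n): k so large that the previous function has
    little mass outside \<open>F k\<close>, then n so late that the new function has little mass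
    inside \<open>F k\<close>. Each chosen function thus lives essentially on the shell between two
    consecutive sets.\<close>
  have "\<exists>f. \<forall>j. (case f j of (k, n) \<Rightarrow> q n (F k) < (1/2)^j \<and> j \<le> n) \<and>
    (case f j of (k, n) \<Rightarrow> case f (Suc j) of (k', n') \<Rightarrow> k \<le> k' \<and> q n (- F k') < (1/2)^j)"
  proof (rule dependent_nat_choice)
   have "\<forall>\<^sub>F n in sequentially. q n (F 0) < 1" by (rule order_tendstoD(2)[OF L]) simp
   then obtain n where "q n (F 0) < 1" using eventually_happens'[OF sequentially_bot] by blast
   then show "\<exists>x. case x of (k, n) \<Rightarrow> q n (F k) < (1 / 2) ^ 0 \<and> 0 \<le> n" by auto
  next
   fix x :: "nat \<times> nat" and j
   obtain k n where x: "x = (k, n)" by (cases x)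
   have "\<forall>\<^sub>F k' in sequentially. q n (- F k') < (1/2)^j" by (rule order_tendstoD(2)[OF R]) simp
   then have "\<forall>\<^sub>F k' in sequentially. q n (- F k') < (1/2)^j \<and> k \<le> k'"
    using eventually_ge_at_top[of k] by eventually_elim simp
   then obtain k' where k': "q n (- F k') < (1/2)^j" "k \<le> k'" using eventually_happens'[OF sequentially_bot] by blast
   have "\<forall>\<^sub>F n' in sequentially. q n' (F k') < (1/2)^(Suc j)" by (rule order_tendstoD(2)[OF L]) simp
   then have "\<forall>\<^sub>F n' in sequentially. q n' (F k') < (1/2)^(Suc j) \<and> Suc j \<le> n'"
    using eventually_ge_at_top[of "Suc j"] by eventually_elim simp
   then obtain n' where n': "q n' (F k') < (1/2)^(Suc j)" "Suc j \<le> n'" using eventually_happens'[OF sequentially_bot] by blast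
   show "\<exists>y. (case y of (k, n) \<Rightarrow> q n (F k) < (1 / 2) ^ Suc j \<and> Suc j \<le> n) \<and>
     (case x of (k, n) \<Rightarrow> case y of (k', n') \<Rightarrow> k \<le> k' \<and> q n (- F k') < (1 / 2) ^ j)"
    by (rule exI[of _ "(k', n')"]) (use k' n' x in simp)
  qed
  then obtain f where f: "\<forall>j. (case f j of (k, n) \<Rightarrow> q n (F k) < (1/2)^j \<and> j \<le> n) \<and>
    (case f j of (k, n) \<Rightarrow> case f (Suc j) of (k', n') \<Rightarrow> k \<le> k' \<and> q n (- F k') < (1/2)^j)" by (elim exE)
  define k where "k j = fst (f j)" for j
  define N where "N j = snd (f j)" for j
  have q1: "q (N j) (F (k j)) < (1/2)^j" and Nj: "j \<le> N j" and kk: "k j \<le> k (Suc j)"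
   and q2: "q (N j) (- F (k (Suc j))) < (1/2)^j" for j
   using f[rule_format, of j] unfolding k_def N_def by (simp_all add: case_prod_beta)
  have kmono: "k i \<le> k j" if "i \<le> j" for i j using lift_Suc_mono_le[of k] kk that by blast
  \<comment> \<open>A collects the shells of even index: for even j the chosen function is
    negligible off A, for odd j it is negligible on A.\<close>
  define A where "A = (\<Union>j\<in>{j. even j}. F (k (Suc j)) - F (k j))"
  have Am[measurable]: "A \<in> sets borel" unfolding A_def by (intro sets.countable_UN' sets.Diff Fm) auto
  have ev: "- A \<subseteq> F (k j) \<union> - F (k (Suc j))" if "even j" for j
   unfolding A_def using that by auto
  have od: "A \<subseteq> F (k j) \<union> - F (k (Suc j))" if "odd j" for j
  proof
   fix x assume "x \<in> A"
   then obtain i where i: "even i" "x \<in> F (k (Suc i))" "x \<notin> F (k i)" unfolding A_def by auto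
   then have "i \<noteq> j" using that by auto
   then consider "Suc i \<le> j" | "Suc j \<le> i" by linarith
   then show "x \<in> F (k j) \<union> - F (k (Suc j))"
   proof cases
    case 1 then show ?thesis using Fmono[OF kmono[OF 1]] i by auto
   next
    case 2 then show ?thesis using Fmono[OF kmono[OF 2]] i by auto
   qed
  qed
  have qe: "q (N j) (- A) \<le> 2 * (1/2)^j" if "even j" for j
   using q_sub[OF ev[OF that], of "N j"] q1[of j] q2[of j] by simp
  have qo: "q (N j) A \<le> 2 * (1/2)^j" if "odd j" for j
   using q_sub[OF od[OF that], of "N j"] q1[of j] q2[of j] by simp
  obtain n1 where n1: "\<And>m n. m \<ge> n1 \<Longrightarrow> n \<ge> n1 \<Longrightarrow> prob {z \<in> space M. \<bar>X m A z - X n A z\<bar> > \<eta>} < \<eta>"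
   using C[OF Am] \<eta> unfolding prob_Cauchy_def X_def by meson
  have "(\<lambda>j. k2 * (2 * (1/2)^j) / \<eta>^2) \<longlonglongrightarrow> k2 * (2 * 0) / \<eta>^2"
   by (intro tendsto_intros LIMSEQ_power_zero) (use \<eta> in auto)
  then have "\<forall>\<^sub>F j in sequentially. k2 * (2 * (1/2)^j) / \<eta>^2 < \<eta>"
   by (rule order_tendstoD(2)) (use \<eta> in simp)
  then obtain j0 where j0: "\<And>j. j \<ge> j0 \<Longrightarrow> k2 * (2 * (1/2)^j) / \<eta>^2 < \<eta>" unfolding eventually_sequentially by blast
  \<comment> \<open>An even index beyond all thresholds. The integral of number \<open>N j\<close>
    is close to its part over A, which by the Cauchy property on A is close to that of number
    \<open>N (Suc j)\<close>, and this one is small; the three errors add up to 3 \<eta>.\<close>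
  define j where "j = 2 * (j0 + n0 + n1)"
  have j: "even j" "odd (Suc j)" "j \<ge> j0" "j \<ge> n0" "j \<ge> n1" unfolding j_def by auto
  have p1: "prob {z \<in> space M. \<bar>X (N j) (- A) z\<bar> > \<eta>} < \<eta>"
  proof -
   have "prob {z \<in> space M. \<bar>X (N j) (- A) z\<bar> > \<eta>} \<le> k2 * q (N j) (- A) / \<eta>^2" by (rule XB) (use \<eta> in auto)
   also have "\<dots> \<le> k2 * (2 * (1/2)^j) / \<eta>^2" using qe[OF j(1)] k2_nonneg by (intro divide_right_mono mult_left_mono) auto
   finally show ?thesis using j0[OF j(3)] by linarith
  qed
  have p2: "prob {z \<in> space M. \<bar>X (N (Suc j)) A z\<bar> > \<eta>} < \<eta>"
  proof -
   have "prob {z \<in> space M. \<bar>X (N (Suc j)) A z\<bar> > \<eta>} \<le> k2 * q (N (Suc j)) A / \<eta>^2" by (rule XB) (use \<eta> in auto)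
   also have "\<dots> \<le> k2 * (2 * (1/2)^(Suc j)) / \<eta>^2" using qo[OF j(2)] k2_nonneg by (intro divide_right_mono mult_left_mono) auto
   finally show ?thesis using j0[of "Suc j"] j(3) by linarith
  qed
  have p3: "prob {z \<in> space M. \<bar>X (N j) A z - X (N (Suc j)) A z\<bar> > \<eta>} < \<eta>"
   by (rule n1) (use j Nj[of j] Nj[of "Suc j"] in auto)
  have dec: "AE z in M. X n UNIV z = X n A z + X n (- A) z" for n
  proof -
   have cA: "- A \<in> sets borel" by measurable
   have "AE z in M. S (\<lambda>s. 1 * (h n s * indicator A s) + 1 * (h n s * indicator (- A) s)) z
     = 1 * S (\<lambda>s. h n s * indicator A s) z + 1 * S (\<lambda>s. h n s * indicator (- A) s) z"
    by (rule simple_integral_lincomb) (intro bounded_simple_mult_indicator h Am cA)+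
   moreover have "(\<lambda>s. 1 * (h n s * indicator A s) + 1 * (h n s * indicator (- A) s)) = h n" by (auto simp: indicator_def)
   ultimately have "AE z in M. S (h n) z = S (\<lambda>s. h n s * indicator A s) z + S (\<lambda>s. h n s * indicator (- A) s) z" by simp
   then show ?thesis using simple_integral_restrict[OF h Am, of n] simple_integral_restrict[OF h cA, of n]
    unfolding X_def by eventually_elim simp
  qed
  have "prob {z \<in> space M. \<bar>X (N j) A z\<bar> > 2 * \<eta>} \<le> prob {z \<in> space M. \<bar>X (N j) A z - X (N (Suc j)) A z\<bar> > \<eta>}
    + prob {z \<in> space M. \<bar>X (N (Suc j)) A z\<bar> > \<eta>}"
   by (rule prob_abs_sum_le) auto
  moreover have "prob {z \<in> space M. \<bar>X (N j) UNIV z\<bar> > 3 * \<eta>} \<le> prob {z \<in> space M. \<bar>X (N j) A z\<bar> > 2 * \<eta>}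
    + prob {z \<in> space M. \<bar>X (N j) (- A) z\<bar> > \<eta>}"
  proof (rule prob_abs_sum_le)
   show "AE z in M. \<bar>X (N j) UNIV z\<bar> \<le> \<bar>X (N j) A z\<bar> + \<bar>X (N j) (- A) z\<bar>"
    using dec[of "N j"] by eventually_elim simp
  qed auto
  ultimately have "prob {z \<in> space M. \<bar>X (N j) UNIV z\<bar> > 3 * \<eta>} < 3 * \<eta>" using p1 p2 p3 by linarith
  moreover have "n0 \<le> N j" using j(4) Nj[of j] by linarith
  ultimately show ?thesis by blast
 qed
 show ?thesis
 proof (rule LIMSEQ_I)
  fix r :: real assume r: "r > 0"
  \<comment> \<open>One small integral beyond the Cauchy threshold makes all later ones small:
    \<eta> is spent on the Cauchy step and 3 \<eta> on that integral.\<close>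
  define \<eta> where "\<eta> = min e r / 4"
  have \<eta>: "\<eta> > 0" "4 * \<eta> \<le> e" "4 * \<eta> \<le> r" unfolding \<eta>_def using e r by auto
  obtain n1 where n1: "\<And>m n. m \<ge> n1 \<Longrightarrow> n \<ge> n1 \<Longrightarrow> prob {z \<in> space M. \<bar>X m UNIV z - X n UNIV z\<bar> > \<eta>} < \<eta>"
   using C[of UNIV] \<eta>(1) unfolding prob_Cauchy_def X_def by (meson sets.top borel_open open_UNIV)
  obtain n where n: "n \<ge> n1" "prob {z \<in> space M. \<bar>X n UNIV z\<bar> > 3 * \<eta>} < 3 * \<eta>" using sparse[OF \<eta>(1)] by blast
  show "\<exists>n0. \<forall>m\<ge>n0. norm (prob {z \<in> space M. \<bar>S (h m) z\<bar> > e} - 0) < r"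
  proof (intro exI allI impI)
   fix m assume m: "n1 \<le> m"
   have "prob {z \<in> space M. \<bar>X m UNIV z\<bar> > e} \<le> prob {z \<in> space M. \<bar>X m UNIV z - X n UNIV z\<bar> > \<eta>} + prob {z \<in> space M. \<bar>X n UNIV z\<bar> > 3 * \<eta>}"
    by (rule prob_abs_sum_le) (use \<eta> in auto)
   also have "\<dots> < r" using n1[OF m n(1)] n(2) \<eta> by linarith
   finally show "norm (prob {z \<in> space M. \<bar>S (h m) z\<bar> > e} - 0) < r" unfolding X_def by simp
  qed
 qed
qed

end

section \<open>Extension of the integral to kernels in L2 and L4\<close>

lemma L24_simple_approximation:
 fixes f :: "real^'d \<Rightarrow> real"
 assumes f: "L24 lborel f"
 obtains \<phi> where "\<And>n::nat. bounded_simple (\<phi> n)" "\<And>s. (\<lambda>n. \<phi> n s) \<longlonglongrightarrow> f s"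
  "(\<lambda>n. \<integral>s. (\<phi> n s - f s)^2 \<partial>lborel) \<longlonglongrightarrow> 0" "(\<lambda>n. \<integral>s. (\<phi> n s - f s)^4 \<partial>lborel) \<longlonglongrightarrow> 0"
proof -
 have fm[measurable]: "f \<in> borel_measurable borel" using L24D(1)[OF f] by simp
 \<comment> \<open>The bound by 2 |f| makes the error at most 3 |f|, so that 3^p f^p dominates for
   both exponents at once.\<close>
 obtain F where F: "\<And>i::nat. simple_function borel (F i)" "\<And>x. (\<lambda>i. F i x) \<longlonglongrightarrow> f x"
  "\<And>i x. dist (F i x) 0 \<le> 2 * dist (f x) 0"
  using borel_measurable_implies_sequence_metric[OF fm, of 0] by auto
 define \<phi> where "\<phi> n s = F n s * indicator (cball 0 (real n)) s" for n s
 have simple: "bounded_simple (\<phi> n)" for n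
  unfolding bounded_simple_def
 proof
  show "simple_function borel (\<phi> n)"
   unfolding \<phi>_def[abs_def] by (intro simple_function_mult F simple_function_indicator) auto
  show "bounded {s. \<phi> n s \<noteq> 0}"
   by (rule bounded_subset[OF bounded_cball[of 0 "real n"]]) (auto simp: \<phi>_def indicator_def split: if_splits)
 qed
 note [measurable] = bounded_simpleD(1)[OF simple]
 have lim: "(\<lambda>n. \<phi> n s) \<longlonglongrightarrow> f s" for s
 proof -
  obtain k0 :: nat where k0: "norm s \<le> real k0" using real_arch_simple by blast
  have "\<forall>\<^sub>F n in sequentially. F n s = \<phi> n s"
   unfolding eventually_sequentially
  proof (intro exI allI impI)
   fix n assume "k0 \<le> n"
   then have "real k0 \<le> real n" by simp
   then have "norm s \<le> real n" using k0 by linarith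
   then show "F n s = \<phi> n s" unfolding \<phi>_def by simp
  qed
  with F(2) show ?thesis by (rule Lim_transform_eventually)
 qed
 have bd: "\<bar>\<phi> n s - f s\<bar> \<le> 3 * \<bar>f s\<bar>" for n s
 proof -
  have "\<bar>\<phi> n s\<bar> \<le> 2 * \<bar>f s\<bar>" using F(3)[of n s] unfolding \<phi>_def by (auto simp: indicator_def dist_real_def)
  then show ?thesis by linarith
 qed
 have conv: "(\<lambda>n. \<integral>s. (\<phi> n s - f s)^p \<partial>lborel) \<longlonglongrightarrow> 0" if p: "integrable lborel (\<lambda>s. (f s)^p)" "even p" "p > 0" for p
 proof -
  have "(\<lambda>n. \<integral>s. (\<phi> n s - f s)^p \<partial>lborel) \<longlonglongrightarrow> integral\<^sup>L lborel (\<lambda>s::real^'d. 0::real)"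
  proof (rule integral_dominated_convergence[where w="\<lambda>s. 3^p * (f s)^p"])
   show "AE s in lborel. (\<lambda>n. (\<phi> n s - f s)^p) \<longlonglongrightarrow> 0"
   proof (rule AE_I2)
    fix s
    have "(\<lambda>n. \<phi> n s - f s) \<longlonglongrightarrow> 0" using lim[of s] by (simp add: LIM_zero)
    from tendsto_power[OF this, of p] show "(\<lambda>n. (\<phi> n s - f s)^p) \<longlonglongrightarrow> 0" unfolding zero_power[OF p(3)] .
   qed
   show "AE s in lborel. norm ((\<phi> n s - f s)^p) \<le> 3^p * (f s)^p" for n
   proof (rule AE_I2)
    fix s
    have "\<bar>\<phi> n s - f s\<bar>^p \<le> (3 * \<bar>f s\<bar>)^p" using bd by (intro power_mono) auto
    also have "\<dots> = 3^p * (f s)^p" using p by (simp add: power_mult_distrib power_even_abs)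
    finally show "norm ((\<phi> n s - f s)^p) \<le> 3^p * (f s)^p" by (simp add: power_abs)
   qed
  qed (use p in auto)
  then show ?thesis by simp
 qed
 show ?thesis
  by (rule that[OF simple lim]) (use conv L24D[OF f] in auto)
qed

lemma integral_power_diff_le:
 fixes f g h :: "'a \<Rightarrow> real"
 assumes "L24 N f" "L24 N g" "L24 N h"
 shows "(\<integral>s. (f s - g s)^2 \<partial>N) \<le> 2 * (\<integral>s. (f s - h s)^2 \<partial>N) + 2 * (\<integral>s. (g s - h s)^2 \<partial>N)"
  and "(\<integral>s. (f s - g s)^4 \<partial>N) \<le> 8 * (\<integral>s. (f s - h s)^4 \<partial>N) + 8 * (\<integral>s. (g s - h s)^4 \<partial>N)"
proof -
 note i = L24D[OF L24_diff[OF assms(1,2)]] L24D[OF L24_diff[OF assms(1,3)]] L24D[OF L24_diff[OF assms(2,3)]]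
 have "(\<integral>s. (f s - g s)^2 \<partial>N) \<le> (\<integral>s. 2 * (f s - h s)^2 + 2 * (g s - h s)^2 \<partial>N)"
 proof (rule integral_mono)
  show "(f s - g s)^2 \<le> 2 * (f s - h s)^2 + 2 * (g s - h s)^2" for s
   using power2_sum_le[of "f s - h s" "h s - g s"] by (simp add: power2_commute)
 qed (use i in auto)
 then show "(\<integral>s. (f s - g s)^2 \<partial>N) \<le> 2 * (\<integral>s. (f s - h s)^2 \<partial>N) + 2 * (\<integral>s. (g s - h s)^2 \<partial>N)"
  using i by simp
 have "(\<integral>s. (f s - g s)^4 \<partial>N) \<le> (\<integral>s. 8 * (f s - h s)^4 + 8 * (g s - h s)^4 \<partial>N)"
 proof (rule integral_mono)
  have "(h s - g s)^4 = (g s - h s)^4" for s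
   using power_even_abs[of 4 "h s - g s"] power_even_abs[of 4 "g s - h s"] by (simp add: abs_minus_commute)
  then show "(f s - g s)^4 \<le> 8 * (f s - h s)^4 + 8 * (g s - h s)^4" for s
   using power4_sum_le[of "f s - h s" "h s - g s"] by simp
 qed (use i in auto)
 then show "(\<integral>s. (f s - g s)^4 \<partial>N) \<le> 8 * (\<integral>s. (f s - h s)^4 \<partial>N) + 8 * (\<integral>s. (g s - h s)^4 \<partial>N)"
  using i by simp
qed

lemma Lp_lincomb_conv:
 fixes u v :: "nat \<Rightarrow> 'x \<Rightarrow> real"
 assumes p: "p = 2 \<or> p = 4"
  and L: "\<And>n. L24 N (u n)" "L24 N u'" "\<And>n. L24 N (v n)" "L24 N v'"
  and conv: "(\<lambda>n. \<integral>s. (u n s - u' s)^p \<partial>N) \<longlonglongrightarrow> 0" "(\<lambda>n. \<integral>s. (v n s - v' s)^p \<partial>N) \<longlonglongrightarrow> 0"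
 shows "(\<lambda>n. \<integral>s. ((a * u n s + b * v n s) - (a * u' s + b * v' s))^p \<partial>N) \<longlonglongrightarrow> 0"
proof (rule tendsto_sandwich[OF always_eventually always_eventually tendsto_const])
 \<comment> \<open>The constant 8 is that of the fourth power inequality and also covers p =
   2.\<close>
 define K where "K c = 8 * c^p" for c :: real
 have i: "integrable N (\<lambda>s. f s ^ p)" if "L24 N f" for f using p L24D(2,3)[OF that] by auto
 have pw: "(a * x + b * y)^p \<le> K a * x^p + K b * y^p" for x y :: real
 proof -
  have "(a * x + b * y)^2 \<le> 8 * (a * x)^2 + 8 * (b * y)^2"
   using power2_sum_le[of "a * x" "b * y"] zero_le_power2[of "a * x"] zero_le_power2[of "b * y"] by linarith
  then show ?thesis
   using p power4_sum_le[of "a * x" "b * y"] unfolding K_def by (auto simp: power_mult_distrib mult.assoc)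
 qed
 have eq: "a * u n s + b * v n s - (a * u' s + b * v' s) = a * (u n s - u' s) + b * (v n s - v' s)" for n s
  by (simp add: algebra_simps)
 note j = i[OF L24_diff[OF L(1) L(2)]] i[OF L24_diff[OF L(3) L(4)]]
 have "(\<integral>s. (a * (u n s - u' s) + b * (v n s - v' s))^p \<partial>N) \<le> (\<integral>s. K a * (u n s - u' s)^p + K b * (v n s - v' s)^p \<partial>N)" for n
  by (rule integral_mono) (use j in \<open>auto intro!: pw i L24_add L24_cmult L24_diff L\<close>)
 then show "\<forall>n. (\<integral>s. (a * u n s + b * v n s - (a * u' s + b * v' s))^p \<partial>N)
   \<le> K a * (\<integral>s. (u n s - u' s)^p \<partial>N) + K b * (\<integral>s. (v n s - v' s)^p \<partial>N)"
  unfolding eq using j by simp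
 show "(\<lambda>n. K a * (\<integral>s. (u n s - u' s)^p \<partial>N) + K b * (\<integral>s. (v n s - v' s)^p \<partial>N)) \<longlonglongrightarrow> 0"
  using tendsto_add[OF tendsto_mult[OF tendsto_const conv(1)] tendsto_mult[OF tendsto_const conv(2)]] by simp
 show "\<forall>n. 0 \<le> (\<integral>s. (a * u n s + b * v n s - (a * u' s + b * v' s))^p \<partial>N)"
  using p by auto
qed

context centered_levy_basis
begin

text \<open>The closure of the simple integral as an operator from L2 and L4 of Lebesgue measure
  into L4 of the probability space. Moments pass to such limits and linear combinations preserve
  them. X is determined only up to null sets, see \<open>has_int_cong_AE\<close>.\<close>

definition has_int :: "(real^'d \<Rightarrow> real) \<Rightarrow> ('w \<Rightarrow> real) \<Rightarrow> bool" where
 "has_int f X \<longleftrightarrow> L24 lborel f \<and> L24 M X \<and> (\<exists>\<phi>. (\<forall>n::nat. bounded_simple (\<phi> n)) \<and>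
   (\<lambda>n. \<integral>s. (\<phi> n s - f s)^2 \<partial>lborel) \<longlonglongrightarrow> 0 \<and> (\<lambda>n. \<integral>s. (\<phi> n s - f s)^4 \<partial>lborel) \<longlonglongrightarrow> 0 \<and>
   (\<lambda>n. expectation (\<lambda>w. (S (\<phi> n) w - X w)^4)) \<longlonglongrightarrow> 0)"

lemma simple_integral_diff_moments:
 assumes "bounded_simple f" "bounded_simple g"
 shows "expectation (\<lambda>w. (S f w - S g w)^2) = k2 * (LBINT s. (f s - g s)^2)"
  and "expectation (\<lambda>w. (S f w - S g w)^4) = c4 * (LBINT s. (f s - g s)^4) + 3 * k2^2 * (LBINT s. (f s - g s)^2)^2"
proof -
 have fg: "bounded_simple (\<lambda>s. f s - g s)" using bounded_simple_lincomb[OF assms, of 1 "-1"] by simp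
 have ae: "AE w in M. S (\<lambda>s. f s - g s) w = S f w - S g w" using simple_integral_lincomb[OF assms, of 1 "-1"] by simp
 note [measurable] = L24D(1)[OF simple_integral_L24[OF fg]] L24D(1)[OF simple_integral_L24[OF assms(1)]] L24D(1)[OF simple_integral_L24[OF assms(2)]]
 have "expectation (\<lambda>w. (S f w - S g w)^n) = expectation (\<lambda>w. (S (\<lambda>s. f s - g s) w)^n)" for n
  by (rule integral_cong_AE) (use ae in auto)
 then show "expectation (\<lambda>w. (S f w - S g w)^2) = k2 * (LBINT s. (f s - g s)^2)"
  and "expectation (\<lambda>w. (S f w - S g w)^4) = c4 * (LBINT s. (f s - g s)^4) + 3 * k2^2 * (LBINT s. (f s - g s)^2)^2"
  using simple_integral_moments[OF fg] by simp_all
qed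

text \<open>The simple functions \<open>fs\<close> supplied by the definition come without moment
  control, so they are compared with an approximation \<open>\<phi>\<close> in L2 and L4. The
  differences \<open>h\<close> tend to 0 almost everywhere and have Cauchy integrals over every
  Borel set, hence their integrals vanish in the limit by the gliding hump. So the integrals of
  \<open>\<phi>\<close> also converge to X in probability, and their L4 bounds pass to X.\<close>

lemma stoch_integral_has_int:
 assumes X: "has_stoch_integral \<Lambda> f X" and f: "L24 lborel f"
 shows "has_int f X"
proof -
 obtain fs where fs: "\<And>n. bounded_simple (fs n)" "AE s in lborel. (\<lambda>n. fs n s) \<longlonglongrightarrow> f s"
  "\<And>A. A \<in> sets borel \<Longrightarrow> \<exists>Z. conv_in_prob (\<lambda>n. simple_stoch_integral \<Lambda> A (fs n)) Z"
  "conv_in_prob (\<lambda>n. S (fs n)) X"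
  using X unfolding has_stoch_integral_def by blast
 obtain \<phi> where \<phi>: "\<And>n. bounded_simple (\<phi> n)" "\<And>s. (\<lambda>n. \<phi> n s) \<longlonglongrightarrow> f s"
  "(\<lambda>n. \<integral>s. (\<phi> n s - f s)^2 \<partial>lborel) \<longlonglongrightarrow> 0" "(\<lambda>n. \<integral>s. (\<phi> n s - f s)^4 \<partial>lborel) \<longlonglongrightarrow> 0"
  using L24_simple_approximation[OF f] by blast
 have Xm[measurable]: "random_variable borel X" using fs(4) unfolding conv_in_prob_def by blast
 note L\<phi> = bounded_simple_L24[OF \<phi>(1)]
 note LS = simple_integral_L24[OF \<phi>(1)]
 note [measurable] = L24D(1)[OF LS] L24D(1)[OF simple_integral_L24[OF fs(1)]]
 define h where "h n s = fs n s - \<phi> n s" for n s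
 have h: "bounded_simple (h n)" for n using bounded_simple_lincomb[OF fs(1) \<phi>(1), of 1 n "-1" n] unfolding h_def by simp
 have cauchy2: "\<exists>n0. \<forall>m\<ge>n0. \<forall>n\<ge>n0. (LBINT s. (\<phi> m s - \<phi> n s)^2) < d" if e: "d > 0" for d
 proof -
  have "\<forall>\<^sub>F n in sequentially. (LBINT s. (\<phi> n s - f s)^2) < d / 4" by (rule order_tendstoD(2)[OF \<phi>(3)]) (use e in simp)
  then obtain n0 where n0: "\<And>n. n \<ge> n0 \<Longrightarrow> (LBINT s. (\<phi> n s - f s)^2) < d / 4" unfolding eventually_sequentially by blast
  show ?thesis
  proof (intro exI allI impI)
   fix m n assume "n0 \<le> m" "n0 \<le> n"
   then show "(LBINT s. (\<phi> m s - \<phi> n s)^2) < d"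
    using integral_power_diff_le(1)[OF L\<phi> L\<phi> f, of m n] n0[of m] n0[of n] by linarith
  qed
 qed
 have cauchy4: "\<exists>n0. \<forall>m\<ge>n0. \<forall>n\<ge>n0. (LBINT s. (\<phi> m s - \<phi> n s)^4) < d" if e: "d > 0" for d
 proof -
  have "\<forall>\<^sub>F n in sequentially. (LBINT s. (\<phi> n s - f s)^4) < d / 16" by (rule order_tendstoD(2)[OF \<phi>(4)]) (use e in simp)
  then obtain n0 where n0: "\<And>n. n \<ge> n0 \<Longrightarrow> (LBINT s. (\<phi> n s - f s)^4) < d / 16" unfolding eventually_sequentially by blast
  show ?thesis
  proof (intro exI allI impI)
   fix m n assume "n0 \<le> m" "n0 \<le> n"
   then show "(LBINT s. (\<phi> m s - \<phi> n s)^4) < d"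
    using integral_power_diff_le(2)[OF L\<phi> L\<phi> f, of m n] n0[of m] n0[of n] by linarith
  qed
 qed
 have C\<phi>: "prob_Cauchy (\<lambda>n. S (\<lambda>s. \<phi> n s * indicator A s))" if A: "A \<in> sets borel" for A
 proof (rule L2_Cauchy_imp_prob_Cauchy)
  note \<phi>A = bounded_simple_mult_indicator[OF \<phi>(1) A]
  show "L24 M (S (\<lambda>s. \<phi> n s * indicator A s))" for n by (rule simple_integral_L24[OF \<phi>A])
  fix d :: real assume e: "d > 0"
  obtain n0 where n0: "\<And>m n. n0 \<le> m \<Longrightarrow> n0 \<le> n \<Longrightarrow> (LBINT s. (\<phi> m s - \<phi> n s)^2) < d / (k2 + 1)"
   using cauchy2[of "d / (k2 + 1)"] e k2_nonneg by auto
  show "\<exists>n0. \<forall>m\<ge>n0. \<forall>n\<ge>n0. expectation (\<lambda>w. (S (\<lambda>s. \<phi> m s * indicator A s) w - S (\<lambda>s. \<phi> n s * indicator A s) w)^2) < d"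
  proof (intro exI allI impI)
   fix m n assume mn: "n0 \<le> m" "n0 \<le> n"
   have "(LBINT s. (\<phi> m s * indicator A s - \<phi> n s * indicator A s)^2) \<le> (LBINT s. (\<phi> m s - \<phi> n s)^2)"
    by (rule integral_mono)
     (use L24D(2)[OF L24_diff[OF bounded_simple_L24[OF \<phi>A] bounded_simple_L24[OF \<phi>A]]] L24D(2)[OF L24_diff[OF L\<phi> L\<phi>]] in \<open>auto simp: indicator_def\<close>)
   also have "\<dots> \<le> d / (k2 + 1)" using n0[OF mn] by simp
   finally have "k2 * (LBINT s. (\<phi> m s * indicator A s - \<phi> n s * indicator A s)^2) \<le> k2 * (d / (k2 + 1))"
    using k2_nonneg by (rule mult_left_mono)
   also have "\<dots> < d" using e k2_nonneg by (simp add: field_simps)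
   finally show "expectation (\<lambda>w. (S (\<lambda>s. \<phi> m s * indicator A s) w - S (\<lambda>s. \<phi> n s * indicator A s) w)^2) < d"
    unfolding simple_integral_diff_moments[OF \<phi>A \<phi>A] .
  qed
 qed
 have hC: "prob_Cauchy (\<lambda>n. simple_stoch_integral \<Lambda> A (h n))" if A: "A \<in> sets borel" for A
 proof (rule prob_Cauchy_diff_AE[OF _ C\<phi>[OF A]])
  show "prob_Cauchy (\<lambda>n. simple_stoch_integral \<Lambda> A (fs n))" using fs(3)[OF A] conv_in_prob_imp_Cauchy by blast
  show "random_variable borel (simple_stoch_integral \<Lambda> A (fs n))" for n by (rule simple_integral_restrict_measurable[OF fs(1) A])
  show "random_variable borel (simple_stoch_integral \<Lambda> A (h n))" for n by (rule simple_integral_restrict_measurable[OF h A])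
  show "random_variable borel (S (\<lambda>s. \<phi> n s * indicator A s))" for n
   by (rule L24D(1)[OF simple_integral_L24[OF bounded_simple_mult_indicator[OF \<phi>(1) A]]])
  show "AE w in M. simple_stoch_integral \<Lambda> A (h n) w = simple_stoch_integral \<Lambda> A (fs n) w - S (\<lambda>s. \<phi> n s * indicator A s) w" for n
  proof -
   have "AE w in M. S (\<lambda>s. 1 * (fs n s * indicator A s) + (- 1) * (\<phi> n s * indicator A s)) w
     = 1 * S (\<lambda>s. fs n s * indicator A s) w + (- 1) * S (\<lambda>s. \<phi> n s * indicator A s) w"
    by (rule simple_integral_lincomb) (intro bounded_simple_mult_indicator fs \<phi> A)+
   moreover have "(\<lambda>s. 1 * (fs n s * indicator A s) + (- 1) * (\<phi> n s * indicator A s)) = (\<lambda>s. h n s * indicator A s)"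
    unfolding h_def by (auto simp: algebra_simps)
   ultimately have "AE w in M. S (\<lambda>s. h n s * indicator A s) w = S (\<lambda>s. fs n s * indicator A s) w - S (\<lambda>s. \<phi> n s * indicator A s) w"
    by simp
   then show ?thesis
    using simple_integral_restrict[OF h A, of n] simple_integral_restrict[OF fs(1) A, of n]
    by eventually_elim simp
  qed
 qed
 have h0: "AE s in lborel. (\<lambda>n. h n s) \<longlonglongrightarrow> 0"
  using fs(2)
 proof eventually_elim
  case (elim s)
  show ?case using tendsto_diff[OF elim \<phi>(2)[of s]] unfolding h_def by simp
 qed
 have lim: "(\<lambda>n. prob {w \<in> space M. \<bar>S (\<phi> n) w - X w\<bar> > d}) \<longlonglongrightarrow> 0" if e: "d > 0" for d
 proof (rule tendsto_sandwich[OF always_eventually always_eventually tendsto_const])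
  have "(\<lambda>n. prob {w \<in> space M. \<bar>S (fs n) w - X w\<bar> > d/2}) \<longlonglongrightarrow> 0"
  proof -
   have "\<forall>d>0. (\<lambda>n. prob {w \<in> space M. \<bar>S (fs n) w - X w\<bar> > d}) \<longlonglongrightarrow> 0"
    using fs(4) unfolding conv_in_prob_def by blast
   from this[rule_format, of "d/2"] e show ?thesis by linarith
  qed
  moreover have "(\<lambda>n. prob {w \<in> space M. \<bar>S (h n) w\<bar> > d/2}) \<longlonglongrightarrow> 0"
   by (rule simple_integral_gliding_hump[OF h h0 hC]) (use e in auto)
  ultimately have "(\<lambda>n. prob {w \<in> space M. \<bar>S (fs n) w - X w\<bar> > d/2} + prob {w \<in> space M. \<bar>S (h n) w\<bar> > d/2}) \<longlonglongrightarrow> 0 + 0"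
   by (rule tendsto_add)
  then show "(\<lambda>n. prob {w \<in> space M. \<bar>S (fs n) w - X w\<bar> > d/2} + prob {w \<in> space M. \<bar>S (h n) w\<bar> > d/2}) \<longlonglongrightarrow> 0" by simp
  show "\<forall>n. prob {w \<in> space M. \<bar>S (\<phi> n) w - X w\<bar> > d} \<le> prob {w \<in> space M. \<bar>S (fs n) w - X w\<bar> > d/2} + prob {w \<in> space M. \<bar>S (h n) w\<bar> > d/2}"
  proof
   fix n
   have hm[measurable]: "random_variable borel (S (h n))" by (rule L24D(1)[OF simple_integral_L24[OF h]])
   have "AE w in M. S (h n) w = S (fs n) w - S (\<phi> n) w"
    using simple_integral_lincomb[OF fs(1) \<phi>(1), of 1 n "-1" n] unfolding h_def by simp
   then have ae: "AE w in M. \<bar>S (\<phi> n) w - X w\<bar> \<le> \<bar>S (fs n) w - X w\<bar> + \<bar>S (h n) w\<bar>"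
    by eventually_elim simp
   show "prob {w \<in> space M. \<bar>S (\<phi> n) w - X w\<bar> > d} \<le> prob {w \<in> space M. \<bar>S (fs n) w - X w\<bar> > d/2} + prob {w \<in> space M. \<bar>S (h n) w\<bar> > d/2}"
    by (rule prob_abs_sum_le[OF _ _ _ ae]) auto
  qed
 qed auto
 have main: "\<exists>n0. \<forall>n\<ge>n0. integrable M (\<lambda>w. (X w - S (\<phi> n) w)^4) \<and> expectation (\<lambda>w. (X w - S (\<phi> n) w)^4) \<le> 8 * d" if e: "d > 0" for d
 proof -
  \<comment> \<open>The fourth moment of a difference is c4 I4 + 3 k2^2 I2^2, with I2 and I4 the
    integrals of its square and fourth power; a and b make each summand at most d / 2. The bound b
    \<le> 1 allows I2^2 to be replaced by I2.\<close>
  define a where "a = d / (2 * (\<bar>c4\<bar> + 1))"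
  define b where "b = min 1 (d / (2 * (3 * k2^2 + 1)))"
  have c1: "\<bar>c4\<bar> + 1 > 0" and k1: "3 * k2^2 + 1 > 0" by (simp_all add: add_nonneg_pos)
  have a: "a > 0" unfolding a_def using e c1 by simp
  have b: "b > 0" unfolding b_def using e k1 by simp
  obtain n0 where n0: "\<And>m n. n0 \<le> m \<Longrightarrow> n0 \<le> n \<Longrightarrow> (LBINT s. (\<phi> m s - \<phi> n s)^4) < a" using cauchy4[OF a] by blast
  obtain n1 where n1: "\<And>m n. n1 \<le> m \<Longrightarrow> n1 \<le> n \<Longrightarrow> (LBINT s. (\<phi> m s - \<phi> n s)^2) < b" using cauchy2[OF b] by blast
  have E: "expectation (\<lambda>w. (S (\<phi> m) w - S (\<phi> n) w)^4) \<le> d" if "max n0 n1 \<le> m" "max n0 n1 \<le> n" for m n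
  proof -
   let ?I4 = "\<integral>s. (\<phi> m s - \<phi> n s)^4 \<partial>lborel" and ?I2 = "\<integral>s. (\<phi> m s - \<phi> n s)^2 \<partial>lborel"
   have I: "0 \<le> ?I4" "?I4 \<le> a" "0 \<le> ?I2" "?I2 \<le> b" using n0[of m n] n1[of m n] that by auto
   have "c4 * ?I4 \<le> \<bar>c4\<bar> * ?I4" using I by (intro mult_right_mono) auto
   also have "\<dots> \<le> (\<bar>c4\<bar> + 1) * a" using I by (intro mult_mono) auto
   also have "\<dots> = d / 2" unfolding a_def using c1 by (simp add: field_simps)
   finally have 1: "c4 * ?I4 \<le> d / 2" .
   have "?I2 * ?I2 \<le> ?I2 * 1" by (rule mult_left_mono) (use I in \<open>auto simp: b_def\<close>)
   then have "?I2^2 \<le> ?I2" by (simp only: power2_eq_square[of ?I2] mult_1_right)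
   then have "3 * k2^2 * ?I2^2 \<le> (3 * k2^2 + 1) * (d / (2 * (3 * k2^2 + 1)))"
    using I k1 e by (intro mult_mono) (auto simp: b_def)
   also have "\<dots> = d / 2" using k1 by (simp add: field_simps)
   finally show ?thesis unfolding simple_integral_diff_moments[OF \<phi>(1) \<phi>(1)] using 1 by linarith
  qed
  show ?thesis
  proof (rule exI[of _ "max n0 n1"], intro allI impI conjI)
   fix n assume n: "max n0 n1 \<le> n"
   show "integrable M (\<lambda>w. (X w - S (\<phi> n) w)^4)"
    by (rule L4_bound_limit_in_prob(1)[OF LS Xm lim LS, of "max n0 n1" n d]) (use E n in auto)
   show "expectation (\<lambda>w. (X w - S (\<phi> n) w)^4) \<le> 8 * d"
    by (rule L4_bound_limit_in_prob(2)[OF LS Xm lim LS, of "max n0 n1" n d]) (use E n in auto)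
  qed
 qed
 have LX: "L24 M X"
 proof -
  obtain n0 where "integrable M (\<lambda>w. (X w - S (\<phi> n0) w)^4)" using main[of 1] by auto
  then have "L24 M (\<lambda>w. X w - S (\<phi> n0) w)" by (intro integrable_power4_imp_L24) auto
  from L24_add[OF this LS[of n0]] show ?thesis by simp
 qed
 have "(\<lambda>n. expectation (\<lambda>w. (S (\<phi> n) w - X w)^4)) \<longlonglongrightarrow> 0"
 proof (rule LIMSEQ_I)
  fix r :: real assume "r > 0"
  then obtain n0 where n0: "\<And>n. n \<ge> n0 \<Longrightarrow> expectation (\<lambda>w. (X w - S (\<phi> n) w)^4) \<le> 8 * (r / 16)"
   using main[of "r/16"] by auto
  have flip: "(S (\<phi> n) w - X w)^4 = (X w - S (\<phi> n) w)^4" for n w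
   using power_even_abs[of 4 "S (\<phi> n) w - X w"] power_even_abs[of 4 "X w - S (\<phi> n) w"] by (simp add: abs_minus_commute)
  show "\<exists>n0. \<forall>n\<ge>n0. norm (expectation (\<lambda>w. (S (\<phi> n) w - X w)^4) - 0) < r"
   unfolding flip
  proof (intro exI allI impI)
   fix n assume "n0 \<le> n"
   then have "expectation (\<lambda>w. (X w - S (\<phi> n) w)^4) < r" using n0[of n] \<open>r > 0\<close> by linarith
   then show "norm (expectation (\<lambda>w. (X w - S (\<phi> n) w)^4) - 0) < r" by simp
  qed
 qed
 then show ?thesis unfolding has_int_def using f LX \<phi> by blast
qed

lemma has_intD: assumes "has_int f X" shows "L24 lborel f" "L24 M X"
 using assms unfolding has_int_def by auto

lemma bounded_simple_has_int:
 assumes "bounded_simple f" shows "has_int f (S f)"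
 unfolding has_int_def
 by (intro conjI exI[of _ "\<lambda>_. f"]) (use assms bounded_simple_L24 simple_integral_L24 in auto)

lemma has_int_lincomb:
 assumes f: "has_int f X" and g: "has_int g Z"
 shows "has_int (\<lambda>s. a * f s + b * g s) (\<lambda>w. a * X w + b * Z w)"
proof -
 obtain \<phi> where \<phi>: "\<And>n::nat. bounded_simple (\<phi> n)"
  "(\<lambda>n. \<integral>s. (\<phi> n s - f s)^2 \<partial>lborel) \<longlonglongrightarrow> 0" "(\<lambda>n. \<integral>s. (\<phi> n s - f s)^4 \<partial>lborel) \<longlonglongrightarrow> 0"
  "(\<lambda>n. expectation (\<lambda>w. (S (\<phi> n) w - X w)^4)) \<longlonglongrightarrow> 0"
  using f unfolding has_int_def by blast
 obtain \<psi> where \<psi>: "\<And>n::nat. bounded_simple (\<psi> n)"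
  "(\<lambda>n. \<integral>s. (\<psi> n s - g s)^2 \<partial>lborel) \<longlonglongrightarrow> 0" "(\<lambda>n. \<integral>s. (\<psi> n s - g s)^4 \<partial>lborel) \<longlonglongrightarrow> 0"
  "(\<lambda>n. expectation (\<lambda>w. (S (\<psi> n) w - Z w)^4)) \<longlonglongrightarrow> 0"
  using g unfolding has_int_def by blast
 note L = has_intD[OF f] has_intD[OF g]
 define \<xi> where "\<xi> n s = a * \<phi> n s + b * \<psi> n s" for n s
 have \<xi>: "bounded_simple (\<xi> n)" for n unfolding \<xi>_def by (rule bounded_simple_lincomb[OF \<phi>(1) \<psi>(1)])
 have Lf: "L24 lborel (\<lambda>s. a * f s + b * g s)" and LX: "L24 M (\<lambda>w. a * X w + b * Z w)"
  by (intro L24_add L24_cmult L)+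
 note B = bounded_simple_L24[OF \<phi>(1)] bounded_simple_L24[OF \<psi>(1)]
 note SL = simple_integral_L24[OF \<phi>(1)] simple_integral_L24[OF \<psi>(1)] simple_integral_L24[OF \<xi>]
 note [measurable] = L24D(1)[OF SL(1)] L24D(1)[OF SL(2)] L24D(1)[OF SL(3)] L24D(1)[OF L(2)] L24D(1)[OF L(4)]
 have "expectation (\<lambda>w. (S (\<xi> n) w - (a * X w + b * Z w))^4) = expectation (\<lambda>w. ((a * S (\<phi> n) w + b * S (\<psi> n) w) - (a * X w + b * Z w))^4)" for n
 proof (rule integral_cong_AE)
  show "AE w in M. (S (\<xi> n) w - (a * X w + b * Z w))^4 = ((a * S (\<phi> n) w + b * S (\<psi> n) w) - (a * X w + b * Z w))^4"
   using simple_integral_lincomb[OF \<phi>(1) \<psi>(1), of a n b n] unfolding \<xi>_def by eventually_elim simp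
 qed measurable
 then have E: "(\<lambda>n. expectation (\<lambda>w. (S (\<xi> n) w - (a * X w + b * Z w))^4)) \<longlonglongrightarrow> 0"
  using Lp_lincomb_conv[OF disjI2[OF refl] SL(1) L(2) SL(2) L(4) \<phi>(4) \<psi>(4)] by simp
 show ?thesis
  unfolding has_int_def
 proof (intro conjI exI[of _ \<xi>] allI)
  show "(\<lambda>n. \<integral>s. (\<xi> n s - (a * f s + b * g s))^2 \<partial>lborel) \<longlonglongrightarrow> 0"
   unfolding \<xi>_def by (rule Lp_lincomb_conv[OF disjI1[OF refl] B(1) L(1) B(2) L(3) \<phi>(2) \<psi>(2)])
  show "(\<lambda>n. \<integral>s. (\<xi> n s - (a * f s + b * g s))^4 \<partial>lborel) \<longlonglongrightarrow> 0"
   unfolding \<xi>_def by (rule Lp_lincomb_conv[OF disjI2[OF refl] B(1) L(1) B(2) L(3) \<phi>(3) \<psi>(3)])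
 qed (rule Lf LX \<xi> E)+
qed

lemma has_int_zero: "has_int (\<lambda>s. 0) (\<lambda>w. 0)"
proof -
 have "bounded_simple (\<lambda>s::real^'d. \<Sum>i\<in>{}. 0 * indicator {} s :: real)"
  by (rule bounded_simple_step) auto
 then have *: "has_int (\<lambda>s. 0) (S (\<lambda>s. 0))" using bounded_simple_has_int by simp
 from has_int_lincomb[OF this this, of 0 0] show ?thesis by simp
qed

lemma has_int_cmult: "has_int f X \<Longrightarrow> has_int (\<lambda>s. a * f s) (\<lambda>w. a * X w)"
 using has_int_lincomb[OF _ has_int_zero, of f X a 0] by simp

lemma has_int_add: "has_int f X \<Longrightarrow> has_int g Z \<Longrightarrow> has_int (\<lambda>s. f s + g s) (\<lambda>w. X w + Z w)"
 using has_int_lincomb[of f X g Z 1 1] by simp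

lemma has_int_diff: "has_int f X \<Longrightarrow> has_int g Z \<Longrightarrow> has_int (\<lambda>s. f s - g s) (\<lambda>w. X w - Z w)"
 using has_int_lincomb[of f X g Z 1 "-1"] by simp

lemma has_int_power_moments:
 assumes "has_int f X"
 shows "expectation X = 0"
  and "expectation (\<lambda>w. (X w)^2) = k2 * (LBINT s. (f s)^2)"
  and "expectation (\<lambda>w. (X w)^4) = c4 * (LBINT s. (f s)^4) + 3 * k2^2 * (LBINT s. (f s)^2)^2"
proof -
 obtain \<phi> where \<phi>: "\<And>n::nat. bounded_simple (\<phi> n)"
  "(\<lambda>n. \<integral>s. (\<phi> n s - f s)^2 \<partial>lborel) \<longlonglongrightarrow> 0" "(\<lambda>n. \<integral>s. (\<phi> n s - f s)^4 \<partial>lborel) \<longlonglongrightarrow> 0"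
  "(\<lambda>n. expectation (\<lambda>w. (S (\<phi> n) w - X w)^4)) \<longlonglongrightarrow> 0"
  using assms unfolding has_int_def by blast
 note L = has_intD[OF assms]
 note B = bounded_simple_L24[OF \<phi>(1)] and SL = simple_integral_L24[OF \<phi>(1)]
 note D = L24_diff[OF SL L(2)]
 have E2: "(\<lambda>n. expectation (\<lambda>w. (S (\<phi> n) w - X w)^2)) \<longlonglongrightarrow> 0"
 proof (rule tendsto_sandwich[OF always_eventually always_eventually tendsto_const])
  show "(\<lambda>n. sqrt (expectation (\<lambda>w. (S (\<phi> n) w - X w)^4))) \<longlonglongrightarrow> 0"
   using tendsto_real_sqrt[OF \<phi>(4)] by simp
 qed (use expectation_sq_le_power4[OF D] in auto)
 have "(\<lambda>n. expectation (\<lambda>w. S (\<phi> n) w - X w)) \<longlonglongrightarrow> 0"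
 proof (rule Lim_null_comparison)
  show "(\<lambda>n. sqrt (expectation (\<lambda>w. (S (\<phi> n) w - X w)^2))) \<longlonglongrightarrow> 0"
   using tendsto_real_sqrt[OF E2] by simp
  show "\<forall>\<^sub>F n in sequentially. norm (expectation (\<lambda>w. S (\<phi> n) w - X w)) \<le> sqrt (expectation (\<lambda>w. (S (\<phi> n) w - X w)^2))"
   unfolding real_norm_def
   by (intro always_eventually allI order_trans[OF integral_abs_bound] expectation_le_sqrt L24D[OF D])
 qed
 moreover have "expectation (\<lambda>w. S (\<phi> n) w - X w) = - expectation X" for n
  using L24_integrable[OF SL[of n]] L24_integrable[OF L(2)] simple_integral_moments(1)[OF \<phi>(1)[of n]] by simp
 ultimately have "(\<lambda>n::nat. - expectation X) \<longlonglongrightarrow> 0" by simp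
 then show "expectation X = 0" using LIMSEQ_unique[OF tendsto_const] by fastforce
 have 2: "(\<lambda>n. \<integral>s. (\<phi> n s)^2 \<partial>lborel) \<longlonglongrightarrow> (LBINT s. (f s)^2)"
  by (rule L2_conv_integral_sq[OF L24D(1)[OF B] L24D(1)[OF L(1)] L24D(2)[OF B] L24D(2)[OF L(1)] \<phi>(2)])
 have 4: "(\<lambda>n. \<integral>s. (\<phi> n s)^4 \<partial>lborel) \<longlonglongrightarrow> (LBINT s. (f s)^4)"
  by (rule L4_conv_integral[OF B L(1) \<phi>(3)])
 have "(\<lambda>n. expectation (\<lambda>w. (S (\<phi> n) w)^2)) \<longlonglongrightarrow> expectation (\<lambda>w. (X w)^2)"
  by (rule L2_conv_integral_sq[OF L24D(1)[OF SL] L24D(1)[OF L(2)] L24D(2)[OF SL] L24D(2)[OF L(2)] E2])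
 then show "expectation (\<lambda>w. (X w)^2) = k2 * (LBINT s. (f s)^2)"
  unfolding simple_integral_moments(2)[OF \<phi>(1)] using LIMSEQ_unique tendsto_mult[OF tendsto_const 2] by blast
 have "(\<lambda>n. expectation (\<lambda>w. (S (\<phi> n) w)^4)) \<longlonglongrightarrow> expectation (\<lambda>w. (X w)^4)"
  by (rule L4_conv_integral[OF SL L(2) \<phi>(4)])
 moreover have "(\<lambda>n. c4 * (LBINT s. (\<phi> n s)^4) + 3 * k2^2 * (LBINT s. (\<phi> n s)^2)^2) \<longlonglongrightarrow> c4 * (LBINT s. (f s)^4) + 3 * k2^2 * (LBINT s. (f s)^2)^2"
  by (intro tendsto_intros 2 4)
 ultimately show "expectation (\<lambda>w. (X w)^4) = c4 * (LBINT s. (f s)^4) + 3 * k2^2 * (LBINT s. (f s)^2)^2"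
  unfolding simple_integral_moments(3)[OF \<phi>(1)] using LIMSEQ_unique by blast
qed

lemma has_int_mult2:
 assumes f: "has_int f X" and g: "has_int g Z"
 shows "expectation (\<lambda>w. X w * Z w) = k2 * (LBINT s. f s * g s)"
proof -
 have pol: "u * v = ((u + v)^2 - (u - v)^2) / 4" for u v :: real by (simp add: power2_eq_square algebra_simps)
 note a = has_int_add[OF f g] and d = has_int_diff[OF f g]
 have "expectation (\<lambda>w. X w * Z w) = (expectation (\<lambda>w. (X w + Z w)^2) - expectation (\<lambda>w. (X w - Z w)^2)) / 4"
  unfolding pol using L24D(2)[OF has_intD(2)[OF a]] L24D(2)[OF has_intD(2)[OF d]] by simp
 also have "\<dots> = k2 * (((LBINT s. (f s + g s)^2) - (LBINT s. (f s - g s)^2)) / 4)"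
  unfolding has_int_power_moments(2)[OF a] has_int_power_moments(2)[OF d] by (simp add: right_diff_distrib)
 also have "((LBINT s. (f s + g s)^2) - (LBINT s. (f s - g s)^2)) / 4 = (LBINT s. f s * g s)"
  unfolding pol using L24D(2)[OF has_intD(1)[OF a]] L24D(2)[OF has_intD(1)[OF d]] by simp
 finally show ?thesis .
qed

text \<open>The joint fourth cumulant plus the three Gaussian pairings. Polarization reduces the
  mixed moment to fourth powers of signed sums, whose moments are known.\<close>

lemma has_int_mult4:
 assumes f: "has_int f1 X1" "has_int f2 X2" "has_int f3 X3" "has_int f4 X4"
 shows "expectation (\<lambda>w. X1 w * X2 w * X3 w * X4 w) = c4 * (LBINT s. f1 s * f2 s * f3 s * f4 s)
  + k2^2 * ((LBINT s. f1 s * f2 s) * (LBINT s. f3 s * f4 s)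
   + (LBINT s. f1 s * f3 s) * (LBINT s. f2 s * f4 s)
   + (LBINT s. f1 s * f4 s) * (LBINT s. f2 s * f3 s))"
proof -
 note Lf = f[THEN has_intD(1)] and LX = f[THEN has_intD(2)]
 define g where "g a b c s = f1 s + a * f2 s + b * f3 s + c * f4 s" for a b c s
 define W where "W a b c w = X1 w + a * X2 w + b * X3 w + c * X4 w" for a b c w
 have gW: "has_int (g a b c) (W a b c)" for a b c
  unfolding g_def W_def by (intro has_int_add has_int_cmult f)
 have pol: "x1 * x2 * x3 * x4 = ((x1+1*x2+1*x3+1*x4)^4 - (x1+1*x2+1*x3+(-1)*x4)^4 - (x1+1*x2+(-1)*x3+1*x4)^4 + (x1+1*x2+(-1)*x3+(-1)*x4)^4
  - (x1+(-1)*x2+1*x3+1*x4)^4 + (x1+(-1)*x2+1*x3+(-1)*x4)^4 + (x1+(-1)*x2+(-1)*x3+1*x4)^4 - (x1+(-1)*x2+(-1)*x3+(-1)*x4)^4) / 192" for x1 x2 x3 x4 :: real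
  using polarization4[of x1 x2 x3 x4] by simp
 define E where "E a b c = expectation (\<lambda>w. (W a b c w)^4)" for a b c
 define I where "I a b c = (LBINT s. (g a b c s)^4)" for a b c
 define J where "J a b c = (LBINT s. (g a b c s)^2)" for a b c
 have EX: "expectation (\<lambda>w. X1 w * X2 w * X3 w * X4 w)
   = (E 1 1 1 - E 1 1 (-1) - E 1 (-1) 1 + E 1 (-1) (-1) - E (-1) 1 1 + E (-1) 1 (-1) + E (-1) (-1) 1 - E (-1) (-1) (-1)) / 192"
  unfolding pol E_def W_def[symmetric] using L24D(3)[OF has_intD(2)[OF gW]] by simp
 have IX: "(LBINT s. f1 s * f2 s * f3 s * f4 s)
   = (I 1 1 1 - I 1 1 (-1) - I 1 (-1) 1 + I 1 (-1) (-1) - I (-1) 1 1 + I (-1) 1 (-1) + I (-1) (-1) 1 - I (-1) (-1) (-1)) / 192"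
  unfolding pol I_def g_def[symmetric] using L24D(3)[OF has_intD(1)[OF gW]] by simp
 have EIJ: "E a b c = c4 * I a b c + 3 * k2^2 * (J a b c)^2" for a b c
  unfolding E_def I_def J_def by (rule has_int_power_moments(3)[OF gW])
 define p q r t u v where "p = (LBINT s. f1 s * f2 s)" and "q = (LBINT s. f1 s * f3 s)" and "r = (LBINT s. f1 s * f4 s)"
  and "t = (LBINT s. f2 s * f3 s)" and "u = (LBINT s. f2 s * f4 s)" and "v = (LBINT s. f3 s * f4 s)"
 define A where "A = (LBINT s. (f1 s)^2) + (LBINT s. (f2 s)^2) + (LBINT s. (f3 s)^2) + (LBINT s. (f4 s)^2)"
 have J: "J a b c = A + 2 * (a * p + b * q + c * r + a * b * t + a * c * u + b * c * v)" if "a^2 = 1" "b^2 = 1" "c^2 = 1" for a b c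
 proof -
  have "(g a b c s)^2 = (f1 s)^2 + a^2 * (f2 s)^2 + b^2 * (f3 s)^2 + c^2 * (f4 s)^2
   + 2 * (a * (f1 s * f2 s) + b * (f1 s * f3 s) + c * (f1 s * f4 s) + a * b * (f2 s * f3 s) + a * c * (f2 s * f4 s) + b * c * (f3 s * f4 s))" for s
   unfolding g_def by (simp add: power2_eq_square algebra_simps)
  then show ?thesis
   unfolding J_def A_def p_def q_def r_def t_def u_def v_def that
   using L24D(2)[OF Lf(1)] L24D(2)[OF Lf(2)] L24D(2)[OF Lf(3)] L24D(2)[OF Lf(4)]
    L24_mult2[OF Lf(1) Lf(2)] L24_mult2[OF Lf(1) Lf(3)] L24_mult2[OF Lf(1) Lf(4)]
    L24_mult2[OF Lf(2) Lf(3)] L24_mult2[OF Lf(2) Lf(4)] L24_mult2[OF Lf(3) Lf(4)]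
   by simp
 qed
 \<comment> \<open>The alternating sum of squares keeps only products of complementary pairs; the
   factor 64 meets 3 / 192 in the moment formula and leaves the coefficient 1.\<close>
 have quad: "(J 1 1 1)^2 - (J 1 1 (-1))^2 - (J 1 (-1) 1)^2 + (J 1 (-1) (-1))^2 - (J (-1) 1 1)^2 + (J (-1) 1 (-1))^2 + (J (-1) (-1) 1)^2 - (J (-1) (-1) (-1))^2
   = 64 * (p * v + q * u + r * t)"
  by (simp add: J) (simp add: power2_eq_square algebra_simps)
 have "expectation (\<lambda>w. X1 w * X2 w * X3 w * X4 w) = c4 * (LBINT s. f1 s * f2 s * f3 s * f4 s) + 3 * k2^2 *
   ((J 1 1 1)^2 - (J 1 1 (-1))^2 - (J 1 (-1) 1)^2 + (J 1 (-1) (-1))^2 - (J (-1) 1 1)^2 + (J (-1) 1 (-1))^2 + (J (-1) (-1) 1)^2 - (J (-1) (-1) (-1))^2) / 192"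
  unfolding EX IX EIJ by (simp add: field_simps)
 also have "\<dots> = c4 * (LBINT s. f1 s * f2 s * f3 s * f4 s) + k2^2 * (p * v + q * u + r * t)"
  unfolding quad by simp
 finally show ?thesis unfolding p_def q_def r_def t_def u_def v_def .
qed

end

section \<open>Exponential decay of the kernel\<close>

lemma poly_sum_coeffs_monic:
 fixes a :: "'x::comm_ring_1 poly"
 assumes "lead_coeff a = 1" "degree a = p" "poly a z = 0"
 shows "(\<Sum>m<p. coeff a m * z^m) = - (z^p)"
 using assms unfolding poly_altdef lessThan_Suc_atMost[symmetric] by (simp add: eq_neg_iff_add_eq_0)

text \<open>All rows but the last force an eigenvector to be a multiple of (1, z, ..., z^(p-1)) with
  nonzero first entry; the last row is then the equation for a root.\<close>

lemma companion_eigenvalue_root: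
 assumes a: "lead_coeff a = 1" "degree a = p" and p: "0 < p"
  and z: "z \<in> spectrum (map_mat complex_of_real (companion_matrix p a))"
 shows "poly (map_poly complex_of_real a) z = 0"
proof -
 let ?A = "map_mat complex_of_real (companion_matrix p a)"
 let ?a = "map_poly complex_of_real a"
 have d: "dim_row ?A = p" "?A \<in> carrier_mat p p" by (auto simp: companion_matrix_def)
 obtain v where v: "v \<in> carrier_vec p" "v \<noteq> 0\<^sub>v p" "?A *\<^sub>v v = z \<cdot>\<^sub>v v"
  using z unfolding spectrum_def eigenvalue_def eigenvector_def d by auto
 have row: "(\<Sum>j<p. ?A $$ (i, j) * vec_index v j) = z * vec_index v i" if "i < p" for i
 proof -
  have "vec_index (?A *\<^sub>v v) i = (\<Sum>j<p. ?A $$ (i, j) * vec_index v j)"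
   using that v(1) d by (simp add: scalar_prod_def atLeast0LessThan)
  then show ?thesis unfolding v(3) using that v(1) by simp
 qed
 have step: "vec_index v (Suc i) = z * vec_index v i" if "Suc i < p" for i
 proof -
  have "(\<Sum>j<p. ?A $$ (i, j) * vec_index v j) = (\<Sum>j<p. if j = Suc i then vec_index v j else 0)"
   using that by (intro sum.cong) (auto simp: companion_matrix_def)
  then show ?thesis using row[of i] that by simp
 qed
 have vi: "vec_index v i = z^i * vec_index v 0" if "i < p" for i
  using that
 proof (induction i)
  case (Suc i)
  then show ?case using step[OF Suc.prems] by simp
 qed simp
 have v0: "vec_index v 0 \<noteq> 0"
 proof
  assume "vec_index v 0 = 0"
  then have "vec_index v i = 0" if "i < p" for i using vi[OF that] by simp
  then have "v = 0\<^sub>v p" using v(1) by (intro eq_vecI) auto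
  then show False using v(2) by simp
 qed
 define w where "w = vec_index v 0"
 note vi = vi[folded w_def]
 have "(\<Sum>j<p. ?A $$ (p - 1, j) * vec_index v j) = - (\<Sum>j<p. coeff ?a j * z^j) * w"
  unfolding sum_negf[symmetric] sum_distrib_right using p
  by (intro sum.cong) (use vi in \<open>auto simp: companion_matrix_def coeff_map_poly\<close>)
 then have "- (\<Sum>j<p. coeff ?a j * z^j) * w = z * (z^(p-1) * w)"
  using row[of "p - 1"] vi[of "p - 1"] p by simp
 also have "\<dots> = z^p * w" using p by (cases p) auto
 finally have "- (\<Sum>j<p. coeff ?a j * z^j) = z^p" using v0[folded w_def] mult_right_cancel[of w] by blast
 then have "(\<Sum>j<p. coeff ?a j * z^j) + z^p = 0" by (metis add.right_inverse)
 moreover have "poly ?a z = (\<Sum>j<p. coeff ?a j * z^j) + z^p"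
  using a unfolding poly_altdef by (simp add: lessThan_Suc_atMost[symmetric] coeff_map_poly degree_map_poly)
 ultimately show ?thesis by simp
qed

section \<open>Exponentials of companion matrices through Lagrange interpolation\<close>

definition lagrange_basis :: "'x::field set \<Rightarrow> 'x \<Rightarrow> 'x poly" where
 "lagrange_basis R k = Polynomial.smult (1 / (\<Prod>m\<in>R-{k}. k - m)) (\<Prod>m\<in>R-{k}. [:-m, 1:])"

lemma poly_lagrange_basis:
 assumes "finite R" "k \<in> R" "z \<in> R"
 shows "poly (lagrange_basis R k) z = (if z = k then 1 else 0)"
proof (cases "z = k")
 case True
 have "(\<Prod>m\<in>R-{k}. k - m) \<noteq> 0" using assms by simp
 then show ?thesis using True by (simp add: lagrange_basis_def poly_prod)
next
 case False
 have "(\<Prod>m\<in>R-{k}. z - m) = 0" using assms False by (intro prod_zero) auto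
 then show ?thesis using False by (simp add: lagrange_basis_def poly_prod)
qed

lemma degree_lagrange_basis:
 assumes "finite R" "k \<in> R"
 shows "degree (lagrange_basis R k) < card R"
proof -
 have "degree (lagrange_basis R k) \<le> degree (\<Prod>m\<in>R-{k}. [:-m, 1:])"
  unfolding lagrange_basis_def by (rule degree_smult_le)
 also have "\<dots> \<le> (\<Sum>m\<in>R-{k}. degree [:-m, 1:])" using degree_prod_sum_le[of "R-{k}" "\<lambda>m. [:-m, 1:]"] assms by (simp add: o_def)
 also have "\<dots> = card R - 1" using assms by simp
 also have "\<dots> < card R" using assms card_gt_0_iff[of R] by auto
 finally show ?thesis .
qed

text \<open>A monomial of degree below the number of nodes is reproduced by interpolation. Comparing
  coefficients says that the Lagrange coefficients form the inverse of the Vandermonde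
  matrix.\<close>

lemma lagrange_basis_power:
 assumes R: "finite R" and i: "i < card R"
 shows "(\<Sum>k\<in>R. k^i * coeff (lagrange_basis R k) j) = (if i = j then 1 else 0)"
proof -
 have "(\<Sum>k\<in>R. Polynomial.smult (k^i) (lagrange_basis R k)) = monom 1 i"
 proof (rule poly_eqI_degree[where A=R])
  fix z assume z: "z \<in> R"
  have "poly (\<Sum>k\<in>R. Polynomial.smult (k^i) (lagrange_basis R k)) z = (\<Sum>k\<in>R. if z = k then k^i else 0)"
   unfolding poly_sum by (rule sum.cong) (use R z in \<open>auto simp: poly_lagrange_basis\<close>)
  then show "poly (\<Sum>k\<in>R. Polynomial.smult (k^i) (lagrange_basis R k)) z = poly (monom 1 i) z"
   using R z by (simp add: poly_monom)
 next
  have "degree (\<Sum>k\<in>R. Polynomial.smult (k^i) (lagrange_basis R k)) \<le> card R - 1"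
   by (rule degree_sum_le[OF R])
    (use degree_lagrange_basis[OF R] degree_smult_le in \<open>fastforce intro: order_trans\<close>)
  then show "degree (\<Sum>k\<in>R. Polynomial.smult (k^i) (lagrange_basis R k)) < card R" using i by simp
 qed (use i in \<open>simp add: degree_monom_eq\<close>)
 then have "coeff (\<Sum>k\<in>R. Polynomial.smult (k^i) (lagrange_basis R k)) j = coeff (monom 1 i) j" by simp
 then show ?thesis by (simp add: coeff_sum)
qed

text \<open>The diagonalization A = V D V^(-1) in coordinates: V is the Vandermonde matrix with
  entries k^i, and the Lagrange coefficients are the entries of its inverse. Multiplication by A
  shifts the rows, and in the last row the equation of the roots closes the recursion.\<close>

lemma companion_power_entry:
 assumes a: "lead_coeff a = 1" "degree a = p" "0 < p"
  and R: "finite R" "card R = p" "\<And>z. z \<in> R \<Longrightarrow> poly (map_poly complex_of_real a) z = 0"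
  and ij: "i < p" "j < p"
 shows "complex_of_real ((companion_matrix p a ^\<^sub>m n) $$ (i, j)) = (\<Sum>k\<in>R. k^(n + i) * coeff (lagrange_basis R k) j)"
 using ij
proof (induction n arbitrary: i)
 case 0
 then show ?case using lagrange_basis_power[OF R(1), of i j] R(2) by (simp add: companion_matrix_def)
next
 case (Suc n)
 let ?A = "companion_matrix p a"
 have A: "?A \<in> carrier_mat p p" by (auto simp: companion_matrix_def)
 \<comment> \<open>Powers are built by multiplication from the right, while the recursion reads the
   rows of a left factor.\<close>
 have comm: "?A * ?A ^\<^sub>m n = ?A ^\<^sub>m n * ?A" for n
 proof (induction n)
  case 0
  show ?case using A left_mult_one_mat[OF A] right_mult_one_mat[OF A] carrier_matD[OF A] by simp
 next
  case (Suc n)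
  then show ?case using assoc_mult_mat[OF A pow_carrier_mat[OF A] A, of n] by simp
 qed
 have An: "dim_row (?A ^\<^sub>m n) = p" "dim_col (?A ^\<^sub>m n) = p" using pow_carrier_mat[OF A, of n] by auto
 have eq: "(?A ^\<^sub>m Suc n) $$ (i, j) = (\<Sum>m<p. ?A $$ (i, m) * (?A ^\<^sub>m n) $$ (m, j))"
  unfolding pow_mat.simps comm[symmetric] using Suc.prems A An by (simp add: scalar_prod_def atLeast0LessThan)
 show ?case
 proof (cases "Suc i < p")
  case True
  have "(\<Sum>m<p. ?A $$ (i, m) * (?A ^\<^sub>m n) $$ (m, j)) = (\<Sum>m<p. if m = Suc i then (?A ^\<^sub>m n) $$ (m, j) else 0)"
   using True by (intro sum.cong) (auto simp: companion_matrix_def)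
  then have "(?A ^\<^sub>m Suc n) $$ (i, j) = (?A ^\<^sub>m n) $$ (Suc i, j)" unfolding eq using True by simp
  then show ?thesis using Suc.IH[OF True Suc.prems(2)] by simp
 next
  case False
  then have i: "i = p - 1" using Suc.prems by simp
  have "complex_of_real ((?A ^\<^sub>m Suc n) $$ (i, j)) = (\<Sum>m<p. - coeff (map_poly complex_of_real a) m * complex_of_real ((?A ^\<^sub>m n) $$ (m, j)))"
   unfolding eq of_real_sum by (rule sum.cong) (use i Suc.prems in \<open>auto simp: companion_matrix_def coeff_map_poly\<close>)
  also have "\<dots> = (\<Sum>m<p. \<Sum>k\<in>R. - coeff (map_poly complex_of_real a) m * (k^(n+m) * coeff (lagrange_basis R k) j))"
   by (rule sum.cong) (use Suc.IH Suc.prems(2) in \<open>auto simp: sum_distrib_left\<close>)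
  also have "\<dots> = (\<Sum>k\<in>R. - (\<Sum>m<p. coeff (map_poly complex_of_real a) m * k^m) * (k^n * coeff (lagrange_basis R k) j))"
   unfolding sum.swap[of _ "{..<p}"] sum_distrib_right sum_negf[symmetric]
   by (intro sum.cong refl) (simp add: power_add)
  also have "\<dots> = (\<Sum>k\<in>R. k^(Suc n + i) * coeff (lagrange_basis R k) j)"
  proof (rule sum.cong)
   fix k assume k: "k \<in> R"
   have "(\<Sum>m<p. coeff (map_poly complex_of_real a) m * k^m) = - (k^p)"
    by (rule poly_sum_coeffs_monic) (use a R(3)[OF k] in \<open>auto simp: degree_map_poly coeff_map_poly\<close>)
   then show "- (\<Sum>m<p. coeff (map_poly complex_of_real a) m * k^m) * (k^n * coeff (lagrange_basis R k) j) = k^(Suc n + i) * coeff (lagrange_basis R k) j"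
    using i a(3) by (simp add: power_add[symmetric] add.commute)
  qed simp
  finally show ?thesis .
 qed
qed

lemma companion_mat_exp_entry:
 assumes a: "lead_coeff a = 1" "degree a = p" "0 < p"
  and R: "finite R" "card R = p" "\<And>z. z \<in> R \<Longrightarrow> poly (map_poly complex_of_real a) z = 0"
  and ij: "i < p" "j < p"
 shows "mat_exp (s \<cdot>\<^sub>m companion_matrix p a) $$ (i, j) = Re (\<Sum>k\<in>R. k^i * coeff (lagrange_basis R k) j * exp (of_real s * k))"
proof -
 let ?A = "companion_matrix p a"
 have A: "?A \<in> carrier_mat p p" "dim_row ?A = p" by (auto simp: companion_matrix_def)
 have pow: "(s \<cdot>\<^sub>m ?A) ^\<^sub>m n = s^n \<cdot>\<^sub>m (?A ^\<^sub>m n)" for n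
 proof (induction n)
  case 0
  show ?case using A by (intro eq_matI) auto
 next
  case (Suc n)
  then show ?case using A pow_carrier_mat[OF A(1), of n]
   by (simp add: mult_smult_distrib[OF pow_carrier_mat[OF A(1)] A(1)] mult_smult_assoc_mat[OF pow_carrier_mat[OF A(1)] A(1)])
    (auto intro!: eq_matI simp: mult_ac)
 qed
 have "(\<lambda>n. (s *\<^sub>R k)^n /\<^sub>R fact n) sums exp (s *\<^sub>R k)" for k :: complex by (rule exp_converges)
 then have "(\<lambda>n. \<Sum>k\<in>R. k^i * coeff (lagrange_basis R k) j * ((s *\<^sub>R k)^n /\<^sub>R fact n))
   sums (\<Sum>k\<in>R. k^i * coeff (lagrange_basis R k) j * exp (s *\<^sub>R k))"
  by (intro sums_sum sums_mult)
 moreover have "(\<Sum>k\<in>R. k^i * coeff (lagrange_basis R k) j * ((s *\<^sub>R k)^n /\<^sub>R fact n)) = complex_of_real ((((s \<cdot>\<^sub>m ?A) ^\<^sub>m n) $$ (i, j)) / fact n)" for n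
 proof -
  have "((s \<cdot>\<^sub>m ?A) ^\<^sub>m n) $$ (i, j) = s^n * (?A ^\<^sub>m n) $$ (i, j)"
   unfolding pow using ij carrier_matD[OF pow_carrier_mat[OF A(1), of n]] by simp
  then show ?thesis
   using companion_power_entry[OF a R ij, of n]
   by (simp add: sum_distrib_left sum_divide_distrib scaleR_conv_of_real power_mult_distrib power_add field_simps)
 qed
 ultimately have "(\<lambda>n. complex_of_real ((((s \<cdot>\<^sub>m ?A) ^\<^sub>m n) $$ (i, j)) / fact n)) sums (\<Sum>k\<in>R. k^i * coeff (lagrange_basis R k) j * exp (s *\<^sub>R k))"
  by simp
 from sums_unique[OF sums_Re[OF this, unfolded Re_complex_of_real]] show ?thesis
  using ij A by (simp add: mat_exp_def scaleR_conv_of_real del: Re_sum)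
qed

text \<open>With p distinct eigenvalues every entry is a combination of the exponentials exp (s k)
  with constant coefficients, no powers of s; stability makes all of them decay.\<close>

lemma companion_mat_exp_decay:
 assumes a: "lead_coeff a = 1" "degree a = p" "0 < p"
  and stable: "\<And>z. poly (map_poly complex_of_real a) z = 0 \<Longrightarrow> Re z < 0"
  and distinct: "distinct_eigenvalues (companion_matrix p a)"
 shows "\<exists>C c. 0 < C \<and> 0 < c \<and> (\<forall>i<p. \<forall>j<p. (\<lambda>s. mat_exp (s \<cdot>\<^sub>m companion_matrix p a) $$ (i, j)) \<in> borel_measurable borel \<and>
  (\<forall>s\<ge>0. \<bar>mat_exp (s \<cdot>\<^sub>m companion_matrix p a) $$ (i, j)\<bar> \<le> C * exp (- c * s)))"
proof -
 define R where "R = spectrum (map_mat complex_of_real (companion_matrix p a))"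
 have cR: "card R = p" using distinct unfolding distinct_eigenvalues_def R_def by (simp add: companion_matrix_def)
 then have fR: "finite R" using a(3) card_ge_0_finite by metis
 have root: "poly (map_poly complex_of_real a) z = 0" if "z \<in> R" for z
  using companion_eigenvalue_root[OF a] that unfolding R_def by simp
 have ne: "R \<noteq> {}" using cR a(3) by auto
 \<comment> \<open>The distance of the spectrum from the imaginary axis. C sums the moduli of all
   coefficients of all entries, and its summand 1 makes it positive.\<close>
 define c where "c = Min ((\<lambda>k. - Re k) ` R)"
 define C where "C = 1 + (\<Sum>i<p. \<Sum>j<p. \<Sum>k\<in>R. cmod (k^i * coeff (lagrange_basis R k) j))"
 have c: "0 < c" unfolding c_def using fR ne stable root by (subst Min_gr_iff) auto
 have ck: "Re k \<le> - c" if "k \<in> R" for k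
 proof -
  have "c \<le> - Re k" unfolding c_def using fR that by (intro Min_le) auto
  then show ?thesis by simp
 qed
 have C: "0 < C" unfolding C_def by (intro add_pos_nonneg sum_nonneg) auto
 have "\<bar>mat_exp (s \<cdot>\<^sub>m companion_matrix p a) $$ (i, j)\<bar> \<le> C * exp (- c * s)" if ij: "i < p" "j < p" and s: "0 \<le> s" for i j s
 proof -
  have "\<bar>mat_exp (s \<cdot>\<^sub>m companion_matrix p a) $$ (i, j)\<bar> \<le> cmod (\<Sum>k\<in>R. k^i * coeff (lagrange_basis R k) j * exp (of_real s * k))"
   by (subst companion_mat_exp_entry[OF a fR cR root ij]) (auto intro: abs_Re_le_cmod simp del: Re_sum)
  also have "\<dots> \<le> (\<Sum>k\<in>R. cmod (k^i * coeff (lagrange_basis R k) j) * exp (- c * s))"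
  proof (rule sum_norm_le)
   fix k assume k: "k \<in> R"
   have "s * Re k \<le> s * (- c)" by (intro mult_left_mono ck k s)
   then have "cmod (exp (of_real s * k)) \<le> exp (- c * s)" by (simp add: mult.commute)
   then show "cmod (k^i * coeff (lagrange_basis R k) j * exp (of_real s * k)) \<le> cmod (k^i * coeff (lagrange_basis R k) j) * exp (- c * s)"
    unfolding norm_mult[of _ "exp _"] by (intro mult_left_mono) auto
  qed
  also have "\<dots> = (\<Sum>k\<in>R. cmod (k^i * coeff (lagrange_basis R k) j)) * exp (- c * s)" by (simp add: sum_distrib_right)
  also have "\<dots> \<le> C * exp (- c * s)"
  proof (rule mult_right_mono)
   have "(\<Sum>k\<in>R. cmod (k^i * coeff (lagrange_basis R k) j)) \<le> (\<Sum>j<p. \<Sum>k\<in>R. cmod (k^i * coeff (lagrange_basis R k) j))"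
    using ij by (intro member_le_sum[where f="\<lambda>j. \<Sum>k\<in>R. cmod (k^i * coeff (lagrange_basis R k) j)"]) (auto intro: sum_nonneg)
   also have "\<dots> \<le> (\<Sum>i<p. \<Sum>j<p. \<Sum>k\<in>R. cmod (k^i * coeff (lagrange_basis R k) j))"
    using ij by (intro member_le_sum[where f="\<lambda>i. \<Sum>j<p. \<Sum>k\<in>R. cmod (k^i * coeff (lagrange_basis R k) j)"]) (auto intro!: sum_nonneg)
   finally show "(\<Sum>k\<in>R. cmod (k^i * coeff (lagrange_basis R k) j)) \<le> C" unfolding C_def by simp
  qed simp
  finally show ?thesis .
 qed
 moreover have "(\<lambda>s. mat_exp (s \<cdot>\<^sub>m companion_matrix p a) $$ (i, j)) \<in> borel_measurable borel" if ij: "i < p" "j < p" for i j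
  by (subst companion_mat_exp_entry[OF a fR cR root ij], simp, intro borel_measurable_continuous_onI continuous_intros)
 ultimately show ?thesis using c C by blast
qed

text \<open>The 1-norm is chosen because its exponential is a product over the coordinates:
  integrals over space and sums over the lattice reduce to one dimension.\<close>

abbreviation expdec :: "real \<Rightarrow> real^'d \<Rightarrow> real" where
 "expdec c x \<equiv> exp (- c * (\<Sum>i\<in>UNIV. \<bar>x $ i\<bar>))"

text \<open>Entrywise estimates apply to factors that do not commute: each multiplication
  contributes a sum of p terms, hence a factor C p, and the exponents add up along the list.\<close>

lemma mat_product_decay:
 fixes E :: "'d::finite \<Rightarrow> real \<Rightarrow> real mat"
 assumes dim: "\<And>i t. E i t \<in> carrier_mat p p" and C: "0 < C"
  and meas: "\<And>i k l. k < p \<Longrightarrow> l < p \<Longrightarrow> (\<lambda>t. E i t $$ (k, l)) \<in> borel_measurable borel"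
  and bound: "\<And>i k l t. k < p \<Longrightarrow> l < p \<Longrightarrow> 0 \<le> t \<Longrightarrow> \<bar>E i t $$ (k, l)\<bar> \<le> C * exp (- c * t)"
 defines "P \<equiv> \<lambda>xs (s::real^'d). foldr (\<lambda>i Q. E i (s $ i) * Q) xs (1\<^sub>m p)"
 shows "P xs s \<in> carrier_mat p p" (is ?carrier)
  and "k < p \<Longrightarrow> l < p \<Longrightarrow> (\<lambda>s. P xs s $$ (k, l)) \<in> borel_measurable borel"
  and "k < p \<Longrightarrow> l < p \<Longrightarrow> (\<And>i. 0 \<le> s $ i) \<Longrightarrow> \<bar>P xs s $$ (k, l)\<bar> \<le> (C * p)^length xs * exp (- c * (\<Sum>i\<leftarrow>xs. s $ i))"
proof -
 have car: "P xs s \<in> carrier_mat p p" for xs s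
  by (induction xs) (auto simp: P_def intro!: mult_carrier_mat[OF dim])
 show ?carrier by (rule car)
 have step: "P (x # xs) s $$ (k, l) = (\<Sum>m<p. E x (s $ x) $$ (k, m) * P xs s $$ (m, l))" if "k < p" "l < p" for x xs s k l
 proof -
  have "P (x # xs) s = E x (s $ x) * P xs s" unfolding P_def by simp
  then show ?thesis using that dim[of x "s $ x"] car[of xs s] by (simp add: scalar_prod_def atLeast0LessThan)
 qed
 show "(\<lambda>s. P xs s $$ (k, l)) \<in> borel_measurable borel" if "k < p" "l < p"
  using that
 proof (induction xs arbitrary: k)
  case Nil
  then show ?case by (simp add: P_def)
 next
  case (Cons x xs)
  have "(\<lambda>s. E x (s $ x) $$ (k, m)) \<in> borel_measurable borel" if "m < p" for m
   using measurable_compose[OF borel_measurable_continuous_onI[where f="\<lambda>s::real^'d. s $ x"] meas[of k m x]] that Cons.prems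
   by (simp add: continuous_intros)
  then show ?case unfolding step[OF Cons.prems]
   by (intro borel_measurable_sum borel_measurable_times Cons.IH Cons.prems) auto
 qed
 show "\<bar>P xs s $$ (k, l)\<bar> \<le> (C * p)^length xs * exp (- c * (\<Sum>i\<leftarrow>xs. s $ i))" if "k < p" "l < p" and s: "\<And>i. 0 \<le> s $ i"
  using that(1,2)
 proof (induction xs arbitrary: k)
  case Nil
  then show ?case by (simp add: P_def)
 next
  case (Cons x xs)
  have "\<bar>P (x # xs) s $$ (k, l)\<bar> \<le> (\<Sum>m<p. \<bar>E x (s $ x) $$ (k, m)\<bar> * \<bar>P xs s $$ (m, l)\<bar>)"
   unfolding step[OF Cons.prems] abs_mult[symmetric] by (rule sum_abs)
  also have "\<dots> \<le> (\<Sum>m<p. (C * exp (- c * s $ x)) * ((C * p)^length xs * exp (- c * (\<Sum>i\<leftarrow>xs. s $ i))))"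
   using C by (intro sum_mono mult_mono bound Cons s) auto
  also have "\<dots> = (C * p)^length (x # xs) * exp (- c * (\<Sum>i\<leftarrow>x # xs. s $ i))"
   by (simp add: algebra_simps flip: exp_add)
  finally show ?case .
 qed
qed

lemma carma_kernel_decay:
 fixes a :: "'d::{finite,linorder} \<Rightarrow> real poly"
 assumes a: "\<And>k. lead_coeff (a k) = 1" "\<And>k. degree (a k) = p" and p: "0 < p"
  and stable: "\<And>k z. poly (map_poly complex_of_real (a k)) z = 0 \<Longrightarrow> Re z < 0"
  and distinct: "\<And>k. distinct_eigenvalues (companion_matrix p (a k))"
 obtains C c where "0 < C" "0 < c" "carma_kernel p b a \<in> borel_measurable borel"
  "\<And>s. \<bar>carma_kernel p b a s\<bar> \<le> C * expdec c s"
proof -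
 define E where "E i t = mat_exp (t \<cdot>\<^sub>m companion_matrix p (a i))" for i t
 have "\<forall>k. \<exists>C c. 0 < C \<and> 0 < c \<and> (\<forall>i<p. \<forall>j<p. (\<lambda>s. E k s $$ (i, j)) \<in> borel_measurable borel \<and>
  (\<forall>s\<ge>0. \<bar>E k s $$ (i, j)\<bar> \<le> C * exp (- c * s)))"
  unfolding E_def by (intro allI companion_mat_exp_decay a p distinct) (rule stable)
 then obtain Cs cs where Cs: "\<And>k. 0 < Cs k" "\<And>k. 0 < cs k"
  and m: "\<And>k i j. i < p \<Longrightarrow> j < p \<Longrightarrow> (\<lambda>s. E k s $$ (i, j)) \<in> borel_measurable borel"
  and bd: "\<And>k i j s. i < p \<Longrightarrow> j < p \<Longrightarrow> 0 \<le> s \<Longrightarrow> \<bar>E k s $$ (i, j)\<bar> \<le> Cs k * exp (- cs k * s)"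
  by metis
 define C where "C = Max (range Cs)"
 define c where "c = Min (range cs)"
 have C: "0 < C" "\<And>k. Cs k \<le> C" unfolding C_def using Cs by (auto simp: Max_gr_iff)
 have c: "0 < c" "\<And>k. c \<le> cs k" unfolding c_def using Cs by (auto simp: Min_gr_iff)
 have bd: "\<bar>E k s $$ (i, j)\<bar> \<le> C * exp (- c * s)" if "i < p" "j < p" "0 \<le> s" for i j k s
 proof -
  have "c * s \<le> cs k * s" using c that by (intro mult_right_mono) auto
  then have "Cs k * exp (- cs k * s) \<le> C * exp (- c * s)" using C by (intro mult_mono) auto
  then show ?thesis using bd[OF that, of k] by linarith
 qed
 have dim: "E i t \<in> carrier_mat p p" for i t by (auto simp: E_def mat_exp_def companion_matrix_def)
 define P where "P s = foldr (\<lambda>i Q. E i (s $ i) * Q) (sorted_list_of_set (UNIV :: 'd set)) (1\<^sub>m p)" for s :: "real^('d::{finite,linorder})"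
 have P1: "P s \<in> carrier_mat p p" for s unfolding P_def by (rule mat_product_decay(1)[OF dim C(1) m bd])
 have P2: "(\<lambda>s. P s $$ (k, l)) \<in> borel_measurable borel" if "k < p" "l < p" for k l
  unfolding P_def by (rule mat_product_decay(2)[OF dim C(1) m bd that])
 have P3: "\<bar>P s $$ (k, l)\<bar> \<le> (C * p)^CARD('d) * exp (- c * (\<Sum>i\<leftarrow>sorted_list_of_set (UNIV :: 'd set). s $ i))"
  if "k < p" "l < p" "\<And>i. 0 \<le> s $ i" for k l s
  unfolding P_def using mat_product_decay(3)[OF dim C(1) m bd that, where xs="sorted_list_of_set (UNIV :: 'd set)"] by simp
 have g: "carma_kernel p b a s = (if \<forall>i. 0 \<le> s $ i then (\<Sum>j<p. b j * P s $$ (j, p - 1)) else 0)" for s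
  unfolding carma_kernel_def E_def[symmetric] P_def[symmetric]
  using carrier_matD[OF P1[of s]] p by (simp add: scalar_prod_def atLeast0LessThan mult_delta_right)
 define C' where "C' = (\<Sum>j<p. \<bar>b j\<bar>) * (C * p)^CARD('d) + 1"
 show thesis
 proof (rule that)
  show "0 < C'" unfolding C'_def using C by (intro add_nonneg_pos mult_nonneg_nonneg sum_nonneg) auto
  show "carma_kernel p b a \<in> borel_measurable borel"
  proof -
   have [measurable]: "(\<lambda>s. P s $$ (j, p - Suc 0)) \<in> borel_measurable borel" if "j < p" for j
    by (rule P2) (use that p in auto)
   have [measurable]: "(\<lambda>s. \<Sum>j<p. b j * P s $$ (j, p - Suc 0)) \<in> borel_measurable borel"
    by (intro borel_measurable_sum borel_measurable_times) auto
   have "{s::real^('d::{finite,linorder}). \<forall>i. 0 \<le> s $ i} \<in> sets borel"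
    by (intro borel_closed) (simp add: closed_Collect_all closed_Collect_le continuous_on_component)
   then show ?thesis unfolding g by (intro measurable_If) (auto simp: pred_def)
  qed
  fix s
  show "\<bar>carma_kernel p b a s\<bar> \<le> C' * expdec c s"
  proof (cases "\<forall>i. 0 \<le> s $ i")
   case True
   have len: "(\<Sum>i\<leftarrow>sorted_list_of_set (UNIV :: 'd set). s $ i) = (\<Sum>i\<in>UNIV. \<bar>s $ i\<bar>)"
    using True by (simp add: sum_list_distinct_conv_sum_set)
   have "\<bar>carma_kernel p b a s\<bar> \<le> (\<Sum>j<p. \<bar>b j\<bar> * \<bar>P s $$ (j, p - 1)\<bar>)"
    using True unfolding g abs_mult[symmetric] by (simp add: sum_abs)
   also have "\<dots> \<le> (\<Sum>j<p. \<bar>b j\<bar> * ((C * p)^CARD('d) * expdec c s))"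
    using P3[of _ "p - 1" s] p True by (intro sum_mono mult_left_mono) (auto simp: len)
   also have "\<dots> = ((\<Sum>j<p. \<bar>b j\<bar>) * (C * p)^CARD('d)) * expdec c s"
    by (simp add: sum_distrib_right mult.assoc)
   also have "\<dots> \<le> C' * expdec c s" unfolding C'_def by (intro mult_right_mono) auto
   finally show ?thesis .
  next
   case False
   then have "carma_kernel p b a s = 0" unfolding g by (rule if_not_P)
   then show ?thesis using \<open>0 < C'\<close> by simp
  qed
 qed (rule c)
qed

section \<open>Convergence in distribution from characteristic functions\<close>

lemma nn_integral_exp_abs_finite:
 assumes "0 < c"
 shows "(\<integral>\<^sup>+x. ennreal (exp (- c * \<bar>x::real\<bar>)) \<partial>lborel) < \<infinity>"
proof -
 have lim: "((\<lambda>x::real. - exp (- c * x) / c) \<longlongrightarrow> 0) at_top"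
  using assms by real_asymp
 have pos: "(\<integral>\<^sup>+x. ennreal (exp (- c * x)) * indicator {0..} x \<partial>lborel) = 1 / c"
  by (subst nn_integral_FTC_atLeast[where F="\<lambda>x. - exp (- c * x) / c" and T=0])
   (use assms lim in \<open>auto intro!: derivative_eq_intros simp: field_simps\<close>)
 have "(\<integral>\<^sup>+x. ennreal (exp (- c * \<bar>x\<bar>)) \<partial>lborel) \<le> (\<integral>\<^sup>+x. ennreal (exp (- c * x)) * indicator {0..} x + ennreal (exp (- c * (- x))) * indicator {0..} (- x) \<partial>lborel)"
  by (rule nn_integral_mono) (auto simp: indicator_def)
 also have "\<dots> = (\<integral>\<^sup>+x. ennreal (exp (- c * x)) * indicator {0..} x \<partial>lborel) + (\<integral>\<^sup>+x. ennreal (exp (- c * (- x))) * indicator {0..} (- x) \<partial>lborel)"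
  by (rule nn_integral_add) auto
 also have "(\<integral>\<^sup>+x. ennreal (exp (- c * (- x))) * indicator {0..} (- x) \<partial>lborel) = (\<integral>\<^sup>+x. ennreal (exp (- c * x)) * indicator {0..} x \<partial>lborel)"
  using nn_integral_distr[of uminus "lborel :: real measure" borel "\<lambda>x. ennreal (exp (- c * x)) * indicator {0..} x", symmetric]
  by (simp add: lborel_distr_uminus)
 finally show ?thesis unfolding pos by (simp add: ennreal_plus[symmetric] del: ennreal_plus) (auto intro: le_less_trans simp: top_unique less_top)
qed

lemma sum_Basis_cart:
 fixes F :: "real \<Rightarrow> 'b::comm_monoid_add" and x :: "real^'d"
 shows "(\<Sum>b\<in>Basis. F (x \<bullet> b)) = (\<Sum>i\<in>UNIV. F (x $ i))"
proof -
 have "(Basis :: (real^'d) set) = (\<lambda>i. axis i 1) ` UNIV" unfolding Basis_vec_def by auto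
 moreover have "inj (\<lambda>i::'d. axis i (1::real))" by (auto simp: inj_on_def axis_eq_axis)
 ultimately have "(\<Sum>b\<in>Basis. F (x \<bullet> b)) = (\<Sum>i\<in>UNIV. F (x \<bullet> axis i 1))"
  using sum.reindex[of "\<lambda>i::'d. axis i (1::real)" UNIV "\<lambda>b. F (x \<bullet> b)"] by simp
 then show ?thesis by (simp add: cart_eq_inner_axis)
qed

lemma integrable_expdec:
 assumes "0 < c"
 shows "integrable lborel (expdec c :: real^'d \<Rightarrow> real)"
proof (rule integrableI_bounded)
 have "(\<integral>\<^sup>+x. ennreal (norm (expdec c (x::real^'d))) \<partial>lborel) = (\<integral>\<^sup>+x. (\<Prod>b\<in>Basis. ennreal (exp (- c * \<bar>(x::real^'d) \<bullet> b\<bar>))) \<partial>lborel)"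
 proof (rule nn_integral_cong)
  fix x :: "real^'d"
  have "expdec c x = exp (\<Sum>b\<in>Basis. - c * \<bar>x \<bullet> b\<bar>)"
   unfolding sum_distrib_left sum_Basis_cart[of "\<lambda>t. - c * \<bar>t\<bar>"] ..
  also have "\<dots> = (\<Prod>b\<in>Basis. exp (- c * \<bar>x \<bullet> b\<bar>))" by (rule exp_sum) simp
  finally show "ennreal (norm (expdec c x)) = (\<Prod>b\<in>Basis. ennreal (exp (- c * \<bar>x \<bullet> b\<bar>)))"
   by (simp add: prod_ennreal prod_nonneg abs_of_nonneg)
 qed
 also have "\<dots> = (\<Prod>b\<in>(Basis::(real^'d) set). (\<integral>\<^sup>+x. ennreal (exp (- c * \<bar>x\<bar>)) \<partial>lborel))"
  by (rule nn_integral_lborel_prod) auto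
 also have "\<dots> < \<infinity>" using nn_integral_exp_abs_finite[OF assms] by (simp add: power_less_top_ennreal)
 finally show "(\<integral>\<^sup>+x. ennreal (norm (expdec c (x::real^'d))) \<partial>lborel) < \<infinity>" .
qed measurable

lemma norm_sq_cart: "(norm (x::real^'d))^2 = (\<Sum>i\<in>UNIV. (x $ i)^2)"
 unfolding power2_norm_eq_inner inner_vec_def by (simp add: power2_eq_square)

section \<open>Gaussian smoothing of test functions\<close>

definition gauss_bump :: "real^'d \<Rightarrow> real" where
 "gauss_bump z = exp (- (norm z)\<^sup>2 / 2)"

lemma gauss_bump_measurable[measurable]: "gauss_bump \<in> borel_measurable borel"
 unfolding gauss_bump_def by measurable

lemma gauss_bump_bounds: "0 < gauss_bump z" "gauss_bump z \<le> 1"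
 unfolding gauss_bump_def by auto

lemma abs_gauss_bump[simp]: "\<bar>gauss_bump z\<bar> = gauss_bump z"
 using gauss_bump_bounds(1)[of z] by simp

lemma gauss_bump_integrable: "integrable lborel (gauss_bump :: real^'d \<Rightarrow> real)"
proof (rule Bochner_Integration.integrable_bound[where f="\<lambda>z. exp (CARD('d) / 2) * expdec 1 z"])
 show "integrable lborel (\<lambda>z::real^'d. exp (CARD('d) / 2) * expdec 1 z)" using integrable_expdec[of 1] by simp
 have "gauss_bump z \<le> exp (CARD('d) / 2) * expdec 1 z" for z :: "real^'d"
 proof -
  have "- t\<^sup>2 / 2 \<le> 1 / 2 - \<bar>t\<bar>" for t :: real
   using sum_squares_bound[of "\<bar>t\<bar>" 1] by simp
  then have "(\<Sum>i\<in>UNIV. - (z $ i)\<^sup>2 / 2) \<le> (\<Sum>i\<in>UNIV. 1 / 2 - \<bar>z $ i\<bar>)" by (rule sum_mono)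
  then have "- (norm z)\<^sup>2 / 2 \<le> CARD('d) / 2 - (\<Sum>i\<in>UNIV. \<bar>z $ i\<bar>)"
   unfolding norm_sq_cart by (simp add: sum_subtractf sum_divide_distrib sum_negf)
  then show ?thesis unfolding gauss_bump_def by (simp add: exp_add[symmetric])
 qed
 then show "AE z in lborel. norm (gauss_bump z) \<le> norm (exp (CARD('d) / 2) * expdec 1 (z::real^'d))"
  by (intro AE_I2) simp
qed measurable

lemma gauss_bump_integral_pos: "0 < (LBINT z. gauss_bump (z::real^'d))"
proof -
 have "(LBINT z. gauss_bump (z::real^'d)) \<noteq> 0"
 proof
  assume "(LBINT z. gauss_bump (z::real^'d)) = 0"
  then have "AE z in lborel. gauss_bump (z::real^'d) = 0"
   using integral_nonneg_eq_0_iff_AE[OF gauss_bump_integrable] gauss_bump_bounds(1) less_imp_le by blast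
  then have "AE z in (lborel :: (real^'d) measure). False"
   by eventually_elim (use gauss_bump_bounds(1) less_irrefl in metis)
  then show False by (simp add: eventually_False ae_filter_eq_bot_iff)
 qed
 moreover have "0 \<le> (LBINT z. gauss_bump (z::real^'d))"
  by (intro integral_nonneg_AE AE_I2 less_imp_le gauss_bump_bounds)
 ultimately show ?thesis by simp
qed

text \<open>The image of independent standard normal variables under a linear map. A Gram matrix as
  covariance includes the singular cases, and independence makes the characteristic function a
  product.\<close>

lemma ex_gaussian_gram:
 fixes a :: "'j \<Rightarrow> real^'k"
 assumes J: "finite J"
 obtains \<mu> where "prob_space \<mu>" "sets \<mu> = sets borel"
  "\<And>u. (CLINT x|\<mu>. iexp (u \<bullet> x)) = complex_of_real (exp (- (\<Sum>j\<in>J. (a j \<bullet> u)^2) / 2))"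
proof -
 let ?N = "\<lambda>_::'j. std_normal_distribution"
 interpret N: real_distribution std_normal_distribution by (rule real_dist_normal_dist)
 interpret P: product_prob_space ?N J by standard
 define T where "T z = (\<Sum>j\<in>J. z j *\<^sub>R a j)" for z :: "'j \<Rightarrow> real"
 have T[measurable]: "T \<in> measurable (Pi\<^sub>M J ?N) borel"
  unfolding T_def by measurable
 show thesis
 proof (rule that[of "distr (Pi\<^sub>M J ?N) borel T"])
  show "prob_space (distr (Pi\<^sub>M J ?N) borel T)" by (rule P.prob_space_distr[OF T])
  fix u
  have "(CLINT x|distr (Pi\<^sub>M J ?N) borel T. iexp (u \<bullet> x)) = (CLINT z|Pi\<^sub>M J ?N. iexp (u \<bullet> T z))"
   by (rule integral_distr) measurable
  also have "\<dots> = (CLINT z|Pi\<^sub>M J ?N. (\<Prod>j\<in>J. iexp ((a j \<bullet> u) * z j)))"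
   unfolding T_def inner_sum_right of_real_sum sum_distrib_left exp_sum[OF J]
   by (simp add: inner_commute mult_ac)
  also have "\<dots> = (\<Prod>j\<in>J. CLINT x|std_normal_distribution. iexp ((a j \<bullet> u) * x))"
   by (rule P.product_integral_prod[OF J]) (simp add: N.integrable_const_bound[where B=1])
  also have "\<dots> = (\<Prod>j\<in>J. complex_of_real (exp (- (a j \<bullet> u)\<^sup>2 / 2)))"
   using char_std_normal_distribution unfolding char_def fun_eq_iff by simp
  also have "\<dots> = complex_of_real (exp (\<Sum>j\<in>J. - (a j \<bullet> u)\<^sup>2 / 2))"
   unfolding exp_sum[OF J] by simp
  finally show "(CLINT x|distr (Pi\<^sub>M J ?N) borel T. iexp (u \<bullet> x)) = complex_of_real (exp (- (\<Sum>j\<in>J. (a j \<bullet> u)^2) / 2))"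
   by (simp add: sum_divide_distrib sum_negf)
 qed simp
qed

text \<open>The Gaussian is its own Fourier transform up to normalization: W is the standard normal
  law.\<close>

lemma gauss_bump_fourier:
 obtains W :: "(real^'d) measure" where "prob_space W" "sets W = sets borel"
  "\<And>x. complex_of_real (gauss_bump x) = (CLINT w|W. iexp (w \<bullet> x))"
proof -
 obtain W :: "(real^'d) measure" where W: "prob_space W" "sets W = sets borel"
  "\<And>u. (CLINT x|W. iexp (u \<bullet> x)) = complex_of_real (exp (- (\<Sum>j\<in>UNIV. (axis j 1 \<bullet> u)^2) / 2))"
  using ex_gaussian_gram[of UNIV "\<lambda>j. axis j 1"] by auto
 show thesis
 proof (rule that[OF W(1,2)])
  fix x :: "real^'d"
  show "complex_of_real (gauss_bump x) = (CLINT w|W. iexp (w \<bullet> x))"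
   using W(3)[of x] by (simp add: inner_commute gauss_bump_def norm_sq_cart cart_eq_inner_axis)
 qed
qed

lemma integral_lborel_affine:
 fixes F :: "real^'d \<Rightarrow> real"
 assumes [measurable]: "F \<in> borel_measurable borel" and s: "0 < s"
 shows "(LBINT y. F y) = s^CARD('d) * (LBINT z. F (x + s *\<^sub>R z))"
proof -
 have "(LBINT y. F y) = (\<integral>y. F y \<partial>density (distr lborel borel (\<lambda>z. x + s *\<^sub>R z)) (\<lambda>_. ennreal (s^CARD('d))))"
  using lborel_affine[of s x] s by (simp add: ennreal_power)
 also have "\<dots> = (\<integral>y. s^CARD('d) *\<^sub>R F y \<partial>distr lborel borel (\<lambda>z. x + s *\<^sub>R z))"
  by (rule integral_density) (use s in auto)
 also have "\<dots> = (LBINT z. s^CARD('d) *\<^sub>R F (x + s *\<^sub>R z))"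
  by (rule integral_distr) measurable
 finally show ?thesis by simp
qed

text \<open>The bump is itself a characteristic function, so its expectation is determined by the
 characteristic function of the random vector.\<close>

lemma (in prob_space) gauss_bump_expectation:
 fixes V :: "'a \<Rightarrow> real^'d"
 assumes V[measurable]: "random_variable borel V" and W: "prob_space W" "sets W = sets borel"
  "\<And>x::real^'d. complex_of_real (gauss_bump x) = (CLINT w|W. iexp (w \<bullet> x))"
 shows "complex_of_real (expectation (\<lambda>z. gauss_bump ((1/s) *\<^sub>R (V z - y)))) =
  (CLINT w|W. (CLINT z|M. iexp (((1/s) *\<^sub>R w) \<bullet> V z)) * iexp (- (((1/s) *\<^sub>R w) \<bullet> y)))"
proof -
 interpret W: prob_space W by (rule W)
 note [measurable_cong] = W(2)
 interpret pair_sigma_finite M W ..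
 interpret MW: pair_prob_space M W ..
 have split: "iexp (w \<bullet> ((1/s) *\<^sub>R (V z - y))) = iexp (((1/s) *\<^sub>R w) \<bullet> V z) * iexp (- (((1/s) *\<^sub>R w) \<bullet> y))" for w z
  by (simp add: inner_diff_right algebra_simps flip: exp_add)
 have "complex_of_real (expectation (\<lambda>z. gauss_bump ((1/s) *\<^sub>R (V z - y))))
   = (CLINT z|M. (CLINT w|W. iexp (w \<bullet> ((1/s) *\<^sub>R (V z - y)))))"
  unfolding W(3)[symmetric] by simp
 also have "\<dots> = (CLINT w|W. (CLINT z|M. iexp (w \<bullet> ((1/s) *\<^sub>R (V z - y)))))"
  by (rule Fubini_integral[symmetric], rule MW.P.integrable_const_bound[where B=1]) auto
 also have "\<dots> = (CLINT w|W. (CLINT z|M. iexp (((1/s) *\<^sub>R w) \<bullet> V z)) * iexp (- (((1/s) *\<^sub>R w) \<bullet> y)))"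
  unfolding split by simp
 finally show ?thesis .
qed

text \<open>Fubini and the substitution y = V + s z. On the left the law of V enters only through
  bump expectations, which the characteristic function determines; on the right stands the
  expectation of a smoothed test function.\<close>

lemma (in prob_space) gauss_smoothing:
 fixes V :: "'a \<Rightarrow> real^'d" and h :: "real^'d \<Rightarrow> real"
 assumes V[measurable]: "random_variable borel V" and h: "integrable lborel h" and s: "0 < s"
 shows "(LBINT y. h y * expectation (\<lambda>w. gauss_bump ((1/s) *\<^sub>R (V w - y))))
  = s^CARD('d) * expectation (\<lambda>w. \<integral>z. h (V w + s *\<^sub>R z) * gauss_bump z \<partial>lborel)"
proof -
 note [measurable] = borel_measurable_integrable[OF h, simplified]
 interpret pair_sigma_finite M "lborel :: (real^'d) measure" ..
 have "(LBINT y. h y * expectation (\<lambda>w. gauss_bump ((1/s) *\<^sub>R (V w - y))))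
   = (LBINT y. expectation (\<lambda>w. h y * gauss_bump ((1/s) *\<^sub>R (V w - y))))"
  by simp
 also have "\<dots> = expectation (\<lambda>w. \<integral>y. h y * gauss_bump ((1/s) *\<^sub>R (V w - y)) \<partial>lborel)"
 proof (rule Fubini_integral)
  have "integrable (M \<Otimes>\<^sub>M lborel) (\<lambda>(w, y). h y)"
   by (rule Fubini_integrable) (use h in auto)
  then show "integrable (M \<Otimes>\<^sub>M lborel) (\<lambda>(w, y). h y * gauss_bump ((1/s) *\<^sub>R (V w - y)))"
   by (rule Bochner_Integration.integrable_bound)
    (auto simp: abs_mult gauss_bump_bounds split_beta intro!: AE_I2 mult_left_le)
 qed
 also have "\<dots> = expectation (\<lambda>w. s^CARD('d) * (LBINT z. h (V w + s *\<^sub>R z) * gauss_bump z))"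
 proof (rule Bochner_Integration.integral_cong[OF refl])
  fix w
  show "(LBINT y. h y * gauss_bump ((1/s) *\<^sub>R (V w - y))) = s^CARD('d) * (LBINT z. h (V w + s *\<^sub>R z) * gauss_bump z)"
   by (subst integral_lborel_affine[OF _ s, of _ "V w"]) (use s in \<open>auto simp: gauss_bump_def\<close>)
 qed
 finally show ?thesis by simp
qed

text \<open>Dominated convergence is used twice: over the frequency w under the probability measure
  W, where characteristic functions are bounded by 1, and over the centre y with the integrable
  weight h.\<close>

lemma (in prob_space) gauss_smoothing_converges:
 fixes V :: "nat \<Rightarrow> 'a \<Rightarrow> real^'d" and h :: "real^'d \<Rightarrow> real"
 assumes V[measurable]: "\<And>n. random_variable borel (V n)" and \<mu>: "prob_space \<mu>" "sets \<mu> = sets borel"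
  and char: "\<And>u. (\<lambda>n. CLINT v|M. iexp (u \<bullet> V n v)) \<longlonglongrightarrow> (CLINT x|\<mu>. iexp (u \<bullet> x))"
  and h: "integrable lborel h" and s: "0 < s"
 shows "(\<lambda>n. expectation (\<lambda>v. \<integral>z. h (V n v + s *\<^sub>R z) * gauss_bump z \<partial>lborel))
  \<longlonglongrightarrow> (\<integral>x. (LBINT z. h (x + s *\<^sub>R z) * gauss_bump z) \<partial>\<mu>)"
proof -
 interpret \<mu>: prob_space \<mu> by (rule \<mu>)
 note [measurable_cong] = \<mu>(2)
 note [measurable] = borel_measurable_integrable[OF h, simplified]
 obtain W :: "(real^'d) measure" where W: "prob_space W" "sets W = sets borel"
  "\<And>x. complex_of_real (gauss_bump x) = (CLINT w|W. iexp (w \<bullet> x))"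
  using gauss_bump_fourier by blast
 interpret W: prob_space W by (rule W)
 note [measurable_cong] = W(2)
 have norm1: "norm (CLINT v|M. iexp (u \<bullet> V n v)) \<le> 1" for u n
  by (rule order_trans[OF integral_norm_bound]) (simp add: prob_space)
 define e where "e n y = expectation (\<lambda>v. gauss_bump ((1/s) *\<^sub>R (V n v - y)))" for n y
 define e' where "e' y = (\<integral>x. gauss_bump ((1/s) *\<^sub>R (x - y)) \<partial>\<mu>)" for y
 have [measurable]: "e n \<in> borel_measurable borel" "e' \<in> borel_measurable borel" for n
  unfolding e_def e'_def by measurable
 have e: "(\<lambda>n. e n y) \<longlonglongrightarrow> e' y" for y
 proof -
  have "(\<lambda>n. CLINT w|W. (CLINT v|M. iexp (((1/s) *\<^sub>R w) \<bullet> V n v)) * iexp (- (((1/s) *\<^sub>R w) \<bullet> y)))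
   \<longlonglongrightarrow> (CLINT w|W. (CLINT x|\<mu>. iexp (((1/s) *\<^sub>R w) \<bullet> x)) * iexp (- (((1/s) *\<^sub>R w) \<bullet> y)))"
  proof (rule integral_dominated_convergence[where w="\<lambda>_. 1"])
   show "AE w in W. norm ((CLINT v|M. iexp (((1/s) *\<^sub>R w) \<bullet> V n v)) * iexp (- (((1/s) *\<^sub>R w) \<bullet> y))) \<le> 1" for n
    by (intro AE_I2) (use norm1 in \<open>simp only: norm_mult norm_exp_i_times mult_1_right\<close>)
  qed (measurable, auto intro!: tendsto_mult char simp del: inner_scaleR_left)
  then have "(\<lambda>n. complex_of_real (e n y)) \<longlonglongrightarrow> complex_of_real (e' y)"
   unfolding e_def e'_def gauss_bump_expectation[OF V W] \<mu>.gauss_bump_expectation[OF measurable_ident_sets[OF \<mu>(2)] W] .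
  then show ?thesis by (simp only: tendsto_of_real_iff)
 qed
 have "(\<lambda>n. \<integral>y. h y * e n y \<partial>lborel) \<longlonglongrightarrow> (LBINT y. h y * e' y)"
 proof (rule integral_dominated_convergence[where w="\<lambda>y. \<bar>h y\<bar>"])
  have "\<bar>e n y\<bar> \<le> 1" for n y
  proof -
   have "\<bar>e n y\<bar> \<le> expectation (\<lambda>v. 1)" unfolding e_def
    by (rule order_trans[OF integral_abs_bound], rule integral_mono)
     (auto intro!: integrable_const_bound[where B=1] simp: gauss_bump_bounds)
   then show ?thesis by (simp add: prob_space)
  qed
  then show "AE y in lborel. norm (h y * e n y) \<le> \<bar>h y\<bar>" for n
   by (intro AE_I2) (simp add: abs_mult mult_left_le)
 qed (use h e in \<open>auto intro!: tendsto_mult\<close>)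
 then have "(\<lambda>n. s^CARD('d) * expectation (\<lambda>v. \<integral>z. h (V n v + s *\<^sub>R z) * gauss_bump z \<partial>lborel))
  \<longlonglongrightarrow> s^CARD('d) * (\<integral>x. (LBINT z. h (x + s *\<^sub>R z) * gauss_bump z) \<partial>\<mu>)"
  unfolding e_def e'_def gauss_smoothing[OF V h s] \<mu>.gauss_smoothing[OF measurable_ident_sets[OF \<mu>(2)] h s] .
 from tendsto_mult[OF tendsto_const[of "inverse (s^CARD('d))"] this] show ?thesis
  using s by (simp add: field_simps)
qed

definition cutoff :: "real \<Rightarrow> real^'d \<Rightarrow> real" where
 "cutoff R x = max 0 (min 1 (R + 1 - norm x))"

lemma cutoff_props:
 "0 \<le> cutoff R x" "cutoff R x \<le> 1" "norm x \<le> R \<Longrightarrow> cutoff R x = 1" "R + 1 \<le> norm x \<Longrightarrow> cutoff R x = 0"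
 unfolding cutoff_def by auto

lemma cutoff_continuous: "continuous_on UNIV (cutoff R)"
 unfolding cutoff_def by (intro continuous_intros)

lemma gauss_smoothing_approx:
 fixes h :: "real^'d \<Rightarrow> real"
 assumes cont: "continuous_on UNIV h" and supp: "\<And>x. R \<le> norm x \<Longrightarrow> h x = 0" and bound: "\<And>x. \<bar>h x\<bar> \<le> B" and e: "0 < e"
 obtains s where "0 < s" "\<And>x. \<bar>(LBINT z. h (x + s *\<^sub>R z) * gauss_bump z) - h x * (LBINT z. gauss_bump (z::real^'d))\<bar> \<le> e"
proof -
 define c where "c = (LBINT z. gauss_bump (z::real^'d))"
 have c: "0 < c" unfolding c_def by (rule gauss_bump_integral_pos)
 have [measurable]: "h \<in> borel_measurable borel" by (rule borel_measurable_continuous_onI[OF cont])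
 have B: "0 \<le> B" using bound[of 0] by linarith
 \<comment> \<open>The ball exceeds the support by 2, so it contains x and x + y whenever x has norm
   at most R + 1 and y is shorter than 1; farther out both values of h vanish.\<close>
 have "uniformly_continuous_on (cball 0 (R + 2)) h"
  by (rule compact_uniformly_continuous) (use cont continuous_on_subset in auto)
 then obtain d0 where d0: "0 < d0" "\<And>x y. norm x \<le> R + 2 \<Longrightarrow> norm y \<le> R + 2 \<Longrightarrow> dist y x < d0 \<Longrightarrow> dist (h y) (h x) < e / (2 * c)"
  unfolding uniformly_continuous_on_def using e c by (metis divide_pos_pos dist_0_norm mem_cball mult_pos_pos zero_less_numeral)
 define d where "d = min d0 1"
 note gb = gauss_bump_integrable[where 'd='d]
 have d: "0 < d" unfolding d_def using d0 by simp
 have close: "\<bar>h (x + y) - h x\<bar> \<le> e / (2 * c)" if y: "norm y < d" for x y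
 proof (cases "norm x \<le> R + 1")
  case True
  have "norm (x + y) \<le> R + 2" using norm_triangle_ineq[of x y] True y unfolding d_def by simp
  then show ?thesis using d0(2)[of x "x + y"] True y unfolding d_def by (simp add: dist_norm)
 next
  case False
  have "R \<le> norm (x + y)" using norm_triangle_ineq4[of "x + y" y] False y unfolding d_def by simp
  then show ?thesis using supp[of x] supp[of "x + y"] False e c by simp
 qed
 \<comment> \<open>The mass of the bump on displacements of length at least d after scaling by 1 /
   (n + 1); there the difference of values of h is only bounded by 2 B.\<close>
 define q where "q n = (LBINT z. indicator {z. d \<le> norm ((1 / real (Suc n)) *\<^sub>R z)} z * gauss_bump (z::real^'d))" for n
 have "q \<longlonglongrightarrow> (\<integral>z. 0 \<partial>(lborel::(real^'d) measure))"
  unfolding q_def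
 proof (rule integral_dominated_convergence[where w=gauss_bump])
  show "AE z in lborel. (\<lambda>n. indicator {z. d \<le> norm ((1 / real (Suc n)) *\<^sub>R z)} z * gauss_bump (z::real^'d)) \<longlonglongrightarrow> 0"
  proof (rule AE_I2)
   fix z :: "real^'d"
   have "(\<lambda>n. norm ((1 / real (Suc n)) *\<^sub>R z)) \<longlonglongrightarrow> 0"
    using tendsto_mult_right[OF LIMSEQ_inverse_real_of_nat, of "norm z"] by (simp add: inverse_eq_divide)
   then have "\<forall>\<^sub>F n in sequentially. norm ((1 / real (Suc n)) *\<^sub>R z) < d" by (rule order_tendstoD(2)[OF _ d])
   then have "\<forall>\<^sub>F n in sequentially. indicator {z. d \<le> norm ((1 / real (Suc n)) *\<^sub>R z)} z * gauss_bump z = 0"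
    by eventually_elim (simp add: indicator_def)
   then show "(\<lambda>n. indicator {z. d \<le> norm ((1 / real (Suc n)) *\<^sub>R z)} z * gauss_bump z) \<longlonglongrightarrow> 0"
    by (rule tendsto_eventually)
  qed
  show "AE z in lborel. norm (indicator {z. d \<le> norm ((1 / real (Suc n)) *\<^sub>R z)} z * gauss_bump z) \<le> gauss_bump (z::real^'d)" for n
   by (intro AE_I2) (auto simp: indicator_def less_imp_le gauss_bump_bounds)
 qed (auto intro: gb)
 then have "\<forall>\<^sub>F n in sequentially. q n < e / (4 * (B + 1))"
  using B e by (intro order_tendstoD(2)) auto
 then obtain n where n: "q n < e / (4 * (B + 1))" unfolding eventually_sequentially by blast
 define s where "s = 1 / real (Suc n)"
 have gi: "integrable lborel (\<lambda>z. h' z * gauss_bump (z::real^'d))" if [measurable]: "h' \<in> borel_measurable borel" and b: "\<And>z. \<bar>h' z\<bar> \<le> K" for h' K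
 proof (rule Bochner_Integration.integrable_bound[where f="\<lambda>z. K * gauss_bump z"])
  show "AE z in lborel. norm (h' z * gauss_bump z) \<le> norm (K * gauss_bump z)"
   by (intro AE_I2) (use b in \<open>auto simp: abs_mult intro!: mult_right_mono less_imp_le[OF gauss_bump_bounds(1)] intro: order_trans[OF _ abs_ge_self]\<close>)
 qed (auto intro: gb)
 show thesis
 proof (rule that)
  show "0 < s" unfolding s_def by simp
  fix x
  have "(LBINT z. h (x + s *\<^sub>R z) * gauss_bump z) - h x * c = (LBINT z. (h (x + s *\<^sub>R z) - h x) * gauss_bump z)"
  proof -
   have I: "integrable lborel (\<lambda>z. h (x + s *\<^sub>R z) * gauss_bump z)" "integrable lborel (\<lambda>z. h x * gauss_bump (z::real^'d))"
    using gi[of "\<lambda>z. h (x + s *\<^sub>R z)" B] gi[of "\<lambda>z. h x" B] bound by simp_all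
   show ?thesis unfolding left_diff_distrib Bochner_Integration.integral_diff[OF I] c_def by simp
  qed
  also have "\<bar>\<dots>\<bar> \<le> (LBINT z. \<bar>(h (x + s *\<^sub>R z) - h x) * gauss_bump z\<bar>)" by (rule integral_abs_bound)
  also have "\<dots> \<le> (LBINT z. e / (2 * c) * gauss_bump (z::real^'d) + 2 * B * (indicator {z. d \<le> norm (s *\<^sub>R z)} z * gauss_bump z))"
  proof (rule integral_mono)
   have "integrable lborel (\<lambda>z. (h (x + s *\<^sub>R z) - h x) * gauss_bump z)"
   proof (rule gi)
    show "\<bar>h (x + s *\<^sub>R z) - h x\<bar> \<le> 2 * B" for z using bound[of x] bound[of "x + s *\<^sub>R z"] by linarith
   qed measurable
   then show "integrable lborel (\<lambda>z. \<bar>(h (x + s *\<^sub>R z) - h x) * gauss_bump z\<bar>)" by (rule integrable_abs)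
   show "integrable lborel (\<lambda>z. e / (2 * c) * gauss_bump (z::real^'d) + 2 * B * (indicator {z. d \<le> norm (s *\<^sub>R z)} z * gauss_bump z))"
    using gi[of "indicator {z. d \<le> norm (s *\<^sub>R z)}" 1] gb by (auto simp: indicator_def)
   fix z
   have "\<bar>h (x + s *\<^sub>R z) - h x\<bar> \<le> e / (2 * c) + 2 * B * indicator {z. d \<le> norm (s *\<^sub>R z)} z"
   proof (cases "norm (s *\<^sub>R z) < d")
    case True
    then show ?thesis using close[OF True, of x] by (simp add: indicator_def)
   next
    case False
    then have "2 * B = 2 * B * indicator {z. d \<le> norm (s *\<^sub>R z)} z" by (simp add: indicator_def)
    moreover have "\<bar>h (x + s *\<^sub>R z) - h x\<bar> \<le> 2 * B" using bound[of x] bound[of "x + s *\<^sub>R z"] by linarith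
    moreover have "0 < e / (2 * c)" using e c by simp
    ultimately show ?thesis by linarith
   qed
   from mult_right_mono[OF this less_imp_le[OF gauss_bump_bounds(1)[of z]]]
   show "\<bar>(h (x + s *\<^sub>R z) - h x) * gauss_bump z\<bar> \<le> e / (2 * c) * gauss_bump z + 2 * B * (indicator {z. d \<le> norm (s *\<^sub>R z)} z * gauss_bump z)"
    by (simp add: abs_mult distrib_right mult.assoc)
  qed
  also have "\<dots> = e / (2 * c) * c + 2 * B * q n"
   unfolding c_def q_def s_def using gi[of "indicator {z. d \<le> norm ((1 / real (Suc n)) *\<^sub>R z)}" 1] gb by (auto simp: indicator_def)
  also have "\<dots> \<le> e"
  proof -
   have "2 * B * q n \<le> 2 * B * (e / (4 * (B + 1)))" using n B by (intro mult_left_mono) auto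
   also have "\<dots> \<le> e / 2" using B e by (simp add: field_simps)
   finally show ?thesis using c by simp
  qed
  finally show "\<bar>(LBINT z. h (x + s *\<^sub>R z) * gauss_bump z) - h x * (LBINT z. gauss_bump (z::real^'d))\<bar> \<le> e" unfolding c_def .
 qed
qed

lemma (in prob_space) expectation_close:
 fixes X Z :: "'a \<Rightarrow> real"
 assumes "integrable M X" "integrable M Z" "\<And>w. \<bar>X w - Z w\<bar> \<le> e"
 shows "\<bar>expectation X - expectation Z\<bar> \<le> e"
proof -
 have "\<bar>expectation X - expectation Z\<bar> = \<bar>expectation (\<lambda>w. X w - Z w)\<bar>" using assms by simp
 also have "\<dots> \<le> expectation (\<lambda>w. \<bar>X w - Z w\<bar>)" by (rule integral_abs_bound)
 also have "\<dots> \<le> expectation (\<lambda>w. e)" using assms by (intro integral_mono) auto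
 finally show ?thesis by (simp add: prob_space)
qed

text \<open>Three errors of size e / 4: smoothing under M, convergence of the smoothed expectations,
  smoothing under \<open>\<mu>\<close>. The common factor c is the mass of the unnormalized
  bump.\<close>

lemma (in prob_space) compact_support_char_convergence:
 fixes V :: "nat \<Rightarrow> 'a \<Rightarrow> real^'d" and h :: "real^'d \<Rightarrow> real"
 assumes V[measurable]: "\<And>n. random_variable borel (V n)" and \<mu>: "prob_space \<mu>" "sets \<mu> = sets borel"
  and char: "\<And>u. (\<lambda>n. CLINT w|M. iexp (u \<bullet> V n w)) \<longlonglongrightarrow> (CLINT x|\<mu>. iexp (u \<bullet> x))"
  and cont: "continuous_on UNIV h" and supp: "\<And>x. R \<le> norm x \<Longrightarrow> h x = 0"
 shows "(\<lambda>n. expectation (\<lambda>w. h (V n w))) \<longlonglongrightarrow> (\<integral>x. h x \<partial>\<mu>)"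
proof -
 interpret \<mu>: prob_space \<mu> by (rule \<mu>)
 note [measurable_cong] = \<mu>(2)
 have hm[measurable]: "h \<in> borel_measurable borel" by (rule borel_measurable_continuous_onI[OF cont])
 obtain B where bound: "\<And>x. \<bar>h x\<bar> \<le> B"
 proof -
  have "bounded (h ` cball 0 R)" by (rule compact_imp_bounded[OF compact_continuous_image[OF continuous_on_subset[OF cont]]]) auto
  then obtain B where "\<forall>y\<in>h ` cball 0 R. norm y \<le> B" unfolding bounded_iff by blast
  then have B: "\<bar>h x\<bar> \<le> B" if "norm x \<le> R" for x using that by simp
  have "\<bar>h x\<bar> \<le> \<bar>B\<bar>" for x
  proof (cases "norm x \<le> R")
   case True
   then show ?thesis using B[of x] by linarith
  qed (use supp[of x] in auto)
  then show thesis by (rule that)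
 qed
 have hint: "integrable lborel h"
 proof (rule Bochner_Integration.integrable_bound[where f="\<lambda>x. B * indicator (cball 0 R) x"])
  show "AE x in lborel. norm (h x) \<le> norm (B * indicator (cball 0 R) x)"
   using bound supp by (intro AE_I2) (auto simp: indicator_def not_le less_imp_le intro: order_trans[OF _ abs_ge_self])
  show "integrable lborel (\<lambda>x::real^'d. B * indicator (cball 0 R) x)"
   by (intro integrable_mult_right integrable_real_indicator) (use emeasure_bounded_finite[OF bounded_cball[of "0::real^'d" R]] in auto)
 qed simp
 define c where "c = (LBINT z. gauss_bump (z::real^'d))"
 have c: "0 < c" unfolding c_def by (rule gauss_bump_integral_pos)
 have "(\<lambda>n. c * expectation (\<lambda>w. h (V n w))) \<longlonglongrightarrow> c * (\<integral>x. h x \<partial>\<mu>)"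
 proof (rule LIMSEQ_I)
  fix e :: real assume e: "0 < e"
  then have e4: "0 < e / 4" by simp
  obtain s where s: "0 < s" "\<And>x. \<bar>(LBINT z. h (x + s *\<^sub>R z) * gauss_bump z) - h x * c\<bar> \<le> e / 4"
   using gauss_smoothing_approx[OF cont supp bound e4] unfolding c_def by blast
  define hs where "hs x = (LBINT z. h (x + s *\<^sub>R z) * gauss_bump z)" for x
  have hsm[measurable]: "hs \<in> borel_measurable borel" unfolding hs_def by measurable
  have hsb: "\<bar>hs x\<bar> \<le> e / 4 + B * c" for x
  proof -
   have "\<bar>h x * c\<bar> \<le> B * c" using bound[of x] c by (simp add: abs_mult)
   then show ?thesis using s(2)[of x] unfolding hs_def by linarith
  qed
  have "(\<lambda>n. expectation (\<lambda>w. hs (V n w))) \<longlonglongrightarrow> (\<integral>x. hs x \<partial>\<mu>)"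
   unfolding hs_def by (rule gauss_smoothing_converges[OF V \<mu> char hint s(1)])
  from LIMSEQ_D[OF this, of "e / 4"] e
  obtain n0 where n0: "\<And>n. n0 \<le> n \<Longrightarrow> \<bar>expectation (\<lambda>w. hs (V n w)) - (\<integral>x. hs x \<partial>\<mu>)\<bar> < e / 4" by auto
  have 1: "\<bar>expectation (\<lambda>w. hs (V n w)) - expectation (\<lambda>w. h (V n w) * c)\<bar> \<le> e / 4" for n
  proof (rule expectation_close)
   show "integrable M (\<lambda>w. hs (V n w))" by (rule integrable_const_bound[where B="e / 4 + B * c"]) (use hsb in auto)
   show "integrable M (\<lambda>w. h (V n w) * c)" by (intro integrable_mult_left integrable_const_bound[where B=B]) (use bound in auto)
  qed (use s(2) in \<open>simp add: hs_def\<close>)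
  have 2: "\<bar>(\<integral>x. hs x \<partial>\<mu>) - (\<integral>x. h x * c \<partial>\<mu>)\<bar> \<le> e / 4"
  proof (rule \<mu>.expectation_close)
   show "integrable \<mu> hs" by (rule \<mu>.integrable_const_bound[where B="e / 4 + B * c"]) (use hsb in auto)
   show "integrable \<mu> (\<lambda>x. h x * c)" by (intro integrable_mult_left \<mu>.integrable_const_bound[where B=B]) (use bound in auto)
  qed (use s(2) in \<open>simp add: hs_def\<close>)
  show "\<exists>n0. \<forall>n\<ge>n0. norm (c * expectation (\<lambda>w. h (V n w)) - c * (\<integral>x. h x \<partial>\<mu>)) < e"
  proof (intro exI allI impI)
   fix n assume "n0 \<le> n"
   have eq: "expectation (\<lambda>w. h (V n w) * c) = c * expectation (\<lambda>w. h (V n w))" "(\<integral>x. h x * c \<partial>\<mu>) = c * (\<integral>x. h x \<partial>\<mu>)"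
    by simp_all
   show "norm (c * expectation (\<lambda>w. h (V n w)) - c * (\<integral>x. h x \<partial>\<mu>)) < e"
    using n0[OF \<open>n0 \<le> n\<close>] 1[of n] 2 e unfolding eq real_norm_def by linarith
  qed
 qed
 from tendsto_mult[OF tendsto_const[of "inverse c"] this] show ?thesis using c by (simp add: field_simps)
qed

text \<open>Bounded second moments provide tightness: cutting f off beyond radius k costs at most B
  E|V|^2 / k^2, since (|x| / k)^2 \<ge> 1 there.\<close>

lemma (in prob_space) char_convergence_in_distribution:
 fixes V :: "nat \<Rightarrow> 'a \<Rightarrow> real^'d"
 assumes V[measurable]: "\<And>n. random_variable borel (V n)" and \<mu>: "prob_space \<mu>" "sets \<mu> = sets borel"
  and char: "\<And>u. (\<lambda>n. CLINT z|M. iexp (u \<bullet> V n z)) \<longlonglongrightarrow> (CLINT x|\<mu>. iexp (u \<bullet> x))"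
  and moment: "\<And>n. integrable M (\<lambda>z. (norm (V n z))^2)" "\<forall>\<^sub>F n in sequentially. expectation (\<lambda>z. (norm (V n z))^2) \<le> C"
 shows "conv_in_distribution V \<mu>"
 unfolding conv_in_distribution_def
proof (intro conjI allI impI V)
 interpret \<mu>: prob_space \<mu> by (rule \<mu>)
 note [measurable_cong] = \<mu>(2)
 fix f :: "real^'d \<Rightarrow> real" assume f: "continuous_on UNIV f \<and> bounded (range f)"
 then obtain B where B: "0 < B" "\<And>x. \<bar>f x\<bar> \<le> B" unfolding bounded_pos by auto
 have [measurable]: "f \<in> borel_measurable borel" using f by (intro borel_measurable_continuous_onI) auto
 have cm[measurable]: "cutoff R \<in> borel_measurable borel" for R :: real by (rule borel_measurable_continuous_onI[OF cutoff_continuous])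
 show "(\<lambda>n. expectation (\<lambda>z. f (V n z))) \<longlonglongrightarrow> (\<integral>x. f x \<partial>\<mu>)"
 proof (rule LIMSEQ_I)
  fix e :: real assume e: "0 < e"
  define h where "h R x = f x * cutoff R x" for R x
  have hc: "continuous_on UNIV (h R)" for R unfolding h_def using f cutoff_continuous by (intro continuous_on_mult) auto
  have hm[measurable]: "h R \<in> borel_measurable borel" for R by (rule borel_measurable_continuous_onI[OF hc])
  have hb: "\<bar>h R x\<bar> \<le> B" for R x
   using mult_mono[OF B(2)[of x] cutoff_props(2)[of R x]] B cutoff_props(1)[of R x] unfolding h_def by (simp add: abs_mult)
  have "(\<lambda>k. \<integral>x. h (real k) x \<partial>\<mu>) \<longlonglongrightarrow> (\<integral>x. f x \<partial>\<mu>)"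
  proof (rule integral_dominated_convergence[where w="\<lambda>_. B"])
   show "AE x in \<mu>. (\<lambda>k. h (real k) x) \<longlonglongrightarrow> f x"
   proof (rule AE_I2)
    fix x :: "real^'d"
    obtain k0 :: nat where k0: "norm x \<le> real k0" using real_arch_simple by blast
    have "\<forall>\<^sub>F k in sequentially. h (real k) x = f x"
     unfolding eventually_sequentially h_def using k0 cutoff_props(3)[of x] by (intro exI[of _ k0]) force
    then show "(\<lambda>k. h (real k) x) \<longlonglongrightarrow> f x" by (rule tendsto_eventually)
   qed
  qed (use hb in auto)
  from LIMSEQ_D[OF this, of "e / 4"] e obtain k0 where k0: "\<And>k. k0 \<le> k \<Longrightarrow> \<bar>(\<integral>x. h (real k) x \<partial>\<mu>) - (\<integral>x. f x \<partial>\<mu>)\<bar> < e / 4" by auto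
  obtain k1 :: nat where k1: "sqrt (8 * B * (\<bar>C\<bar> + 1) / e) \<le> real k1" using real_arch_simple by blast
  define k where "k = max (max k0 k1) 1"
  have k: "1 \<le> k" "k0 \<le> k" "k1 \<le> k" unfolding k_def by auto
  have kC: "B * (\<bar>C\<bar> + 1) / (real k)^2 \<le> e / 8"
  proof -
   have "8 * B * (\<bar>C\<bar> + 1) / e \<le> (real k)^2"
    using k1 k(3) by (intro sqrt_le_D order_trans[OF k1]) simp
   then show ?thesis using k(1) e by (simp add: field_simps)
  qed
  have "(\<lambda>n. expectation (\<lambda>z. h (real k) (V n z))) \<longlonglongrightarrow> (\<integral>x. h (real k) x \<partial>\<mu>)"
   by (rule compact_support_char_convergence[OF V \<mu> char hc, where R="real k + 1"]) (auto simp: h_def cutoff_props)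
  from LIMSEQ_D[OF this, of "e / 4"] e
  have "\<forall>\<^sub>F n in sequentially. \<bar>expectation (\<lambda>z. h (real k) (V n z)) - (\<integral>x. h (real k) x \<partial>\<mu>)\<bar> < e / 4"
   unfolding eventually_sequentially by auto
  then have "\<forall>\<^sub>F n in sequentially. norm (expectation (\<lambda>z. f (V n z)) - (\<integral>x. f x \<partial>\<mu>)) < e"
   using moment(2)
  proof eventually_elim
   case (elim n)
   have fi: "integrable M (\<lambda>z. f (V n z))" by (rule integrable_const_bound[where B=B]) (use B in auto)
   have hi: "integrable M (\<lambda>z. h (real k) (V n z))" by (rule integrable_const_bound[where B=B]) (use hb in auto)
   have tail: "\<bar>f x - h (real k) x\<bar> \<le> B * (norm x)^2 / (real k)^2" for x
   proof (cases "norm x \<le> real k")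
    case True
    then show ?thesis using cutoff_props(3)[OF True] B unfolding h_def by simp
   next
    case False
    have "\<bar>f x - h (real k) x\<bar> = \<bar>f x\<bar> * (1 - cutoff (real k) x)"
    proof -
     have "f x - h (real k) x = f x * (1 - cutoff (real k) x)" unfolding h_def by (simp add: right_diff_distrib)
     then show ?thesis using cutoff_props(2)[of "real k" x] by (simp add: abs_mult)
    qed
    also have "\<dots> \<le> B * 1" using B cutoff_props(1,2)[of "real k" x] by (intro mult_mono) auto
    also have "\<dots> \<le> B * ((norm x)^2 / (real k)^2)" using False B k by (intro mult_left_mono) (auto simp: le_divide_eq)
    finally show ?thesis by simp
   qed
   have "\<bar>expectation (\<lambda>z. f (V n z)) - expectation (\<lambda>z. h (real k) (V n z))\<bar> = \<bar>expectation (\<lambda>z. f (V n z) - h (real k) (V n z))\<bar>"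
    using fi hi by simp
   also have "\<dots> \<le> expectation (\<lambda>z. \<bar>f (V n z) - h (real k) (V n z)\<bar>)" by (rule integral_abs_bound)
   also have "\<dots> \<le> expectation (\<lambda>z. B * (norm (V n z))^2 / (real k)^2)"
    using fi hi moment(1) tail by (intro integral_mono) auto
   also have "\<dots> = B * expectation (\<lambda>z. (norm (V n z))^2) / (real k)^2" by simp
   also have "\<dots> \<le> B * (\<bar>C\<bar> + 1) / (real k)^2" using elim B by (intro divide_right_mono mult_left_mono) auto
   also have "\<dots> \<le> e / 8" by (rule kC)
   finally show ?case using elim k0[OF k(2)] e unfolding real_norm_def by linarith
  qed
  then show "\<exists>n0. \<forall>n\<ge>n0. norm (expectation (\<lambda>z. f (V n z)) - (\<integral>x. f x \<partial>\<mu>)) < e"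
   unfolding eventually_sequentially .
 qed
qed

section \<open>Existence of normal laws with possibly singular covariance\<close>

lemma psd_sum_of_squares:
 fixes s :: "'i \<Rightarrow> 'i \<Rightarrow> real"
 assumes "finite I" and "\<And>i j. i \<in> I \<Longrightarrow> j \<in> I \<Longrightarrow> s i j = s j i"
  and "\<And>u. 0 \<le> (\<Sum>i\<in>I. \<Sum>j\<in>I. u i * u j * s i j)"
 shows "\<exists>a. \<forall>u. (\<Sum>i\<in>I. \<Sum>j\<in>I. u i * u j * s i j) = (\<Sum>m\<in>I. (\<Sum>i\<in>I. a m i * u i)^2)"
 using assms
proof (induction I arbitrary: s rule: finite_induct)
 case (insert x I)
 note fin = insert(1) and x = insert(2)
 have sym: "s i x = s x i" if "i \<in> I" for i using insert.prems(1) that by simp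
 \<comment> \<open>Preparation for completing the square in the variable x: L is half the linear
   coefficient of that variable, and Q is the form in the remaining ones.\<close>
 define L where "L u = (\<Sum>i\<in>I. s x i * u i)" for u
 define Q where "Q u = (\<Sum>i\<in>I. \<Sum>j\<in>I. u i * u j * s i j)" for u
 have expand: "(\<Sum>i\<in>insert x I. \<Sum>j\<in>insert x I. u i * u j * s i j) = (u x)^2 * s x x + 2 * u x * L u + Q u" for u
 proof -
  have "(\<Sum>i\<in>insert x I. \<Sum>j\<in>insert x I. u i * u j * s i j)
    = u x * u x * s x x + (\<Sum>j\<in>I. u x * u j * s x j) + ((\<Sum>i\<in>I. u i * u x * s i x) + Q u)"
   using fin x by (simp add: Q_def sum.distrib)
  also have "(\<Sum>i\<in>I. u i * u x * s i x) = u x * L u"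
   unfolding L_def sum_distrib_left by (rule sum.cong) (auto simp: sym)
  also have "(\<Sum>j\<in>I. u x * u j * s x j) = u x * L u"
   unfolding L_def sum_distrib_left by (rule sum.cong) auto
  finally show ?thesis by (simp add: power2_eq_square)
 qed
 have nonneg: "0 \<le> t^2 * s x x + 2 * t * L u + Q u" for t u
 proof -
  have LQ: "L (u(x := t)) = L u" "Q (u(x := t)) = Q u" unfolding L_def Q_def using x by (auto intro!: sum.cong)
  show ?thesis using insert.prems(2)[of "u(x := t)"] unfolding expand LQ by simp
 qed
 define w where "w = sqrt (s x x)"
 \<comment> \<open>With a zero diagonal entry the form is affine in the variable x, and a nonzero
   slope would make it negative somewhere.\<close>
 have L0: "L u = 0" if "s x x = 0" for u
 proof (rule ccontr)
  assume "L u \<noteq> 0"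
  then show False using nonneg[of "- (Q u + 1) / (2 * L u)" u] that by (simp add: field_simps)
 qed
 have sx: "0 \<le> s x x" using nonneg[of 1 "\<lambda>_. 0"] by (simp add: L_def Q_def)
 \<comment> \<open>The Schur complement. Division by zero yields 0, so the formula also covers a
   zero diagonal entry, where L = 0 and nothing has to be subtracted.\<close>
 define s' where "s' i j = s i j - s x i * s x j / s x x" for i j
 have Q': "(\<Sum>i\<in>I. \<Sum>j\<in>I. u i * u j * s' i j) = Q u - (L u)^2 / s x x" for u
  unfolding s'_def Q_def L_def power2_eq_square sum_product
  by (simp add: right_diff_distrib sum_subtractf sum_divide_distrib mult_ac)
 have "\<exists>a. \<forall>u. (\<Sum>i\<in>I. \<Sum>j\<in>I. u i * u j * s' i j) = (\<Sum>m\<in>I. (\<Sum>i\<in>I. a m i * u i)^2)"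
 proof (rule insert.IH)
  show "s' i j = s' j i" if "i \<in> I" "j \<in> I" for i j using insert.prems(1) that unfolding s'_def by simp
  show "0 \<le> (\<Sum>i\<in>I. \<Sum>j\<in>I. u i * u j * s' i j)" for u
  proof (cases "s x x = 0")
   case True
   then show ?thesis using nonneg[of 0 u] unfolding Q' by simp
  next
   case False
   then show ?thesis using nonneg[of "- L u / s x x" u] unfolding Q' by (simp add: field_simps power2_eq_square)
  qed
 qed
 then obtain a where a: "\<And>u. Q u - (L u)^2 / s x x = (\<Sum>m\<in>I. (\<Sum>i\<in>I. a m i * u i)^2)" unfolding Q' by blast
 define a' where "a' m i = (if m = x then (if i = x then w else s x i / w) else if i = x then 0 else a m i)" for m i
 have "(\<Sum>m\<in>insert x I. (\<Sum>i\<in>insert x I. a' m i * u i)^2) = (w * u x + L u / w)^2 + (Q u - (L u)^2 / s x x)" for u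
 proof -
  have "(\<Sum>i\<in>insert x I. a' x i * u i) = w * u x + L u / w"
   unfolding L_def sum_divide_distrib using fin x by (auto simp: a'_def intro!: sum.cong)
  moreover have "(\<Sum>i\<in>insert x I. a' m i * u i) = (\<Sum>i\<in>I. a m i * u i)" if "m \<in> I" for m
   using fin x that by (auto simp: a'_def intro!: sum.cong)
  ultimately show ?thesis unfolding a using fin x by simp
 qed
 moreover have "(w * u x + L u / w)^2 + (Q u - (L u)^2 / s x x) = (u x)^2 * s x x + 2 * u x * L u + Q u" for u
 proof (cases "s x x = 0")
  case True
  then show ?thesis using L0[OF True] by (simp add: w_def)
 next
  case False
  then have "w^2 = s x x" "w \<noteq> 0" unfolding w_def using sx by auto
  then show ?thesis by (simp add: power2_sum power_mult_distrib power_divide)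
 qed
 ultimately show ?case unfolding expand by (intro exI[of _ a']) simp
qed simp

lemma ex_multivariate_normal:
 fixes S :: "real^'k^'k"
 assumes "\<And>u. 0 \<le> u \<bullet> (S *v u)"
 shows "\<exists>\<mu>. is_multivariate_normal 0 S \<mu>"
proof -
 \<comment> \<open>A quadratic form sees only the symmetric part of its matrix, and the
   decomposition into squares starts from symmetric coefficients.\<close>
 define s where "s i j = (S $ i $ j + S $ j $ i) / 2" for i j
 have quad: "(\<Sum>i\<in>UNIV. \<Sum>j\<in>UNIV. f i * f j * s i j) = (\<chi> i. f i) \<bullet> (S *v (\<chi> i. f i))" for f :: "'k \<Rightarrow> real"
 proof -
  have "(\<Sum>i\<in>UNIV. \<Sum>j\<in>UNIV. f i * f j * s i j)
    = ((\<Sum>i\<in>UNIV. \<Sum>j\<in>UNIV. f i * f j * S $ i $ j) + (\<Sum>i\<in>UNIV. \<Sum>j\<in>UNIV. f i * f j * S $ j $ i)) / 2"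
  proof -
   have "f i * f j * s i j = (f i * f j * S $ i $ j + f i * f j * S $ j $ i) / 2" for i j
    unfolding s_def by (simp add: distrib_left)
   then show ?thesis by (simp only: sum_divide_distrib[symmetric] sum.distrib)
  qed
  also have "(\<Sum>i\<in>UNIV. \<Sum>j\<in>UNIV. f i * f j * S $ j $ i) = (\<Sum>i\<in>UNIV. \<Sum>j\<in>UNIV. f i * f j * S $ i $ j)"
   by (subst sum.swap) (simp add: mult.commute[of "f _" "f _"])
  also have "((\<Sum>i\<in>UNIV. \<Sum>j\<in>UNIV. f i * f j * S $ i $ j) + (\<Sum>i\<in>UNIV. \<Sum>j\<in>UNIV. f i * f j * S $ i $ j)) / 2
    = (\<Sum>i\<in>UNIV. \<Sum>j\<in>UNIV. f i * f j * S $ i $ j)"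
   unfolding add_divide_distrib by (rule field_sum_of_halves)
  also have "\<dots> = (\<chi> i. f i) \<bullet> (S *v (\<chi> i. f i))"
   by (simp add: inner_vec_def matrix_vector_mult_def sum_distrib_left mult_ac)
  finally show ?thesis .
 qed
 have "\<exists>a. \<forall>u :: 'k \<Rightarrow> real. (\<Sum>i\<in>UNIV. \<Sum>j\<in>UNIV. u i * u j * s i j) = (\<Sum>m\<in>(UNIV::'k set). (\<Sum>i\<in>UNIV. a m i * u i)^2)"
 proof (rule psd_sum_of_squares)
  show "s i j = s j i" for i j by (simp add: s_def add.commute)
  show "0 \<le> (\<Sum>i\<in>UNIV. \<Sum>j\<in>UNIV. u i * u j * s i j)" for u unfolding quad by (rule assms)
 qed simp
 then obtain a :: "'k \<Rightarrow> 'k \<Rightarrow> real" where a: "\<And>u. (\<Sum>i\<in>UNIV. \<Sum>j\<in>UNIV. u i * u j * s i j) = (\<Sum>m\<in>UNIV. (\<Sum>i\<in>UNIV. a m i * u i)^2)"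
  by blast
 obtain \<mu> where \<mu>: "prob_space \<mu>" "sets \<mu> = sets borel"
  "\<And>u. (CLINT x|\<mu>. iexp (u \<bullet> x)) = complex_of_real (exp (- (\<Sum>j\<in>UNIV. ((\<chi> i. a j i) \<bullet> u)^2) / 2))"
  using ex_gaussian_gram[of UNIV "\<lambda>j::'k. \<chi> i. a j i"] by auto
 have "(\<Sum>j\<in>UNIV. ((\<chi> i. a j i) \<bullet> u)^2) = u \<bullet> (S *v u)" for u
  using a[of "\<lambda>i. u $ i"] quad[of "\<lambda>i. u $ i"] by (simp add: inner_vec_def vec_lambda_eta)
 then have "(CLINT x|\<mu>. iexp (u \<bullet> x)) = exp (\<i> * of_real (u \<bullet> 0) - of_real (u \<bullet> (S *v u)) / 2)" for u
  unfolding \<mu>(3) by (simp add: exp_of_real[symmetric])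
 then show ?thesis unfolding is_multivariate_normal_def using \<mu>(1,2) by blast
qed

section \<open>Sums of products of moving averages over the lattice\<close>

lemma expdec_uminus[simp]: "expdec c (- x) = expdec c x" by simp

lemma expdec_bounds: "0 \<le> c \<Longrightarrow> expdec c x \<le> 1" "0 < expdec c x"
 by (auto simp: sum_nonneg)

lemma expdec_commute: "expdec c (x - y) = expdec c (y - x)"
 by (simp add: abs_minus_commute)

lemma expdec_measurable[measurable]: "expdec c \<in> borel_measurable borel"
 by (intro borel_measurable_continuous_onI continuous_intros)

text \<open>By the triangle inequality half of the rate pays for the distance between x and y; the
  other half remains for integrability in s.\<close>

lemma expdec_mult_le:
 assumes "0 \<le> c"
 shows "expdec c (x - s) * expdec c (y - s) \<le> expdec (c/2) (x - y) * expdec (c/2) (x - s)"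
proof -
 have "(\<Sum>i\<in>UNIV. \<bar>(x - y) $ i\<bar>) \<le> (\<Sum>i\<in>UNIV. \<bar>(x - s) $ i\<bar> + \<bar>(y - s) $ i\<bar>)"
  by (rule sum_mono) auto
 also have "\<dots> = (\<Sum>i\<in>UNIV. \<bar>(x - s) $ i\<bar>) + (\<Sum>i\<in>UNIV. \<bar>(y - s) $ i\<bar>)" by (rule sum.distrib)
 finally have "(\<Sum>i\<in>UNIV. \<bar>(x - y) $ i\<bar>) \<le> (\<Sum>i\<in>UNIV. \<bar>(x - s) $ i\<bar>) + (\<Sum>i\<in>UNIV. \<bar>(y - s) $ i\<bar>)" .
 moreover have "0 \<le> (\<Sum>i\<in>UNIV. \<bar>(y - s) $ i\<bar>)" by (rule sum_nonneg) simp
 moreover have "- c * u + - c * v \<le> - (c/2) * w + - (c/2) * u" if "w \<le> u + v" "0 \<le> v" for u v w :: real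
 proof -
  have "(c/2) * (w + u) \<le> (c/2) * (2 * (u + v))" using that assms by (intro mult_left_mono) auto
  then show ?thesis by (simp add: algebra_simps)
 qed
 ultimately show ?thesis unfolding exp_add[symmetric] exp_le_cancel_iff by blast
qed

lemma integral_lborel_reflect:
 fixes F :: "real^'d \<Rightarrow> real"
 assumes [measurable]: "F \<in> borel_measurable borel"
 shows "(LBINT s. F (x - s)) = (LBINT s. F s)"
proof -
 have "lborel = distr (lborel :: (real^'d) measure) borel (\<lambda>s. x - s)"
  using lborel_affine[of "-1" x] by (simp add: density_1)
 then have "(LBINT s. F s) = (\<integral>s. F s \<partial>distr lborel borel (\<lambda>s. x - s))" by simp
 also have "\<dots> = (LBINT s. F (x - s))" by (rule integral_distr) measurable
 finally show ?thesis ..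
qed

lemma integrable_expdec_shift:
 assumes "0 < c"
 shows "integrable lborel (\<lambda>s::real^'d. expdec c (x - s))"
proof -
 have "lborel = distr (lborel :: (real^'d) measure) borel (\<lambda>s. x - s)"
  using lborel_affine[of "-1" x] by (simp add: density_1)
 then have "integrable (distr lborel borel (\<lambda>s. x - s)) (expdec c :: real^'d \<Rightarrow> real)"
  using integrable_expdec[OF assms, where 'd='d] by simp
 then show ?thesis by (subst (asm) integrable_distr_eq) measurable
qed

text \<open>The centre x is recorded because the integrand of a field at x is the reflected
  translate h (x - s). Integrals of products of kernels then decay in the distance of their centres,
  see \<open>decays_integral_mult\<close>.\<close>

definition decays :: "real \<Rightarrow> real \<Rightarrow> real^'d \<Rightarrow> (real^'d \<Rightarrow> real) \<Rightarrow> bool" where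
 "decays c B x f \<longleftrightarrow> f \<in> borel_measurable borel \<and> (\<forall>s. \<bar>f s\<bar> \<le> B * expdec c (x - s))"

lemma decaysD:
 assumes "decays c B x f"
 shows "f \<in> borel_measurable borel" "\<bar>f s\<bar> \<le> B * expdec c (x - s)" "0 \<le> B"
proof -
 show "f \<in> borel_measurable borel" "\<bar>f s\<bar> \<le> B * expdec c (x - s)" using assms unfolding decays_def by auto
 have "0 \<le> B * expdec c (x - x)" using assms unfolding decays_def by (metis abs_ge_zero order_trans)
 then show "0 \<le> B" by simp
qed

lemma decays_bound:
 assumes "decays c B x f" "0 \<le> c"
 shows "\<bar>f s\<bar> \<le> B"
 using decaysD(2)[OF assms(1), of s] mult_left_mono[OF expdec_bounds(1)[OF assms(2), of "x - s"] decaysD(3)[OF assms(1)]] by simp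

lemma decays_integrable:
 assumes f: "decays c B x f" and c: "0 < c"
 shows "integrable lborel f"
proof (rule Bochner_Integration.integrable_bound[where f="\<lambda>s. B * expdec c (x - s)"])
 show "integrable lborel (\<lambda>s. B * expdec c (x - s))" using integrable_expdec_shift[OF c] by (rule integrable_mult_right)
 show "AE s in lborel. norm (f s) \<le> norm (B * expdec c (x - s))"
  using decaysD(2)[OF f] decaysD(3)[OF f] by (intro AE_I2) (simp add: abs_mult)
qed (use decaysD(1)[OF f] in simp)

lemma decays_mult:
 assumes f: "decays c a x f" and h: "decays c b x' h" and c: "0 \<le> c"
 shows "decays c (a * b) x (\<lambda>s. f s * h s)"
 unfolding decays_def
proof (intro conjI allI)
 show "(\<lambda>s. f s * h s) \<in> borel_measurable borel" using decaysD(1)[OF f] decaysD(1)[OF h] by measurable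
 fix s
 have "\<bar>f s * h s\<bar> \<le> (a * expdec c (x - s)) * b"
  unfolding abs_mult by (intro mult_mono decaysD(2)[OF f] decays_bound[OF h c]) (use decaysD(3)[OF f] in auto)
 then show "\<bar>f s * h s\<bar> \<le> a * b * expdec c (x - s)" by (simp add: mult_ac)
qed

lemma decays_L24:
 assumes f: "decays c B x f" and c: "0 < c"
 shows "L24 lborel f"
proof -
 note d2 = decays_mult[OF f f less_imp_le[OF c]]
 note d4 = decays_mult[OF d2 d2 less_imp_le[OF c]]
 have "(f s)^2 = f s * f s" "(f s)^4 = (f s * f s) * (f s * f s)" for s
  by (simp_all add: power2_eq_square power4_eq_xxxx mult.assoc)
 then show ?thesis
  unfolding L24_def using decaysD(1)[OF f] decays_integrable[OF d2 c] decays_integrable[OF d4 c] by simp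
qed

lemma decays_mono:
 assumes "decays c B x f" "B \<le> B'"
 shows "decays c B' x f"
 unfolding decays_def
proof (intro conjI allI decaysD(1)[OF assms(1)])
 fix s
 have "B * expdec c (x - s) \<le> B' * expdec c (x - s)" by (rule mult_right_mono[OF assms(2)]) simp
 then show "\<bar>f s\<bar> \<le> B' * expdec c (x - s)" using decaysD(2)[OF assms(1), of s] by linarith
qed

definition decay_mass :: "'d::finite itself \<Rightarrow> real \<Rightarrow> real" where
 "decay_mass _ c = (LBINT s. expdec (c/2) (s::real^'d))"

lemma decays_integral_mult:
 fixes x y :: "real^'d"
 assumes f: "decays c a x f" and h: "decays c b y h" and c: "0 < c"
 shows "\<bar>\<integral>s. f s * h s \<partial>lborel\<bar> \<le> a * b * expdec (c/2) (x - y) * decay_mass TYPE('d) c"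
proof -
 note ab = decaysD(3)[OF f] decaysD(3)[OF h]
 have "\<bar>\<integral>s. f s * h s \<partial>lborel\<bar> \<le> (LBINT s. \<bar>f s * h s\<bar>)" by (rule integral_abs_bound)
 also have "\<dots> \<le> (LBINT s. a * b * expdec (c/2) (x - y) * expdec (c/2) (x - s))"
 proof (rule integral_mono)
  show "integrable lborel (\<lambda>s. \<bar>f s * h s\<bar>)"
   using decays_integrable[OF decays_mult[OF f h] c] c by auto
  show "integrable lborel (\<lambda>s. a * b * expdec (c/2) (x - y) * expdec (c/2) (x - s))"
   using integrable_expdec_shift[of "c/2" x] c by (intro integrable_mult_right) auto
  fix s
  have "\<bar>f s * h s\<bar> \<le> (a * expdec c (x - s)) * (b * expdec c (y - s))"
   unfolding abs_mult by (intro mult_mono decaysD(2)[OF f] decaysD(2)[OF h]) (use ab in auto)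
  also have "\<dots> = a * b * (expdec c (x - s) * expdec c (y - s))" by (simp only: mult_ac)
  also have "\<dots> \<le> a * b * (expdec (c/2) (x - y) * expdec (c/2) (x - s))"
   using expdec_mult_le[of c x s y] ab c by (intro mult_left_mono) auto
  finally show "\<bar>f s * h s\<bar> \<le> a * b * expdec (c/2) (x - y) * expdec (c/2) (x - s)" by (simp only: mult.assoc)
 qed
 also have "\<dots> = a * b * expdec (c/2) (x - y) * decay_mass TYPE('d) c"
  using integral_lborel_reflect[of "expdec (c/2)" x] unfolding decay_mass_def by simp
 finally show ?thesis .
qed

text \<open>One geometric series for each sign, with the index 0 counted twice.\<close>

lemma sum_geometric_int_le:
 assumes q: "0 \<le> q" "q < (1::real)"
 shows "(\<Sum>k\<in>{-int m..int m}. q ^ nat \<bar>k\<bar>) \<le> 2 / (1 - q)"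
proof -
 have g: "(\<Sum>k\<le>m. q^k) \<le> 1 / (1 - q)"
  using q by (simp add: sum_gp0 divide_right_mono)
 have "{-int m..int m} \<subseteq> int ` {..m} \<union> (\<lambda>k. - int k) ` {..m}"
 proof
  fix k assume k: "k \<in> {-int m..int m}"
  show "k \<in> int ` {..m} \<union> (\<lambda>k. - int k) ` {..m}"
  proof (cases "0 \<le> k")
   case True
   then have "k = int (nat k)" "nat k \<le> m" using k by auto
   then show ?thesis by blast
  next
   case False
   then have "k = - int (nat (- k))" "nat (- k) \<le> m" using k by auto
   then show ?thesis by blast
  qed
 qed
 then have "(\<Sum>k\<in>{-int m..int m}. q ^ nat \<bar>k\<bar>) \<le> (\<Sum>k\<in>int ` {..m} \<union> (\<lambda>k. - int k) ` {..m}. q ^ nat \<bar>k\<bar>)"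
  using q by (intro sum_mono2) auto
 also have "\<dots> \<le> (\<Sum>k\<in>int ` {..m}. q ^ nat \<bar>k\<bar>) + (\<Sum>k\<in>(\<lambda>k. - int k) ` {..m}. q ^ nat \<bar>k\<bar>)"
  using q by (subst sum.union_inter[symmetric]) (auto intro!: sum_nonneg)
 also have "\<dots> = (\<Sum>k\<le>m. q^k) + (\<Sum>k\<le>m. q^k)"
  by (simp add: sum.reindex inj_on_def)
 finally show ?thesis using g by simp
qed

lemma lattice_pts_closed:
 assumes "x \<in> lattice_pts \<Delta>" "y \<in> lattice_pts \<Delta>"
 shows "x - y \<in> lattice_pts \<Delta>" "x + y \<in> lattice_pts \<Delta>" "- x \<in> lattice_pts \<Delta>" "0 \<in> lattice_pts \<Delta>"
proof -
 obtain k l :: "'a \<Rightarrow> int" where k: "\<And>i. x $ i = \<Delta> * of_int (k i)" and l: "\<And>i. y $ i = \<Delta> * of_int (l i)"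
  using assms unfolding lattice_pts_def by (auto simp: choice_iff)
 show "x - y \<in> lattice_pts \<Delta>" unfolding lattice_pts_def by (auto simp: k l right_diff_distrib[symmetric] of_int_diff[symmetric] simp del: of_int_diff)
 show "x + y \<in> lattice_pts \<Delta>" unfolding lattice_pts_def by (auto simp: k l distrib_left[symmetric] of_int_add[symmetric] simp del: of_int_add)
 show "- x \<in> lattice_pts \<Delta>" unfolding lattice_pts_def by (auto simp: k mult_minus_right[symmetric] of_int_minus[symmetric] simp del: of_int_minus mult_minus_right)
 show "0 \<in> lattice_pts \<Delta>" unfolding lattice_pts_def by (auto intro: exI[of _ 0])
qed

text \<open>Once A is enlarged to a cube of lattice points, the sum factorizes over the coordinates
  into two-sided geometric series. The bound does not depend on A, which will give summability over
  the lattice.\<close>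

lemma lattice_sum_expdec_bound:
 fixes A :: "(real^'d) set"
 assumes c: "0 < c" and \<Delta>: "0 < \<Delta>" and A: "finite A" "A \<subseteq> lattice_pts \<Delta>"
 shows "(\<Sum>l\<in>A. expdec c (l::real^'d)) \<le> (2 / (1 - exp (- c * \<Delta>)))^CARD('d)"
proof -
 define q where "q = exp (- c * \<Delta>)"
 have q: "0 \<le> q" "q < 1" unfolding q_def using c \<Delta> by auto
 define n where "n l i = (SOME k::int. l $ i = \<Delta> * of_int k)" for l :: "real^'d" and i
 have n: "l $ i = \<Delta> * of_int (n l i)" if "l \<in> A" for l i
  using A(2) that someI_ex[of "\<lambda>k::int. l $ i = \<Delta> * of_int k"] unfolding n_def lattice_pts_def by blast
 define m where "m = (\<Sum>l\<in>A. \<Sum>i\<in>UNIV. nat \<bar>n l i\<bar>)"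
 have m: "nat \<bar>n l i\<bar> \<le> m" if "l \<in> A" for l i
 proof -
  have "nat \<bar>n l i\<bar> \<le> (\<Sum>i\<in>UNIV. nat \<bar>n l i\<bar>)" by (rule member_le_sum) auto
  also have "\<dots> \<le> m" unfolding m_def using A(1) that by (intro member_le_sum[where f="\<lambda>l. \<Sum>i\<in>UNIV. nat \<bar>n l i\<bar>"]) auto
  finally show ?thesis .
 qed
 have inj: "inj_on n A" 
 proof (rule inj_onI)
  fix x y assume "x \<in> A" "y \<in> A" "n x = n y"
  then show "x = y" using n[of x] n[of y] by (simp add: Finite_Cartesian_Product.vec_eq_iff)
 qed
 have trm: "expdec c l = (\<Prod>i\<in>UNIV. q ^ nat \<bar>n l i\<bar>)" if "l \<in> A" for l
 proof -
  have "expdec c l = exp (\<Sum>i\<in>UNIV. - c * \<bar>l $ i\<bar>)" by (simp add: sum_distrib_left)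
  also have "\<dots> = (\<Prod>i\<in>UNIV. exp (- c * \<bar>l $ i\<bar>))" by (rule exp_sum) simp
  also have "\<dots> = (\<Prod>i\<in>UNIV. q ^ nat \<bar>n l i\<bar>)"
  proof (rule prod.cong[OF refl])
   fix i
   have "- c * \<bar>l $ i\<bar> = real (nat \<bar>n l i\<bar>) * (- c * \<Delta>)"
    unfolding n[OF that] using \<Delta> by (simp add: abs_mult)
   then show "exp (- c * \<bar>l $ i\<bar>) = q ^ nat \<bar>n l i\<bar>" unfolding q_def by (simp only: exp_of_nat_mult)
  qed
  finally show ?thesis .
 qed
 have "(\<Sum>l\<in>A. expdec c l) = (\<Sum>g\<in>n ` A. \<Prod>i\<in>UNIV. q ^ nat \<bar>g i\<bar>)"
  using inj trm by (simp add: sum.reindex)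
 also have "\<dots> \<le> (\<Sum>g\<in>PiE (UNIV::'d set) (\<lambda>_. {-int m..int m}). \<Prod>i\<in>UNIV. q ^ nat \<bar>g i\<bar>)"
 proof (rule sum_mono2)
  show "n ` A \<subseteq> PiE (UNIV::'d set) (\<lambda>_. {-int m..int m})" 
  proof
   fix g assume "g \<in> n ` A"
   then obtain l where l: "l \<in> A" "g = n l" by blast
   have "n l i \<in> {-int m..int m}" for i using m[OF l(1), of i] by auto
   then show "g \<in> PiE (UNIV::'d set) (\<lambda>_. {-int m..int m})" unfolding l(2) by (auto simp: PiE_UNIV_domain)
  qed
 qed (use q in \<open>auto intro!: prod_nonneg finite_PiE\<close>)
 also have "\<dots> = (\<Prod>i\<in>(UNIV::'d set). \<Sum>k\<in>{-int m..int m}. q ^ nat \<bar>k\<bar>)"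
  by (rule prod_sum_PiE[symmetric]) auto
 also have "\<dots> \<le> (\<Prod>i\<in>(UNIV::'d set). 2 / (1 - q))"
  using sum_geometric_int_le[OF q] q by (intro prod_mono) (auto intro!: sum_nonneg)
 finally show ?thesis by (simp add: q_def)
qed

context centered_levy_basis
begin

text \<open>Of the three pairings of \<open>has_int_mult4\<close>, the one inside the two products
  cancels against the product of their means; the two cross pairings remain.\<close>

lemma has_int_product_covariance:
 assumes f: "has_int f1 X1" "has_int f2 X2" "has_int f3 X3" "has_int f4 X4"
 shows "expectation (\<lambda>w. (X1 w * X2 w - expectation (\<lambda>w. X1 w * X2 w)) * (X3 w * X4 w - expectation (\<lambda>w. X3 w * X4 w)))
  = c4 * (LBINT s. (f1 s * f2 s) * (f3 s * f4 s))
   + k2^2 * ((LBINT s. f1 s * f3 s) * (LBINT s. f2 s * f4 s)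
    + (LBINT s. f1 s * f4 s) * (LBINT s. f2 s * f3 s))"
proof -
 define A where "A w = X1 w * X2 w" for w
 define C where "C w = X3 w * X4 w" for w
 note L = f[THEN has_intD(2)]
 have AC: "integrable M (\<lambda>w. A w * C w)" unfolding A_def C_def using L24_mult4[OF L] by (simp add: mult.assoc)
 have A: "integrable M A" and C: "integrable M C" unfolding A_def C_def using L24_mult2[OF L(1,2)] L24_mult2[OF L(3,4)] by auto
 have "expectation (\<lambda>w. (A w - expectation A) * (C w - expectation C)) = expectation (\<lambda>w. A w * C w - expectation A * C w - expectation C * A w + expectation A * expectation C)"
  by (rule Bochner_Integration.integral_cong) (auto simp: algebra_simps)
 also have "\<dots> = expectation (\<lambda>w. A w * C w) - expectation A * expectation C"
  using AC A C by (simp add: prob_space)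
 also have "\<dots> = c4 * (LBINT s. (f1 s * f2 s) * (f3 s * f4 s))
   + k2^2 * ((LBINT s. f1 s * f3 s) * (LBINT s. f2 s * f4 s)
    + (LBINT s. f1 s * f4 s) * (LBINT s. f2 s * f3 s))"
  using has_int_mult4[OF f] unfolding A_def C_def has_int_mult2[OF f(1,2)] has_int_mult2[OF f(3,4)]
  by (simp add: mult.assoc power2_eq_square distrib_left)
 finally show ?thesis unfolding A_def C_def .
qed

definition cov_const :: "real \<Rightarrow> real" where
 "cov_const c = \<bar>c4\<bar> * decay_mass TYPE('d) c + 2 * k2^2 * (decay_mass TYPE('d) c)^2"

text \<open>The sizes \<open>a1\<close> and \<open>a3\<close> stay explicit while the other two
  kernels share B: when the first kernels are truncation errors, the bound is quadratic in those
  errors. Each term contains an integral of a factor centred at x against one centred at y, whence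
  the decay in x - y.\<close>

lemma product_covariance_bound:
 assumes f: "has_int f1 X1" "has_int f2 X2" "has_int f3 X3" "has_int f4 X4" and c: "0 < c"
  and d: "decays c a1 x f1" "decays c B x f2" "decays c a3 y f3" "decays c B y f4"
 shows "\<bar>expectation (\<lambda>w. (X1 w * X2 w - expectation (\<lambda>w. X1 w * X2 w)) * (X3 w * X4 w - expectation (\<lambda>w. X3 w * X4 w)))\<bar>
  \<le> a1 * a3 * B^2 * cov_const c * expdec (c/2) (x - y)"
proof -
 define J where "J = decay_mass TYPE('d) c"
 define e where "e = expdec (c/2) (x - y)"
 have J: "0 \<le> J" unfolding J_def decay_mass_def by (rule integral_nonneg_AE) simp
 have e: "0 \<le> e" "e \<le> 1" unfolding e_def using expdec_bounds(1)[of "c/2" "x - y"] c by simp_all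
 note nn = d[THEN decaysD(3)]
 have 2: "\<bar>\<integral>s. f s * h s \<partial>lborel\<bar> \<le> a * b * J * e" if "decays c a x f" "decays c b y h" for f h a b
  using decays_integral_mult[OF that c] unfolding J_def e_def by (simp add: mult_ac)
 have 1: "\<bar>\<integral>s. f s * h s \<partial>lborel\<bar> \<le> a * b * J" if "decays c a x f" "decays c b y h" for f h a b
 proof -
  have "a * b * J * e \<le> a * b * J * 1" using e J that[THEN decaysD(3)] by (intro mult_left_mono) auto
  then show ?thesis using 2[OF that] by simp
 qed
 have 4: "\<bar>\<integral>s. (f1 s * f2 s) * (f3 s * f4 s) \<partial>lborel\<bar> \<le> (a1 * B) * (a3 * B) * J * e"
  by (rule 2[OF decays_mult[OF d(1,2)] decays_mult[OF d(3,4)]]) (use c in auto)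
 have p: "\<bar>(LBINT s. f1 s * f3 s) * (LBINT s. f2 s * f4 s)\<bar> \<le> (a1 * a3 * J * e) * (B * B * J)"
  unfolding abs_mult by (intro mult_mono 2 1 d) (use nn J e in auto)
 have "\<bar>\<integral>s. f2 s * f3 s \<partial>lborel\<bar> \<le> B * a3 * J" by (rule 1[OF d(2,3)])
 then have q: "\<bar>(LBINT s. f1 s * f4 s) * (LBINT s. f2 s * f3 s)\<bar> \<le> (a1 * B * J * e) * (B * a3 * J)"
  unfolding abs_mult by (intro mult_mono 2 d) (use nn J e in auto)
 have m1: "\<bar>c4 * (LBINT s. (f1 s * f2 s) * (f3 s * f4 s))\<bar> \<le> \<bar>c4\<bar> * ((a1 * B) * (a3 * B) * J * e)"
  unfolding abs_mult by (rule mult_left_mono[OF 4]) simp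
 have m2: "\<bar>k2^2 * ((LBINT s. f1 s * f3 s) * (LBINT s. f2 s * f4 s) + (LBINT s. f1 s * f4 s) * (LBINT s. f2 s * f3 s))\<bar>
   \<le> k2^2 * ((a1 * a3 * J * e) * (B * B * J) + (a1 * B * J * e) * (B * a3 * J))"
  unfolding abs_mult using p q by (intro mult_mono order_trans[OF abs_triangle_ineq] add_mono) auto
 have m3: "\<bar>c4\<bar> * ((a1 * B) * (a3 * B) * J * e) + k2^2 * ((a1 * a3 * J * e) * (B * B * J) + (a1 * B * J * e) * (B * a3 * J))
   = a1 * a3 * B^2 * cov_const c * e"
  unfolding cov_const_def J_def[symmetric] by (simp add: power2_eq_square algebra_simps)
 show ?thesis unfolding has_int_product_covariance[OF f] e_def[symmetric]
  by (rule order_trans[OF abs_triangle_ineq order_trans[OF add_mono[OF m1 m2] eq_refl[OF m3]]])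
qed

lemma cov_const_nonneg: "0 \<le> cov_const c"
proof -
 have "0 \<le> decay_mass TYPE('d) c" unfolding decay_mass_def by (rule integral_nonneg_AE) simp
 then show ?thesis unfolding cov_const_def by simp
qed

definition var_const :: "real \<Rightarrow> real \<Rightarrow> real" where
 "var_const \<Delta> c = cov_const c * (2 / (1 - exp (- (c/2) * \<Delta>)))^CARD('d)"

text \<open>A Schur test: \<open>\<delta> x * \<delta> y\<close> is at most half the sum of the
  squares, and every row sum of the decay matrix is at most the lattice constant. The cost is thus a
  sum of squared sizes, with no factor for the number of pairs.\<close>

lemma product_sum_variance_bound:
 fixes A :: "(real^'d) set"
 assumes f: "\<And>x. x \<in> A \<Longrightarrow> has_int (f x) (X x)" "\<And>x. x \<in> A \<Longrightarrow> has_int (h x) (Z x)" and c: "0 < c" and \<Delta>: "0 < \<Delta>"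
  and d: "\<And>x. x \<in> A \<Longrightarrow> decays c (\<delta> x) x (f x)" "\<And>x. x \<in> A \<Longrightarrow> decays c B x (h x)"
  and A: "finite A" "A \<subseteq> lattice_pts \<Delta>"
 shows "expectation (\<lambda>w. (\<Sum>x\<in>A. X x w * Z x w - expectation (\<lambda>w. X x w * Z x w))^2)
  \<le> B^2 * var_const \<Delta> c * (\<Sum>x\<in>A. (\<delta> x)^2)"
proof -
 define P where "P x w = X x w * Z x w - expectation (\<lambda>w. X x w * Z x w)" for x w
 define R where "R = (2 / (1 - exp (- (c/2) * \<Delta>)))^CARD('d)"
 define K where "K = B^2 * cov_const c"
 have K: "0 \<le> K" unfolding K_def using cov_const_nonneg by simp
 have PP: "integrable M (\<lambda>w. P x w * P y w)" if "x \<in> A" "y \<in> A" for x y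
 proof (rule sq_integrable_mult)
  have "integrable M (\<lambda>w. (P x w)^2)" "P x \<in> borel_measurable M" if "x \<in> A" for x
  proof -
   note L = has_intD(2)[OF f(1)[OF that]] has_intD(2)[OF f(2)[OF that]]
   note [measurable] = L24D(1)[OF L(1)] L24D(1)[OF L(2)]
   show "P x \<in> borel_measurable M" unfolding P_def by measurable
   show "integrable M (\<lambda>w. (P x w)^2)"
    unfolding P_def power2_diff using L24_mult_sq[OF L] L24_mult2[OF L] by simp
  qed
  then show "P x \<in> borel_measurable M" "P y \<in> borel_measurable M" "integrable M (\<lambda>w. (P x w)^2)" "integrable M (\<lambda>w. (P y w)^2)"
   using that by auto
 qed
 have R: "(\<Sum>y\<in>A. expdec (c/2) (x - y)) \<le> R" if "x \<in> A" for x
 proof -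
  have inj: "inj_on (\<lambda>y. x - y) A" by (auto simp: inj_on_def)
  have "(\<Sum>y\<in>A. expdec (c/2) (x - y)) = (\<Sum>l\<in>(\<lambda>y. x - y) ` A. expdec (c/2) l)" using inj by (simp add: sum.reindex)
  also have "\<dots> \<le> R" unfolding R_def by (rule lattice_sum_expdec_bound) (use c \<Delta> A that in \<open>auto intro!: lattice_pts_closed(1)\<close>)
  finally show ?thesis .
 qed
 have cov: "expectation (\<lambda>w. P x w * P y w) \<le> K * (((\<delta> x)^2 + (\<delta> y)^2) / 2 * expdec (c/2) (x - y))" if "x \<in> A" "y \<in> A" for x y
 proof -
  have "expectation (\<lambda>w. P x w * P y w) \<le> \<delta> x * \<delta> y * B^2 * cov_const c * expdec (c/2) (x - y)"
   unfolding P_def by (rule order_trans[OF abs_ge_self product_covariance_bound]) (use f d c that in auto)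
  also have "\<dots> = K * (\<delta> x * \<delta> y * expdec (c/2) (x - y))" unfolding K_def by simp
  also have "\<dots> \<le> K * (((\<delta> x)^2 + (\<delta> y)^2) / 2 * expdec (c/2) (x - y))"
   using K sum_squares_bound[of "\<delta> x" "\<delta> y"] by (intro mult_left_mono mult_right_mono) auto
  finally show ?thesis .
 qed
 have "expectation (\<lambda>w. (\<Sum>x\<in>A. P x w)^2) = (\<Sum>x\<in>A. \<Sum>y\<in>A. expectation (\<lambda>w. P x w * P y w))"
  unfolding power2_eq_square sum_product using PP by (simp add: Bochner_Integration.integral_sum)
 also have "\<dots> \<le> (\<Sum>x\<in>A. \<Sum>y\<in>A. K * (((\<delta> x)^2 + (\<delta> y)^2) / 2 * expdec (c/2) (x - y)))"
  by (intro sum_mono cov)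
 also have "\<dots> = K * ((\<Sum>x\<in>A. \<Sum>y\<in>A. (\<delta> x)^2 / 2 * expdec (c/2) (x - y)) + (\<Sum>x\<in>A. \<Sum>y\<in>A. (\<delta> y)^2 / 2 * expdec (c/2) (x - y)))"
  by (simp only: add_divide_distrib distrib_right sum.distrib distrib_left sum_distrib_left)
 also have "(\<Sum>x\<in>A. \<Sum>y\<in>A. (\<delta> y)^2 / 2 * expdec (c/2) (x - y)) = (\<Sum>x\<in>A. \<Sum>y\<in>A. (\<delta> x)^2 / 2 * expdec (c/2) (x - y))"
  by (subst sum.swap) (simp only: expdec_commute)
 also have "(\<Sum>x\<in>A. \<Sum>y\<in>A. (\<delta> x)^2 / 2 * expdec (c/2) (x - y)) \<le> (\<Sum>x\<in>A. (\<delta> x)^2 / 2 * R)"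
  unfolding sum_distrib_left[symmetric] by (intro sum_mono mult_left_mono R) auto
 finally have "expectation (\<lambda>w. (\<Sum>x\<in>A. P x w)^2) \<le> K * ((\<Sum>x\<in>A. (\<delta> x)^2 / 2 * R) + (\<Sum>x\<in>A. (\<delta> x)^2 / 2 * R))"
  using K by (simp add: mult_left_mono)
 also have "\<dots> = B^2 * var_const \<Delta> c * (\<Sum>x\<in>A. (\<delta> x)^2)"
  unfolding K_def var_const_def R_def[symmetric] sum_divide_distrib[symmetric] sum_distrib_right[symmetric] by simp
 finally show ?thesis unfolding P_def .
qed

end

section \<open>Counting pairs of observation points with a given lag\<close>

lemma card_interval_shift:
 "card {n \<in> {1..int N}. n + k \<in> {1..int N}} = nat (int N - \<bar>k\<bar>)"
proof -
 have "{n \<in> {1..int N}. n + k \<in> {1..int N}} = {max 1 (1 - k)..min (int N) (int N - k)}" by auto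
 then show ?thesis by (auto simp: max_def min_def)
qed

lemma lag_pts_image:
 fixes k :: "'d::finite \<Rightarrow> int"
 assumes \<Delta>: "0 < \<Delta>" and t: "\<And>i. t $ i = \<Delta> * of_int (k i)"
 shows "lag_pts \<Delta> N t = (\<lambda>n. \<chi> i. \<Delta> * of_int (n i)) ` PiE UNIV (\<lambda>i. {n \<in> {1..int N}. n + k i \<in> {1..int N}})"
proof -
 have obs: "(\<chi> i. \<Delta> * of_int (n i)) \<in> obs_pts \<Delta> N \<longleftrightarrow> (\<forall>i. n i \<in> {1..int N})" for n :: "'d \<Rightarrow> int"
 proof -
  have "(\<exists>j\<in>{1..N}. \<Delta> * real_of_int (n i) = \<Delta> * real j) \<longleftrightarrow> n i \<in> {1..int N}" for i
  proof
   assume "\<exists>j\<in>{1..N}. \<Delta> * real_of_int (n i) = \<Delta> * real j"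
   then obtain j where "j \<in> {1..N}" "real_of_int (n i) = real j" using \<Delta> by auto
   moreover from this(2) have "n i = int j" by linarith
   ultimately show "n i \<in> {1..int N}" by auto
  next
   assume "n i \<in> {1..int N}"
   then show "\<exists>j\<in>{1..N}. \<Delta> * real_of_int (n i) = \<Delta> * real j" by (intro bexI[of _ "nat (n i)"]) auto
  qed
  then show ?thesis unfolding obs_pts_def by simp
 qed
 have shift: "(\<chi> i. \<Delta> * of_int (n i)) + t = (\<chi> i. \<Delta> * of_int (n i + k i))" for n
  by (simp add: Finite_Cartesian_Product.vec_eq_iff t distrib_left)
 show ?thesis
 proof (intro equalityI subsetI)
  fix s assume s: "s \<in> lag_pts \<Delta> N t"
  then obtain n where "\<And>i. s $ i = \<Delta> * of_int (n i)" unfolding lag_pts_def lattice_pts_def by (auto simp: choice_iff)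
  then have sn: "s = (\<chi> i. \<Delta> * of_int (n i))" by (simp add: Finite_Cartesian_Product.vec_eq_iff)
  have "n \<in> PiE UNIV (\<lambda>i. {n \<in> {1..int N}. n + k i \<in> {1..int N}})"
   using s unfolding sn by (auto simp: PiE_UNIV_domain lag_pts_def shift obs simp del: of_int_add)
  then show "s \<in> (\<lambda>n. \<chi> i. \<Delta> * of_int (n i)) ` PiE UNIV (\<lambda>i. {n \<in> {1..int N}. n + k i \<in> {1..int N}})" using sn by blast
 next
  fix s assume "s \<in> (\<lambda>n. \<chi> i. \<Delta> * of_int (n i)) ` PiE UNIV (\<lambda>i. {n \<in> {1..int N}. n + k i \<in> {1..int N}})"
  then obtain n where n: "s = (\<chi> i. \<Delta> * of_int (n i))" "\<And>i. n i \<in> {1..int N}" "\<And>i. n i + k i \<in> {1..int N}"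
   by (auto simp: PiE_UNIV_domain)
  show "s \<in> lag_pts \<Delta> N t"
   using n(2,3) unfolding lag_pts_def n(1) mem_Collect_eq shift by (auto simp: obs lattice_pts_def simp del: of_int_add)
 qed
qed

lemma card_lag_pts:
 fixes k :: "'d::finite \<Rightarrow> int"
 assumes \<Delta>: "0 < \<Delta>" and t: "\<And>i. t $ i = \<Delta> * of_int (k i)"
 shows "finite (lag_pts \<Delta> N t)" "card (lag_pts \<Delta> N t) = (\<Prod>i\<in>UNIV. nat (int N - \<bar>k i\<bar>))"
proof -
 have inj: "inj_on (\<lambda>n. (\<chi> i. \<Delta> * of_int (n i)) :: real^'d) A" for A :: "('d \<Rightarrow> int) set"
  using \<Delta> by (auto simp: inj_on_def Finite_Cartesian_Product.vec_eq_iff)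
 have fin: "finite {n \<in> {1..int N}. n + k i \<in> {1..int N}}" for i by (rule finite_subset[of _ "{1..int N}"]) auto
 show "finite (lag_pts \<Delta> N t)" unfolding lag_pts_image[OF assms] by (intro finite_imageI finite_PiE fin) simp
 show "card (lag_pts \<Delta> N t) = (\<Prod>i\<in>UNIV. nat (int N - \<bar>k i\<bar>))"
  unfolding lag_pts_image[OF assms] card_image[OF inj] by (subst card_PiE) (simp_all only: card_interval_shift finite)
qed

lemma lattice_pts_obtain:
 assumes "t \<in> lattice_pts \<Delta>"
 obtains k where "\<And>i. t $ i = \<Delta> * of_int (k i)"
 using assms unfolding lattice_pts_def by (auto simp: choice_iff)

lemma obs_pts_lattice: "obs_pts \<Delta> N \<subseteq> lattice_pts \<Delta>"
proof
 fix s assume s: "s \<in> obs_pts \<Delta> N"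
 have "\<exists>k::int. s $ i = \<Delta> * of_int k" for i
 proof -
  obtain j :: nat where "s $ i = \<Delta> * of_nat j" using s unfolding obs_pts_def by blast
  then show ?thesis by (intro exI[of _ "int j"]) simp
 qed
 then show "s \<in> lattice_pts \<Delta>" unfolding lattice_pts_def by blast
qed

lemma lag_pts_zero: "lag_pts \<Delta> N 0 = obs_pts \<Delta> N"
 using obs_pts_lattice[of \<Delta> N] unfolding lag_pts_def by auto

lemma obs_pts_finite_card:
 assumes "0 < \<Delta>"
 shows "finite (obs_pts \<Delta> N :: (real^'d) set)" "card (obs_pts \<Delta> N :: (real^'d) set) = N ^ CARD('d)"
 using card_lag_pts[OF assms, of "0 :: real^'d" "\<lambda>_. 0" N] unfolding lag_pts_zero by simp_all

lemma lag_pts_subset: "lag_pts \<Delta> N t \<subseteq> obs_pts \<Delta> N" "s \<in> lag_pts \<Delta> N t \<Longrightarrow> s + t \<in> obs_pts \<Delta> N"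
 unfolding lag_pts_def by auto

lemma lag_pts_finite: "0 < \<Delta> \<Longrightarrow> finite (lag_pts \<Delta> N t)"
 using finite_subset[OF lag_pts_subset(1) obs_pts_finite_card(1)] .

lemma lag_pts_mono:
 assumes "N \<le> N'"
 shows "lag_pts \<Delta> N t \<subseteq> lag_pts \<Delta> N' t"
proof -
 have "obs_pts \<Delta> N \<subseteq> obs_pts \<Delta> N'" using assms unfolding obs_pts_def by fastforce
 then show ?thesis unfolding lag_pts_def by auto
qed

lemma card_lag_pts_limit:
 fixes t :: "real^'d"
 assumes \<Delta>: "0 < \<Delta>" and t: "t \<in> lattice_pts \<Delta>"
 shows "(\<lambda>N. real (card (lag_pts \<Delta> N t)) / real N ^ CARD('d)) \<longlonglongrightarrow> 1"
proof -
 obtain k where k: "\<And>i. t $ i = \<Delta> * of_int (k i)" using lattice_pts_obtain[OF t] by blast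
 have 1: "(\<lambda>N. real (nat (int N - \<bar>j\<bar>)) / real N) \<longlonglongrightarrow> 1" for j :: int
 proof (rule Lim_transform_eventually)
  show "(\<lambda>N. 1 - real_of_int \<bar>j\<bar> / real N) \<longlonglongrightarrow> 1" by real_asymp
  show "\<forall>\<^sub>F N in sequentially. 1 - real_of_int \<bar>j\<bar> / real N = real (nat (int N - \<bar>j\<bar>)) / real N"
   using eventually_ge_at_top[of "Suc (nat \<bar>j\<bar>)"] by eventually_elim (auto simp: field_simps of_nat_diff)
 qed
 have "(\<lambda>N. \<Prod>i\<in>UNIV. real (nat (int N - \<bar>k i\<bar>)) / real N) \<longlonglongrightarrow> (\<Prod>i\<in>(UNIV::'d set). 1)"
  by (intro tendsto_prod 1)
 then show ?thesis unfolding card_lag_pts(2)[OF \<Delta> k] by (simp add: prod_dividef)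
qed

lemma card_boundary_limit:
 fixes t :: "real^'d"
 assumes \<Delta>: "0 < \<Delta>" and t: "t \<in> lattice_pts \<Delta>"
 shows "(\<lambda>N. real (card (obs_pts \<Delta> N - lag_pts \<Delta> N t)) / real N ^ CARD('d)) \<longlonglongrightarrow> 0"
  "(\<lambda>N. real (card (obs_pts \<Delta> N - (\<lambda>s. s + t) ` lag_pts \<Delta> N t)) / real N ^ CARD('d)) \<longlonglongrightarrow> 0"
proof -
 note fin = obs_pts_finite_card(1)[OF \<Delta>, where 'd='d]
 have *: "(\<lambda>N. real (card (obs_pts \<Delta> N - D N)) / real N ^ CARD('d)) \<longlonglongrightarrow> 0"
  if D: "\<And>N. D N \<subseteq> obs_pts \<Delta> N" "\<And>N. card (D N) = card (lag_pts \<Delta> N t)" for D :: "nat \<Rightarrow> (real^'d) set"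
 proof (rule Lim_transform_eventually)
  show "(\<lambda>N. 1 - real (card (lag_pts \<Delta> N t)) / real N ^ CARD('d)) \<longlonglongrightarrow> 0"
   using tendsto_diff[OF tendsto_const card_lag_pts_limit[OF \<Delta> t], of 1] by simp
  show "\<forall>\<^sub>F N in sequentially. 1 - real (card (lag_pts \<Delta> N t)) / real N ^ CARD('d) = real (card (obs_pts \<Delta> N - D N)) / real N ^ CARD('d)"
   using eventually_gt_at_top[of 0]
  proof eventually_elim
   case (elim N)
   have "card (obs_pts \<Delta> N - D N) = card (obs_pts \<Delta> N :: (real^'d) set) - card (D N)"
    using D(1) by (intro card_Diff_subset finite_subset[OF D(1) fin])
   moreover have "card (D N) \<le> card (obs_pts \<Delta> N :: (real^'d) set)" by (rule card_mono[OF fin D(1)])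
   ultimately show ?case using elim D(2) obs_pts_finite_card(2)[OF \<Delta>, where 'd='d, of N]
    by (simp add: of_nat_diff field_simps)
  qed
 qed
 show "(\<lambda>N. real (card (obs_pts \<Delta> N - lag_pts \<Delta> N t)) / real N ^ CARD('d)) \<longlonglongrightarrow> 0"
  by (rule *) (use lag_pts_subset in auto)
 show "(\<lambda>N. real (card (obs_pts \<Delta> N - (\<lambda>s. s + t) ` lag_pts \<Delta> N t)) / real N ^ CARD('d)) \<longlonglongrightarrow> 0"
  by (rule *) (use lag_pts_subset in \<open>auto simp: card_image\<close>)
qed

text \<open>The number of pairs with difference l is the size of the lag window of l. Writing the
  result as an integral over the whole lattice makes dominated convergence available as N
  grows.\<close>

lemma sum_differences:
 fixes \<rho> :: "real^'d \<Rightarrow> real"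
 assumes \<Delta>: "0 < \<Delta>"
 shows "(\<Sum>x\<in>obs_pts \<Delta> N. \<Sum>y\<in>obs_pts \<Delta> N. \<rho> (y - x))
  = (\<integral>l. \<rho> l * real (card (lag_pts \<Delta> N l)) \<partial>count_space (lattice_pts \<Delta>))"
proof -
 define Ob where "Ob = (obs_pts \<Delta> N :: (real^'d) set)"
 note fin = obs_pts_finite_card(1)[OF \<Delta>, where 'd='d, of N, folded Ob_def]
 have Ob: "Ob \<subseteq> lattice_pts \<Delta>" unfolding Ob_def by (rule obs_pts_lattice)
 define D where "D = (\<lambda>(x, y). y - x) ` (Ob \<times> Ob)"
 have D: "finite D" "D \<subseteq> lattice_pts \<Delta>" unfolding D_def using fin Ob by (auto intro!: lattice_pts_closed(1))
 have card: "card {p \<in> Ob \<times> Ob. (case p of (x, y) \<Rightarrow> y - x) = l} = card (lag_pts \<Delta> N l)" for l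
 proof -
  have "lag_pts \<Delta> N l = fst ` {p \<in> Ob \<times> Ob. (case p of (x, y) \<Rightarrow> y - x) = l}"
  proof (intro equalityI subsetI)
   fix x assume "x \<in> lag_pts \<Delta> N l"
   then show "x \<in> fst ` {p \<in> Ob \<times> Ob. (case p of (x, y) \<Rightarrow> y - x) = l}"
    unfolding lag_pts_def Ob_def by (intro image_eqI[of _ _ "(x, x + l)"]) auto
  next
   fix x assume "x \<in> fst ` {p \<in> Ob \<times> Ob. (case p of (x, y) \<Rightarrow> y - x) = l}"
   then show "x \<in> lag_pts \<Delta> N l" using Ob unfolding lag_pts_def Ob_def by (auto simp: algebra_simps)
  qed
  moreover have "inj_on fst {p \<in> Ob \<times> Ob. (case p of (x, y) \<Rightarrow> y - x) = l}"
   by (auto simp: inj_on_def algebra_simps)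
  ultimately show ?thesis by (simp add: card_image)
 qed
 have zero: "card (lag_pts \<Delta> N l) = 0" if "l \<notin> D" for l
 proof -
  have "lag_pts \<Delta> N l = {}"
  proof (rule ccontr)
   assume "lag_pts \<Delta> N l \<noteq> {}"
   then obtain x where "x \<in> Ob" "x + l \<in> Ob" unfolding lag_pts_def Ob_def by auto
   then have "l \<in> D" unfolding D_def by (intro image_eqI[of _ _ "(x, x + l)"]) auto
   then show False using that by simp
  qed
  then show ?thesis by simp
 qed
 have "(\<Sum>x\<in>Ob. \<Sum>y\<in>Ob. \<rho> (y - x)) = (\<Sum>p\<in>Ob \<times> Ob. \<rho> (case p of (x, y) \<Rightarrow> y - x))"
  by (simp add: sum.cartesian_product split_beta)
 also have "\<dots> = (\<Sum>l\<in>D. \<Sum>p\<in>{p \<in> Ob \<times> Ob. (case p of (x, y) \<Rightarrow> y - x) = l}. \<rho> (case p of (x, y) \<Rightarrow> y - x))"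
  unfolding D_def by (rule sum.image_gen) (use fin in simp)
 also have "\<dots> = (\<Sum>l\<in>D. \<rho> l * real (card (lag_pts \<Delta> N l)))"
 proof (rule sum.cong[OF refl])
  fix l
  have "(\<Sum>p\<in>{p \<in> Ob \<times> Ob. (case p of (x, y) \<Rightarrow> y - x) = l}. \<rho> (case p of (x, y) \<Rightarrow> y - x)) = (\<Sum>p\<in>{p \<in> Ob \<times> Ob. (case p of (x, y) \<Rightarrow> y - x) = l}. \<rho> l)"
   by (rule sum.cong) auto
  then show "(\<Sum>p\<in>{p \<in> Ob \<times> Ob. (case p of (x, y) \<Rightarrow> y - x) = l}. \<rho> (case p of (x, y) \<Rightarrow> y - x)) = \<rho> l * real (card (lag_pts \<Delta> N l))"
   by (simp add: card mult.commute)
 qed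
 also have "\<dots> = infsetsum (\<lambda>l. \<rho> l * real (card (lag_pts \<Delta> N l))) D" using D by simp
 also have "\<dots> = infsetsum (\<lambda>l. \<rho> l * real (card (lag_pts \<Delta> N l))) (lattice_pts \<Delta>)"
  by (rule infsetsum_cong_neutral) (use D zero in auto)
 finally show ?thesis unfolding infsetsum_def Ob_def .
qed

lemma decays_translate:
 assumes "decays c B 0 h"
 shows "decays c B x (\<lambda>s. h (x - s))"
 unfolding decays_def
proof (intro conjI allI)
 show "(\<lambda>s. h (x - s)) \<in> borel_measurable borel" using decaysD(1)[OF assms] by measurable
 have "expdec c (0 - (x - s)) = expdec c (x - s)" for s by (simp add: abs_minus_commute)
 then show "\<bar>h (x - s)\<bar> \<le> B * expdec c (x - s)" for s using decaysD(2)[OF assms, of "x - s"] by metis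
qed

text \<open>The two factors may have different kernels: in the central limit theorem for the
  variogram the second kernel is a linear combination of translates of the first.\<close>

locale product_field = centered_levy_basis M \<Lambda> \<beta> \<sigma> \<nu>
 for M :: "'w measure" and \<Lambda> :: "(real^'d) set \<Rightarrow> 'w \<Rightarrow> real" and \<beta> \<sigma> \<nu> +
 fixes f f' :: "real^'d \<Rightarrow> real" and X X' :: "real^'d \<Rightarrow> 'w \<Rightarrow> real" and c B \<Delta> :: real
 assumes c_pos: "0 < c" and \<Delta>_pos: "0 < \<Delta>"
  and f_decays: "decays c B 0 f" and f'_decays: "decays c B 0 f'"
  and X_int: "\<And>x. has_int (\<lambda>s. f (x - s)) (X x)" and X'_int: "\<And>x. has_int (\<lambda>s. f' (x - s)) (X' x)"
begin

definition P :: "real^'d \<Rightarrow> 'w \<Rightarrow> real" where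
 "P x w = X x w * X' x w - expectation (\<lambda>w. X x w * X' x w)"

definition rho :: "real^'d \<Rightarrow> real" where
 "rho l = expectation (\<lambda>w. P 0 w * P l w)"

lemma P_measurable[measurable]: "P x \<in> borel_measurable M"
proof -
 note [measurable] = L24D(1)[OF has_intD(2)[OF X_int[of x]]] L24D(1)[OF has_intD(2)[OF X'_int[of x]]]
 show ?thesis unfolding P_def by measurable
qed

lemma P_sq_integrable: "integrable M (\<lambda>w. (P x w)^2)"
 unfolding P_def power2_diff
 using L24_mult_sq[OF has_intD(2)[OF X_int[of x]] has_intD(2)[OF X'_int[of x]]]
  L24_mult2[OF has_intD(2)[OF X_int[of x]] has_intD(2)[OF X'_int[of x]]] by simp

lemma PP_integrable: "integrable M (\<lambda>w. P x w * P y w)"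
 by (rule sq_integrable_mult) (auto intro: P_sq_integrable)

lemma covariance_P:
 "expectation (\<lambda>w. P x w * P y w) = c4 * (LBINT s. f s * f' s * f (s + (y - x)) * f' (s + (y - x)))
  + k2^2 * ((LBINT s. f s * f (s + (y - x))) * (LBINT s. f' s * f' (s + (y - x)))
   + (LBINT s. f s * f' (s + (y - x))) * (LBINT s. f' s * f (s + (y - x))))"
proof -
 note [measurable] = decaysD(1)[OF f_decays] decaysD(1)[OF f'_decays]
 have e: "x - s + (y - x) = y - s" for s by simp
 have r: "(LBINT s. h (x - s) * k (y - s)) = (LBINT s. h s * k (s + (y - x)))"
  if [measurable]: "h \<in> borel_measurable borel" "k \<in> borel_measurable borel" for h k :: "real^'d \<Rightarrow> real"
  using integral_lborel_reflect[of "\<lambda>s. h s * k (s + (y - x))" x] unfolding e by simp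
 have r4: "(LBINT s. (f (x - s) * f' (x - s)) * (f (y - s) * f' (y - s))) = (LBINT s. f s * f' s * f (s + (y - x)) * f' (s + (y - x)))"
  using r[of "\<lambda>s. f s * f' s" "\<lambda>s. f s * f' s"] by (simp add: mult.assoc)
 show ?thesis
  unfolding P_def has_int_product_covariance[OF X_int X'_int X_int X'_int] r4 by (simp add: r)
qed

lemma covariance_P_rho: "expectation (\<lambda>w. P x w * P y w) = rho (y - x)"
 unfolding rho_def covariance_P by simp

lemma rho_bound: "\<bar>rho l\<bar> \<le> B * B * B^2 * cov_const c * expdec (c/2) l"
proof -
 have "\<bar>rho l\<bar> \<le> B * B * B^2 * cov_const c * expdec (c/2) (0 - l)"
  unfolding rho_def P_def
  by (rule product_covariance_bound[OF X_int X'_int X_int X'_int c_pos])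
   (intro decays_translate f_decays f'_decays)+
 then show ?thesis by simp
qed

lemma rho_summable: "Infinite_Set_Sum.abs_summable_on rho (lattice_pts \<Delta>)"
proof (rule abs_summable_on_comparison_test)
 show "norm (rho l) \<le> norm (B * B * B^2 * cov_const c * expdec (c/2) l)" for l
  using rho_bound[of l] by (simp add: order_trans[OF _ abs_ge_self])
 have "(\<lambda>l. expdec (c/2) l) summable_on (lattice_pts \<Delta> :: (real^'d) set)"
  using lattice_sum_expdec_bound[of "c/2" \<Delta>] c_pos \<Delta>_pos
  by (intro nonneg_bdd_above_summable_on bdd_aboveI[of _ "(2 / (1 - exp (- (c/2) * \<Delta>)))^CARD('d)"]) auto
 then have "Infinite_Set_Sum.abs_summable_on (expdec (c/2)) (lattice_pts \<Delta> :: (real^'d) set)"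
  by (simp add: abs_summable_equivalent[symmetric])
 then show "Infinite_Set_Sum.abs_summable_on (\<lambda>l. B * B * B^2 * cov_const c * expdec (c/2) l) (lattice_pts \<Delta> :: (real^'d) set)"
  by (rule abs_summable_on_cmult_right)
qed

lemma sum_P_variance_bound:
 assumes "finite A" "A \<subseteq> lattice_pts \<Delta>"
 shows "expectation (\<lambda>w. (\<Sum>x\<in>A. P x w)^2) \<le> B^2 * var_const \<Delta> c * B^2 * real (card A)"
proof -
 have "expectation (\<lambda>w. (\<Sum>x\<in>A. P x w)^2) \<le> B^2 * var_const \<Delta> c * (\<Sum>x\<in>A. B^2)"
  unfolding P_def by (rule product_sum_variance_bound[OF X_int X'_int c_pos \<Delta>_pos])
   (intro decays_translate f_decays f'_decays assms)+
 then show ?thesis by (simp add: mult_ac)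
qed

text \<open>By stationarity the variance is the sum of \<open>rho l\<close> times the number of
  pairs at lag l. Relative to N^d this number is at most 1 and tends to 1 for each fixed lag, so
  summability of \<open>rho\<close> gives the limit.\<close>

lemma sum_P_variance_limit:
 "(\<lambda>N. expectation (\<lambda>z. (\<Sum>x\<in>obs_pts \<Delta> N. P x z)^2) / real N ^ CARD('d)) \<longlonglongrightarrow> (\<Sum>\<^sub>\<infinity>l\<in>lattice_pts \<Delta>. rho l)"
proof -
 have var: "expectation (\<lambda>z. (\<Sum>x\<in>obs_pts \<Delta> N. P x z)^2) / real N ^ CARD('d)
   = (\<integral>l. rho l * (real (card (lag_pts \<Delta> N l)) / real N ^ CARD('d)) \<partial>count_space (lattice_pts \<Delta>))" for N
 proof -
  have "expectation (\<lambda>z. (\<Sum>x\<in>obs_pts \<Delta> N. P x z)^2) = (\<Sum>x\<in>obs_pts \<Delta> N. \<Sum>y\<in>obs_pts \<Delta> N. rho (y - x))"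
   unfolding power2_eq_square sum_product using PP_integrable by (simp add: Bochner_Integration.integral_sum covariance_P_rho)
  then show ?thesis unfolding sum_differences[OF \<Delta>_pos] by simp
 qed
 have "(\<lambda>N. \<integral>l. rho l * (real (card (lag_pts \<Delta> N l)) / real N ^ CARD('d)) \<partial>count_space (lattice_pts \<Delta>))
   \<longlonglongrightarrow> (\<integral>l. rho l * 1 \<partial>count_space (lattice_pts \<Delta>))"
 proof (rule integral_dominated_convergence[where w="\<lambda>l. \<bar>rho l\<bar>"])
  show "integrable (count_space (lattice_pts \<Delta>)) (\<lambda>l. \<bar>rho l\<bar>)"
   using rho_summable unfolding abs_summable_on_def by auto
  show "AE l in count_space (lattice_pts \<Delta>). (\<lambda>N. rho l * (real (card (lag_pts \<Delta> N l)) / real N ^ CARD('d))) \<longlonglongrightarrow> rho l * 1"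
   unfolding AE_count_space by (intro ballI tendsto_mult tendsto_const card_lag_pts_limit[OF \<Delta>_pos])
  show "AE l in count_space (lattice_pts \<Delta>). norm (rho l * (real (card (lag_pts \<Delta> N l)) / real N ^ CARD('d))) \<le> \<bar>rho l\<bar>" for N
  proof (rule AE_I2)
   fix l :: "real^'d"
   have "card (lag_pts \<Delta> N l) \<le> N ^ CARD('d)"
    using card_mono[OF obs_pts_finite_card(1)[OF \<Delta>_pos] lag_pts_subset(1)[of \<Delta> N l]] obs_pts_finite_card(2)[OF \<Delta>_pos, where 'd='d, of N] by simp
   then have "real (card (lag_pts \<Delta> N l)) \<le> real N ^ CARD('d)" by (metis of_nat_le_iff of_nat_power)
   then have "real (card (lag_pts \<Delta> N l)) / real N ^ CARD('d) \<le> 1" by (cases "N = 0") (auto simp: divide_le_eq_1)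
   then show "norm (rho l * (real (card (lag_pts \<Delta> N l)) / real N ^ CARD('d))) \<le> \<bar>rho l\<bar>"
    unfolding real_norm_def abs_mult by (intro mult_left_le) auto
  qed
 qed auto
 then show ?thesis unfolding var using infsetsum_infsum[OF rho_summable] by (simp add: infsetsum_def)
qed

end

section \<open>A strong law for monotone sums of nonnegative terms\<close>

lemma (in prob_space) nonneg_monotone_slln:
 fixes T :: "nat \<Rightarrow> 'a \<Rightarrow> real"
 assumes T: "\<And>N. integrable M (T N)" "\<And>N. integrable M (\<lambda>w. (T N w)^2)" and mono: "\<And>N N' w. N \<le> N' \<Longrightarrow> T N w \<le> T N' w"
  and nonneg: "\<And>N w. 0 \<le> T N w" and d: "0 < d"
  and mean: "(\<lambda>N. expectation (T N) / real N ^ d) \<longlonglongrightarrow> m"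
  and var: "\<And>N. expectation (\<lambda>w. (T N w - expectation (T N))^2) \<le> C * real N ^ d"
 shows "AE w in M. (\<lambda>N. T N w / real N ^ d) \<longlonglongrightarrow> m"
proof -
 \<comment> \<open>The normalized deviation at side n^2: its second moment is at most C / n^(2 d),
   hence at most C / n^2, which is summable in every dimension d.\<close>
 define Z where "Z n w = (T (n^2) w - expectation (T (n^2))) / real (n^2) ^ d" for n w
 have [measurable]: "T N \<in> borel_measurable M" for N using T(1) by auto
 have Zm[measurable]: "Z n \<in> borel_measurable M" for n unfolding Z_def by measurable
 have Tc: "integrable M (\<lambda>w. (T N w - expectation (T N))^2)" for N
  unfolding power2_diff using T by simp
 have "0 \<le> C * real 1 ^ d" by (rule order_trans[OF _ var]) simp
 then have C: "0 \<le> C" by simp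
 have EZ: "(\<integral>\<^sup>+w. ennreal ((Z n w)^2) \<partial>M) \<le> ennreal (C * (1 / real n ^ 2))" for n
 proof -
  have i: "integrable M (\<lambda>w. (Z n w)^2)" unfolding Z_def power_divide using Tc by simp
  have "expectation (\<lambda>w. (Z n w)^2) = expectation (\<lambda>w. (T (n^2) w - expectation (T (n^2)))^2) / (real (n^2) ^ d)^2"
   unfolding Z_def power_divide by simp
  also have "\<dots> \<le> C * real (n^2) ^ d / (real (n^2) ^ d)^2" by (intro divide_right_mono var) simp
  also have "\<dots> \<le> C * (1 / real n ^ 2)"
  proof (cases "n = 0")
   case True
   then show ?thesis using C by (simp add: zero_power[OF d])
  next
   case False
   have "real n ^ 2 \<le> (real n ^ 2) ^ d" using False d self_le_power[of "real n ^ 2" d] by simp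
   then have "C * (1 / (real n ^ 2) ^ d) \<le> C * (1 / real n ^ 2)"
    using False C by (intro mult_left_mono divide_left_mono) auto
   then show ?thesis using False by (simp add: power2_eq_square[of "_ ^ d"])
  qed
  finally show ?thesis using nn_integral_eq_integral[OF i] by (simp add: ennreal_leI)
 qed
 have "(\<integral>\<^sup>+w. (\<Sum>n. ennreal ((Z n w)^2)) \<partial>M) = (\<Sum>n. \<integral>\<^sup>+w. ennreal ((Z n w)^2) \<partial>M)"
  by (rule nn_integral_suminf) measurable
 also have "\<dots> \<le> (\<Sum>n. ennreal (C * (1 / real n ^ 2)))" by (intro suminf_le EZ) auto
 also have "\<dots> < \<infinity>"
 proof -
  have "summable (\<lambda>n. C * (1 / real n ^ 2))"
   using inverse_power_summable[of 2, where 'a=real] by (intro summable_mult) (simp add: inverse_eq_divide)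
  then show ?thesis using C by (subst suminf_ennreal2) auto
 qed
 finally have "AE w in M. (\<Sum>n. ennreal ((Z n w)^2)) \<noteq> \<infinity>"
  by (intro nn_integral_PInf_AE) auto
 then have Z0: "AE w in M. (\<lambda>n. Z n w) \<longlonglongrightarrow> 0"
 proof eventually_elim
  case (elim w)
  have "summable (\<lambda>n. (Z n w)^2)" by (rule summable_suminf_not_top) (use elim in auto)
  then have "(\<lambda>n. (Z n w)^2) \<longlonglongrightarrow> 0" by (rule summable_LIMSEQ_zero)
  from tendsto_real_sqrt[OF this] show ?case by (simp add: tendsto_rabs_zero_iff)
 qed
 have sq: "filterlim (\<lambda>n::nat. n^2) at_top sequentially"
  by (rule filterlim_subseq) (auto simp: strict_mono_def power_strict_mono)
 have mean2: "(\<lambda>n. expectation (T (n^2)) / real (n^2) ^ d) \<longlonglongrightarrow> m"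
  by (rule filterlim_compose[OF mean sq])
 show ?thesis
  using Z0
 proof eventually_elim
  case (elim w)
  define u where "u n = T (n^2) w / real (n^2) ^ d" for n
  have u: "u \<longlonglongrightarrow> m"
   using tendsto_add[OF elim mean2] unfolding u_def Z_def by (simp add: diff_divide_distrib)
  \<comment> \<open>N lies between the squares of \<open>r N\<close> and \<open>Suc (r N)\<close>.
    Monotonicity brackets the average at N by the averages at these squares, up to powers of a ratio
    that tends to 1.\<close>
  define r where "r N = nat \<lfloor>sqrt (real N)\<rfloor>" for N :: nat
  have r: "(r N)^2 \<le> N" "N \<le> (Suc (r N))^2" for N
  proof -
   have 1: "real (r N) \<le> sqrt (real N)" unfolding r_def by simp
   have "(real (r N))^2 \<le> (sqrt (real N))^2" by (rule power_mono[OF 1]) simp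
   then show "(r N)^2 \<le> N" by (simp flip: of_nat_power)
   have 2: "sqrt (real N) \<le> real (Suc (r N))" unfolding r_def by (simp add: of_nat_nat) linarith
   have "(sqrt (real N))^2 \<le> (real (Suc (r N)))^2" by (rule power_mono[OF 2]) simp
   then have "real N \<le> real ((Suc (r N))^2)" by (simp only: of_nat_power real_sqrt_pow2 of_nat_0_le_iff)
   then show "N \<le> (Suc (r N))^2" by (simp only: of_nat_le_iff)
  qed
  have rlim: "filterlim r at_top sequentially"
   unfolding r_def by real_asymp
  have q1: "(\<lambda>n. (real (n^2) / real ((Suc n)^2)) ^ d) \<longlonglongrightarrow> 1"
  proof -
   have "(\<lambda>n. real (n^2) / real ((Suc n)^2)) \<longlonglongrightarrow> 1" by real_asymp
   from tendsto_power[OF this, of d] show ?thesis by simp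
  qed
  have q2: "(\<lambda>n. (real ((Suc n)^2) / real (n^2)) ^ d) \<longlonglongrightarrow> 1"
  proof -
   have "(\<lambda>n. real ((Suc n)^2) / real (n^2)) \<longlonglongrightarrow> 1" by real_asymp
   from tendsto_power[OF this, of d] show ?thesis by simp
  qed
  have low: "(\<lambda>N. u (r N) * (real ((r N)^2) / real ((Suc (r N))^2)) ^ d) \<longlonglongrightarrow> m"
   using filterlim_compose[OF tendsto_mult[OF u q1] rlim] by simp
  have up: "(\<lambda>N. u (Suc (r N)) * (real ((Suc (r N))^2) / real ((r N)^2)) ^ d) \<longlonglongrightarrow> m"
   using filterlim_compose[OF tendsto_mult[OF LIMSEQ_Suc[OF u] q2] rlim] by simp
  have pos: "\<forall>\<^sub>F N in sequentially. 1 \<le> r N" using rlim by (simp add: filterlim_at_top)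
  show ?case
  proof (rule tendsto_sandwich[OF _ _ low up])
   show "\<forall>\<^sub>F N in sequentially. u (r N) * (real ((r N)^2) / real ((Suc (r N))^2)) ^ d \<le> T N w / real N ^ d"
    using pos
   proof eventually_elim
    case (elim N)
    have N: "0 < N" using elim r(1)[of N] by (cases N) auto
    have "u (r N) * (real ((r N)^2) / real ((Suc (r N))^2)) ^ d = T ((r N)^2) w / real ((Suc (r N))^2) ^ d"
     unfolding u_def power_divide using elim by simp
    also have "\<dots> \<le> T N w / real N ^ d"
     by (rule frac_le[OF nonneg mono[OF r(1)]]) (use N r(2)[of N] in \<open>auto intro!: power_mono simp del: of_nat_power of_nat_Suc\<close>)
    finally show ?case .
   qed
   show "\<forall>\<^sub>F N in sequentially. T N w / real N ^ d \<le> u (Suc (r N)) * (real ((Suc (r N))^2) / real ((r N)^2)) ^ d"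
    using pos
   proof eventually_elim
    case (elim N)
    have "T N w / real N ^ d \<le> T ((Suc (r N))^2) w / real ((r N)^2) ^ d"
     by (rule frac_le[OF nonneg mono[OF r(2)]]) (use elim r(1)[of N] in \<open>auto intro!: power_mono simp del: of_nat_power\<close>)
    also have "\<dots> = u (Suc (r N)) * (real ((Suc (r N))^2) / real ((r N)^2)) ^ d"
     unfolding u_def power_divide by simp
    finally show ?case .
   qed
  qed
 qed
qed

section \<open>Truncation of the kernel to cells\<close>

lemma translate_bounded_borel:
 fixes B :: "(real^'d) set"
 assumes "B \<in> bounded_borel"
 shows "{s. s - a \<in> B} \<in> bounded_borel" "measure lborel {s. s - a \<in> B} = measure lborel B"
proof -
 have Bm[measurable]: "B \<in> sets borel" and Bb: "bounded B" using assms unfolding bounded_borel_def by auto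
 have eq: "{s. s - a \<in> B} = (+) a ` B"
 proof (intro equalityI subsetI)
  fix s assume "s \<in> {s. s - a \<in> B}"
  then show "s \<in> (+) a ` B" by (intro image_eqI[of _ _ "s - a"]) auto
 qed auto
 have m: "{s. s - a \<in> B} \<in> sets borel" by measurable
 show "{s. s - a \<in> B} \<in> bounded_borel"
  unfolding bounded_borel_def using m bounded_translation[OF Bb, of a] eq by auto
 have "measure lborel {s. s - a \<in> B} = measure (distr lborel borel ((+) a)) {s. s - a \<in> B}"
  unfolding lborel_distr_plus ..
 also have "\<dots> = measure lborel ((+) a -` {s. s - a \<in> B} \<inter> space lborel)" by (rule measure_distr) (use m in auto)
 also have "(+) a -` {s. s - a \<in> B} \<inter> space lborel = B" by auto
 finally show "measure lborel {s. s - a \<in> B} = measure lborel B" .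
qed

context centered_levy_basis
begin

lemma has_int_cong_AE:
 assumes X: "has_int f X" and Z: "Z \<in> borel_measurable M" and ae: "AE w in M. X w = Z w"
 shows "has_int f Z"
proof -
 note [measurable] = Z L24D(1)[OF has_intD(2)[OF X]]
 obtain \<phi> where \<phi>: "\<forall>n::nat. bounded_simple (\<phi> n)" "(\<lambda>n. \<integral>s. (\<phi> n s - f s)^2 \<partial>lborel) \<longlonglongrightarrow> 0"
  "(\<lambda>n. \<integral>s. (\<phi> n s - f s)^4 \<partial>lborel) \<longlonglongrightarrow> 0" "(\<lambda>n. expectation (\<lambda>w. (S (\<phi> n) w - X w)^4)) \<longlonglongrightarrow> 0"
  using X unfolding has_int_def by blast
 have "expectation (\<lambda>w. (S (\<phi> n) w - X w)^4) = expectation (\<lambda>w. (S (\<phi> n) w - Z w)^4)" for n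
 proof (rule integral_cong_AE)
  note [measurable] = L24D(1)[OF simple_integral_L24[OF \<phi>(1)[rule_format]]]
  show "(\<lambda>w. (S (\<phi> n) w - X w)^4) \<in> borel_measurable M" "(\<lambda>w. (S (\<phi> n) w - Z w)^4) \<in> borel_measurable M"
   by measurable
 qed (use ae in auto)
 moreover have "integrable M (\<lambda>w. (Z w)^p) \<longleftrightarrow> integrable M (\<lambda>w. (X w)^p)" for p
  by (rule integrable_cong_AE) (use ae in auto)
 then have "L24 M Z" using has_intD(2)[OF X] Z unfolding L24_def by simp
 ultimately show ?thesis unfolding has_int_def using has_intD(1)[OF X] \<phi> by auto
qed

lemma has_int_step:
 assumes I: "finite I" "disjoint_family_on B I" "\<And>i. i \<in> I \<Longrightarrow> B i \<in> bounded_borel"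
 shows "has_int (\<lambda>s. \<Sum>i\<in>I. a i * indicator (B i) s) (\<lambda>w. \<Sum>i\<in>I. a i * \<Lambda> (B i) w)"
proof (rule has_int_cong_AE[OF bounded_simple_has_int])
 show "bounded_simple (\<lambda>s. \<Sum>i\<in>I. a i * indicator (B i) s)" by (rule bounded_simple_step[OF I(1,3)])
 show "(\<lambda>w. \<Sum>i\<in>I. a i * \<Lambda> (B i) w) \<in> borel_measurable M"
  using basis_rv I(3) by (intro borel_measurable_sum borel_measurable_times) auto
 show "AE w in M. S (\<lambda>s. \<Sum>i\<in>I. a i * indicator (B i) s) w = (\<Sum>i\<in>I. a i * \<Lambda> (B i) w)"
  by (rule simple_integral_partition[OF I refl])
qed

text \<open>Basis values on disjoint sets are independent and have laws given by the volumes, which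
  translation preserves. Any measurable statistic \<open>\<Phi>\<close> of the values on one block
  therefore has independent copies with a common law.\<close>

lemma translated_blocks_iid:
 fixes B :: "'v \<Rightarrow> (real^'d) set" and \<tau> :: "'j \<Rightarrow> real^'d"
 assumes I: "finite I" "\<And>v. v \<in> I \<Longrightarrow> B v \<in> bounded_borel" "disjoint_family_on B I" and J: "finite J"
  and disj: "disjoint_family_on (\<lambda>p. {s. s - \<tau> (fst p) \<in> B (snd p)}) (J \<times> I)"
  and \<Phi>[measurable]: "\<Phi> \<in> borel_measurable (PiM I (\<lambda>_. borel))"
 shows "indep_vars (\<lambda>_. borel) (\<lambda>j w. \<Phi> (\<lambda>v\<in>I. \<Lambda> {s. s - \<tau> j \<in> B v} w)) J"
  and "distr M borel (\<lambda>w. \<Phi> (\<lambda>v\<in>I. \<Lambda> {s. s - a \<in> B v} w)) = distr M borel (\<lambda>w. \<Phi> (\<lambda>v\<in>I. \<Lambda> (B v) w))"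
proof -
 have "indep_vars (\<lambda>_. borel) (\<lambda>p. \<Lambda> {s. s - \<tau> (fst p) \<in> B (snd p)}) (J \<times> I)"
  by (rule basis_indep_finite) (use I J disj in \<open>auto intro: translate_bounded_borel(1)\<close>)
 then have "indep_vars (\<lambda>j. PiM ({j} \<times> I) (\<lambda>_. borel)) (\<lambda>j w. restrict (\<lambda>p. \<Lambda> {s. s - \<tau> (fst p) \<in> B (snd p)} w) ({j} \<times> I)) J"
  by (rule indep_vars_restrict) (auto simp: disjoint_family_on_def)
 then have "indep_vars (\<lambda>_. borel) (\<lambda>j w. (\<lambda>g. \<Phi> (\<lambda>v\<in>I. g (j, v))) (restrict (\<lambda>p. \<Lambda> {s. s - \<tau> (fst p) \<in> B (snd p)} w) ({j} \<times> I))) J"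
 proof (rule indep_vars_compose2[where Y="\<lambda>j g. \<Phi> (\<lambda>v\<in>I. g (j, v))"])
  fix j assume "j \<in> J"
  have "(\<lambda>g. \<lambda>v\<in>I. g (j, v)) \<in> measurable (PiM ({j} \<times> I) (\<lambda>_. borel)) (PiM I (\<lambda>_. borel :: real measure))"
   by (intro measurable_restrict measurable_component_singleton) auto
  then show "(\<lambda>g. \<Phi> (\<lambda>v\<in>I. g (j, v))) \<in> borel_measurable (PiM ({j} \<times> I) (\<lambda>_. borel))"
   by (rule measurable_compose[OF _ \<Phi>])
 qed
 moreover have "restrict (\<lambda>v. restrict (\<lambda>p. \<Lambda> {s. s - \<tau> (fst p) \<in> B (snd p)} w) ({j} \<times> I) (j, v)) I = (\<lambda>v\<in>I. \<Lambda> {s. s - \<tau> j \<in> B v} w)" for j w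
  by (rule restrict_ext) simp
 ultimately show "indep_vars (\<lambda>_. borel) (\<lambda>j w. \<Phi> (\<lambda>v\<in>I. \<Lambda> {s. s - \<tau> j \<in> B v} w)) J" by simp
 define Ba where "Ba v = {s. s - a \<in> B v}" for v
 have Ba: "Ba v \<in> bounded_borel" "measure lborel (Ba v) = measure lborel (B v)" if "v \<in> I" for v
  using translate_bounded_borel[OF I(2)[OF that]] unfolding Ba_def by auto
 have law: "distr M (PiM I (\<lambda>_. borel)) (\<lambda>w. \<lambda>v\<in>I. \<Lambda> (D v) w) = PiM I (\<lambda>v. distr M borel (\<Lambda> (D v)))"
  if "\<And>v. v \<in> I \<Longrightarrow> D v \<in> bounded_borel" "disjoint_family_on D I" "I \<noteq> {}" for D
  by (rule indep_vars_iff_distr_eq_PiM'[THEN iffD1, OF that(3) _ basis_indep_finite[OF I(1) that(1,2)]]) (use that basis_rv in auto)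
 have m[measurable]: "(\<lambda>w. \<lambda>v\<in>I. \<Lambda> (D v) w) \<in> measurable M (PiM I (\<lambda>_. borel))" if "\<And>v. v \<in> I \<Longrightarrow> D v \<in> bounded_borel" for D
  by (intro measurable_restrict basis_rv that)
 have "distr M (PiM I (\<lambda>_. borel)) (\<lambda>w. \<lambda>v\<in>I. \<Lambda> (Ba v) w) = distr M (PiM I (\<lambda>_. borel)) (\<lambda>w. \<lambda>v\<in>I. \<Lambda> (B v) w)"
 proof (cases "I = {}")
  case False
  have "disjoint_family_on Ba I" using I(3) unfolding Ba_def disjoint_family_on_def by blast
  moreover have "PiM I (\<lambda>v. distr M borel (\<Lambda> (Ba v))) = PiM I (\<lambda>v. distr M borel (\<Lambda> (B v)))"
   by (rule PiM_cong) (use basis_law Ba I(2) in auto)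
  ultimately show ?thesis using law[of Ba] law[of B] False Ba I by simp
 qed (simp add: restrict_def)
 moreover have "distr M borel (\<lambda>w. \<Phi> (\<lambda>v\<in>I. \<Lambda> (D v) w)) = distr (distr M (PiM I (\<lambda>_. borel)) (\<lambda>w. \<lambda>v\<in>I. \<Lambda> (D v) w)) borel \<Phi>"
  if "\<And>v. v \<in> I \<Longrightarrow> D v \<in> bounded_borel" for D
  using distr_distr[OF \<Phi> m[OF that]] by (simp add: o_def)
 ultimately have "distr M borel (\<lambda>w. \<Phi> (\<lambda>v\<in>I. \<Lambda> (Ba v) w)) = distr M borel (\<lambda>w. \<Phi> (\<lambda>v\<in>I. \<Lambda> (B v) w))"
  using Ba(1) I(2) by simp
 then show "distr M borel (\<lambda>w. \<Phi> (\<lambda>v\<in>I. \<Lambda> {s. s - a \<in> B v} w)) = distr M borel (\<lambda>w. \<Phi> (\<lambda>v\<in>I. \<Lambda> (B v) w))"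
  unfolding Ba_def .
qed

end

text \<open>A version for square integrable variables: the blocks will be sums of products of
  integrals, and fourth moments of the factors give only second moments of the products.\<close>

lemma (in prob_space) indep_sum_second_moment:
 fixes X :: "'i \<Rightarrow> 'a \<Rightarrow> real"
 assumes "finite I" "indep_vars (\<lambda>_. borel) X I" "\<And>i. i \<in> I \<Longrightarrow> integrable M (\<lambda>w. (X i w)^2)" "\<And>i. i \<in> I \<Longrightarrow> expectation (X i) = 0"
 shows "integrable M (\<lambda>w. (\<Sum>i\<in>I. X i w)^2) \<and> expectation (\<lambda>w. (\<Sum>i\<in>I. X i w)^2) = (\<Sum>i\<in>I. expectation (\<lambda>w. (X i w)^2))"
 using assms
proof (induction I rule: finite_induct)
 case (insert i I)
 define Z where "Z w = (\<Sum>i\<in>I. X i w)" for w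
 have IH: "integrable M (\<lambda>w. (Z w)^2)" "expectation (\<lambda>w. (Z w)^2) = (\<Sum>i\<in>I. expectation (\<lambda>w. (X i w)^2))"
  using insert.IH[OF indep_vars_subset[OF insert.prems(1)]] insert.prems unfolding Z_def by auto
 have rv[measurable]: "X k \<in> borel_measurable M" if "k \<in> insert i I" for k using insert.prems(1) that unfolding indep_vars_def by auto
 have [measurable]: "X i \<in> borel_measurable M" by (rule rv) simp
 have Zm[measurable]: "Z \<in> borel_measurable M" unfolding Z_def by (intro borel_measurable_sum rv) auto
 have X2: "integrable M (\<lambda>w. (X i w)^2)" using insert.prems by auto
 have Xi: "integrable M (X i)" "integrable M Z"
  using square_integrable_imp_integrable[of "X i"] square_integrable_imp_integrable[of Z] X2 IH(1) by auto
 have ind: "indep_var borel (X i) borel Z" unfolding Z_def by (rule indep_vars_sum[OF insert(1,2) insert.prems(1)])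
 have "expectation (\<lambda>w. X i w * Z w) = expectation (X i) * expectation Z" by (rule indep_var_lebesgue_integral[OF ind Xi])
 then have XZ: "expectation (\<lambda>w. X i w * Z w) = 0" using insert.prems by simp
 have XZi: "integrable M (\<lambda>w. X i w * Z w)" by (rule sq_integrable_mult) (use X2 IH(1) in auto)
 have sq: "(\<Sum>k\<in>insert i I. X k w)^2 = (X i w)^2 + (Z w)^2 + 2 * (X i w * Z w)" for w
  using insert(1,2) unfolding Z_def by (simp add: power2_sum)
 show ?case unfolding sq using X2 IH XZ XZi insert(1,2) by simp
qed simp

text \<open>Rounding is towards zero, not down: absolute values do not increase, so decay bounds are
  inherited, and the error is bounded both by e and by the absolute value itself.\<close>

definition trunc :: "real \<Rightarrow> real \<Rightarrow> real" where
 "trunc e v = e * (if 0 \<le> v then of_int \<lfloor>v / e\<rfloor> else of_int \<lceil>v / e\<rceil>)"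

lemma trunc_measurable[measurable]: "trunc e \<in> borel_measurable borel"
 unfolding trunc_def by measurable

lemma trunc_bounds:
 assumes e: "0 < e"
 shows "\<bar>trunc e v\<bar> \<le> \<bar>v\<bar>" "\<bar>v - trunc e v\<bar> \<le> e" "\<bar>v - trunc e v\<bar> \<le> \<bar>v\<bar>"
proof -
 have "\<bar>trunc e v\<bar> \<le> \<bar>v\<bar> \<and> \<bar>v - trunc e v\<bar> \<le> e \<and> \<bar>v - trunc e v\<bar> \<le> \<bar>v\<bar>"
 proof (cases "0 \<le> v")
  case True
  have "e * of_int \<lfloor>v / e\<rfloor> \<le> e * (v / e)" "e * (v / e) \<le> e * (of_int \<lfloor>v / e\<rfloor> + 1)"
   using e by (intro mult_left_mono; linarith)+
  moreover have "0 \<le> e * of_int \<lfloor>v / e\<rfloor>" using True e by simp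
  ultimately show ?thesis using True e unfolding trunc_def by (simp add: distrib_left abs_le_iff)
 next
  case False
  have "e * (v / e) \<le> e * of_int \<lceil>v / e\<rceil>" "e * (of_int \<lceil>v / e\<rceil> - 1) \<le> e * (v / e)"
   using e by (intro mult_left_mono; linarith)+
  moreover have "e * of_int \<lceil>v / e\<rceil> \<le> 0"
  proof -
   have "v / e \<le> 0" using False e by (simp add: divide_nonpos_pos)
   then have "\<lceil>v / e\<rceil> \<le> 0" by linarith
   then show ?thesis using e by (intro mult_nonneg_nonpos) auto
  qed
  ultimately show ?thesis using False e unfolding trunc_def by (simp add: right_diff_distrib abs_le_iff)
 qed
 then show "\<bar>trunc e v\<bar> \<le> \<bar>v\<bar>" "\<bar>v - trunc e v\<bar> \<le> e" "\<bar>v - trunc e v\<bar> \<le> \<bar>v\<bar>" by auto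
qed

context product_field
begin

text \<open>Space is divided into cubic cells, each containing the \<open>L\<^sup>d\<close> lattice points with
 coordinates \<open>\<Delta>(L j\<^sub>i + 1), \<dots>, \<Delta>(L j\<^sub>i + L)\<close>.\<close>

definition cidx :: "nat \<Rightarrow> real^'d \<Rightarrow> 'd \<Rightarrow> int" where
 "cidx L s i = \<lfloor>(s $ i / \<Delta> - 1) / real L\<rfloor>"

text \<open>The cell is that of the evaluation point x, so points of different cells get kernels
  with disjoint supports; this is the source of independence. The rounding makes the kernel
  simple.\<close>

definition cut :: "nat \<Rightarrow> real \<Rightarrow> (real^'d \<Rightarrow> real) \<Rightarrow> real^'d \<Rightarrow> real^'d \<Rightarrow> real" where
 "cut L e h x s = (if cidx L s = cidx L x then trunc e (h (x - s)) else 0)"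

definition shift :: "nat \<Rightarrow> ('d \<Rightarrow> int) \<Rightarrow> real^'d" where
 "shift L j = (\<chi> i. \<Delta> * (real L * of_int (j i)))"

lemma cidx_shift:
 assumes "0 < L"
 shows "cidx L (s + shift L j) = (\<lambda>i. cidx L s i + j i)" "cidx L (s - shift L j) = (\<lambda>i. cidx L s i - j i)"
proof -
 have "((s + shift L j) $ i / \<Delta> - 1) / real L = (s $ i / \<Delta> - 1) / real L + of_int (j i)"
    "((s - shift L j) $ i / \<Delta> - 1) / real L = (s $ i / \<Delta> - 1) / real L - of_int (j i)" for i
  using assms \<Delta>_pos by (auto simp: shift_def field_simps)
 then show "cidx L (s + shift L j) = (\<lambda>i. cidx L s i + j i)" "cidx L (s - shift L j) = (\<lambda>i. cidx L s i - j i)"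
  unfolding cidx_def fun_eq_iff by simp_all
qed

lemma cut_shift:
 assumes "0 < L"
 shows "cut L e h (x + shift L j) s = cut L e h x (s - shift L j)"
proof -
 have c: "cidx L s = cidx L (x + shift L j) \<longleftrightarrow> cidx L (s - shift L j) = cidx L x"
  unfolding cidx_shift[OF assms] fun_eq_iff by (auto simp: algebra_simps)
 have d: "x + shift L j - s = x - (s - shift L j)" by simp
 show ?thesis unfolding cut_def c d ..
qed

lemma cell_iff:
 assumes "0 < L"
 shows "cidx L s = j \<longleftrightarrow> (\<forall>i. \<Delta> * (real L * of_int (j i) + 1) \<le> s $ i \<and> s $ i < \<Delta> * (real L * (of_int (j i) + 1) + 1))"
proof -
 have "cidx L s i = j i \<longleftrightarrow> \<Delta> * (real L * of_int (j i) + 1) \<le> s $ i \<and> s $ i < \<Delta> * (real L * (of_int (j i) + 1) + 1)" for i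
  unfolding cidx_def floor_eq_iff using assms \<Delta>_pos by (simp add: field_simps)
 then show ?thesis unfolding fun_eq_iff by simp
qed

lemma cut_measurable:
 assumes h: "h \<in> borel_measurable borel" and L: "0 < L"
 shows "cut L e h x \<in> borel_measurable borel"
proof -
 note [measurable] = h
 have "{s. cidx L s = cidx L x} \<in> sets borel" unfolding cell_iff[OF L] by measurable
 moreover have "(\<lambda>s. trunc e (h (x - s))) \<in> borel_measurable borel" by measurable
 ultimately show ?thesis unfolding cut_def by (intro measurable_If) auto
qed

lemma cut_decays:
 assumes h: "decays c B 0 h" and e: "0 < e" and L: "0 < L"
 shows "decays c B x (cut L e h x)"
 unfolding decays_def
proof (intro conjI allI cut_measurable decaysD(1)[OF h] L)
 fix s
 have "\<bar>cut L e h x s\<bar> \<le> \<bar>h (x - s)\<bar>" unfolding cut_def using trunc_bounds(1)[OF e] by simp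
 then show "\<bar>cut L e h x s\<bar> \<le> B * expdec c (x - s)" using decaysD(2)[OF decays_translate[OF h], of x s] by linarith
qed

lemma cut_bounded_simple:
 assumes h: "decays c B 0 h" and e: "0 < e" and L: "0 < L"
 shows "bounded_simple (cut L e h x)"
 unfolding bounded_simple_def
proof
 have rng: "range (cut L e h x) \<subseteq> (\<lambda>k. e * of_int k) ` {- \<lceil>B / e\<rceil>..\<lceil>B / e\<rceil>}"
 proof
  fix y assume "y \<in> range (cut L e h x)"
  then obtain s where y: "y = cut L e h x s" by blast
  obtain k where k: "y = e * of_int k"
  proof (cases "cidx L s = cidx L x")
   case True
   then show thesis using that[of "if 0 \<le> h (x - s) then \<lfloor>h (x - s) / e\<rfloor> else \<lceil>h (x - s) / e\<rceil>"] unfolding y cut_def trunc_def by simp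
  next
   case False
   then show thesis using that[of 0] unfolding y cut_def by simp
  qed
  have "\<bar>y\<bar> \<le> B" unfolding y by (rule decays_bound[OF cut_decays[OF h e L]]) (use c_pos in simp)
  then have "\<bar>of_int k\<bar> \<le> B / e" using e unfolding k by (simp add: abs_mult pos_le_divide_eq mult.commute)
  then have "\<bar>k\<bar> \<le> \<lceil>B / e\<rceil>" by linarith
  then show "y \<in> (\<lambda>k. e * of_int k) ` {- \<lceil>B / e\<rceil>..\<lceil>B / e\<rceil>}" unfolding k by (intro imageI) auto
 qed
 show "simple_function borel (cut L e h x)"
  by (rule simple_function_borel_measurable[OF cut_measurable[OF decaysD(1)[OF h] L]])
   (use finite_subset[OF rng] in simp)
 have "{s. cut L e h x s \<noteq> 0} \<subseteq> cbox (\<chi> i. \<Delta> * (real L * of_int (cidx L x i) + 1)) (\<chi> i. \<Delta> * (real L * (of_int (cidx L x i) + 1) + 1))"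
 proof
  fix s assume "s \<in> {s. cut L e h x s \<noteq> 0}"
  then have "cidx L s = cidx L x" unfolding cut_def by (auto split: if_splits)
  then show "s \<in> cbox (\<chi> i. \<Delta> * (real L * of_int (cidx L x i) + 1)) (\<chi> i. \<Delta> * (real L * (of_int (cidx L x i) + 1) + 1))"
   unfolding cell_iff[OF L] by (auto simp: mem_box_cart less_imp_le)
 qed
 then show "bounded {s. cut L e h x s \<noteq> 0}" by (rule bounded_subset[OF bounded_cbox])
qed

text \<open>Here a is the distance of a point from the lower face of its cell in one coordinate, in
  units of \<open>\<Delta>\<close>, and L - a the distance from the upper face; the kernel decay
  over both distances is added up.\<close>

definition edge_weight :: "nat \<Rightarrow> real \<Rightarrow> real" where
 "edge_weight L a = exp (- (c/2) * \<Delta>) powr a + exp (- (c/2) * \<Delta>) powr (real L - a)"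

definition edge :: "nat \<Rightarrow> real^'d \<Rightarrow> real" where
 "edge L x = (\<Sum>i\<in>UNIV. edge_weight L (x $ i / \<Delta> - 1 - real L * of_int (cidx L x i)))"

text \<open>A point of another cell has a different index in some coordinate and lies beyond one of
  the two faces in that direction, so it is at least as far from x as that face.\<close>

lemma expdec_outside_cell:
 assumes L: "0 < L" and s: "cidx L s \<noteq> cidx L x"
 shows "expdec (c/2) (x - s) \<le> edge L x"
proof -
 obtain i where i: "cidx L s i \<noteq> cidx L x i" using s by auto
 define q where "q = cidx L x i"
 define a where "a = x $ i / \<Delta> - 1 - real L * of_int q"
 have "\<Delta> * a \<le> \<bar>x $ i - s $ i\<bar> \<or> \<Delta> * (real L - a) \<le> \<bar>x $ i - s $ i\<bar>"
 proof (cases "cidx L s i < q")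
  case True
  then have "(s $ i / \<Delta> - 1) / real L < of_int q" unfolding cidx_def by linarith
  then have "s $ i / \<Delta> - 1 < real L * of_int q" using L by (simp add: field_simps)
  then have "\<Delta> * a \<le> \<Delta> * (x $ i / \<Delta> - s $ i / \<Delta>)" unfolding a_def using \<Delta>_pos by (intro mult_left_mono) auto
  also have "\<dots> = x $ i - s $ i" using \<Delta>_pos by (simp add: field_simps)
  finally show ?thesis by linarith
 next
  case False
  then have "q + 1 \<le> cidx L s i" using i unfolding q_def by linarith
  then have "of_int q + 1 \<le> (s $ i / \<Delta> - 1) / real L" unfolding cidx_def by linarith
  then have "real L * of_int q + real L \<le> s $ i / \<Delta> - 1" using L by (simp add: field_simps)
  then have "\<Delta> * (real L - a) \<le> \<Delta> * (s $ i / \<Delta> - x $ i / \<Delta>)" unfolding a_def using \<Delta>_pos by (intro mult_left_mono) auto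
  also have "\<dots> = s $ i - x $ i" using \<Delta>_pos by (simp add: field_simps)
  finally show ?thesis by linarith
 qed
 moreover have "\<bar>x $ i - s $ i\<bar> \<le> (\<Sum>i\<in>UNIV. \<bar>(x - s) $ i\<bar>)"
  using member_le_sum[of i UNIV "\<lambda>i. \<bar>(x - s) $ i\<bar>"] by simp
 ultimately obtain b where b: "b = a \<or> b = real L - a" "\<Delta> * b \<le> (\<Sum>i\<in>UNIV. \<bar>(x - s) $ i\<bar>)" by fastforce
 have "expdec (c/2) (x - s) \<le> exp (- (c/2) * (\<Delta> * b))" using mult_left_mono[OF b(2), of "c/2"] c_pos by simp
 also have "\<dots> = exp (- (c/2) * \<Delta>) powr b" by (simp add: powr_def)
 also have "\<dots> \<le> edge_weight L a" unfolding edge_weight_def using b(1) by auto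
 also have "\<dots> \<le> edge L x" unfolding edge_def a_def q_def
  by (rule member_le_sum[where f="\<lambda>i. edge_weight L (x $ i / \<Delta> - 1 - real L * of_int (cidx L x i))"]) (auto simp: edge_weight_def)
 finally show ?thesis .
qed

lemma edge_bounds:
 assumes "0 < L"
 shows "0 \<le> edge L x" "edge L x \<le> 2 * CARD('d)"
proof -
 show "0 \<le> edge L x" unfolding edge_def edge_weight_def by (intro sum_nonneg) simp
 have "edge_weight L (x $ i / \<Delta> - 1 - real L * of_int (cidx L x i)) \<le> 2" for i
 proof -
  define y where "y = (x $ i / \<Delta> - 1) / real L"
  have y: "x $ i / \<Delta> - 1 = real L * y" unfolding y_def using assms by simp
  have q: "exp (- (c/2) * \<Delta>) \<le> 1" using c_pos \<Delta>_pos by simp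
  then have q: "\<bar>exp (- (c/2) * \<Delta>)\<bar> \<le> 1" by simp
  have "0 \<le> real L * (y - of_int \<lfloor>y\<rfloor>)" "0 \<le> real L * (1 - (y - of_int \<lfloor>y\<rfloor>))"
   using assms by (intro mult_nonneg_nonneg; linarith)+
  then have nn: "0 \<le> x $ i / \<Delta> - 1 - real L * of_int (cidx L x i)" "0 \<le> real L - (x $ i / \<Delta> - 1 - real L * of_int (cidx L x i))"
   unfolding cidx_def y_def[symmetric] y by (simp_all add: algebra_simps)
  show ?thesis unfolding edge_weight_def
   using add_mono[OF powr_le1[OF nn(1) q] powr_le1[OF nn(2) q]] by simp
 qed
 then have "edge L x \<le> (\<Sum>i\<in>(UNIV::'d set). 2)" unfolding edge_def by (intro sum_mono)
 then show "edge L x \<le> 2 * CARD('d)" by simp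
qed

definition cut_err :: "nat \<Rightarrow> real \<Rightarrow> real^'d \<Rightarrow> real" where
 "cut_err L e x = sqrt (e * B) + B * edge L x"

text \<open>Inside the cell the rounding error is at most e and at most |h|, so its square is at
  most e |h|; the square root gives the factor sqrt (e B) and halves the rate. Outside the cell half
  of the rate is spent on reaching the boundary.\<close>

lemma cut_error_decays:
 assumes h: "decays c B 0 h" and e: "0 < e" and L: "0 < L"
 shows "decays (c/2) (cut_err L e x) x (\<lambda>s. h (x - s) - cut L e h x s)"
 unfolding decays_def
proof (intro conjI allI)
 have hx: "(\<lambda>s. h (x - s)) \<in> borel_measurable borel" by (rule decaysD(1)[OF decays_translate[OF h, of x]])
 have cx: "cut L e h x \<in> borel_measurable borel" by (rule cut_measurable[OF decaysD(1)[OF h] L])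
 show "(\<lambda>s. h (x - s) - cut L e h x s) \<in> borel_measurable borel"
  by (rule borel_measurable_diff[OF hx cx])
 fix s
 have B: "0 \<le> B" by (rule decaysD(3)[OF h])
 have e2: "expdec c (x - s) = expdec (c/2) (x - s) * expdec (c/2) (x - s)" by (simp add: exp_add[symmetric])
 have hb: "\<bar>h (x - s)\<bar> \<le> B * expdec c (x - s)" by (rule decaysD(2)[OF decays_translate[OF h]])
 show "\<bar>h (x - s) - cut L e h x s\<bar> \<le> cut_err L e x * expdec (c/2) (x - s)"
 proof (cases "cidx L s = cidx L x")
  case True
  define D where "D = \<bar>h (x - s) - trunc e (h (x - s))\<bar>"
  have "D * D \<le> e * \<bar>h (x - s)\<bar>" unfolding D_def by (intro mult_mono trunc_bounds[OF e]) (use e in auto)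
  also have "\<dots> \<le> e * (B * expdec c (x - s))" using e hb by (intro mult_left_mono) auto
  also have "\<dots> = (sqrt (e * B) * expdec (c/2) (x - s))^2"
   unfolding power_mult_distrib e2 using e B by (simp add: power2_eq_square mult.assoc)
  finally have "D^2 \<le> (sqrt (e * B) * expdec (c/2) (x - s))^2" unfolding power2_eq_square[of D] .
  moreover have "0 \<le> sqrt (e * B) * expdec (c/2) (x - s)" using e B by (intro mult_nonneg_nonneg) simp_all
  ultimately have "D \<le> sqrt (e * B) * expdec (c/2) (x - s)" by (rule power2_le_imp_le)
  also have "\<dots> \<le> cut_err L e x * expdec (c/2) (x - s)"
   unfolding cut_err_def using B edge_bounds(1)[OF L] by (intro mult_right_mono) auto
  finally show ?thesis unfolding cut_def D_def if_P[OF True] .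
 next
  case False
  have "\<bar>h (x - s) - cut L e h x s\<bar> \<le> B * (expdec (c/2) (x - s) * expdec (c/2) (x - s))"
   using hb unfolding cut_def e2 if_not_P[OF False] by simp
  also have "\<dots> \<le> B * (edge L x * expdec (c/2) (x - s))"
   by (intro mult_left_mono mult_right_mono expdec_outside_cell[OF L False] B) simp
  also have "\<dots> \<le> cut_err L e x * expdec (c/2) (x - s)"
   unfolding cut_err_def mult.assoc[symmetric] using e B by (intro mult_right_mono) auto
  finally show ?thesis .
 qed
qed

end

section \<open>The central limit theorem for the products\<close>

context product_field
begin

lemma obs_block_cidx:
 assumes L: "0 < L" and x: "x \<in> obs_pts \<Delta> L"
 shows "cidx L x = (\<lambda>_. 0)"
proof
 fix i
 obtain k where k: "k \<in> {1..L}" "x $ i = \<Delta> * real k" using x unfolding obs_pts_def by blast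
 have "0 \<le> (real k - 1) / real L" "(real k - 1) / real L < 1" using k(1) L by (auto simp: field_simps)
 then show "cidx L x i = 0" unfolding cidx_def k(2) using \<Delta>_pos by (simp add: floor_eq_iff)
qed

abbreviation blocks :: "nat \<Rightarrow> ('d \<Rightarrow> int) set" where
 "blocks K \<equiv> PiE UNIV (\<lambda>_. {0..<int K})"

text \<open>In each coordinate this is division of n - 1 by L with remainder: observation indices
  start at 1, which is also why \<open>cidx\<close> subtracts 1 before dividing.\<close>

lemma obs_decompose:
 assumes L: "0 < L"
 shows "bij_betw (\<lambda>(j, x). x + shift L j) (blocks K \<times> obs_pts \<Delta> L) (obs_pts \<Delta> (K * L))"
proof (rule bij_betw_byWitness[where f'="\<lambda>y. (cidx L y, y - shift L (cidx L y))"])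
 show "\<forall>a\<in>blocks K \<times> obs_pts \<Delta> L. (\<lambda>y. (cidx L y, y - shift L (cidx L y))) ((\<lambda>(j, x). x + shift L j) a) = a"
  using obs_block_cidx[OF L] by (auto simp: cidx_shift[OF L])
 show "\<forall>y\<in>obs_pts \<Delta> (K * L). (\<lambda>(j, x). x + shift L j) (cidx L y, y - shift L (cidx L y)) = y" by simp
 show "(\<lambda>(j, x). x + shift L j) ` (blocks K \<times> obs_pts \<Delta> L) \<subseteq> obs_pts \<Delta> (K * L)"
 proof clarify
  fix j and x :: "real^'d" assume j: "j \<in> blocks K" and x: "x \<in> obs_pts \<Delta> L"
  have "\<exists>k\<in>{1..K * L}. (x + shift L j) $ i = \<Delta> * real k" for i :: 'd
  proof -
   obtain k where k: "k \<in> {1..L}" "x $ i = \<Delta> * real k" using x unfolding obs_pts_def by blast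
   have ji: "0 \<le> j i" "j i < int K" using j by (auto simp: PiE_UNIV_domain)
   define m where "m = nat (j i)"
   have m: "m < K" "real_of_int (j i) = real m" using ji unfolding m_def by auto
   have "L * m + L \<le> K * L" using mult_le_mono2[of "Suc m" K L] m(1) by (simp add: mult.commute)
   then have "k + L * m \<in> {1..K * L}" using k(1) by auto
   moreover have "(x + shift L j) $ i = \<Delta> * real (k + L * m)" unfolding shift_def by (simp add: k(2) m(2) distrib_left)
   ultimately show ?thesis by blast
  qed
  then show "x + shift L j \<in> obs_pts \<Delta> (K * L)" unfolding obs_pts_def by blast
 qed
 show "(\<lambda>y. (cidx L y, y - shift L (cidx L y))) ` obs_pts \<Delta> (K * L) \<subseteq> blocks K \<times> obs_pts \<Delta> L"
 proof clarify
  fix y :: "real^'d" assume y: "y \<in> obs_pts \<Delta> (K * L)"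
  have *: "cidx L y i \<in> {0..<int K} \<and> (\<exists>k\<in>{1..L}. (y - shift L (cidx L y)) $ i = \<Delta> * real k)" for i :: 'd
  proof -
   obtain n where n: "n \<in> {1..K * L}" "y $ i = \<Delta> * real n" using y unfolding obs_pts_def by blast
   define m where "m = (n - 1) div L"
   have n1: "1 \<le> n" "n \<le> K * L" using n(1) by auto
   have eq: "(y $ i / \<Delta> - 1) / real L = real (n - 1) / real L" using n \<Delta>_pos by (simp add: of_nat_diff)
   have c: "cidx L y i = int m" unfolding cidx_def m_def eq by (rule floor_divide_of_nat_eq)
   have mK: "m < K" unfolding m_def by (rule less_mult_imp_div_less) (use n1 in linarith)
   have "n = L * m + ((n - 1) mod L + 1)" using n1 mult_div_mod_eq[of L "n - 1"] unfolding m_def by linarith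
   then have "(y - shift L (cidx L y)) $ i = \<Delta> * real ((n - 1) mod L + 1)"
    unfolding shift_def vector_minus_component vec_lambda_beta c n(2) right_diff_distrib[symmetric]
    by (metis add_diff_cancel_left' of_int_of_nat_eq of_nat_add of_nat_mult)
   moreover have "(n - 1) mod L + 1 \<in> {1..L}" using L by (simp add: Suc_leI)
   ultimately show ?thesis using c mK by (intro conjI bexI[of _ "(n - 1) mod L + 1"]) auto
  qed
  then show "cidx L y \<in> blocks K \<and> y - shift L (cidx L y) \<in> obs_pts \<Delta> L"
   by (auto simp: PiE_UNIV_domain obs_pts_def)
 qed
qed

lemma sum_obs_decompose:
 fixes F :: "real^'d \<Rightarrow> 'b::comm_monoid_add"
 assumes L: "0 < L"
 shows "(\<Sum>y\<in>obs_pts \<Delta> (K * L). F y) = (\<Sum>j\<in>blocks K. \<Sum>x\<in>obs_pts \<Delta> L. F (x + shift L j))"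
 using sum.reindex_bij_betw[OF obs_decompose[OF L], of F K] by (simp add: sum.cartesian_product split_beta)

lemma blocks_card: "finite (blocks K)" "card (blocks K) = K ^ CARD('d)"
 by (auto simp: finite_PiE card_PiE)

lemma edge_shift: "0 < L \<Longrightarrow> edge L (x + shift L j) = edge L x"
proof -
 assume L: "0 < L"
 have "(x + shift L j) $ i / \<Delta> - 1 - real L * of_int (cidx L x i + j i) = x $ i / \<Delta> - 1 - real L * of_int (cidx L x i)" for i
  using \<Delta>_pos by (simp add: shift_def field_simps)
 note eq = this
 show "edge L (x + shift L j) = edge L x" unfolding edge_def cidx_shift[OF L] eq ..
qed

text \<open>One geometric series for each face. The distances L - k from the upper face start at 1
  and are lowered to L - k - 1, so that the second series is the first in reverse order.\<close>

lemma sum_edge_weight_le: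
 "(\<Sum>k\<in>{1..int L}. edge_weight L (of_int k - 1)) \<le> 2 / (1 - exp (- (c/2) * \<Delta>))"
proof -
 define q where "q = exp (- (c/2) * \<Delta>)"
 have q: "0 < q" "q < 1" unfolding q_def using c_pos \<Delta>_pos by auto
 have g: "(\<Sum>k<L. q ^ k) \<le> 1 / (1 - q)"
 proof -
  have "(\<Sum>k<L. q ^ k) = (1 - q ^ L) / (1 - q)" using q by (subst sum_gp_strict) simp
  then show ?thesis using q by (simp add: divide_right_mono)
 qed
 have img: "{1..int L} = (\<lambda>k. int k + 1) ` {..<L}"
 proof (intro equalityI subsetI)
  fix k assume "k \<in> {1..int L}"
  then show "k \<in> (\<lambda>k. int k + 1) ` {..<L}" by (intro image_eqI[of _ _ "nat (k - 1)"]) auto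
 qed auto
 have "(\<Sum>k\<in>{1..int L}. edge_weight L (of_int k - 1)) = (\<Sum>k<L. q powr real k + q powr (real L - real k))"
  unfolding img by (subst sum.reindex) (auto simp: inj_on_def edge_weight_def q_def)
 also have "\<dots> \<le> (\<Sum>k<L. q ^ k + q ^ (L - Suc k))"
 proof (rule sum_mono)
  fix k assume k: "k \<in> {..<L}"
  have "q powr (real L - real k) \<le> q powr real (L - Suc k)"
   using q k by (intro powr_mono') (auto simp: of_nat_diff)
  then show "q powr real k + q powr (real L - real k) \<le> q ^ k + q ^ (L - Suc k)"
   using q by (simp add: powr_realpow)
 qed
 also have "\<dots> = 2 * (\<Sum>k<L. q ^ k)" unfolding sum.distrib sum.nat_diff_reindex by simp
 also have "\<dots> \<le> 2 / (1 - q)" using g by simp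
 finally show ?thesis unfolding q_def .
qed

text \<open>Up to exponentially small weights only the points near a face count, of which there are
  of the order L^(d-1); relative to the volume of the block this is O(1 / L).\<close>

lemma sum_edge_le:
 assumes L: "0 < L"
 shows "(\<Sum>x\<in>obs_pts \<Delta> L. edge L x) \<le> real L ^ CARD('d) * (real CARD('d) * (2 / (1 - exp (- (c/2) * \<Delta>))) / real L)"
proof -
 define S where "S = (\<Sum>k\<in>{1..int L}. edge_weight L (of_int k - 1))"
 define T where "T = PiE (UNIV::'d set) (\<lambda>_. {1..int L})"
 have im: "obs_pts \<Delta> L = (\<lambda>n. (\<chi> i. \<Delta> * of_int (n i)) :: real^'d) ` T"
 proof -
  have s: "{n \<in> {1..int L}. n + 0 \<in> {1..int L}} = {1..int L}" by auto
  show ?thesis using lag_pts_image[OF \<Delta>_pos, of "0::real^'d" "\<lambda>_. 0" L] unfolding lag_pts_zero s T_def by simp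
 qed
 have inj: "inj_on (\<lambda>n. (\<chi> i. \<Delta> * of_int (n i)) :: real^'d) T"
  using \<Delta>_pos by (auto simp: inj_on_def Finite_Cartesian_Product.vec_eq_iff)
 \<comment> \<open>Written as a product over the coordinates with factor 1 away from i, the sum over
   the cube becomes a one-dimensional sum times L^(d-1).\<close>
 have one: "(\<Sum>n\<in>T. edge_weight L (of_int (n i) - 1)) = S * real L ^ (CARD('d) - 1)" for i
 proof -
  have "(\<Sum>n\<in>T. edge_weight L (of_int (n i) - 1)) = (\<Sum>n\<in>T. \<Prod>j\<in>UNIV. if j = i then edge_weight L (of_int (n j) - 1) else 1)"
   by (rule sum.cong) simp_all
  also have "\<dots> = (\<Prod>j\<in>UNIV. \<Sum>k\<in>{1..int L}. if j = i then edge_weight L (of_int k - 1) else 1)"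
   unfolding T_def by (rule prod_sum_PiE[symmetric]) auto
  also have "\<dots> = (\<Prod>j\<in>UNIV. if j = i then S else real L)"
   unfolding S_def by (rule prod.cong) auto
  also have "\<dots> = S * (\<Prod>j\<in>UNIV - {i}. if j = i then S else real L)"
   by (subst prod.remove[of _ i]) auto
  also have "(\<Prod>j\<in>UNIV - {i}. if j = i then S else real L) = real L ^ (CARD('d) - 1)"
   by (simp add: card_Diff_singleton)
  finally show ?thesis .
 qed
 have "(\<Sum>x\<in>obs_pts \<Delta> L. edge L x) = (\<Sum>x\<in>obs_pts \<Delta> L. \<Sum>i\<in>UNIV. edge_weight L ((x::real^'d) $ i / \<Delta> - 1))"
  by (rule sum.cong) (auto simp: edge_def obs_block_cidx[OF L])
 also have "\<dots> = (\<Sum>n\<in>T. \<Sum>i\<in>UNIV. edge_weight L (of_int (n i) - 1))"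
  unfolding im by (subst sum.reindex[OF inj]) (use \<Delta>_pos in simp)
 also have "\<dots> = real CARD('d) * (S * real L ^ (CARD('d) - 1))"
  by (subst sum.swap) (simp add: one)
 also have "\<dots> \<le> real CARD('d) * (2 / (1 - exp (- (c/2) * \<Delta>)) * real L ^ (CARD('d) - 1))"
  using sum_edge_weight_le[of L] unfolding S_def by (intro mult_left_mono mult_right_mono) auto
 also have "real L ^ (CARD('d) - 1) = real L ^ CARD('d) / real L"
  using L zero_less_card_finite[where 'a='d] by (simp add: power_diff)
 finally show ?thesis by (simp add: mult_ac)
qed

text \<open>The mean square error per point is small in e and in 1 / L, uniformly in the number K of
  blocks per side. This uniformity lets the block structure be fixed before the window
  grows.\<close>

lemma sum_cut_err_le:
 assumes L: "0 < L" and e: "0 < e"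
 shows "(\<Sum>y\<in>obs_pts \<Delta> (K * L). (cut_err L e y)^2)
  \<le> real (K * L) ^ CARD('d) * (2 * e * B + 4 * B^2 * (real CARD('d))^2 * (2 / (1 - exp (- (c/2) * \<Delta>))) / real L)"
proof -
 define D where "D = real CARD('d)"
 define R where "R = 2 / (1 - exp (- (c/2) * \<Delta>))"
 have B: "0 \<le> B" by (rule decaysD(3)[OF f_decays])
 have pt: "(cut_err L e x)^2 \<le> 2 * e * B + 4 * B^2 * D * edge L x" for x
 proof -
  have "(cut_err L e x)^2 \<le> 2 * (sqrt (e * B))^2 + 2 * (B * edge L x)^2"
   unfolding cut_err_def by (rule power2_sum_le)
  also have "(B * edge L x)^2 \<le> B^2 * (2 * D * edge L x)"
   unfolding power_mult_distrib power2_eq_square[of "edge L x"]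
   using edge_bounds[OF L, of x] unfolding D_def by (intro mult_left_mono mult_right_mono) auto
  finally show ?thesis using e B by (simp add: mult_ac)
 qed
 have "(\<Sum>y\<in>obs_pts \<Delta> (K * L). (cut_err L e y)^2) = (\<Sum>j\<in>blocks K. \<Sum>x\<in>obs_pts \<Delta> L. (cut_err L e (x + shift L j))^2)"
  by (rule sum_obs_decompose[OF L])
 also have "\<dots> = real K ^ CARD('d) * (\<Sum>x\<in>obs_pts \<Delta> L. (cut_err L e x)^2)"
  unfolding cut_err_def edge_shift[OF L] by (simp add: blocks_card)
 also have "\<dots> \<le> real K ^ CARD('d) * (\<Sum>x\<in>obs_pts \<Delta> L. 2 * e * B + 4 * B^2 * D * edge L x)"
  by (intro mult_left_mono sum_mono pt) simp
 also have "\<dots> = real K ^ CARD('d) * (real L ^ CARD('d) * (2 * e * B) + 4 * B^2 * D * (\<Sum>x\<in>obs_pts \<Delta> L. edge L x))"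
  using obs_pts_finite_card[OF \<Delta>_pos, where 'd='d, of L] by (simp add: sum.distrib sum_distrib_left)
 also have "\<dots> \<le> real K ^ CARD('d) * (real L ^ CARD('d) * (2 * e * B) + 4 * B^2 * D * (real L ^ CARD('d) * (D * R / real L)))"
  using sum_edge_le[OF L] unfolding D_def R_def by (intro mult_left_mono add_left_mono) auto
 also have "\<dots> = real (K * L) ^ CARD('d) * (2 * e * B + 4 * B^2 * D^2 * R / real L)"
  by (simp add: power_mult_distrib power2_eq_square algebra_simps)
 finally show ?thesis unfolding D_def R_def .
qed

end

section \<open>Approximation by independent block sums\<close>

lemma (in prob_space) second_moment_sum_le:
 fixes U V :: "'a \<Rightarrow> real"
 assumes [measurable]: "U \<in> borel_measurable M" "V \<in> borel_measurable M"
  and U: "integrable M (\<lambda>w. (U w)^2)" and V: "integrable M (\<lambda>w. (V w)^2)"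
 shows "integrable M (\<lambda>w. (U w + V w)^2)"
  "expectation (\<lambda>w. (U w + V w)^2) \<le> 2 * expectation (\<lambda>w. (U w)^2) + 2 * expectation (\<lambda>w. (V w)^2)"
proof -
 show i: "integrable M (\<lambda>w. (U w + V w)^2)"
  by (rule Bochner_Integration.integrable_bound[where f="\<lambda>x. 2 * (U x)^2 + 2 * (V x)^2"])
   (use U V power2_sum_le in auto)
 have "expectation (\<lambda>w. (U w + V w)^2) \<le> expectation (\<lambda>w. 2 * (U w)^2 + 2 * (V w)^2)"
  by (rule integral_mono) (use i U V power2_sum_le in auto)
 then show "expectation (\<lambda>w. (U w + V w)^2) \<le> 2 * expectation (\<lambda>w. (U w)^2) + 2 * expectation (\<lambda>w. (V w)^2)"
  using U V by simp
qed

lemma (in prob_space) integrable_sum_sq: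
 fixes U :: "'i \<Rightarrow> 'a \<Rightarrow> real"
 assumes "\<And>i. i \<in> I \<Longrightarrow> U i \<in> borel_measurable M" "\<And>i. i \<in> I \<Longrightarrow> integrable M (\<lambda>w. (U i w)^2)"
 shows "integrable M (\<lambda>w. (\<Sum>i\<in>I. U i w)^2)"
 using assms
proof (induction I rule: infinite_finite_induct)
 case (insert i I)
 then show ?case using second_moment_sum_le(1)[of "U i" "\<lambda>w. \<Sum>i\<in>I. U i w"] by (simp add: borel_measurable_sum)
qed auto

context product_field
begin

lemma centered_product_L2:
 assumes "L24 M U" "L24 M V"
 shows "(\<lambda>w. U w * V w - expectation (\<lambda>w. U w * V w)) \<in> borel_measurable M"
  "integrable M (\<lambda>w. (U w * V w - expectation (\<lambda>w. U w * V w))^2)"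
proof -
 note [measurable] = L24D(1)[OF assms(1)] L24D(1)[OF assms(2)]
 show "(\<lambda>w. U w * V w - expectation (\<lambda>w. U w * V w)) \<in> borel_measurable M" by measurable
 show "integrable M (\<lambda>w. (U w * V w - expectation (\<lambda>w. U w * V w))^2)"
  unfolding power2_diff using L24_mult_sq[OF assms] L24_mult2[OF assms] by simp
qed

text \<open>The window of side K L splits into K^d translated blocks, and cutting both kernels to
  the cell of the point makes the block sums independent with one law. The accuracy e alone
  determines L and the rounding step, so the number of blocks may tend to infinity
  afterwards.\<close>

lemma block_approximation:
 assumes e: "0 < e"
 shows "\<exists>L W0 Wsum. 0 < L \<and> W0 \<in> borel_measurable M \<and> integrable M (\<lambda>w. (W0 w)^2) \<and> expectation W0 = 0 \<and>
  (\<forall>K. Wsum K \<in> borel_measurable M \<and> integrable M (\<lambda>w. (Wsum K w)^2) \<and>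
   expectation (\<lambda>w. ((\<Sum>y\<in>obs_pts \<Delta> (K * L). P y w) - Wsum K w)^2) \<le> e * real (K * L) ^ CARD('d) \<and>
   (\<forall>t. char (distr M borel (Wsum K)) t = char (distr M borel W0) t ^ (K ^ CARD('d))) \<and>
   expectation (\<lambda>w. (Wsum K w)^2) = real K ^ CARD('d) * expectation (\<lambda>w. (W0 w)^2))"
proof -
 define c' where "c' = c / 2"
 have c': "0 < c'" unfolding c'_def using c_pos by simp
 have B: "0 \<le> B" by (rule decaysD(3)[OF f_decays])
 \<comment> \<open>The 4 collects the factor 2 from squaring a sum of two errors and the two equal
   bounds for them. The rate is \<open>c'\<close> because the cut errors decay only at half the
   rate.\<close>
 define V where "V = 4 * B^2 * var_const \<Delta> c'"
 have vc: "0 \<le> var_const \<Delta> c'" unfolding var_const_def using cov_const_nonneg[of c'] c' \<Delta>_pos by simp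
 then have V: "0 \<le> V" unfolding V_def by simp
 define C2 where "C2 = 4 * B^2 * (real CARD('d))^2 * (2 / (1 - exp (- (c/2) * \<Delta>)))"
 have C2: "0 \<le> C2" unfolding C2_def using c_pos \<Delta>_pos by simp
 \<comment> \<open>With this rounding step and with L chosen next, rounding and cell boundaries each
   contribute at most e / 2 after multiplication by V.\<close>
 define \<eta> where "\<eta> = e / (4 * (B + 1) * (V + 1))"
 have \<eta>: "0 < \<eta>" unfolding \<eta>_def using e B V by simp
 obtain L :: nat where L0: "2 * (V + 1) * C2 / e < real L" using reals_Archimedean2 by blast
 have Lpos: "0 < L"
 proof -
  have "0 \<le> 2 * (V + 1) * C2 / e" using V C2 e by simp
  then have "0 < real L" using L0 by linarith
  then show ?thesis by simp
 qed
 note L = this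
 have small: "V * (2 * \<eta> * B + C2 / real L) \<le> e"
 proof -
  have "V * (2 * \<eta> * B) \<le> (V + 1) * (2 * \<eta> * (B + 1))" using V B \<eta> by (intro mult_mono) auto
  also have "\<dots> = \<eta> * (4 * (B + 1) * (V + 1)) / 2" by (simp add: algebra_simps)
  also have "\<eta> * (4 * (B + 1) * (V + 1)) = e" unfolding \<eta>_def using B V by simp
  finally have 1: "V * (2 * \<eta> * B) \<le> e / 2" .
  have "2 * (V + 1) * C2 < e * real L" using L0 e by (simp add: field_simps)
  then have "(V + 1) * C2 / real L \<le> e / 2" using L by (simp add: field_simps)
  moreover have "V * (C2 / real L) \<le> (V + 1) * (C2 / real L)" using C2 by (intro mult_right_mono) auto
  ultimately show ?thesis using 1 unfolding distrib_left times_divide_eq_right by linarith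
 qed
 \<comment> \<open>Both kernel families are indexed together, so that one common refinement
   expresses all integrals of a block through the same finitely many basis values.\<close>
 define F where "F p = (if fst p then cut L \<eta> f (snd p) else cut L \<eta> f' (snd p))" for p :: "bool \<times> (real^'d)"
 define N0 where "N0 = (UNIV :: bool set) \<times> (obs_pts \<Delta> L :: (real^'d) set)"
 have "finite N0" unfolding N0_def using obs_pts_finite_card(1)[OF \<Delta>_pos, where 'd='d, of L] by simp
 moreover have "bounded_simple (F p)" for p unfolding F_def using cut_bounded_simple[OF f_decays \<eta> L] cut_bounded_simple[OF f'_decays \<eta> L] by simp
 ultimately obtain I :: "((bool \<times> (real^'d)) \<Rightarrow> real) set" and Bv where I: "finite I" "disjoint_family_on Bv I"
  "\<And>v. v \<in> I \<Longrightarrow> Bv v \<in> bounded_borel" and F: "\<And>p. p \<in> N0 \<Longrightarrow> F p = (\<lambda>s. \<Sum>v\<in>I. v p * indicator (Bv v) s)"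
  and Bv: "\<And>v s. v \<in> I \<Longrightarrow> s \<in> Bv v \<Longrightarrow> \<exists>p\<in>N0. F p s \<noteq> 0"
  using bounded_simple_common_refinement[of N0 F] by blast
 \<comment> \<open>At each point of a refinement set some cut kernel is nonzero, so the set lies in
   the reference cell; its translates to different cells are therefore disjoint.\<close>
 have Bcell: "cidx L s = (\<lambda>_. 0)" if v: "v \<in> I" "s \<in> Bv v" for v s
 proof -
  obtain p where p: "p \<in> N0" "F p s \<noteq> 0" using Bv[OF v] by blast
  then have "cidx L s = cidx L (snd p)" unfolding F_def cut_def by (auto split: if_splits)
  then show ?thesis using obs_block_cidx[OF L] p(1) unfolding N0_def by auto
 qed
 define Bt where "Bt j v = {s. s - shift L j \<in> Bv v}" for j v
 have Bt: "Bt j v \<in> bounded_borel" if "v \<in> I" for j v unfolding Bt_def using translate_bounded_borel(1)[OF I(3)[OF that]] .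
 have Btd: "disjoint_family_on (Bt j) I" for j using I(2) unfolding Bt_def disjoint_family_on_def by blast
 define U where "U b j x w = (\<Sum>v\<in>I. v (b, x) * \<Lambda> (Bt j v) w)" for b j x w
 have U_int: "has_int (\<lambda>s. F (b, x) (s - shift L j)) (U b j x)" if "x \<in> obs_pts \<Delta> L" for b j x
 proof -
  have "F (b, x) (s - shift L j) = (\<Sum>v\<in>I. v (b, x) * indicator (Bt j v) s)" for s
   using F[of "(b, x)"] that unfolding N0_def Bt_def by (simp add: indicator_def)
  then show ?thesis unfolding U_def using has_int_step[OF I(1) Btd[of j] Bt] by simp
 qed
 note UL = has_intD(2)[OF U_int]
 define \<Phi> where "\<Phi> z = (\<Sum>x\<in>obs_pts \<Delta> L. (\<Sum>v\<in>I. v (True, x) * z v) * (\<Sum>v\<in>I. v (False, x) * z v))" for z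
 have \<Phi>m[measurable]: "\<Phi> \<in> borel_measurable (PiM I (\<lambda>_. borel))"
  unfolding \<Phi>_def by (intro borel_measurable_sum borel_measurable_times borel_measurable_const measurable_component_singleton)
 define Q where "Q j w = \<Phi> (\<lambda>v\<in>I. \<Lambda> (Bt j v) w)" for j w
 have Q: "Q j w = (\<Sum>x\<in>obs_pts \<Delta> L. U True j x w * U False j x w)" for j w
  unfolding Q_def \<Phi>_def U_def by simp
 define z0 where "z0 = (\<lambda>_::'d. 0::int)"
 define q0 where "q0 = expectation (Q z0)"
 have disj: "disjoint_family_on (\<lambda>p. {s. s - shift L (fst p) \<in> Bv (snd p)}) (blocks K \<times> I)" for K
  unfolding disjoint_family_on_def
 proof (intro ballI impI)
  fix p p' assume p: "p \<in> blocks K \<times> I" "p' \<in> blocks K \<times> I" "p \<noteq> p'"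
  show "{s. s - shift L (fst p) \<in> Bv (snd p)} \<inter> {s. s - shift L (fst p') \<in> Bv (snd p')} = {}"
  proof (rule ccontr)
   assume "\<not> ?thesis"
   then obtain s where s: "s - shift L (fst p) \<in> Bv (snd p)" "s - shift L (fst p') \<in> Bv (snd p')" by blast
   have r: "cidx L s = fst r" if "r \<in> {p, p'}" for r
   proof -
    have "cidx L (s - shift L (fst r)) = (\<lambda>_. 0)" using Bcell[of "snd r"] s p that by auto
    then show ?thesis unfolding cidx_shift(2)[OF L] fun_eq_iff by simp
   qed
   have 1: "fst p = fst p'" using r[of p] r[of p'] by simp
   then have "snd p \<noteq> snd p'" using p(3) by (auto simp: prod_eq_iff)
   then show False using I(2) s p(1,2) 1 unfolding disjoint_family_on_def by (auto simp: mem_Times_iff)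
  qed
 qed
 have bf: "finite (blocks K)" for K by (rule blocks_card)
 have indepQ: "indep_vars (\<lambda>_. borel) Q (blocks K)" for K
  using translated_blocks_iid(1)[OF I(1,3,2) bf disj \<Phi>m] unfolding Q_def Bt_def by simp
 have lawQ: "distr M borel (Q j) = distr M borel (Q z0)" for j
  using translated_blocks_iid(2)[OF I(1,3,2) bf disj \<Phi>m] unfolding Q_def Bt_def by simp
 have Qm[measurable]: "Q j \<in> borel_measurable M" for j
 proof -
  have "(\<lambda>w. \<lambda>v\<in>I. \<Lambda> (Bt j v) w) \<in> measurable M (PiM I (\<lambda>_. borel))"
   by (intro measurable_restrict basis_rv Bt)
  then show ?thesis unfolding Q_def by (rule measurable_compose[OF _ \<Phi>m])
 qed
 have EQ: "expectation (Q j) = q0" for j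
 proof -
  have "expectation (Q j) = (\<integral>x. x \<partial>distr M borel (Q j))" by (subst integral_distr) auto
  also have "\<dots> = q0" unfolding lawQ[of j] q0_def by (subst integral_distr) auto
  finally show ?thesis .
 qed
 define W where "W j w = Q j w - q0" for j w
 have Wm[measurable]: "W j \<in> borel_measurable M" for j unfolding W_def by measurable
 have UU: "integrable M (\<lambda>w. U True j x w * U False j x w)" if "x \<in> obs_pts \<Delta> L" for j x
  by (rule L24_mult2[OF UL[OF that] UL[OF that]])
 have W: "W j w = (\<Sum>x\<in>obs_pts \<Delta> L. U True j x w * U False j x w - expectation (\<lambda>w. U True j x w * U False j x w))" for j w
 proof -
  have "q0 = (\<Sum>x\<in>obs_pts \<Delta> L. expectation (\<lambda>w. U True j x w * U False j x w))"
   unfolding EQ[of j, symmetric] Q by (rule Bochner_Integration.integral_sum) (rule UU)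
  then show ?thesis unfolding W_def Q by (simp add: sum_subtractf)
 qed
 have W2: "integrable M (\<lambda>w. (W j w)^2)" for j
  unfolding W by (rule integrable_sum_sq) (rule centered_product_L2[OF UL UL]; assumption)+
 have Qi: "integrable M (Q j)" for j unfolding Q using UU by (intro Bochner_Integration.integrable_sum) auto
 have EW: "expectation (W j) = 0" for j unfolding W_def using Qi by (simp add: EQ prob_space)
 have lawW: "distr M borel (W j) = distr M borel (W z0)" for j
 proof -
  have "distr M borel (W j) = distr (distr M borel (Q j)) borel (\<lambda>x. x - q0)" for j
   unfolding W_def by (subst distr_distr) (auto simp: o_def)
  then show ?thesis using lawQ[of j] by simp
 qed
 have indepW: "indep_vars (\<lambda>_. borel) W (blocks K)" for K
  using indep_vars_compose2[OF indepQ, where Y="\<lambda>_ x. x - q0" and N="\<lambda>_. borel"] unfolding W_def by simp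
 have EW2: "expectation (\<lambda>w. (W j w)^2) = expectation (\<lambda>w. (W z0 w)^2)" for j
 proof -
  have "expectation (\<lambda>w. (W j w)^2) = (\<integral>x. x^2 \<partial>distr M borel (W j))" for j by (subst integral_distr) auto
  then show ?thesis using lawW[of j] by simp
 qed
 define Wsum where "Wsum K w = (\<Sum>j\<in>blocks K. W j w)" for K w
 have Wsm: "Wsum K \<in> borel_measurable M" for K unfolding Wsum_def by measurable
 have Ws2: "integrable M (\<lambda>w. (Wsum K w)^2)" "expectation (\<lambda>w. (Wsum K w)^2) = real K ^ CARD('d) * expectation (\<lambda>w. (W z0 w)^2)" for K
 proof -
  have "(\<Sum>j\<in>blocks K. expectation (\<lambda>w. (W j w)^2)) = (\<Sum>j\<in>blocks K. expectation (\<lambda>w. (W z0 w)^2))"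
   by (rule sum.cong[OF refl EW2])
  then show "integrable M (\<lambda>w. (Wsum K w)^2)" "expectation (\<lambda>w. (Wsum K w)^2) = real K ^ CARD('d) * expectation (\<lambda>w. (W z0 w)^2)"
   using indep_sum_second_moment[OF bf indepW W2 EW, of K] unfolding Wsum_def by (simp_all add: blocks_card)
 qed
 have Wchar: "char (distr M borel (Wsum K)) t = char (distr M borel (W z0)) t ^ (K ^ CARD('d))" for K t
 proof -
  have "char (distr M borel (Wsum K)) t = (\<Prod>j\<in>blocks K. char (distr M borel (W j)) t)"
   unfolding Wsum_def by (rule char_distr_sum[OF indepW])
  also have "\<dots> = (\<Prod>j\<in>blocks K. char (distr M borel (W z0)) t)"
   by (rule prod.cong[OF refl]) (subst lawW, rule refl)
  finally show ?thesis by (simp add: blocks_card)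
 qed
 have err: "expectation (\<lambda>w. ((\<Sum>y\<in>obs_pts \<Delta> (K * L). P y w) - Wsum K w)^2) \<le> e * real (K * L) ^ CARD('d)" for K
 proof -
  define Ob where "Ob = (obs_pts \<Delta> (K * L) :: (real^'d) set)"
  \<comment> \<open>The block integral that belongs to the window point y: its cell index selects
    the block, the remainder selects the point of the reference block.\<close>
  define Z where "Z b y = U b (cidx L y) (y - shift L (cidx L y))" for b y
  have Ob: "finite Ob" "Ob \<subseteq> lattice_pts \<Delta>" unfolding Ob_def using obs_pts_finite_card(1)[OF \<Delta>_pos] obs_pts_lattice by auto
  have Zs: "Z b (x + shift L j) = U b j x" if "x \<in> obs_pts \<Delta> L" for b x j
   unfolding Z_def cidx_shift[OF L] obs_block_cidx[OF L that] by simp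
  have Z_int: "has_int (if b then cut L \<eta> f y else cut L \<eta> f' y) (Z b y)" if y: "y \<in> Ob" for b y
  proof -
   have "(cidx L y, y - shift L (cidx L y)) \<in> blocks K \<times> obs_pts \<Delta> L"
   proof -
    have "y \<in> (\<lambda>(j, x). x + shift L j) ` (blocks K \<times> obs_pts \<Delta> L)"
     using y unfolding Ob_def bij_betw_imp_surj_on[OF obs_decompose[OF L, of K]] .
    then obtain j x where jx: "j \<in> blocks K" "x \<in> obs_pts \<Delta> L" "y = x + shift L j"
     by auto
    have "cidx L y = j" unfolding jx(3) cidx_shift[OF L] obs_block_cidx[OF L jx(2)] by simp
    then show ?thesis using jx by simp
   qed
   then have x: "y - shift L (cidx L y) \<in> obs_pts \<Delta> L" by simp
   have "F (b, y - shift L (cidx L y)) (s - shift L (cidx L y)) = (if b then cut L \<eta> f y else cut L \<eta> f' y) s" for s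
    unfolding F_def fst_conv snd_conv using cut_shift[OF L, of \<eta> _ "y - shift L (cidx L y)" "cidx L y" s] by simp
   then show ?thesis using U_int[OF x, of b "cidx L y"] unfolding Z_def by simp
  qed
  have Zt: "has_int (cut L \<eta> f y) (Z True y)" and Zf: "has_int (cut L \<eta> f' y) (Z False y)" if "y \<in> Ob" for y
   using Z_int[OF that, of True] Z_int[OF that, of False] by auto
  \<comment> \<open>With Z and Z' the cut versions of X and X', the difference X X' - Z Z' equals (X
    - Z) X' + (X' - Z') Z. Each product has one small factor, placed first to match
    \<open>product_sum_variance_bound\<close>.\<close>
  define S1 where "S1 w = (\<Sum>y\<in>Ob. (X y w - Z True y w) * X' y w - expectation (\<lambda>w. (X y w - Z True y w) * X' y w))" for w
  define S2 where "S2 w = (\<Sum>y\<in>Ob. (X' y w - Z False y w) * Z True y w - expectation (\<lambda>w. (X' y w - Z False y w) * Z True y w))" for w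
  have dec: "(\<Sum>y\<in>Ob. P y w) - Wsum K w = S1 w + S2 w" for w
  proof -
   have "Wsum K w = (\<Sum>y\<in>Ob. Z True y w * Z False y w - expectation (\<lambda>w. Z True y w * Z False y w))"
    unfolding Wsum_def W Ob_def sum_obs_decompose[OF L] by (intro sum.cong refl) (simp add: Zs)
   moreover have "P y w - (Z True y w * Z False y w - expectation (\<lambda>w. Z True y w * Z False y w))
     = ((X y w - Z True y w) * X' y w - expectation (\<lambda>w. (X y w - Z True y w) * X' y w))
     + ((X' y w - Z False y w) * Z True y w - expectation (\<lambda>w. (X' y w - Z False y w) * Z True y w))" if y: "y \<in> Ob" for y
   proof -
    note a = has_intD(2)[OF X_int[of y]] and b = has_intD(2)[OF X'_int[of y]] and t = has_intD(2)[OF Zt[OF y]] and u = has_intD(2)[OF Zf[OF y]]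
    have "expectation (\<lambda>w. (X y w - Z True y w) * X' y w) = expectation (\<lambda>w. X y w * X' y w) - expectation (\<lambda>w. Z True y w * X' y w)"
     unfolding left_diff_distrib by (rule Bochner_Integration.integral_diff[OF L24_mult2[OF a b] L24_mult2[OF t b]])
    moreover have "expectation (\<lambda>w. (X' y w - Z False y w) * Z True y w) = expectation (\<lambda>w. X' y w * Z True y w) - expectation (\<lambda>w. Z False y w * Z True y w)"
     unfolding left_diff_distrib by (rule Bochner_Integration.integral_diff[OF L24_mult2[OF b t] L24_mult2[OF u t]])
    ultimately show ?thesis unfolding P_def by (simp add: algebra_simps)
   qed
   ultimately show ?thesis unfolding S1_def S2_def sum.distrib[symmetric] by (simp add: sum_subtractf[symmetric])
  qed
  have dc: "decays c' B' x h" if "decays c B' x h" for B' x and h :: "real^'d \<Rightarrow> real"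
   unfolding decays_def
  proof (intro conjI allI decaysD(1)[OF that])
   fix s
   have "(c / 2) * (\<Sum>i\<in>UNIV. \<bar>(x - s) $ i\<bar>) \<le> c * (\<Sum>i\<in>UNIV. \<bar>(x - s) $ i\<bar>)"
    using c_pos by (intro mult_right_mono sum_nonneg) auto
   then have "expdec c (x - s) \<le> expdec c' (x - s)" unfolding c'_def by simp
   then have "B' * expdec c (x - s) \<le> B' * expdec c' (x - s)" by (rule mult_left_mono[OF _ decaysD(3)[OF that]])
   then show "\<bar>h s\<bar> \<le> B' * expdec c' (x - s)" using decaysD(2)[OF that, of s] by linarith
  qed
  have E1: "expectation (\<lambda>w. (S1 w)^2) \<le> B^2 * var_const \<Delta> c' * (\<Sum>y\<in>Ob. (cut_err L \<eta> y)^2)"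
   unfolding S1_def
   by (rule product_sum_variance_bound[OF has_int_diff[OF X_int Zt] X'_int c' \<Delta>_pos _ _ Ob])
    (use cut_error_decays[OF f_decays \<eta> L] dc[OF decays_translate[OF f'_decays]] in \<open>auto simp: c'_def\<close>)
  have E2: "expectation (\<lambda>w. (S2 w)^2) \<le> B^2 * var_const \<Delta> c' * (\<Sum>y\<in>Ob. (cut_err L \<eta> y)^2)"
   unfolding S2_def
   by (rule product_sum_variance_bound[OF has_int_diff[OF X'_int Zf] Zt c' \<Delta>_pos _ _ Ob])
    (use cut_error_decays[OF f'_decays \<eta> L] dc[OF cut_decays[OF f_decays \<eta> L]] in \<open>auto simp: c'_def\<close>)
  have S1: "S1 \<in> borel_measurable M" "integrable M (\<lambda>w. (S1 w)^2)"
   unfolding S1_def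
   by (intro borel_measurable_sum integrable_sum_sq centered_product_L2 L24_diff has_intD(2)[OF X_int] has_intD(2)[OF X'_int] has_intD(2)[OF Zt]; assumption)+
  have S2: "S2 \<in> borel_measurable M" "integrable M (\<lambda>w. (S2 w)^2)"
   unfolding S2_def
   by (intro borel_measurable_sum integrable_sum_sq centered_product_L2 L24_diff has_intD(2)[OF X'_int] has_intD(2)[OF Zt] has_intD(2)[OF Zf]; assumption)+
  have "expectation (\<lambda>w. ((\<Sum>y\<in>Ob. P y w) - Wsum K w)^2) \<le> 2 * expectation (\<lambda>w. (S1 w)^2) + 2 * expectation (\<lambda>w. (S2 w)^2)"
   unfolding dec by (rule second_moment_sum_le(2)[OF S1(1) S2(1) S1(2) S2(2)])
  also have "\<dots> \<le> V * (\<Sum>y\<in>Ob. (cut_err L \<eta> y)^2)" using E1 E2 unfolding V_def by simp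
  also have "\<dots> \<le> V * (real (K * L) ^ CARD('d) * (2 * \<eta> * B + C2 / real L))"
   using sum_cut_err_le[OF L \<eta>, of K] V unfolding Ob_def C2_def by (intro mult_left_mono) auto
  also have "\<dots> = real (K * L) ^ CARD('d) * (V * (2 * \<eta> * B + C2 / real L))" by (simp only: mult_ac)
  also have "\<dots> \<le> real (K * L) ^ CARD('d) * e" by (rule mult_left_mono[OF small]) simp
  finally show ?thesis unfolding Ob_def by (simp only: mult.commute)
 qed
 show ?thesis
  by (intro exI[of _ L] exI[of _ "W z0"] exI[of _ Wsum] conjI allI L Wm W2 EW Wsm Ws2 Wchar err)
qed

end

text \<open>z^k is compared with exp (z - 1)^k. Both bases lie in the closed unit disc, so the
  powers differ by at most k |z - exp (z - 1)|; this is k times a quantity quadratic in z - 1 and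
  hence negligible.\<close>

lemma power_exp_limit:
 fixes z :: "nat \<Rightarrow> complex" and k :: "nat \<Rightarrow> nat"
 assumes z: "\<And>n. cmod (z n) \<le> 1" and lim: "(\<lambda>n. of_nat (k n) * (z n - 1)) \<longlonglongrightarrow> a" and z1: "z \<longlonglongrightarrow> 1"
 shows "(\<lambda>n. z n ^ k n) \<longlonglongrightarrow> exp a"
proof -
 have bound: "cmod (z n ^ k n - exp (of_nat (k n) * (z n - 1))) \<le> exp 2 * cmod (of_nat (k n) * (z n - 1)) * cmod (z n - 1)" for n
 proof -
  have re: "Re (z n - 1) \<le> 0" using z[of n] complex_Re_le_cmod[of "z n"] by simp
  have n1: "cmod (exp (z n - 1)) \<le> 1" using re by simp
  have taylor: "cmod (z n - exp (z n - 1)) \<le> exp 2 * (cmod (z n - 1))^2"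
  proof -
   have "cmod (exp (z n - 1) - (\<Sum>i\<le>1. (z n - 1) ^ i / fact i)) \<le> exp \<bar>Re (z n - 1)\<bar> * cmod (z n - 1) ^ Suc 1 / fact 1"
    by (rule Taylor_exp)
   then have "cmod (z n - exp (z n - 1)) \<le> exp \<bar>Re (z n - 1)\<bar> * (cmod (z n - 1))^2"
    by (simp add: norm_minus_commute power2_eq_square)
   also have "\<dots> \<le> exp 2 * (cmod (z n - 1))^2"
   proof (intro mult_right_mono)
    have "\<bar>Re (z n)\<bar> \<le> 1" using abs_Re_le_cmod[of "z n"] z[of n] by linarith
    then show "exp \<bar>Re (z n - 1)\<bar> \<le> exp 2" by simp
   qed simp
   finally show ?thesis .
  qed
  have "cmod (z n ^ k n - exp (of_nat (k n) * (z n - 1))) = cmod (z n ^ k n - exp (z n - 1) ^ k n)"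
   by (simp add: exp_of_nat_mult)
  also have "\<dots> \<le> k n * cmod (z n - exp (z n - 1))" by (rule norm_power_diff[OF z n1])
  also have "\<dots> \<le> k n * (exp 2 * (cmod (z n - 1))^2)" by (rule mult_left_mono[OF taylor]) simp
  finally show ?thesis by (simp add: norm_mult power2_eq_square mult_ac)
 qed
 have "(\<lambda>n. z n - 1) \<longlonglongrightarrow> 0" using tendsto_diff[OF z1 tendsto_const, of 1] by simp
 from tendsto_mult[OF tendsto_mult[OF tendsto_const[of "exp 2"] tendsto_norm[OF lim]] tendsto_norm[OF this]]
 have "(\<lambda>n. exp 2 * cmod (of_nat (k n) * (z n - 1)) * cmod (z n - 1)) \<longlonglongrightarrow> 0" by simp
 then have "(\<lambda>n. z n ^ k n - exp (of_nat (k n) * (z n - 1))) \<longlonglongrightarrow> 0"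
  by (rule Lim_null_comparison[OF always_eventually[OF allI[OF bound]]])
 from tendsto_add[OF this tendsto_exp[OF lim]] show ?thesis by simp
qed

text \<open>The number of summands and the scaling are tied only through the limit
  \<open>\<kappa>\<close>: with blocks of side L there will be about N^d / L^d summands, scaled by
  N^(-d/2).\<close>

lemma (in prob_space) iid_char_limit:
 fixes W :: "'a \<Rightarrow> real" and s :: "nat \<Rightarrow> real" and k :: "nat \<Rightarrow> nat"
 assumes W[measurable]: "W \<in> borel_measurable M" and W2: "integrable M (\<lambda>w. (W w)^2)" and EW: "expectation W = 0"
  and s: "s \<longlonglongrightarrow> 0" and ks: "(\<lambda>n. real (k n) * (s n)^2) \<longlonglongrightarrow> \<kappa>"
 shows "(\<lambda>n. char (distr M borel W) (s n) ^ k n) \<longlonglongrightarrow> exp (of_real (- \<kappa> * expectation (\<lambda>w. (W w)^2) / 2))"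
proof (rule power_exp_limit)
 interpret D: real_distribution "distr M borel W" by (rule real_distribution_distr[OF W])
 show "cmod (char (distr M borel W) (s n)) \<le> 1" for n by (rule D.cmod_char_le_1)
 have "isCont (char (distr M borel W)) 0" by (rule D.isCont_char)
 then have "(\<lambda>n. char (distr M borel W) (s n)) \<longlonglongrightarrow> char (distr M borel W) 0"
  using s by (simp add: isCont_tendsto_compose)
 then show "(\<lambda>n. char (distr M borel W) (s n)) \<longlonglongrightarrow> 1" by (simp add: D.char_zero)
 define v where "v = expectation (\<lambda>w. (W w)^2)"
 obtain e where e: "e \<longlonglongrightarrow> 0"
  "\<And>n. cmod (char (distr M borel W) (s n) - of_real (1 - (s n)^2 * v / 2)) \<le> (s n)^2 * e n"
  using char_quadratic_approx[OF W W2 EW s] unfolding v_def by blast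
 have z: "(\<lambda>n. real (k n) * (s n)^2 * e n) \<longlonglongrightarrow> 0" using tendsto_mult[OF ks e(1)] by simp
 have "(\<lambda>n. of_nat (k n) * (char (distr M borel W) (s n) - of_real (1 - (s n)^2 * v / 2))) \<longlonglongrightarrow> 0"
 proof (rule Lim_null_comparison[OF always_eventually z], rule allI)
  show "cmod (of_nat (k n) * (char (distr M borel W) (s n) - of_real (1 - (s n)^2 * v / 2))) \<le> real (k n) * (s n)^2 * e n" for n
   unfolding norm_mult norm_of_nat mult.assoc by (intro mult_left_mono e(2)) simp
 qed
 moreover have "(\<lambda>n. complex_of_real (real (k n) * (s n)^2 * (v / 2))) \<longlonglongrightarrow> of_real (\<kappa> * (v / 2))"
  by (intro tendsto_of_real tendsto_mult ks tendsto_const)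
 ultimately have "(\<lambda>n. of_nat (k n) * (char (distr M borel W) (s n) - of_real (1 - (s n)^2 * v / 2)) - of_real (real (k n) * (s n)^2 * (v / 2)))
   \<longlonglongrightarrow> 0 - of_real (\<kappa> * (v / 2))" by (rule tendsto_diff)
 then show "(\<lambda>n. of_nat (k n) * (char (distr M borel W) (s n) - 1)) \<longlonglongrightarrow> of_real (- \<kappa> * v / 2)"
  by (simp add: algebra_simps)
qed

text \<open>The map u to exp (i u) is Lipschitz with constant 1, and the first absolute moment is at
  most the L2 norm.\<close>

lemma (in prob_space) char_difference_le:
 fixes U V :: "'a \<Rightarrow> real"
 assumes [measurable]: "U \<in> borel_measurable M" "V \<in> borel_measurable M" and D: "integrable M (\<lambda>w. (U w - V w)^2)"
 shows "cmod ((CLINT w|M. iexp (U w)) - (CLINT w|M. iexp (V w))) \<le> sqrt (expectation (\<lambda>w. (U w - V w)^2))"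
proof -
 have i: "integrable M (\<lambda>w. iexp (U w))" "integrable M (\<lambda>w. iexp (V w))"
  by (rule integrable_const_bound[where B=1]; auto)+
 have Di: "integrable M (\<lambda>w. U w - V w)" using square_integrable_imp_integrable[OF _ D] by simp
 have "cmod ((CLINT w|M. iexp (U w)) - (CLINT w|M. iexp (V w))) = cmod (CLINT w|M. iexp (U w) - iexp (V w))" using i by simp
 also have "\<dots> \<le> expectation (\<lambda>w. cmod (iexp (U w) - iexp (V w)))" by (rule integral_norm_bound)
 also have "\<dots> \<le> expectation (\<lambda>w. \<bar>U w - V w\<bar>)"
 proof (rule integral_mono)
  show "integrable M (\<lambda>w. cmod (iexp (U w) - iexp (V w)))" using i by auto
  show "integrable M (\<lambda>w. \<bar>U w - V w\<bar>)" using Di by auto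
  show "cmod (iexp u - iexp v) \<le> \<bar>u - v\<bar>" for u v :: real
  proof -
   have "iexp u - iexp v = iexp v * (iexp (u - v) - 1)" by (simp add: right_diff_distrib exp_add[symmetric] flip: distrib_left)
   then show ?thesis using iexp_approx1[of "u - v" 0] by (simp add: norm_mult)
  qed
 qed
 also have "\<dots> \<le> sqrt (expectation (\<lambda>w. (U w - V w)^2))" by (rule expectation_le_sqrt) (use D in auto)
 finally show ?thesis .
qed

text \<open>The difference of squares is (U - V) (U + V), and U + V = 2 U - (U - V) has a second
  moment controlled by those of U and U - V.\<close>

lemma (in prob_space) second_moment_difference_le:
 fixes U V :: "'a \<Rightarrow> real"
 assumes [measurable]: "U \<in> borel_measurable M" "V \<in> borel_measurable M"
  and U: "integrable M (\<lambda>w. (U w)^2)" and V: "integrable M (\<lambda>w. (V w)^2)"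
  and D: "expectation (\<lambda>w. (U w - V w)^2) \<le> d" and UC: "expectation (\<lambda>w. (U w)^2) \<le> C"
 shows "\<bar>expectation (\<lambda>w. (U w)^2) - expectation (\<lambda>w. (V w)^2)\<bar> \<le> sqrt d * sqrt (8 * C + 2 * d)"
proof -
 have V': "integrable M (\<lambda>w. (- V w)^2)" using V by simp
 have Di: "integrable M (\<lambda>w. (U w - V w)^2)" using second_moment_sum_le(1)[of U "\<lambda>w. - V w"] U V' by simp
 have Si: "integrable M (\<lambda>w. (U w + V w)^2)" using second_moment_sum_le(1)[of U V] U V by simp
 have "expectation (\<lambda>w. (U w + V w)^2) = expectation (\<lambda>w. (2 * U w + - (U w - V w))^2)" by (simp add: algebra_simps)
 also have "\<dots> \<le> 2 * expectation (\<lambda>w. (2 * U w)^2) + 2 * expectation (\<lambda>w. (- (U w - V w))^2)"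
  by (rule second_moment_sum_le(2)) (use U Di in \<open>auto simp: power_mult_distrib power2_commute\<close>)
 also have "\<dots> = 8 * expectation (\<lambda>w. (U w)^2) + 2 * expectation (\<lambda>w. (U w - V w)^2)"
  by (simp add: power_mult_distrib power2_commute)
 also have "\<dots> \<le> 8 * C + 2 * d" using D UC by simp
 finally have S: "expectation (\<lambda>w. (U w + V w)^2) \<le> 8 * C + 2 * d" .
 have "expectation (\<lambda>w. (U w)^2) - expectation (\<lambda>w. (V w)^2) = expectation (\<lambda>w. (U w - V w) * (U w + V w))"
  using U V by (simp add: power2_eq_square algebra_simps)
 also have "\<bar>\<dots>\<bar> \<le> sqrt (expectation (\<lambda>w. (U w - V w)^2)) * sqrt (expectation (\<lambda>w. (U w + V w)^2))"
  by (rule integral_abs_Cauchy_Schwarz) (use Di Si in auto)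
 also have "\<dots> \<le> sqrt d * sqrt (8 * C + 2 * d)"
  using D S order_trans[OF _ D, of 0] by (intro mult_mono) auto
 finally show ?thesis .
qed

lemma exp_neg_half_lipschitz:
 assumes "0 \<le> x" "0 \<le> (y::real)"
 shows "\<bar>exp (- x / 2) - exp (- y / 2)\<bar> \<le> \<bar>x - y\<bar>"
proof -
 have *: "\<bar>exp (- x / 2) - exp (- y / 2)\<bar> \<le> \<bar>x - y\<bar>" if "0 \<le> x" "x \<le> y" for x y :: real
 proof -
  have "exp (- x / 2) - exp (- y / 2) = exp (- x / 2) * (1 - exp (- ((y - x) / 2)))"
   by (simp add: right_diff_distrib exp_add[symmetric] diff_divide_distrib)
  also have "\<dots> \<le> 1 * ((y - x) / 2)" using that exp_neg_bounds(1)[of "(y - x) / 2"] by (intro mult_mono) auto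
  finally have "exp (- x / 2) - exp (- y / 2) \<le> (y - x) / 2" by simp
  moreover have "exp (- y / 2) \<le> exp (- x / 2)" using that by simp
  ultimately have "\<bar>exp (- x / 2) - exp (- y / 2)\<bar> \<le> (y - x) / 2" by simp
  also have "\<dots> \<le> \<bar>x - y\<bar>" using that by simp
  finally show ?thesis .
 qed
 show ?thesis using *[of x y] *[of y x] assms by (cases "x \<le> y") (auto simp: abs_minus_commute)
qed

text \<open>For a fixed accuracy e the normalized sum \<open>T\<close> is eventually close in L2 to
  a block sum \<open>T'\<close>, whose characteristic function converges to a normal one with
  variance \<open>\<kappa> * v\<close>. The same closeness brings \<open>\<kappa> * v\<close> near
  the limiting variance \<open>\<sigma>2\<close>; letting e tend to 0 afterwards removes the
  blocks.\<close>

lemma (in product_field) product_sum_clt: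
 defines "\<sigma>2 \<equiv> \<Sum>\<^sub>\<infinity>l\<in>lattice_pts \<Delta>. rho l"
 shows "(\<lambda>N. CLINT w|M. iexp ((\<Sum>x\<in>obs_pts \<Delta> N. P x w) / sqrt (real N ^ CARD('d)))) \<longlonglongrightarrow> of_real (exp (- \<sigma>2 / 2))"
  and "0 \<le> \<sigma>2"
proof -
 define r where "r N = sqrt (real N ^ CARD('d))" for N
 define C where "C = B^2 * var_const \<Delta> c * B^2"
 have C: "0 \<le> C" unfolding C_def var_const_def using cov_const_nonneg[of c] c_pos \<Delta>_pos by simp
 have Sm: "(\<lambda>w. \<Sum>x\<in>A. P x w) \<in> borel_measurable M" "integrable M (\<lambda>w. (\<Sum>x\<in>A. P x w)^2)" for A
  by (auto intro!: borel_measurable_sum integrable_sum_sq P_sq_integrable)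
 note lim\<sigma> = sum_P_variance_limit[folded \<sigma>2_def]
 show \<sigma>2: "0 \<le> \<sigma>2" by (rule LIMSEQ_le_const[OF lim\<sigma>]) auto
 have r2: "(r N)^2 = real N ^ CARD('d)" for N unfolding r_def by simp
 \<comment> \<open>The term sqrt (3 e) pays for replacing \<open>T\<close> by \<open>T'\<close>, the
   first e for the limit of the block sums, and the product of roots for the change of variance; the
   last e is slack.\<close>
 have key: "\<forall>\<^sub>F N in sequentially. cmod ((CLINT w|M. iexp ((\<Sum>x\<in>obs_pts \<Delta> N. P x w) / r N)) - of_real (exp (- \<sigma>2 / 2)))
   < sqrt (3 * e) + e + (sqrt (3 * e) * sqrt (8 * C + 6) + e)" if e: "0 < e" "e \<le> 1" for e
 proof -
  have e2: "0 < e / 2" using e by simp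
  from block_approximation[OF e2] obtain L W0 Wsum where L: "0 < L" and W0: "W0 \<in> borel_measurable M" "integrable M (\<lambda>w. (W0 w)^2)" "expectation W0 = 0"
   and H: "\<forall>K. Wsum K \<in> borel_measurable M \<and> integrable M (\<lambda>w. (Wsum K w)^2) \<and>
    expectation (\<lambda>w. ((\<Sum>y\<in>obs_pts \<Delta> (K * L). P y w) - Wsum K w)^2) \<le> e / 2 * real (K * L) ^ CARD('d) \<and>
    (\<forall>t. char (distr M borel (Wsum K)) t = char (distr M borel W0) t ^ (K ^ CARD('d))) \<and>
    expectation (\<lambda>w. (Wsum K w)^2) = real K ^ CARD('d) * expectation (\<lambda>w. (W0 w)^2)"
   by blast
  have Ws: "Wsum K \<in> borel_measurable M" "integrable M (\<lambda>w. (Wsum K w)^2)"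
   and err: "expectation (\<lambda>w. ((\<Sum>y\<in>obs_pts \<Delta> (K * L). P y w) - Wsum K w)^2) \<le> e / 2 * real (K * L) ^ CARD('d)"
   and Wchar: "char (distr M borel (Wsum K)) t = char (distr M borel W0) t ^ (K ^ CARD('d))"
   and Wvar: "expectation (\<lambda>w. (Wsum K w)^2) = real K ^ CARD('d) * expectation (\<lambda>w. (W0 w)^2)" for K t
   using H by blast+
  define v where "v = expectation (\<lambda>w. (W0 w)^2)"
  \<comment> \<open>The asymptotic number of blocks per observation point.\<close>
  define \<kappa> where "\<kappa> = 1 / real L ^ CARD('d)"
  define K where "K N = N div L" for N
  note [measurable] = Ws(1) Sm(1)
  have Kratio: "(\<lambda>N. real (K N) / real N) \<longlonglongrightarrow> 1 / real L"
  proof (rule tendsto_sandwich[OF _ _ _ tendsto_const])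
   show "(\<lambda>N. 1 / real L - 1 / real N) \<longlonglongrightarrow> 1 / real L" by real_asymp
   have KL: "N = L * K N + N mod L" for N unfolding K_def by simp
   show "\<forall>\<^sub>F N in sequentially. real (K N) / real N \<le> 1 / real L"
    using eventually_gt_at_top[of 0]
   proof eventually_elim
    case (elim N)
    have "real L * real (K N) \<le> real N" using KL[of N] by (metis le_add1 of_nat_le_iff of_nat_mult)
    then show ?case using elim L by (simp add: field_simps)
   qed
   show "\<forall>\<^sub>F N in sequentially. 1 / real L - 1 / real N \<le> real (K N) / real N"
    using eventually_gt_at_top[of 0]
   proof eventually_elim
    case (elim N)
    have "N mod L < L" using L by simp
    then have "N \<le> L * K N + L" using KL[of N] by linarith
    then have "real N \<le> real L * real (K N) + real L" by (metis of_nat_add of_nat_le_iff of_nat_mult)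
    then have "real N / real L - 1 \<le> real (K N)" using L by (simp add: field_simps)
    then have "(real N / real L - 1) / real N \<le> real (K N) / real N" by (rule divide_right_mono) simp
    then show ?case using elim by (simp add: diff_divide_distrib)
   qed
  qed
  have Kpow: "(\<lambda>N. real (K N) ^ CARD('d) / real N ^ CARD('d)) \<longlonglongrightarrow> \<kappa>"
   using tendsto_power[OF Kratio, of "CARD('d)"] unfolding \<kappa>_def by (simp add: power_divide)
  have KLpow: "(\<lambda>N. real (K N * L) ^ CARD('d) / real N ^ CARD('d)) \<longlonglongrightarrow> 1"
   using tendsto_mult_left[OF Kpow, of "real L ^ CARD('d)"] L unfolding \<kappa>_def by (simp add: power_mult_distrib mult.commute)
  define T where "T N w = (\<Sum>x\<in>obs_pts \<Delta> N. P x w) / r N" for N w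
  define T' where "T' N w = Wsum (K N) w / r N" for N w
  have Tm[measurable]: "T N \<in> borel_measurable M" "T' N \<in> borel_measurable M" for N unfolding T_def T'_def by measurable
  have T2: "integrable M (\<lambda>w. (T N w)^2)" "integrable M (\<lambda>w. (T' N w)^2)" for N
   unfolding T_def T'_def power_divide using Sm(2) Ws(2) by auto
  have D2: "integrable M (\<lambda>w. (T N w - T' N w)^2)" for N
   using second_moment_sum_le(1)[of "T N" "\<lambda>w. - T' N w"] T2 by simp
  \<comment> \<open>N need not be a multiple of L: the observation points outside the cube of side K
    L give the first term, the block approximation inside it gives the second.\<close>
  have D: "expectation (\<lambda>w. (T N w - T' N w)^2) \<le> 2 * C * (1 - real (K N * L) ^ CARD('d) / real N ^ CARD('d)) + e" if N: "0 < N" for N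
  proof -
   define On where "On = (obs_pts \<Delta> N :: (real^'d) set)"
   define Ok where "Ok = (obs_pts \<Delta> (K N * L) :: (real^'d) set)"
   have fin: "finite On" unfolding On_def by (rule obs_pts_finite_card[OF \<Delta>_pos])
   have KLN: "K N * L \<le> N" unfolding K_def by simp
   have sub: "Ok \<subseteq> On" unfolding Ok_def On_def using lag_pts_mono[OF KLN, of \<Delta> 0] unfolding lag_pts_zero .
   have cards: "real (card (On - Ok)) = real N ^ CARD('d) - real (K N * L) ^ CARD('d)"
    unfolding card_Diff_subset[OF finite_subset[OF sub fin] sub] using card_mono[OF fin sub]
    by (simp add: of_nat_diff On_def Ok_def obs_pts_finite_card(2)[OF \<Delta>_pos])
   have split: "r N * (T N w - T' N w) = (\<Sum>x\<in>On - Ok. P x w) + ((\<Sum>x\<in>Ok. P x w) - Wsum (K N) w)" for w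
   proof -
    have "r N \<noteq> 0" unfolding r_def using N by simp
    then show ?thesis unfolding T_def T'_def On_def[symmetric] using sum.subset_diff[OF sub fin, of "\<lambda>x. P x w"]
     by (simp add: right_diff_distrib)
   qed
   have i: "integrable M (\<lambda>w. ((\<Sum>x\<in>Ok. P x w) - Wsum (K N) w)^2)"
    using second_moment_sum_le(1)[of "\<lambda>w. \<Sum>x\<in>Ok. P x w" "\<lambda>w. - Wsum (K N) w"] Sm Ws by simp
   have "real N ^ CARD('d) * expectation (\<lambda>w. (T N w - T' N w)^2) = expectation (\<lambda>w. (r N * (T N w - T' N w))^2)"
    unfolding power_mult_distrib r2 by simp
   also have "\<dots> \<le> 2 * expectation (\<lambda>w. (\<Sum>x\<in>On - Ok. P x w)^2) + 2 * expectation (\<lambda>w. ((\<Sum>x\<in>Ok. P x w) - Wsum (K N) w)^2)"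
    unfolding split by (rule second_moment_sum_le(2)[OF _ _ Sm(2) i]) measurable
   also have "\<dots> \<le> 2 * (C * real (card (On - Ok))) + 2 * (e / 2 * real (K N * L) ^ CARD('d))"
    using sum_P_variance_bound[of "On - Ok"] err[of "K N"] fin obs_pts_lattice[of \<Delta> N] unfolding C_def On_def Ok_def
    by (intro add_mono mult_left_mono) auto
   also have "\<dots> \<le> 2 * (C * (real N ^ CARD('d) - real (K N * L) ^ CARD('d))) + e * real N ^ CARD('d)"
   proof -
    have "real (K N * L) ^ CARD('d) \<le> real N ^ CARD('d)" using KLN by (intro power_mono) (auto simp del: of_nat_mult)
    then have "e * real (K N * L) ^ CARD('d) \<le> e * real N ^ CARD('d)" using e by (intro mult_left_mono) auto
    then show ?thesis unfolding cards by simp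
   qed
   finally show ?thesis using N by (simp add: field_simps)
  qed
  have rinf: "(\<lambda>N. 1 / r N) \<longlonglongrightarrow> 0"
  proof -
   have "filterlim r at_top sequentially" unfolding r_def
    by (intro filterlim_compose[OF sqrt_at_top] filterlim_pow_at_top filterlim_real_sequentially) simp
   then show ?thesis using tendsto_divide_0[OF tendsto_const filterlim_at_top_imp_at_infinity] by blast
  qed
  have kr: "(\<lambda>N. real (K N ^ CARD('d)) * (1 / r N)^2) \<longlonglongrightarrow> \<kappa>"
   using Kpow unfolding power_divide r2 by simp
  have lchar: "(\<lambda>N. CLINT w|M. iexp (T' N w)) \<longlonglongrightarrow> of_real (exp (- \<kappa> * v / 2))"
  proof -
   have "(CLINT w|M. iexp (T' N w)) = char (distr M borel W0) (1 / r N) ^ (K N ^ CARD('d))" for N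
   proof -
    have "char (distr M borel (Wsum (K N))) (1 / r N) = (CLINT w|M. iexp ((1 / r N) * Wsum (K N) w))"
     unfolding char_def by (rule integral_distr) measurable
    then show ?thesis unfolding Wchar[of "K N" "1 / r N"] T'_def by simp
   qed
   then show ?thesis using iid_char_limit[OF W0 rinf kr] unfolding v_def exp_of_real by simp
  qed
  have lvar: "(\<lambda>N. expectation (\<lambda>w. (T' N w)^2)) \<longlonglongrightarrow> \<kappa> * v"
   using tendsto_mult_right[OF Kpow, of v] unfolding T'_def power_divide r2 v_def by (simp add: Wvar)
  have lT: "(\<lambda>N. expectation (\<lambda>w. (T N w)^2)) \<longlonglongrightarrow> \<sigma>2"
   using lim\<sigma> unfolding T_def power_divide r2 by simp
  have EC: "expectation (\<lambda>w. (T N w)^2) \<le> C" for N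
  proof -
   have "expectation (\<lambda>w. (T N w)^2) = expectation (\<lambda>w. (\<Sum>x\<in>obs_pts \<Delta> N. P x w)^2) / real N ^ CARD('d)"
    unfolding T_def power_divide r2 by simp
   also have "\<dots> \<le> C * real (N ^ CARD('d)) / real N ^ CARD('d)"
    using sum_P_variance_bound[OF obs_pts_finite_card(1)[OF \<Delta>_pos] obs_pts_lattice, of N]
    unfolding C_def obs_pts_finite_card(2)[OF \<Delta>_pos] by (intro divide_right_mono) auto
   also have "\<dots> \<le> C" using C by (cases "N = 0") auto
   finally show ?thesis .
  qed
  have Dev: "\<forall>\<^sub>F N in sequentially. expectation (\<lambda>w. (T N w - T' N w)^2) \<le> 3 * e"
  proof -
   have "(\<lambda>N. 2 * C * (1 - real (K N * L) ^ CARD('d) / real N ^ CARD('d)) + e) \<longlonglongrightarrow> 2 * C * (1 - 1) + e"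
    by (intro tendsto_intros KLpow)
   then have "\<forall>\<^sub>F N in sequentially. 2 * C * (1 - real (K N * L) ^ CARD('d) / real N ^ CARD('d)) + e < 3 * e"
    using e by (intro order_tendstoD(2)) auto
   then show ?thesis using eventually_gt_at_top[of 0]
   proof eventually_elim
    case (elim N)
    then show ?case using D[of N] by linarith
   qed
  qed
  have "(\<lambda>N. \<bar>expectation (\<lambda>w. (T N w)^2) - expectation (\<lambda>w. (T' N w)^2)\<bar>) \<longlonglongrightarrow> \<bar>\<sigma>2 - \<kappa> * v\<bar>"
   by (intro tendsto_intros lT lvar)
  moreover have "\<forall>\<^sub>F N in sequentially. \<bar>expectation (\<lambda>w. (T N w)^2) - expectation (\<lambda>w. (T' N w)^2)\<bar> \<le> sqrt (3 * e) * sqrt (8 * C + 6)"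
   using Dev
  proof eventually_elim
   case (elim N)
   have "\<bar>expectation (\<lambda>w. (T N w)^2) - expectation (\<lambda>w. (T' N w)^2)\<bar> \<le> sqrt (3 * e) * sqrt (8 * C + 2 * (3 * e))"
    by (rule second_moment_difference_le[OF Tm T2 elim EC])
   also have "\<dots> \<le> sqrt (3 * e) * sqrt (8 * C + 6)" using e by (intro mult_left_mono real_sqrt_le_mono) auto
   finally show ?case .
  qed
  ultimately have "\<bar>\<sigma>2 - \<kappa> * v\<bar> \<le> sqrt (3 * e) * sqrt (8 * C + 6)" by (rule tendsto_upperbound) simp
  moreover have "0 \<le> \<kappa> * v" unfolding \<kappa>_def v_def by simp
  ultimately have expdiff: "\<bar>exp (- \<sigma>2 / 2) - exp (- (\<kappa> * v) / 2)\<bar> \<le> sqrt (3 * e) * sqrt (8 * C + 6)"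
   using exp_neg_half_lipschitz[OF \<sigma>2] by (meson order_trans)
  have "\<forall>\<^sub>F N in sequentially. cmod ((CLINT w|M. iexp (T' N w)) - of_real (exp (- \<kappa> * v / 2))) < e"
   using tendstoD[OF lchar e(1)] by (simp add: dist_norm)
  then show ?thesis using Dev
  proof eventually_elim
   case (elim N)
   have 1: "cmod ((CLINT w|M. iexp (T N w)) - (CLINT w|M. iexp (T' N w))) \<le> sqrt (3 * e)"
    by (rule order_trans[OF char_difference_le[OF Tm D2] real_sqrt_le_mono[OF elim(2)]])
   have 3: "cmod (of_real (exp (- \<kappa> * v / 2)) - complex_of_real (exp (- \<sigma>2 / 2))) \<le> sqrt (3 * e) * sqrt (8 * C + 6)"
    unfolding of_real_diff[symmetric] norm_of_real using expdiff by (simp add: abs_minus_commute)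
   have "(CLINT w|M. iexp (T N w)) - of_real (exp (- \<sigma>2 / 2)) = ((CLINT w|M. iexp (T N w)) - (CLINT w|M. iexp (T' N w)))
    + ((CLINT w|M. iexp (T' N w)) - of_real (exp (- \<kappa> * v / 2))) + (of_real (exp (- \<kappa> * v / 2)) - of_real (exp (- \<sigma>2 / 2)))" by simp
   then have "cmod ((CLINT w|M. iexp (T N w)) - of_real (exp (- \<sigma>2 / 2)))
     \<le> cmod ((CLINT w|M. iexp (T N w)) - (CLINT w|M. iexp (T' N w))) + cmod ((CLINT w|M. iexp (T' N w)) - of_real (exp (- \<kappa> * v / 2)))
      + cmod (of_real (exp (- \<kappa> * v / 2)) - complex_of_real (exp (- \<sigma>2 / 2)))"
    by (metis norm_triangle_ineq norm_triangle_mono order_refl)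
   then show ?case using 1 3 elim(1) e(1) unfolding T_def by linarith
  qed
 qed
 show "(\<lambda>N. CLINT w|M. iexp ((\<Sum>x\<in>obs_pts \<Delta> N. P x w) / sqrt (real N ^ CARD('d)))) \<longlonglongrightarrow> of_real (exp (- \<sigma>2 / 2))"
  unfolding r_def[symmetric]
 proof (rule tendstoI)
  fix d :: real assume d: "0 < d"
  have "((\<lambda>e. sqrt (3 * e) + e + (sqrt (3 * e) * sqrt (8 * C + 6) + e)) \<longlongrightarrow> sqrt (3 * 0) + 0 + (sqrt (3 * 0) * sqrt (8 * C + 6) + 0)) (at_right 0)"
   by (intro tendsto_intros)
  then have "\<forall>\<^sub>F e in at_right 0. sqrt (3 * e) + e + (sqrt (3 * e) * sqrt (8 * C + 6) + e) < d"
   using d by (intro order_tendstoD(2)) auto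
  moreover have "\<forall>\<^sub>F e in at_right (0::real). 0 < e \<and> e \<le> 1"
   using eventually_at_right_real[of 0 1] by (rule eventually_mono) auto
  ultimately have "\<forall>\<^sub>F e in at_right 0. sqrt (3 * e) + e + (sqrt (3 * e) * sqrt (8 * C + 6) + e) < d \<and> 0 < e \<and> e \<le> 1"
   by (rule eventually_conj)
  from eventually_happens'[OF trivial_limit_at_right_real this] obtain e where e: "0 < e" "e \<le> 1" "sqrt (3 * e) + e + (sqrt (3 * e) * sqrt (8 * C + 6) + e) < d" by blast
  show "\<forall>\<^sub>F N in sequentially. dist (CLINT w|M. iexp ((\<Sum>x\<in>obs_pts \<Delta> N. P x w) / r N)) (of_real (exp (- \<sigma>2 / 2))) < d"
   using key[OF e(1,2)] by (rule eventually_mono) (use e(3) in \<open>simp add: dist_norm\<close>)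
 qed
qed

section \<open>The empirical variogram of a moving average\<close>

lemma decays_shift:
 fixes t :: "real^'d"
 assumes h: "decays c B 0 h" and c: "0 \<le> c"
 shows "decays c (B * exp (c * (\<Sum>i\<in>UNIV. \<bar>t $ i\<bar>))) 0 (\<lambda>s. h (s + t))"
 unfolding decays_def
proof (intro conjI allI)
 note [measurable] = decaysD(1)[OF h]
 show "(\<lambda>s. h (s + t)) \<in> borel_measurable borel" by measurable
 fix s :: "real^'d"
 have "(\<Sum>i\<in>UNIV. \<bar>s $ i\<bar>) \<le> (\<Sum>i\<in>UNIV. \<bar>(s + t) $ i\<bar> + \<bar>t $ i\<bar>)" by (rule sum_mono) simp
 then have "(\<Sum>i\<in>UNIV. \<bar>s $ i\<bar>) \<le> (\<Sum>i\<in>UNIV. \<bar>(s + t) $ i\<bar>) + (\<Sum>i\<in>UNIV. \<bar>t $ i\<bar>)" unfolding sum.distrib .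
 then have "c * (\<Sum>i\<in>UNIV. \<bar>s $ i\<bar>) \<le> c * ((\<Sum>i\<in>UNIV. \<bar>(s + t) $ i\<bar>) + (\<Sum>i\<in>UNIV. \<bar>t $ i\<bar>))" using c by (rule mult_left_mono)
 then have "expdec c (s + t) \<le> exp (c * (\<Sum>i\<in>UNIV. \<bar>t $ i\<bar>)) * expdec c s"
  unfolding exp_add[symmetric] exp_le_cancel_iff by (simp only: distrib_left minus_mult_left[symmetric])
 from mult_left_mono[OF this decaysD(3)[OF h]]
 have a: "B * expdec c (s + t) \<le> B * exp (c * (\<Sum>i\<in>UNIV. \<bar>t $ i\<bar>)) * expdec c s" by (simp only: mult.assoc)
 have b: "\<bar>h (s + t)\<bar> \<le> B * expdec c (s + t)" using decaysD(2)[OF h, of "s + t"] by (simp only: diff_0 expdec_uminus)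
 show "\<bar>h (s + t)\<bar> \<le> B * exp (c * (\<Sum>i\<in>UNIV. \<bar>t $ i\<bar>)) * expdec c (0 - s)"
  unfolding diff_0 expdec_uminus by (rule order_trans[OF b a])
qed

lemma decays_add:
 assumes f: "decays c a x f" and h: "decays c b x h"
 shows "decays c (a + b) x (\<lambda>s. f s + h s)"
 unfolding decays_def
proof (intro conjI allI)
 show "(\<lambda>s. f s + h s) \<in> borel_measurable borel" using decaysD(1)[OF f] decaysD(1)[OF h] by (rule borel_measurable_add)
 fix s
 have "\<bar>f s + h s\<bar> \<le> \<bar>f s\<bar> + \<bar>h s\<bar>" by (rule abs_triangle_ineq)
 also have "\<dots> \<le> a * expdec c (x - s) + b * expdec c (x - s)" by (rule add_mono[OF decaysD(2)[OF f] decaysD(2)[OF h]])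
 finally show "\<bar>f s + h s\<bar> \<le> (a + b) * expdec c (x - s)" by (simp only: distrib_right)
qed

lemma decays_cmult:
 assumes f: "decays c a x f"
 shows "decays c (\<bar>w\<bar> * a) x (\<lambda>s. w * f s)"
 unfolding decays_def
proof (intro conjI allI)
 show "(\<lambda>s. w * f s) \<in> borel_measurable borel" using decaysD(1)[OF f] by simp
 fix s
 show "\<bar>w * f s\<bar> \<le> \<bar>w\<bar> * a * expdec c (x - s)"
  unfolding abs_mult mult.assoc by (rule mult_left_mono[OF decaysD(2)[OF f]]) simp
qed

lemma lattice_summable:
 fixes F :: "real^'d \<Rightarrow> real"
 assumes c: "0 < c" and \<Delta>: "0 < \<Delta>" and F: "\<And>l. \<bar>F l\<bar> \<le> K * expdec c l"
 shows "F summable_on lattice_pts \<Delta>"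
proof -
 have "(\<lambda>l. expdec c l) summable_on (lattice_pts \<Delta> :: (real^'d) set)"
  using lattice_sum_expdec_bound[of c \<Delta>] c \<Delta>
  by (intro nonneg_bdd_above_summable_on bdd_aboveI[of _ "(2 / (1 - exp (- c * \<Delta>)))^CARD('d)"]) auto
 then have "Infinite_Set_Sum.abs_summable_on (expdec c) (lattice_pts \<Delta> :: (real^'d) set)"
  by (simp add: abs_summable_equivalent[symmetric])
 then have "Infinite_Set_Sum.abs_summable_on (\<lambda>l. K * expdec c l) (lattice_pts \<Delta> :: (real^'d) set)"
  by (rule abs_summable_on_cmult_right)
 then have "Infinite_Set_Sum.abs_summable_on F (lattice_pts \<Delta>)"
  by (rule abs_summable_on_comparison_test) (use F in \<open>auto intro: order_trans[OF _ abs_ge_self]\<close>)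
 then show ?thesis unfolding abs_summable_equivalent[symmetric] by (rule abs_summable_summable)
qed

lemma has_sum_finite_sum:
 fixes F :: "'j \<Rightarrow> 'x \<Rightarrow> real"
 assumes "finite J" "\<And>j. j \<in> J \<Longrightarrow> (F j has_sum S j) A"
 shows "((\<lambda>x. \<Sum>j\<in>J. F j x) has_sum (\<Sum>j\<in>J. S j)) A"
 using assms by (induction J rule: finite_induct) (auto intro!: has_sum_add)

context prob_space
begin

definition centered :: "('a \<Rightarrow> real) \<Rightarrow> 'a \<Rightarrow> real" where
 "centered U w = U w - expectation U"

lemma L2_limit_add:
 fixes U V :: "nat \<Rightarrow> 'a \<Rightarrow> real"
 assumes "\<And>n. U n \<in> borel_measurable M" "\<And>n. V n \<in> borel_measurable M"
  "\<And>n. integrable M (\<lambda>w. (U n w)^2)" "\<And>n. integrable M (\<lambda>w. (V n w)^2)"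
  and U: "(\<lambda>n. expectation (\<lambda>w. (U n w)^2)) \<longlonglongrightarrow> 0" and V: "(\<lambda>n. expectation (\<lambda>w. (V n w)^2)) \<longlonglongrightarrow> 0"
 shows "(\<lambda>n. expectation (\<lambda>w. (U n w + V n w)^2)) \<longlonglongrightarrow> 0"
proof (rule tendsto_sandwich[OF always_eventually always_eventually tendsto_const])
 show "(\<lambda>n. 2 * expectation (\<lambda>w. (U n w)^2) + 2 * expectation (\<lambda>w. (V n w)^2)) \<longlonglongrightarrow> 0"
  using tendsto_add[OF tendsto_mult[OF tendsto_const[of 2] U] tendsto_mult[OF tendsto_const[of 2] V]] by simp
qed (use assms second_moment_sum_le(2) in auto)

lemma L2_limit_sum:
 fixes U :: "'k \<Rightarrow> nat \<Rightarrow> 'a \<Rightarrow> real"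
 assumes "finite I" "\<And>k n. U k n \<in> borel_measurable M" "\<And>k n. integrable M (\<lambda>w. (U k n w)^2)"
  and "\<And>k. (\<lambda>n. expectation (\<lambda>w. (U k n w)^2)) \<longlonglongrightarrow> 0"
 shows "(\<lambda>n. expectation (\<lambda>w. (\<Sum>k\<in>I. U k n w)^2)) \<longlonglongrightarrow> 0"
 using assms(1)
proof (induction I rule: finite_induct)
 case (insert k I)
 have "(\<lambda>n. expectation (\<lambda>w. (U k n w + (\<Sum>k\<in>I. U k n w))^2)) \<longlonglongrightarrow> 0"
  by (rule L2_limit_add) (use assms(2-4) insert.IH in \<open>auto intro!: borel_measurable_sum integrable_sum_sq\<close>)
 then show ?case using insert(1,2) by simp
qed simp

end

locale moving_average = centered_levy_basis M \<Lambda> \<beta> \<sigma> \<nu>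
 for M :: "'w measure" and \<Lambda> :: "(real^'d) set \<Rightarrow> 'w \<Rightarrow> real" and \<beta> \<sigma> \<nu> +
 fixes g :: "real^'d \<Rightarrow> real" and Y :: "real^'d \<Rightarrow> 'w \<Rightarrow> real" and c B \<Delta> :: real
 assumes c_pos: "0 < c" and \<Delta>_pos: "0 < \<Delta>" and g_decays: "decays c B 0 g"
  and Y_int: "\<And>x. has_int (\<lambda>s. g (x - s)) (Y x)"
begin

text \<open>Translates of g and their linear combinations belong to this class, with the
  correspondingly combined values of Y; in particular it contains the increments and the lag
  combinations.\<close>

definition ma :: "(real^'d \<Rightarrow> real) \<Rightarrow> (real^'d \<Rightarrow> 'w \<Rightarrow> real) \<Rightarrow> bool" where
 "ma h Z \<longleftrightarrow> (\<exists>b. decays c b 0 h) \<and> (\<forall>x. has_int (\<lambda>s. h (x - s)) (Z x))"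

lemma ma_shift: "ma (\<lambda>s. g (s + t)) (\<lambda>x. Y (x + t))"
 unfolding ma_def
proof (intro conjI allI exI)
 show "decays c (B * exp (c * (\<Sum>i\<in>UNIV. \<bar>t $ i\<bar>))) 0 (\<lambda>s. g (s + t))"
  by (rule decays_shift[OF g_decays]) (use c_pos in simp)
 have eq: "x - s + t = x + t - s" for x s :: "real^'d" by simp
 show "has_int (\<lambda>s. g (x - s + t)) (Y (x + t))" for x unfolding eq by (rule Y_int)
qed

lemma ma_base: "ma g Y" using ma_shift[of 0] by simp

lemma ma_add: "ma h Z \<Longrightarrow> ma h' Z' \<Longrightarrow> ma (\<lambda>s. h s + h' s) (\<lambda>x w. Z x w + Z' x w)"
 unfolding ma_def using decays_add has_int_add by blast

lemma ma_cmult: "ma h Z \<Longrightarrow> ma (\<lambda>s. w * h s) (\<lambda>x z. w * Z x z)"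
 unfolding ma_def using decays_cmult has_int_cmult by blast

lemma ma_diff: "ma h Z \<Longrightarrow> ma h' Z' \<Longrightarrow> ma (\<lambda>s. h s - h' s) (\<lambda>x w. Z x w - Z' x w)"
 using ma_add[of h Z "\<lambda>s. -1 * h' s" "\<lambda>x w. -1 * Z' x w"] ma_cmult[of h' Z' "-1"] by simp

lemma ma_sum:
 assumes "finite I" "I \<noteq> {}" "\<And>i. i \<in> I \<Longrightarrow> ma (h i) (Z i)"
 shows "ma (\<lambda>s. \<Sum>i\<in>I. h i s) (\<lambda>x w. \<Sum>i\<in>I. Z i x w)"
 using assms by (induction I rule: finite_ne_induct) (auto intro!: ma_add)

lemma ma_L24: "ma h Z \<Longrightarrow> L24 M (Z x)"
 unfolding ma_def using has_intD(2) by blast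

lemma ma_product_field:
 assumes h: "ma h Z" and h': "ma h' Z'"
 obtains b where "product_field M \<Lambda> \<beta> \<sigma> \<nu> h h' Z Z' c b \<Delta>"
proof -
 obtain b b' where b: "decays c b 0 h" "decays c b' 0 h'" using h h' unfolding ma_def by blast
 have "decays c (max b b') 0 h" "decays c (max b b') 0 h'"
  by (rule decays_mono[OF b(1)] decays_mono[OF b(2)]; simp)+
 then have "product_field M \<Lambda> \<beta> \<sigma> \<nu> h h' Z Z' c (max b b') \<Delta>"
  using h h' c_pos \<Delta>_pos unfolding ma_def by unfold_locales auto
 then show thesis by (rule that)
qed

lemma ma_variance_bound:
 assumes h: "ma h Z" and h': "ma h' Z'"
 obtains K where "0 \<le> K" "\<And>A. finite A \<Longrightarrow> A \<subseteq> lattice_pts \<Delta> \<Longrightarrow>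
  expectation (\<lambda>w. (\<Sum>x\<in>A. centered (\<lambda>w. Z x w * Z' x w) w)^2) \<le> K * real (card A)"
proof -
 obtain b where "product_field M \<Lambda> \<beta> \<sigma> \<nu> h h' Z Z' c b \<Delta>" using ma_product_field[OF h h'] by blast
 then interpret pf: product_field M \<Lambda> \<beta> \<sigma> \<nu> h h' Z Z' c b \<Delta> .
 have "pf.P x = centered (\<lambda>w. Z x w * Z' x w)" for x unfolding pf.P_def centered_def by simp
 then have "expectation (\<lambda>w. (\<Sum>x\<in>A. centered (\<lambda>w. Z x w * Z' x w) w)^2) \<le> b^2 * var_const \<Delta> c * b^2 * real (card A)"
  if "finite A" "A \<subseteq> lattice_pts \<Delta>" for A using pf.sum_P_variance_bound[OF that] by simp
 moreover have "0 \<le> b^2 * var_const \<Delta> c * b^2"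
  unfolding var_const_def using cov_const_nonneg[of c] c_pos \<Delta>_pos by simp
 ultimately show thesis by (rule that[rotated])
qed

lemma centered_L2:
 assumes "ma h Z" "ma h' Z'"
 shows "centered (\<lambda>w. Z x w * Z' y w) \<in> borel_measurable M" "integrable M (\<lambda>w. (centered (\<lambda>w. Z x w * Z' y w) w)^2)"
  "integrable M (\<lambda>w. Z x w * Z' y w)"
proof -
 note L = ma_L24[OF assms(1), of x] ma_L24[OF assms(2), of y]
 note [measurable] = L[THEN L24D(1)]
 show "centered (\<lambda>w. Z x w * Z' y w) \<in> borel_measurable M" unfolding centered_def by measurable
 show "integrable M (\<lambda>w. Z x w * Z' y w)" by (rule L24_mult2[OF L])
 then show "integrable M (\<lambda>w. (centered (\<lambda>w. Z x w * Z' y w) w)^2)"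
  unfolding centered_def power2_diff using L24_mult_sq[OF L] by simp
qed

lemma Y_mean: "expectation (Y x) = 0"
 by (rule has_int_power_moments(1)[OF Y_int])

lemma Y_product: "expectation (\<lambda>w. Y x w * Y y w) = k2 * (LBINT s. g (x - s) * g (y - s))"
 by (rule has_int_mult2[OF Y_int Y_int])

lemma Y_product_translate: "expectation (\<lambda>w. Y (x + z) w * Y (y + z) w) = expectation (\<lambda>w. Y x w * Y y w)"
proof -
 note [measurable] = decaysD(1)[OF g_decays]
 have "(LBINT s. g (x + z - s) * g (y + z - s)) = (LBINT s. g s * g (y - x + s))"
  using integral_lborel_reflect[of "\<lambda>s. g s * g (y - x + s)" "x + z"] by (simp add: algebra_simps)
 moreover have "(LBINT s. g (x - s) * g (y - s)) = (LBINT s. g s * g (y - x + s))"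
  using integral_lborel_reflect[of "\<lambda>s. g s * g (y - x + s)" x] by (simp add: algebra_simps)
 ultimately show ?thesis unfolding Y_product by simp
qed

abbreviation "\<gamma> \<equiv> autocov Y"

lemma Y_product_autocov: "expectation (\<lambda>w. Y x w * Y y w) = \<gamma> (x - y)"
 using Y_product_translate[of "x - y" y 0] unfolding autocov_def covariance_def Y_mean by simp

lemma autocov_uminus: "\<gamma> (- t) = \<gamma> t"
 using Y_product_autocov[of 0 t] Y_product_autocov[of t 0] by (simp add: mult.commute)

lemma variogram_eq: "variogram Y t = expectation (\<lambda>w. (Y t w - Y 0 w)^2)"
proof -
 have "expectation (\<lambda>w. Y t w - Y 0 w) = 0"
  using Y_mean L24_integrable[OF ma_L24[OF ma_base]] by simp
 then show ?thesis unfolding variogram_def by simp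
qed

lemma increment_second_moment: "expectation (\<lambda>w. (Y (x + t) w - Y x w)^2) = 2 * \<gamma> 0 - 2 * \<gamma> t"
proof -
 note i = centered_L2(3)[OF ma_base ma_base]
 have "expectation (\<lambda>w. (Y (x + t) w - Y x w)^2)
   = expectation (\<lambda>w. Y (x + t) w * Y (x + t) w + Y x w * Y x w - 2 * (Y (x + t) w * Y x w))"
  by (simp add: power2_eq_square algebra_simps)
 also have "\<dots> = \<gamma> 0 + \<gamma> 0 - 2 * \<gamma> t" using i by (simp add: Y_product_autocov)
 finally show ?thesis by simp
qed

lemma increment_variogram: "expectation (\<lambda>w. (Y (x + t) w - Y x w)^2) = variogram Y t"
 using increment_second_moment[of 0 t] by (simp add: variogram_eq increment_second_moment)

text \<open>The increment at lag t is itself a moving average, so its squares are products covered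
  by \<open>ma_variance_bound\<close>, with the variogram as common mean. The lag windows increase
  with N, which makes the sums of squares monotone, and their size is asymptotically N^d.\<close>

lemma variogram_strong_law:
 assumes t: "t \<in> lattice_pts \<Delta>"
 shows "AE w in M. (\<lambda>N. empirical_variogram Y \<Delta> N t w) \<longlonglongrightarrow> variogram Y t"
proof -
 define D where "D x w = Y (x + t) w - Y x w" for x w
 have D: "ma (\<lambda>s. g (s + t) - g s) D" unfolding D_def by (rule ma_diff[OF ma_shift ma_base])
 obtain K where K: "0 \<le> K" "\<And>A. finite A \<Longrightarrow> A \<subseteq> lattice_pts \<Delta> \<Longrightarrow>
  expectation (\<lambda>w. (\<Sum>x\<in>A. centered (\<lambda>w. D x w * D x w) w)^2) \<le> K * real (card A)"
  using ma_variance_bound[OF D D] by blast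
 define T where "T N w = (\<Sum>s\<in>lag_pts \<Delta> N t. (D s w)^2)" for N w
 have Di: "integrable M (\<lambda>w. (D x w)^2)" for x using L24D(2)[OF ma_L24[OF D]] .
 have ED: "expectation (\<lambda>w. (D x w)^2) = variogram Y t" for x unfolding D_def by (rule increment_variogram)
 have ET: "expectation (T N) = real (card (lag_pts \<Delta> N t)) * variogram Y t" for N
  unfolding T_def using Di by (simp add: Bochner_Integration.integral_sum ED)
 have cen: "T N w - expectation (T N) = (\<Sum>x\<in>lag_pts \<Delta> N t. centered (\<lambda>w. D x w * D x w) w)" for N w
  unfolding ET T_def centered_def power2_eq_square[symmetric] ED by (simp add: sum_subtractf)
 have lagL: "lag_pts \<Delta> N t \<subseteq> lattice_pts \<Delta>" for N unfolding lag_pts_def by auto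
 have "AE w in M. (\<lambda>N. T N w / real N ^ CARD('d)) \<longlonglongrightarrow> variogram Y t"
 proof (rule nonneg_monotone_slln)
  show "integrable M (T N)" for N unfolding T_def using Di by (intro Bochner_Integration.integrable_sum)
  show "integrable M (\<lambda>w. (T N w)^2)" for N unfolding T_def
  proof (rule integrable_sum_sq)
   fix x
   show "integrable M (\<lambda>w. ((D x w)^2)^2)" using L24_mult_sq[OF ma_L24[OF D] ma_L24[OF D], of x x] by (simp add: power2_eq_square)
  qed (use Di in auto)
  show "T N w \<le> T N' w" if "N \<le> N'" for N N' w
   unfolding T_def using lag_pts_mono[OF that] lag_pts_finite[OF \<Delta>_pos] by (intro sum_mono2) auto
  show "0 \<le> T N w" for N w unfolding T_def by (intro sum_nonneg) simp
  show "(\<lambda>N. expectation (T N) / real N ^ CARD('d)) \<longlonglongrightarrow> variogram Y t"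
   using tendsto_mult_right[OF card_lag_pts_limit[OF \<Delta>_pos t], of "variogram Y t"] unfolding ET by simp
  show "expectation (\<lambda>w. (T N w - expectation (T N))^2) \<le> K * real N ^ CARD('d)" for N
  proof -
   have "expectation (\<lambda>w. (T N w - expectation (T N))^2) \<le> K * real (card (lag_pts \<Delta> N t))"
    unfolding cen by (rule K(2)[OF lag_pts_finite[OF \<Delta>_pos] lagL])
   also have "\<dots> \<le> K * real (card (obs_pts \<Delta> N :: (real^'d) set))"
    using card_mono[OF obs_pts_finite_card(1)[OF \<Delta>_pos] lag_pts_subset(1)[of \<Delta> N t]] K(1) by (intro mult_left_mono) auto
   finally show ?thesis by (simp add: obs_pts_finite_card(2)[OF \<Delta>_pos])
  qed
 qed simp
 then show ?thesis
 proof eventually_elim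
  case (elim w)
  have "(\<lambda>N. (T N w / real N ^ CARD('d)) / (real (card (lag_pts \<Delta> N t)) / real N ^ CARD('d))) \<longlonglongrightarrow> variogram Y t / 1"
   by (rule tendsto_divide[OF elim card_lag_pts_limit[OF \<Delta>_pos t]]) simp
  moreover have "\<forall>\<^sub>F N in sequentially. (T N w / real N ^ CARD('d)) / (real (card (lag_pts \<Delta> N t)) / real N ^ CARD('d)) = empirical_variogram Y \<Delta> N t w"
   using eventually_gt_at_top[of 0]
   by eventually_elim (simp add: empirical_variogram_def T_def D_def add.commute)
  ultimately show ?case using Lim_transform_eventually by simp
 qed
qed

end

text \<open>\<open>powr\<close> gives 0 at base 0 even for the exponent 0, whence the exceptional
  case.\<close>

lemma powr_half_eq_sqrt_power: "real N powr (real d / 2) = (if d = 0 \<and> N = 0 then 0 else sqrt (real N ^ d))"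
proof (cases "N = 0")
 case False
 then have "sqrt (real N ^ d) = (real N powr real d) powr (1/2)" by (simp add: powr_half_sqrt powr_realpow)
 then show ?thesis using False by (simp add: powr_powr)
qed simp

section \<open>Linearization of the empirical variogram and its limit law\<close>

context moving_average
begin

definition cov2 :: "real^'d \<Rightarrow> real^'d \<Rightarrow> 'w \<Rightarrow> real" where
 "cov2 t x = centered (\<lambda>w. Y x w * Y (x + t) w)"

text \<open>One row of \<open>F_matrix\<close> applied to the normalized sums of centred lagged
  products over the full window.\<close>

definition lin_vario :: "real^'d \<Rightarrow> nat \<Rightarrow> 'w \<Rightarrow> real" where
 "lin_vario t N w = (2 * (\<Sum>x\<in>obs_pts \<Delta> N. cov2 0 x w) - 2 * (\<Sum>x\<in>obs_pts \<Delta> N. cov2 t x w)) / sqrt (real N ^ CARD('d))"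

definition scaled_vario :: "real^'d \<Rightarrow> nat \<Rightarrow> 'w \<Rightarrow> real" where
 "scaled_vario t N w = real N powr (real CARD('d) / 2) * (empirical_variogram Y \<Delta> N t w - variogram Y t)"

lemma cov2_L2: "cov2 t x \<in> borel_measurable M" "integrable M (\<lambda>w. (cov2 t x w)^2)"
 unfolding cov2_def using centered_L2[OF ma_base ma_shift] by auto

lemma sum_cov2_L2: "(\<lambda>w. \<Sum>x\<in>A. cov2 t x w) \<in> borel_measurable M" "integrable M (\<lambda>w. (\<Sum>x\<in>A. cov2 t x w)^2)"
 using cov2_L2 by (auto intro!: borel_measurable_sum integrable_sum_sq)

lemma sum_cov2_bound:
 obtains K where "0 \<le> K" "\<And>A. finite A \<Longrightarrow> A \<subseteq> lattice_pts \<Delta> \<Longrightarrow>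
  expectation (\<lambda>w. (\<Sum>x\<in>A. cov2 t x w)^2) \<le> K * real (card A)"
 using ma_variance_bound[OF ma_base ma_shift[of t]] unfolding cov2_def by blast

lemma lin_vario_L2: "lin_vario t N \<in> borel_measurable M" "integrable M (\<lambda>w. (lin_vario t N w)^2)"
proof -
 note [measurable] = sum_cov2_L2(1)
 show "lin_vario t N \<in> borel_measurable M" unfolding lin_vario_def by measurable
 have "integrable M (\<lambda>w. (2 * (\<Sum>x\<in>obs_pts \<Delta> N. cov2 0 x w) + (-2) * (\<Sum>x\<in>obs_pts \<Delta> N. cov2 t x w))^2)"
  by (rule second_moment_sum_le(1)) (use sum_cov2_L2 in \<open>auto simp: power_mult_distrib\<close>)
 then show "integrable M (\<lambda>w. (lin_vario t N w)^2)" unfolding lin_vario_def power_divide by simp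
qed

lemma lin_vario_bounded:
 obtains C where "\<And>N. expectation (\<lambda>w. (lin_vario t N w)^2) \<le> C"
proof -
 note [measurable] = sum_cov2_L2(1)
 obtain K0 where K0: "0 \<le> K0" "\<And>A. finite A \<Longrightarrow> A \<subseteq> lattice_pts \<Delta> \<Longrightarrow> expectation (\<lambda>w. (\<Sum>x\<in>A. cov2 0 x w)^2) \<le> K0 * real (card A)"
  using sum_cov2_bound by blast
 obtain K where K: "0 \<le> K" "\<And>A. finite A \<Longrightarrow> A \<subseteq> lattice_pts \<Delta> \<Longrightarrow> expectation (\<lambda>w. (\<Sum>x\<in>A. cov2 t x w)^2) \<le> K * real (card A)"
  using sum_cov2_bound by blast
 have "expectation (\<lambda>w. (lin_vario t N w)^2) \<le> 8 * K0 + 8 * K" for N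
 proof -
  note Obs = obs_pts_finite_card[OF \<Delta>_pos, where 'd='d, of N]
  have "expectation (\<lambda>w. (lin_vario t N w)^2)
    = expectation (\<lambda>w. (2 * (\<Sum>x\<in>obs_pts \<Delta> N. cov2 0 x w) + (-2) * (\<Sum>x\<in>obs_pts \<Delta> N. cov2 t x w))^2) / real N ^ CARD('d)"
   unfolding lin_vario_def power_divide by simp
  also have "\<dots> \<le> (2 * expectation (\<lambda>w. (2 * (\<Sum>x\<in>obs_pts \<Delta> N. cov2 0 x w))^2) + 2 * expectation (\<lambda>w. ((-2) * (\<Sum>x\<in>obs_pts \<Delta> N. cov2 t x w))^2)) / real N ^ CARD('d)"
   by (intro divide_right_mono second_moment_sum_le(2)) (use sum_cov2_L2 in \<open>auto simp: power_mult_distrib\<close>)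
  also have "\<dots> = (8 * expectation (\<lambda>w. (\<Sum>x\<in>obs_pts \<Delta> N. cov2 0 x w)^2) + 8 * expectation (\<lambda>w. (\<Sum>x\<in>obs_pts \<Delta> N. cov2 t x w)^2)) / real N ^ CARD('d)"
   by (simp add: power_mult_distrib)
  also have "\<dots> \<le> (8 * (K0 * real N ^ CARD('d)) + 8 * (K * real N ^ CARD('d))) / real N ^ CARD('d)"
   using K0(2)[OF Obs(1) obs_pts_lattice] K(2)[OF Obs(1) obs_pts_lattice] Obs(2)
   by (intro divide_right_mono add_mono mult_left_mono) auto
  also have "\<dots> \<le> 8 * K0 + 8 * K" using K0(1) K(1) by (cases "N = 0") (auto simp: add_divide_distrib)
  finally show ?thesis .
 qed
 then show thesis by (rule that)
qed

lemma increment_decompose: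
 "(Y (t + x) w - Y x w)^2 - variogram Y t = cov2 0 (x + t) w + cov2 0 x w - 2 * cov2 t x w"
proof -
 have v: "variogram Y t = 2 * \<gamma> 0 - 2 * \<gamma> t" using increment_variogram[of 0 t] increment_second_moment[of 0 t] by simp
 have e: "expectation (\<lambda>w. Y x w * Y (x + t) w) = \<gamma> t" for x t
  unfolding Y_product_autocov using autocov_uminus[of t] by simp
 have e0: "expectation (\<lambda>w. Y x w * Y x w) = \<gamma> 0" for x
  unfolding Y_product_autocov by simp
 show ?thesis unfolding cov2_def centered_def add_0_right e e0 v add.commute[of t x]
  by (simp add: power2_eq_square algebra_simps)
qed

text \<open>The summands are expanded into products, and the three sums over shifted observation windows
 are replaced by sums over the whole window at the cost of boundary terms.\<close>

lemma scaled_vario_linearization: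
 assumes t: "t \<in> lattice_pts \<Delta>"
 shows "scaled_vario t N \<in> borel_measurable M" "integrable M (\<lambda>w. (scaled_vario t N w)^2)"
  "(\<lambda>N. expectation (\<lambda>w. (scaled_vario t N w - lin_vario t N w)^2)) \<longlonglongrightarrow> 0"
proof -
 note [measurable] = sum_cov2_L2(1) lin_vario_L2(1)
 obtain K0 where K0: "0 \<le> K0" "\<And>A. finite A \<Longrightarrow> A \<subseteq> lattice_pts \<Delta> \<Longrightarrow> expectation (\<lambda>w. (\<Sum>x\<in>A. cov2 0 x w)^2) \<le> K0 * real (card A)"
  using sum_cov2_bound by blast
 obtain K where K: "0 \<le> K" "\<And>A. finite A \<Longrightarrow> A \<subseteq> lattice_pts \<Delta> \<Longrightarrow> expectation (\<lambda>w. (\<Sum>x\<in>A. cov2 t x w)^2) \<le> K * real (card A)"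
  using sum_cov2_bound by blast
 obtain C where C: "\<And>N. expectation (\<lambda>w. (lin_vario t N w)^2) \<le> C" using lin_vario_bounded by blast
 define Ob where "Ob N = (obs_pts \<Delta> N :: (real^'d) set)" for N
 \<comment> \<open>B1 holds the window points whose translate by t leaves the window, B2 the window
   points that are not such a translate of another one; both are of lower order than N^d.\<close>
 define B1 where "B1 N = Ob N - lag_pts \<Delta> N t" for N
 define B2 where "B2 N = Ob N - (\<lambda>s. s + t) ` lag_pts \<Delta> N t" for N
 define U where "U N w = (\<Sum>x\<in>B2 N. cov2 0 x w)" for N w
 define V where "V N w = (\<Sum>x\<in>B1 N. cov2 0 x w)" for N w
 define W where "W N w = (\<Sum>x\<in>B1 N. cov2 t x w)" for N w
 define R where "R N w = - (U N w) + (- (V N w) + 2 * W N w)" for N w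
 define r where "r N = sqrt (real N ^ CARD('d))" for N
 \<comment> \<open>The correction for averaging over the lag window in place of the full window; it
   tends to 1.\<close>
 define \<rho> where "\<rho> N = real N ^ CARD('d) / real (card (lag_pts \<Delta> N t))" for N
 have fin: "finite (Ob N)" "finite (B1 N)" "finite (B2 N)" for N
  unfolding B1_def B2_def Ob_def using obs_pts_finite_card(1)[OF \<Delta>_pos] by auto
 have lat: "B1 N \<subseteq> lattice_pts \<Delta>" "B2 N \<subseteq> lattice_pts \<Delta>" for N
  unfolding B1_def B2_def Ob_def using obs_pts_lattice by auto
 have m[measurable]: "U N \<in> borel_measurable M" "V N \<in> borel_measurable M" "W N \<in> borel_measurable M" for N
  unfolding U_def V_def W_def by measurable
 have i: "integrable M (\<lambda>w. (U N w)^2)" "integrable M (\<lambda>w. (V N w)^2)" "integrable M (\<lambda>w. (W N w)^2)" for N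
  unfolding U_def V_def W_def by (rule sum_cov2_L2(2))+
 have Rm[measurable]: "R N \<in> borel_measurable M" for N unfolding R_def by measurable
 have VW: "integrable M (\<lambda>w. (- V N w + 2 * W N w)^2)" "expectation (\<lambda>w. (- V N w + 2 * W N w)^2) \<le> 2 * expectation (\<lambda>w. (V N w)^2) + 8 * expectation (\<lambda>w. (W N w)^2)" for N
  using second_moment_sum_le[of "\<lambda>w. - V N w" "\<lambda>w. 2 * W N w"] i by (simp_all add: power_mult_distrib)
 have R2: "integrable M (\<lambda>w. (R N w)^2)" for N
  unfolding R_def by (rule second_moment_sum_le(1)[of "\<lambda>w. - U N w"]) (use i VW in auto)
 have ER: "expectation (\<lambda>w. (R N w)^2) \<le> 2 * K0 * real (card (B2 N)) + (4 * K0 + 16 * K) * real (card (B1 N))" for N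
 proof -
  have "expectation (\<lambda>w. (R N w)^2) \<le> 2 * expectation (\<lambda>w. (- U N w)^2) + 2 * expectation (\<lambda>w. (- V N w + 2 * W N w)^2)"
   unfolding R_def by (rule second_moment_sum_le(2)) (use i VW in auto)
  also have "\<dots> \<le> 2 * expectation (\<lambda>w. (U N w)^2) + 4 * expectation (\<lambda>w. (V N w)^2) + 16 * expectation (\<lambda>w. (W N w)^2)"
   using VW(2)[of N] by simp
  also have "\<dots> \<le> 2 * (K0 * real (card (B2 N))) + 4 * (K0 * real (card (B1 N))) + 16 * (K * real (card (B1 N)))"
   unfolding U_def V_def W_def by (intro add_mono mult_left_mono K0(2) K(2) fin lat) auto
  finally show ?thesis by (simp add: algebra_simps)
 qed
 have Rlim: "(\<lambda>N. expectation (\<lambda>w. (R N w)^2) / real N ^ CARD('d)) \<longlonglongrightarrow> 0"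
 proof (rule tendsto_sandwich[OF always_eventually always_eventually tendsto_const])
  show "\<forall>N. expectation (\<lambda>w. (R N w)^2) / real N ^ CARD('d)
   \<le> 2 * K0 * (real (card (B2 N)) / real N ^ CARD('d)) + (4 * K0 + 16 * K) * (real (card (B1 N)) / real N ^ CARD('d))"
   using divide_right_mono[OF ER] by (simp add: add_divide_distrib)
  show "(\<lambda>N. 2 * K0 * (real (card (B2 N)) / real N ^ CARD('d)) + (4 * K0 + 16 * K) * (real (card (B1 N)) / real N ^ CARD('d))) \<longlonglongrightarrow> 0"
   unfolding B1_def B2_def Ob_def
   using tendsto_add[OF tendsto_mult[OF tendsto_const[of "2 * K0"] card_boundary_limit(2)[OF \<Delta>_pos t]]
     tendsto_mult[OF tendsto_const[of "4 * K0 + 16 * K"] card_boundary_limit(1)[OF \<Delta>_pos t]]] by simp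
 qed auto
 have \<rho>lim: "\<rho> \<longlonglongrightarrow> 1"
  using tendsto_inverse[OF card_lag_pts_limit[OF \<Delta>_pos t]] unfolding \<rho>_def by (simp add: inverse_eq_divide)
 have decomp: "scaled_vario t N w = \<rho> N * (lin_vario t N w + R N w / r N)" if N: "0 < N" "0 < card (lag_pts \<Delta> N t)" for N w
 proof -
  define b where "b = real (card (lag_pts \<Delta> N t))"
  have b: "0 < b" unfolding b_def using N by simp
  have r: "0 < r N" "(r N)^2 = real N ^ CARD('d)" unfolding r_def using N by auto
  define A where "A D s = (\<Sum>x\<in>D. cov2 s x w)" for D s
  have lagO: "lag_pts \<Delta> N t \<subseteq> Ob N" "(\<lambda>s. s + t) ` lag_pts \<Delta> N t \<subseteq> Ob N"
   unfolding Ob_def using lag_pts_subset by auto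
  have e1: "A (lag_pts \<Delta> N t) s = A (Ob N) s - A (B1 N) s" for s
   unfolding A_def B1_def using sum_diff[OF fin(1) lagO(1), of "\<lambda>x. cov2 s x w"] by simp
  have e2: "(\<Sum>x\<in>lag_pts \<Delta> N t. cov2 0 (x + t) w) = A (Ob N) 0 - A (B2 N) 0"
  proof -
   have "(\<Sum>x\<in>lag_pts \<Delta> N t. cov2 0 (x + t) w) = A ((\<lambda>s. s + t) ` lag_pts \<Delta> N t) 0"
    unfolding A_def by (subst sum.reindex) (auto simp: inj_on_def)
   then show ?thesis unfolding A_def B2_def using sum_diff[OF fin(1) lagO(2), of "\<lambda>x. cov2 0 x w"] by simp
  qed
  have "(\<Sum>x\<in>lag_pts \<Delta> N t. (Y (t + x) w - Y x w)^2) - b * variogram Y t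
    = (\<Sum>x\<in>lag_pts \<Delta> N t. (Y (t + x) w - Y x w)^2 - variogram Y t)"
   unfolding b_def sum_subtractf by simp
  also have "\<dots> = (\<Sum>x\<in>lag_pts \<Delta> N t. cov2 0 (x + t) w) + A (lag_pts \<Delta> N t) 0 - 2 * A (lag_pts \<Delta> N t) t"
   unfolding increment_decompose A_def by (simp add: sum.distrib sum_subtractf sum_distrib_left)
  also have "\<dots> = (2 * A (Ob N) 0 - 2 * A (Ob N) t) + R N w"
   unfolding e1 e2 R_def U_def V_def W_def A_def[symmetric] by simp
  also have "\<dots> = r N * (lin_vario t N w + R N w / r N)"
   unfolding lin_vario_def Ob_def[symmetric] A_def[symmetric] r_def[symmetric] using r(1) by (simp add: distrib_left)
  finally have eq: "(\<Sum>x\<in>lag_pts \<Delta> N t. (Y (t + x) w - Y x w)^2) - b * variogram Y t = r N * (lin_vario t N w + R N w / r N)" .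
  have "empirical_variogram Y \<Delta> N t w - variogram Y t = ((\<Sum>x\<in>lag_pts \<Delta> N t. (Y (t + x) w - Y x w)^2) - b * variogram Y t) / b"
   unfolding empirical_variogram_def b_def[symmetric] using b by (simp add: diff_divide_distrib)
  then have "scaled_vario t N w = r N * ((r N * (lin_vario t N w + R N w / r N)) / b)"
   unfolding scaled_vario_def powr_half_eq_sqrt_power eq r_def[symmetric] using N by simp
  also have "\<dots> = \<rho> N * (lin_vario t N w + R N w / r N)"
   unfolding \<rho>_def b_def[symmetric] r(2)[symmetric] by (simp add: power2_eq_square)
  finally show ?thesis .
 qed
 have Ym[measurable]: "Y x \<in> borel_measurable M" for x using ma_L24[OF ma_base] L24D(1) by blast
 show Tm[measurable]: "scaled_vario t N \<in> borel_measurable M" for N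
  unfolding scaled_vario_def empirical_variogram_def by measurable
 have LR: "integrable M (\<lambda>w. (a * lin_vario t N w + b * R N w)^2)"
  "expectation (\<lambda>w. (a * lin_vario t N w + b * R N w)^2) \<le> 2 * a^2 * expectation (\<lambda>w. (lin_vario t N w)^2) + 2 * b^2 * expectation (\<lambda>w. (R N w)^2)" for a b N
  using second_moment_sum_le[of "\<lambda>w. a * lin_vario t N w" "\<lambda>w. b * R N w"] lin_vario_L2(2) R2 by (simp_all add: power_mult_distrib)
 show "integrable M (\<lambda>w. (scaled_vario t N w)^2)" for N
 proof (cases "0 < N \<and> 0 < card (lag_pts \<Delta> N t)")
  case True
  have eq: "scaled_vario t N w = \<rho> N * lin_vario t N w + (\<rho> N / r N) * R N w" for w
   using decomp[of N w] True by (simp add: distrib_left)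
  show ?thesis unfolding eq by (rule LR(1))
 next
  \<comment> \<open>Without a pair of observation points at lag t the empirical variogram is 0 / 0 =
    0, so the scaled error is a constant.\<close>
  case False
  then have "scaled_vario t N = (\<lambda>w. real N powr (real CARD('d) / 2) * (0 - variogram Y t))"
   unfolding scaled_vario_def empirical_variogram_def by auto
  then show ?thesis by simp
 qed
 have ev: "\<forall>\<^sub>F N in sequentially. 0 < N \<and> 0 < card (lag_pts \<Delta> N t)"
 proof -
  have "\<forall>\<^sub>F N in sequentially. 0 < real (card (lag_pts \<Delta> N t)) / real N ^ CARD('d)"
   by (rule order_tendstoD(1)[OF card_lag_pts_limit[OF \<Delta>_pos t]]) simp
  then show ?thesis using eventually_gt_at_top[of 0] by eventually_elim (auto intro: gr0I)
 qed
 show "(\<lambda>N. expectation (\<lambda>w. (scaled_vario t N w - lin_vario t N w)^2)) \<longlonglongrightarrow> 0"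
 proof (rule tendsto_sandwich[OF _ _ tendsto_const])
  show "\<forall>\<^sub>F N in sequentially. expectation (\<lambda>w. (scaled_vario t N w - lin_vario t N w)^2)
   \<le> 2 * (\<rho> N - 1)^2 * C + 2 * (\<rho> N)^2 * (expectation (\<lambda>w. (R N w)^2) / real N ^ CARD('d))"
   using ev
  proof eventually_elim
   case (elim N)
   have eq: "scaled_vario t N w - lin_vario t N w = (\<rho> N - 1) * lin_vario t N w + (\<rho> N / r N) * R N w" for w
    using decomp[of N w] elim by (simp add: algebra_simps)
   have "expectation (\<lambda>w. (scaled_vario t N w - lin_vario t N w)^2)
     \<le> 2 * (\<rho> N - 1)^2 * expectation (\<lambda>w. (lin_vario t N w)^2) + 2 * (\<rho> N / r N)^2 * expectation (\<lambda>w. (R N w)^2)"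
    unfolding eq by (rule LR(2))
   also have "\<dots> \<le> 2 * (\<rho> N - 1)^2 * C + 2 * (\<rho> N / r N)^2 * expectation (\<lambda>w. (R N w)^2)"
    by (intro add_right_mono mult_left_mono C) simp
   also have "(\<rho> N / r N)^2 = (\<rho> N)^2 / real N ^ CARD('d)" unfolding power_divide r_def by simp
   finally show ?case by simp
  qed
  have "(\<lambda>N. 2 * (\<rho> N - 1)^2 * C + 2 * (\<rho> N)^2 * (expectation (\<lambda>w. (R N w)^2) / real N ^ CARD('d))) \<longlonglongrightarrow> 2 * (1 - 1)^2 * C + 2 * 1^2 * 0"
   by (intro tendsto_intros \<rho>lim Rlim)
  then show "(\<lambda>N. 2 * (\<rho> N - 1)^2 * C + 2 * (\<rho> N)^2 * (expectation (\<lambda>w. (R N w)^2) / real N ^ CARD('d))) \<longlonglongrightarrow> 0" by simp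
 qed auto
qed

definition lag_covariance :: "real^'d \<Rightarrow> real^'d \<Rightarrow> real^'d \<Rightarrow> real" where
 "lag_covariance t t' l = c4 * (LBINT s. g s * g (s + t) * g (s + l) * g (s + l + t'))
   + \<gamma> l * \<gamma> (l + t - t') + \<gamma> (l + t) * \<gamma> (l - t')"

text \<open>Compared with the summand of \<open>V_matrix\<close>, the true covariance has t and t'
  exchanged in the products of autocovariances. Writing it as that summand plus a correction
  antisymmetric in t and t' prepares the cancellation in quadratic forms.\<close>

lemma cov2_covariance:
 "expectation (\<lambda>w. cov2 t 0 w * cov2 t' l w) = lag_covariance t t' l
  - (\<gamma> l * \<gamma> (l + t - t') + \<gamma> (l + t) * \<gamma> (l - t')) + (\<gamma> l * \<gamma> (l + t' - t) + \<gamma> (l + t') * \<gamma> (l - t))"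
proof -
 note [measurable] = decaysD(1)[OF g_decays]
 have I: "(LBINT s. (g (0 - s) * g (t - s)) * (g (l - s) * g (l + t' - s))) = (LBINT s. g s * g (s + t) * g (s + l) * g (s + l + t'))"
 proof -
  have "0 - s + t = t - s" "0 - s + l = l - s" "0 - s + l + t' = l + t' - s" for s :: "real^'d" by simp_all
  then show ?thesis using integral_lborel_reflect[of "\<lambda>s. g s * g (s + t) * g (s + l) * g (s + l + t')" 0]
   by (simp only: mult.assoc) simp
 qed
 have k: "k2^2 * (p * q + p' * q') = (k2 * p) * (k2 * q) + (k2 * p') * (k2 * q')" for p q p' q' :: real
  by (simp add: power2_eq_square algebra_simps)
 have "\<gamma> (0 - l) = \<gamma> l" "\<gamma> (t - (l + t')) = \<gamma> (l + t' - t)" "\<gamma> (0 - (l + t')) = \<gamma> (l + t')" "\<gamma> (t - l) = \<gamma> (l - t)"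
  using autocov_uminus[of l] autocov_uminus[of "l + t' - t"] autocov_uminus[of "l + t'"] autocov_uminus[of "l - t"] by simp_all
 then show ?thesis
  using has_int_product_covariance[OF Y_int[of 0] Y_int[of t] Y_int[of l] Y_int[of "l + t'"]]
  unfolding I k Y_product[symmetric] cov2_def centered_def add_0_left unfolding Y_product_autocov lag_covariance_def by simp
qed

text \<open>In each summand one factor decays in l while the rest stays bounded; translation by a
  fixed lag only changes the constant.\<close>

lemma lag_covariance_summable: "lag_covariance t t' summable_on lattice_pts \<Delta>"
proof -
 define J where "J = decay_mass TYPE('d) c"
 define G where "G = k2 * (B * B * J)"
 have J: "0 \<le> J" unfolding J_def decay_mass_def by (rule integral_nonneg_AE) simp
 have G: "0 \<le> G" unfolding G_def using J k2_nonneg decaysD(3)[OF g_decays] by simp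
 have \<gamma>: "\<bar>\<gamma> l\<bar> \<le> G * expdec (c/2) l" for l
 proof -
  have "\<gamma> l = k2 * (LBINT s. g (l - s) * g (0 - s))" using Y_product_autocov[of l 0] Y_product[of l 0] by simp
  then have "\<bar>\<gamma> l\<bar> = k2 * \<bar>\<integral>s. g (l - s) * g (0 - s) \<partial>lborel\<bar>" using k2_nonneg by (simp add: abs_mult)
  also have "\<dots> \<le> k2 * (B * B * expdec (c/2) (l - 0) * J)"
   unfolding J_def by (intro mult_left_mono k2_nonneg decays_integral_mult decays_translate g_decays c_pos)
  finally show ?thesis unfolding G_def by (simp add: mult_ac)
 qed
 have \<gamma>1: "\<bar>\<gamma> l\<bar> \<le> G" for l
  using order_trans[OF \<gamma> mult_left_mono[OF expdec_bounds(1) G, of "c/2" l]] c_pos by simp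
 define e where "e = exp ((c/2) * (\<Sum>i\<in>UNIV. \<bar>t $ i\<bar>))"
 have shift: "expdec (c/2) (l + t) \<le> e * expdec (c/2) l" for l
 proof -
  have "decays (c/2) 1 0 (expdec (c/2) :: real^'d \<Rightarrow> real)" unfolding decays_def by simp
  from decaysD(2)[OF decays_shift[OF this, of t], of l] show ?thesis using c_pos unfolding e_def by simp
 qed
 have I: "\<bar>\<integral>s. g s * g (s + t) * g (s + l) * g (s + l + t') \<partial>lborel\<bar> \<le> K * expdec (c/2) l"
  if K: "K = (B * (B * exp (c * (\<Sum>i\<in>UNIV. \<bar>t $ i\<bar>)))) * (B * (B * exp (c * (\<Sum>i\<in>UNIV. \<bar>t' $ i\<bar>)))) * J" for K l
 proof -
  have d: "decays c (B * (B * exp (c * (\<Sum>i\<in>UNIV. \<bar>t $ i\<bar>)))) 0 (\<lambda>s. g s * g (s + t))" for t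
   by (rule decays_mult[OF g_decays decays_shift[OF g_decays]]) (use c_pos in auto)
  have "(LBINT s. g s * g (s + t) * g (s + l) * g (s + l + t')) = (LBINT s. (g (0 - s) * g (0 - s + t)) * (g (l - s) * g (l - s + t')))"
  proof -
   note [measurable] = decaysD(1)[OF g_decays]
   have "0 - s + l = l - s" for s :: "real^'d" by simp
   then show ?thesis using integral_lborel_reflect[of "\<lambda>s. g s * g (s + t) * g (s + l) * g (s + l + t')" 0]
    by (simp only: mult.assoc) simp
  qed
  also have "\<bar>\<dots>\<bar> \<le> (B * (B * exp (c * (\<Sum>i\<in>UNIV. \<bar>t $ i\<bar>)))) * (B * (B * exp (c * (\<Sum>i\<in>UNIV. \<bar>t' $ i\<bar>)))) * expdec (c/2) (0 - l) * J"
   unfolding J_def by (rule decays_integral_mult[OF decays_translate[OF d] decays_translate[OF d] c_pos])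
  finally show ?thesis unfolding K diff_0 expdec_uminus by (simp only: mult_ac)
 qed
 obtain K where K: "\<And>l. \<bar>\<integral>s. g s * g (s + t) * g (s + l) * g (s + l + t') \<partial>lborel\<bar> \<le> K * expdec (c/2) l" using I by blast
 show ?thesis
 proof (rule lattice_summable[where c="c/2" and K="\<bar>c4\<bar> * K + G * G + G * e * G"])
  fix l
  have "\<bar>c4 * (LBINT s. g s * g (s + t) * g (s + l) * g (s + l + t'))\<bar> \<le> \<bar>c4\<bar> * (K * expdec (c/2) l)"
   unfolding abs_mult by (rule mult_left_mono[OF K]) simp
  moreover have "\<bar>\<gamma> l * \<gamma> (l + t - t')\<bar> \<le> (G * expdec (c/2) l) * G"
   unfolding abs_mult by (intro mult_mono \<gamma> \<gamma>1) (use G in auto)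
  moreover have "\<bar>\<gamma> (l + t)\<bar> \<le> G * (e * expdec (c/2) l)"
   using order_trans[OF \<gamma> mult_left_mono[OF shift G]] .
  then have "\<bar>\<gamma> (l + t) * \<gamma> (l - t')\<bar> \<le> (G * (e * expdec (c/2) l)) * G"
   unfolding abs_mult by (intro mult_mono \<gamma>1) (use G in \<open>auto simp: e_def\<close>)
  moreover have "\<bar>c4\<bar> * (K * expdec (c/2) l) + (G * expdec (c/2) l) * G + (G * (e * expdec (c/2) l)) * G = (\<bar>c4\<bar> * K + G * G + G * e * G) * expdec (c/2) l"
   by (simp add: algebra_simps)
  ultimately show "\<bar>lag_covariance t t' l\<bar> \<le> (\<bar>c4\<bar> * K + G * G + G * e * G) * expdec (c/2) l"
   unfolding lag_covariance_def by linarith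
 qed (use c_pos \<Delta>_pos in auto)
qed

text \<open>The weights w = F^T u turn a linear combination of the linearized variograms into a
  normalized sum of products of Y with one moving average, so the scalar limit theorem applies.
  Nonnegativity of the quadratic form comes along because the form is a limit of variances.\<close>

lemma lin_vario_char_limit:
 fixes lag :: "'k::finite \<Rightarrow> real^'d" and u :: "real^'k"
 defines "V \<equiv> V_matrix k2 (kappa4 \<Lambda>) g \<gamma> \<Delta> lag" and "w \<equiv> transpose F_matrix *v u"
 shows "(\<lambda>N. CLINT z|M. iexp (\<Sum>k\<in>UNIV. u $ k * lin_vario (lag k) N z)) \<longlonglongrightarrow> of_real (exp (- (w \<bullet> (V *v w)) / 2))"
  and "0 \<le> w \<bullet> (V *v w)"
proof -
 have wN: "w $ None = 2 * (\<Sum>k\<in>UNIV. u $ k)" and wS: "w $ Some k = - 2 * u $ k" for k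
  unfolding w_def matrix_vector_mult_def transpose_def F_matrix_def
  by (simp_all add: sum_distrib_left if_distrib[of "\<lambda>x. 2 * x * _"] cong: if_cong)
 define f' where "f' s = (\<Sum>i\<in>UNIV. w $ i * g (s + lag0 lag i))" for s
 define X' where "X' x z = (\<Sum>i\<in>UNIV. w $ i * Y (x + lag0 lag i) z)" for x z
 have f': "ma f' X'" unfolding f'_def X'_def by (rule ma_sum) (auto intro: ma_cmult ma_shift)
 obtain b where "product_field M \<Lambda> \<beta> \<sigma> \<nu> g f' Y X' c b \<Delta>" using ma_product_field[OF ma_base f'] by blast
 then interpret pf: product_field M \<Lambda> \<beta> \<sigma> \<nu> g f' Y X' c b \<Delta> .
 have P: "pf.P x z = (\<Sum>i\<in>UNIV. w $ i * cov2 (lag0 lag i) x z)" for x z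
 proof -
  have e: "Y x z * X' x z = (\<Sum>i\<in>UNIV. w $ i * (Y x z * Y (x + lag0 lag i) z))" for z
   unfolding X'_def sum_distrib_left by (rule sum.cong) auto
  show ?thesis unfolding pf.P_def cov2_def centered_def e
   using centered_L2(3)[OF ma_base ma_base] by (simp add: Bochner_Integration.integral_sum sum_subtractf right_diff_distrib)
 qed
 have Pk: "pf.P x z = (\<Sum>k\<in>UNIV. u $ k * (2 * cov2 0 x z - 2 * cov2 (lag k) x z))" for x z
  unfolding P UNIV_option_conv
  by (simp add: sum.reindex lag0_def wN wS sum_distrib_left sum_distrib_right sum_subtractf right_diff_distrib sum_negf mult_ac)
 have sumP: "(\<Sum>x\<in>obs_pts \<Delta> N. pf.P x z) / sqrt (real N ^ CARD('d)) = (\<Sum>k\<in>UNIV. u $ k * lin_vario (lag k) N z)" for N z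
 proof -
  have "(\<Sum>x\<in>obs_pts \<Delta> N. pf.P x z) = (\<Sum>k\<in>UNIV. \<Sum>x\<in>obs_pts \<Delta> N. u $ k * (2 * cov2 0 x z - 2 * cov2 (lag k) x z))"
   unfolding Pk by (rule sum.swap)
  also have "\<dots> = (\<Sum>k\<in>UNIV. u $ k * (2 * (\<Sum>x\<in>obs_pts \<Delta> N. cov2 0 x z) - 2 * (\<Sum>x\<in>obs_pts \<Delta> N. cov2 (lag k) x z)))"
   by (simp only: sum_distrib_left[symmetric] sum_subtractf)
  finally have eq: "(\<Sum>x\<in>obs_pts \<Delta> N. pf.P x z) = \<dots>" .
  show ?thesis unfolding eq sum_divide_distrib lin_vario_def by simp
 qed
 define \<kappa> where "\<kappa> i j l = lag_covariance (lag0 lag i) (lag0 lag j) l" for i j l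
 \<comment> \<open>Summation over all i and j with the symmetric weights w_i w_j cancels the
   antisymmetric correction of \<open>cov2_covariance\<close>.\<close>
 have rho: "pf.rho l = (\<Sum>i\<in>UNIV. \<Sum>j\<in>UNIV. w $ i * w $ j * \<kappa> i j l)" for l
 proof -
  define h where "h i j = \<gamma> l * \<gamma> (l + lag0 lag i - lag0 lag j) + \<gamma> (l + lag0 lag i) * \<gamma> (l - lag0 lag j)" for i j
  have "integrable M (\<lambda>z. cov2 a 0 z * cov2 a' l z)" for a a' by (rule sq_integrable_mult) (rule cov2_L2)+
  then have "pf.rho l = (\<Sum>i\<in>UNIV. \<Sum>j\<in>UNIV. w $ i * w $ j * expectation (\<lambda>z. cov2 (lag0 lag i) 0 z * cov2 (lag0 lag j) l z))"
   unfolding pf.rho_def P sum_product by (simp add: Bochner_Integration.integral_sum mult_ac)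
  also have "\<dots> = (\<Sum>i\<in>UNIV. \<Sum>j\<in>UNIV. w $ i * w $ j * \<kappa> i j l) - (\<Sum>i\<in>UNIV. \<Sum>j\<in>UNIV. w $ i * w $ j * h i j) + (\<Sum>i\<in>UNIV. \<Sum>j\<in>UNIV. w $ i * w $ j * h j i)"
   unfolding cov2_covariance \<kappa>_def[symmetric] h_def[symmetric] by (simp only: distrib_left right_diff_distrib sum.distrib sum_subtractf)
  also have "(\<Sum>i\<in>UNIV. \<Sum>j\<in>UNIV. w $ i * w $ j * h j i) = (\<Sum>i\<in>UNIV. \<Sum>j\<in>UNIV. w $ i * w $ j * h i j)"
   by (subst sum.swap) (simp only: mult.commute[of "w $ _" "w $ _"])
  finally show ?thesis by simp
 qed
 have V: "V $ i $ j = (\<Sum>\<^sub>\<infinity>l\<in>lattice_pts \<Delta>. \<kappa> i j l)" for i j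
  unfolding V_def V_matrix_def \<kappa>_def lag_covariance_def by simp
 have "((\<lambda>l. \<Sum>i\<in>UNIV. \<Sum>j\<in>UNIV. w $ i * w $ j * \<kappa> i j l) has_sum (\<Sum>i\<in>UNIV. \<Sum>j\<in>UNIV. w $ i * w $ j * V $ i $ j)) (lattice_pts \<Delta>)"
  unfolding V \<kappa>_def by (intro has_sum_finite_sum has_sum_cmult_right has_sum_infsum lag_covariance_summable) auto
 then have "infsum pf.rho (lattice_pts \<Delta>) = (\<Sum>i\<in>UNIV. \<Sum>j\<in>UNIV. w $ i * w $ j * V $ i $ j)"
  unfolding rho by (rule infsumI)
 also have "\<dots> = w \<bullet> (V *v w)"
  unfolding inner_vec_def matrix_vector_mult_def by (simp add: sum_distrib_left mult_ac)
 finally have s: "infsum pf.rho (lattice_pts \<Delta>) = w \<bullet> (V *v w)" .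
 show "(\<lambda>N. CLINT z|M. iexp (\<Sum>k\<in>UNIV. u $ k * lin_vario (lag k) N z)) \<longlonglongrightarrow> of_real (exp (- (w \<bullet> (V *v w)) / 2))"
  using pf.product_sum_clt(1) unfolding sumP s .
 show "0 \<le> w \<bullet> (V *v w)" using pf.product_sum_clt(2) unfolding s .
qed

text \<open>The linearization errors vanish in L2 and hence in the characteristic functions, so the
  limit of every linear combination carries over to the scaled empirical variograms. The L2 bounds
  also supply the second moments from which convergence in distribution is concluded.\<close>

lemma variogram_clt:
 fixes lag :: "'k::finite \<Rightarrow> real^'d"
 defines "V \<equiv> V_matrix k2 (kappa4 \<Lambda>) g \<gamma> \<Delta> lag"
 assumes lag: "range lag \<subseteq> lattice_pts \<Delta>"
 shows "\<exists>\<mu>. is_multivariate_normal 0 (F_matrix ** V ** transpose F_matrix) \<mu> \<and>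
  conv_in_distribution (\<lambda>N w. \<chi> k. scaled_vario (lag k) N w) \<mu>"
proof -
 define S where "S = (F_matrix :: real^('k option)^'k) ** V ** transpose F_matrix"
 have quad: "u \<bullet> (S *v u) = (transpose F_matrix *v u) \<bullet> (V *v (transpose F_matrix *v u))" for u
 proof -
  have "S *v u = F_matrix *v (V *v (transpose F_matrix *v u))"
   unfolding S_def matrix_vector_mul_assoc[symmetric] ..
  then show ?thesis unfolding transpose_matrix_vector[of F_matrix u] by (simp add: dot_lmul_matrix)
 qed
 have psd: "0 \<le> u \<bullet> (S *v u)" for u unfolding quad V_def by (rule lin_vario_char_limit(2))
 obtain \<mu> where \<mu>: "is_multivariate_normal 0 S \<mu>" using ex_multivariate_normal[of S] psd by blast
 define T where "T N w = (\<chi> k. scaled_vario (lag k) N w)" for N w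
 have l: "lag k \<in> lattice_pts \<Delta>" for k using lag by auto
 note L = scaled_vario_linearization[OF l]
 note [measurable] = L(1) lin_vario_L2(1)
 have Tm: "T N \<in> borel_measurable M" for N
  by (subst borel_measurable_euclidean_space) (auto simp: Basis_vec_def T_def inner_axis L(1))
 have D2: "integrable M (\<lambda>w. (scaled_vario (lag k) N w - lin_vario (lag k) N w)^2)" for k N
  using second_moment_sum_le(1)[of "scaled_vario (lag k) N" "\<lambda>w. - lin_vario (lag k) N w"] L(2) lin_vario_L2(2) by simp
 have "\<exists>C. \<forall>N. expectation (\<lambda>w. (lin_vario (lag k) N w)^2) \<le> C" for k using lin_vario_bounded[of "lag k"] by metis
 then obtain C where C: "\<And>k N. expectation (\<lambda>w. (lin_vario (lag k) N w)^2) \<le> C k" by metis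
 have "conv_in_distribution T \<mu>"
 proof (rule char_convergence_in_distribution[OF Tm])
  show "prob_space \<mu>" "sets \<mu> = sets borel" using \<mu> unfolding is_multivariate_normal_def by auto
  fix u :: "real^'k"
  define D where "D k N w = u $ k * (scaled_vario (lag k) N w - lin_vario (lag k) N w)" for k N w
  define G where "G N w = (\<Sum>k\<in>UNIV. u $ k * lin_vario (lag k) N w)" for N w
  have Dm[measurable]: "D k N \<in> borel_measurable M" for k N unfolding D_def by measurable
  have Gm[measurable]: "G N \<in> borel_measurable M" for N unfolding G_def by measurable
  have Di: "integrable M (\<lambda>w. (D k N w)^2)" for k N unfolding D_def power_mult_distrib using D2 by simp
  have "(\<lambda>N. expectation (\<lambda>w. (D k N w)^2)) \<longlonglongrightarrow> 0" for k
   unfolding D_def power_mult_distrib using tendsto_mult_right_zero[OF L(3)[of k]] by simp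
  then have lim: "(\<lambda>N. expectation (\<lambda>w. (\<Sum>k\<in>UNIV. D k N w)^2)) \<longlonglongrightarrow> 0"
   by (intro L2_limit_sum Dm Di) auto
  have TG: "u \<bullet> T N w = G N w + (\<Sum>k\<in>UNIV. D k N w)" for N w
   unfolding T_def G_def D_def inner_vec_def by (simp add: sum.distrib[symmetric] algebra_simps)
  have "(\<lambda>N. (CLINT w|M. iexp (u \<bullet> T N w)) - (CLINT w|M. iexp (G N w))) \<longlonglongrightarrow> 0"
  proof (rule Lim_null_comparison[OF always_eventually])
   show "\<forall>N. norm ((CLINT w|M. iexp (u \<bullet> T N w)) - (CLINT w|M. iexp (G N w))) \<le> sqrt (expectation (\<lambda>w. (\<Sum>k\<in>UNIV. D k N w)^2))"
   proof
    fix N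
    show "norm ((CLINT w|M. iexp (u \<bullet> T N w)) - (CLINT w|M. iexp (G N w))) \<le> sqrt (expectation (\<lambda>w. (\<Sum>k\<in>UNIV. D k N w)^2))"
     using char_difference_le[of "\<lambda>w. G N w + (\<Sum>k\<in>UNIV. D k N w)" "G N"]
      integrable_sum_sq[where U="\<lambda>k. D k N" and I=UNIV, OF Dm Di] unfolding TG by simp
   qed
   show "(\<lambda>N. sqrt (expectation (\<lambda>w. (\<Sum>k\<in>UNIV. D k N w)^2))) \<longlonglongrightarrow> 0" using tendsto_real_sqrt[OF lim] by simp
  qed
  from tendsto_add[OF this lin_vario_char_limit(1)[of u lag, folded G_def]]
  have "(\<lambda>N. CLINT w|M. iexp (u \<bullet> T N w)) \<longlonglongrightarrow> of_real (exp (- (u \<bullet> (S *v u)) / 2))"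
   unfolding quad V_def by simp
  moreover have "(CLINT x|\<mu>. iexp (u \<bullet> x)) = of_real (exp (- (u \<bullet> (S *v u)) / 2))"
   using \<mu> unfolding is_multivariate_normal_def by (simp add: exp_of_real[symmetric])
  ultimately show "(\<lambda>N. CLINT w|M. iexp (u \<bullet> T N w)) \<longlonglongrightarrow> (CLINT x|\<mu>. iexp (u \<bullet> x))" by simp
 next
  have nT: "(norm (T N w))^2 = (\<Sum>k\<in>UNIV. (scaled_vario (lag k) N w)^2)" for N w
   unfolding norm_sq_cart T_def by simp
  show "integrable M (\<lambda>w. (norm (T N w))^2)" for N unfolding nT using L(2) by simp
  have "\<forall>\<^sub>F N in sequentially. \<forall>k. expectation (\<lambda>w. (scaled_vario (lag k) N w - lin_vario (lag k) N w)^2) < 1"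
   by (intro eventually_all_finite allI order_tendstoD(2)[OF L(3)]) simp
  then show "\<forall>\<^sub>F N in sequentially. expectation (\<lambda>w. (norm (T N w))^2) \<le> (\<Sum>k\<in>UNIV. 2 + 2 * C k)"
  proof eventually_elim
   case (elim N)
   have "expectation (\<lambda>w. (scaled_vario (lag k) N w)^2) \<le> 2 + 2 * C k" for k
   proof -
    have "expectation (\<lambda>w. ((scaled_vario (lag k) N w - lin_vario (lag k) N w) + lin_vario (lag k) N w)^2)
     \<le> 2 * expectation (\<lambda>w. (scaled_vario (lag k) N w - lin_vario (lag k) N w)^2) + 2 * expectation (\<lambda>w. (lin_vario (lag k) N w)^2)"
     by (rule second_moment_sum_le(2)) (use D2 lin_vario_L2(2) in auto)
    then show ?thesis using elim[rule_format, of k] C[of k N] by simp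
   qed
   from sum_mono[of UNIV, OF this] show ?case unfolding nT using L(2) by (simp add: Bochner_Integration.integral_sum)
  qed
 qed
 then show ?thesis using \<mu> unfolding S_def T_def by blast
qed

end

theorem theorem3p1:
  fixes M :: "'w measure"
    and \<Lambda> :: "(real^('d::{finite,linorder})) set \<Rightarrow> 'w \<Rightarrow> real"
    and \<beta> \<sigma> :: real and \<nu> :: "real measure"
    and p q :: nat and b :: "nat \<Rightarrow> real" and a :: "'d \<Rightarrow> real poly"
    and Y :: "real^('d::{finite,linorder}) \<Rightarrow> 'w \<Rightarrow> real"
    and \<Delta> :: real
  assumes carma: "causal_carma_field M \<Lambda> \<beta> \<sigma> \<nu> p q b a Y"
    and distinct: "\<And>i. distinct_eigenvalues (companion_matrix p (a i))"
    and mean_zero: "\<And>B. B \<in> bounded_borel \<Longrightarrow> (\<integral>\<omega>. \<Lambda> B \<omega> \<partial>M) = 0"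
    and second_moment: "\<And>B. B \<in> bounded_borel \<Longrightarrow> integrable M (\<lambda>\<omega>. (\<Lambda> B \<omega>)\<^sup>2)"
    and fourth_moment: "integrable M (\<lambda>\<omega>. (\<Lambda> (cbox 0 1) \<omega>) ^ 4)"
    and \<Delta>_pos: "\<Delta> > 0"
  shows "(\<forall>t \<in> lattice_pts \<Delta>. AE \<omega> in M.
            (\<lambda>N. empirical_variogram Y \<Delta> N t \<omega>) \<longlonglongrightarrow> prob_space.variogram M Y t)
       \<and> (\<forall>lag :: 'k::finite \<Rightarrow> real^('d::{finite,linorder}). inj lag \<and> range lag \<subseteq> lattice_pts \<Delta> \<longrightarrow>
            (let V = V_matrix (kappa2 \<sigma> \<nu>) (prob_space.kappa4 M \<Lambda>)
                       (carma_kernel p b a) (prob_space.autocov M Y) \<Delta> lag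
             in \<exists>\<mu>. is_multivariate_normal 0 (F_matrix ** V ** transpose F_matrix) \<mu> \<and>
                prob_space.conv_in_distribution M
                  (\<lambda>N \<omega>. \<chi> k. real N powr (real CARD('d) / 2) *
                     (empirical_variogram Y \<Delta> N (lag k) \<omega> - prob_space.variogram M Y (lag k))) \<mu>))"
proof -
 interpret causal_carma_field M \<Lambda> \<beta> \<sigma> \<nu> p q b a Y by (rule carma)
 interpret centered_levy_basis M \<Lambda> \<beta> \<sigma> \<nu>
  by unfold_locales (fact mean_zero second_moment fourth_moment)+
 define g where "g = carma_kernel p b a"
 have "0 < p" using q_less_p by simp
 obtain C c where c: "0 < c" and m: "carma_kernel p b a \<in> borel_measurable borel"
   and d: "\<And>s. \<bar>carma_kernel p b a s\<bar> \<le> C * expdec c s"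
  by (rule carma_kernel_decay[where a=a and b=b, OF a_monic a_degree \<open>0 < p\<close> a_stable distinct]) (assumption, rule that)
 have g: "decays c C 0 g" unfolding decays_def diff_0 expdec_uminus g_def using m d by (intro conjI allI)
 \<comment> \<open>Exponential decay puts the translated kernel into L2 and L4, which identifies
   \<open>Y x\<close> as an integral with explicit moments.\<close>
 have "has_int (\<lambda>s. g (x - s)) (Y x)" for x
  unfolding g_def by (rule stoch_integral_has_int[OF Y_integral decays_L24[OF decays_translate c]]) (use g in \<open>simp add: g_def\<close>)
 then interpret moving_average M \<Lambda> \<beta> \<sigma> \<nu> g Y c C \<Delta>
  by unfold_locales (use c \<Delta>_pos g in auto)
 show ?thesis
  unfolding Let_def
 proof (intro conjI ballI allI impI)
  fix t :: "real^('d::{finite,linorder})" assume "t \<in> lattice_pts \<Delta>"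
  then show "AE w in M. (\<lambda>N. empirical_variogram Y \<Delta> N t w) \<longlonglongrightarrow> variogram Y t" by (rule variogram_strong_law)
 next
  fix lag :: "'k::finite \<Rightarrow> real^('d::{finite,linorder})"
  assume "inj lag \<and> range lag \<subseteq> lattice_pts \<Delta>"
  then have "range lag \<subseteq> lattice_pts \<Delta>" by (rule conjunct2)
  from variogram_clt[OF this]
  show "\<exists>\<mu>. is_multivariate_normal 0 (F_matrix ** V_matrix k2 (kappa4 \<Lambda>) (carma_kernel p b a) \<gamma> \<Delta> lag ** transpose F_matrix) \<mu> \<and>
    conv_in_distribution (\<lambda>N w. \<chi> k. real N powr (real CARD('d) / 2) *
     (empirical_variogram Y \<Delta> N (lag k) w - variogram Y (lag k))) \<mu>"
   unfolding scaled_vario_def g_def .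
 qed
qed

end
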